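(* Fix $h\ge0$, $D\in\mathbb R$. There exists $\beta'>0$ such that for every $\beta\in(0,\beta')$: if $(g_T,g_S)$ is a centered Gaussian vector with covariance matrix $\begin{pmatrix}A_0^2&C_0^2\\C_0^2&B_0^2\end{pmatrix}$, then for all nonnegative integers $h,h'$, $$\nu(T^hS^{h'})=\mathbb E[g_T^hg_S^{h'}]+O(N^{-(h+h'+1)/2}),$$ with implied constant independent of $N$.
   Context: Fix an integer $\mathcal S\ge1$ and $N\ge2$; $\Sigma_N=\{0,\pm1,\dots,\pm\mathcal S\}^N$. For $\beta>0$, $h\ge0$, $D\in\mathbb R$ and i.i.d. standard Gaussians $(g_{i,j})_{i<j}$, $H_N(\sigma)=\frac{\beta}{\sqrt N}\sum_{i<j}g_{i,j}\sigma_i\sigma_j+D\sum_i\sigma_i^2+h\sum_i\sigma_i$, Gibbs measure $G(\sigma)\propto e^{H_N(\sigma)}$ on $\Sigma_N$; $\langle\cdot\rangle$ is the Gibbs average, $\nu(f)=\mathbb E\langle f\rangle$. $p,q$: for $\eta\sim N(0,1)$, $\langle\phi\rangle_\eta=\sum_s\phi(s)w_\eta(s)/\sum_sw_\eta(s)$, $w_\eta(s)=\exp(\beta\sqrt q\eta s+hs+(D+\frac{\beta^2}{2}(p-q))s^2)$, $s\in\{0,\pm1,\dots,\pm\mathcal S\}$; $(p,q)$ solves $q=\mathbb E\langle s\rangle_\eta^2$, $p=\mathbb E\langle s^2\rangle_\eta$ (unique at high temperature). $T=\frac1N\sum_i\langle\sigma_i\rangle^2-q$, $S=\frac1N\sum_i\langle\sigma_i^2\rangle-p$.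 Constants: $m_j=\langle s^j\rangle_\eta$, expectations over $\eta$: $A=\mathbb E[(m_2-m_1^2)^2]$, $\mathcal D=\mathbb E[m_4-m_2^2]$, $F=\mathbb E[m_2^2-m_1^2m_2]$, $G=\mathbb E[m_1^2(m_2-m_1^2)]$, $\mathcal E=\mathbb E[m_1(m_3-m_1m_2)]$, $I_3=\mathbb E[m_1^4]-q^2$, $I_5=\mathbb E[m_1^2m_2]-pq$, $K_4=\mathbb E[m_2^2]-p^2$; $M_1=1-\beta^2(F-3G)$, $M_2=1-\frac{\beta^2}{2}\mathcal D$, $M_3=1-\beta^2(F-G)$, $M=M_1M_2+\beta^4\mathcal E^2$; $A_2^2=\frac{A}{N(1-\beta^2A)}$, $A_1^2=\frac{GM_2+\frac{\beta^2}{2}\mathcal E^2}{NMM_3}$, $B_1^2=\frac{\mathcal DM_1-2\beta^2\mathcal E^2}{NM}$, $C_1^2=\frac{\mathcal E}{NM}$; $A_0^2=\frac{\beta^2}{M}(\beta^2\mathcal EK_4+M_2I_5)C_1^2+\frac{2\beta^2}{M}(\beta^2\mathcal E(\mathcal E-I_5)+M_2(2G-I_3))A_1^2+\frac{\beta^2}{M}(\beta^2\mathcal EI_5+M_2I_3)A_2^2+\frac{1}{MN}(\beta^2\mathcal EI_5+M_2I_3)$, $B_0^2=\frac{\beta^2}{2M}(M_1K_4-\beta^2\mathcal EI_5)B_1^2+\frac{\beta^2}{M}(M_1(\mathcal E-I_5)-\beta^2\mathcal E(2G-I_3))C_1^2+\frac{1}{MN}(M_1K_4-\beta^2\mathcal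 EI_5)$, $C_0^2=\frac{\beta^2}{2M}(M_2I_5+\beta^2\mathcal EK_4)B_1^2+\frac{\beta^2}{M}(M_2(2G-I_3)+\beta^2\mathcal E(\mathcal E-I_5))C_1^2+\frac{1}{MN}(M_2I_5+\beta^2\mathcal EK_4)$. *)

theory Defs
  imports "HOL-Probability.Probability"
begin

definition spins :: "nat \<Rightarrow> real set" where
  "spins \<S> = real_of_int ` {- int \<S> .. int \<S>}"

definition configs :: "nat \<Rightarrow> nat \<Rightarrow> (nat \<Rightarrow> real) set" where
  "configs \<S> N = PiE {..<N} (\<lambda>_. spins \<S>)"

definition pairs :: "nat \<Rightarrow> (nat \<times> nat) set" where
  "pairs N = {(i, j). i < j \<and> j < N}"

definition hamiltonian ::
  "nat \<Rightarrow> real \<Rightarrow> real \<Rightarrow> real \<Rightarrow> (nat \<times> nat \<Rightarrow> real) \<Rightarrow> (nat \<Rightarrow> real) \<Rightarrow> real" where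
  "hamiltonian N \<beta> D h g \<sigma> =
     \<beta> / sqrt (real N) * (\<Sum>(i, j)\<in>pairs N. g (i, j) * \<sigma> i * \<sigma> j)
     + D * (\<Sum>i<N. (\<sigma> i)\<^sup>2) + h * (\<Sum>i<N. \<sigma> i)"

definition gibbs_avg ::
  "nat \<Rightarrow> nat \<Rightarrow> real \<Rightarrow> real \<Rightarrow> real \<Rightarrow> (nat \<times> nat \<Rightarrow> real) \<Rightarrow> ((nat \<Rightarrow> real) \<Rightarrow> real) \<Rightarrow> real" where
  "gibbs_avg \<S> N \<beta> D h g f =
     (\<Sum>\<sigma>\<in>configs \<S> N. f \<sigma> * exp (hamiltonian N \<beta> D h g \<sigma>))
     / (\<Sum>\<sigma>\<in>configs \<S> N. exp (hamiltonian N \<beta> D h g \<sigma>))"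

definition disorder :: "nat \<Rightarrow> (nat \<times> nat \<Rightarrow> real) measure" where
  "disorder N = PiM (pairs N) (\<lambda>_. density lborel std_normal_density)"

definition overlapT :: "nat \<Rightarrow> nat \<Rightarrow> real \<Rightarrow> real \<Rightarrow> real \<Rightarrow> real \<Rightarrow> (nat \<times> nat \<Rightarrow> real) \<Rightarrow> real" where
  "overlapT \<S> N \<beta> D h q g =
     (\<Sum>i<N. (gibbs_avg \<S> N \<beta> D h g (\<lambda>\<sigma>. \<sigma> i))\<^sup>2) / real N - q"

definition overlapS :: "nat \<Rightarrow> nat \<Rightarrow> real \<Rightarrow> real \<Rightarrow> real \<Rightarrow> real \<Rightarrow> (nat \<times> nat \<Rightarrow> real) \<Rightarrow> real" where
  "overlapS \<S> N \<beta> D h p g =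
     (\<Sum>i<N. gibbs_avg \<S> N \<beta> D h g (\<lambda>\<sigma>. (\<sigma> i)\<^sup>2)) / real N - p"

definition Eeta :: "(real \<Rightarrow> real) \<Rightarrow> real" where
  "Eeta f = (\<integral>x. f x \<partial>(density lborel std_normal_density))"

definition site_w :: "real \<Rightarrow> real \<Rightarrow> real \<Rightarrow> real \<Rightarrow> real \<Rightarrow> real \<Rightarrow> real \<Rightarrow> real" where
  "site_w \<beta> D h p q \<eta> s = exp (\<beta> * sqrt q * \<eta> * s + h * s + (D + \<beta>\<^sup>2 / 2 * (p - q)) * s\<^sup>2)"

definition site_mom :: "nat \<Rightarrow> real \<Rightarrow> real \<Rightarrow> real \<Rightarrow> real \<Rightarrow> real \<Rightarrow> nat \<Rightarrow> real \<Rightarrow> real" where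
  "site_mom \<S> \<beta> D h p q j \<eta> =
     (\<Sum>s\<in>spins \<S>. s ^ j * site_w \<beta> D h p q \<eta> s) / (\<Sum>s\<in>spins \<S>. site_w \<beta> D h p q \<eta> s)"

definition fixed_point :: "nat \<Rightarrow> real \<Rightarrow> real \<Rightarrow> real \<Rightarrow> real \<Rightarrow> real \<Rightarrow> bool" where
  "fixed_point \<S> \<beta> D h p q \<longleftrightarrow>
     q = Eeta (\<lambda>\<eta>. (site_mom \<S> \<beta> D h p q 1 \<eta>)\<^sup>2) \<and>
     p = Eeta (\<lambda>\<eta>. site_mom \<S> \<beta> D h p q 2 \<eta>)"

context
  fixes \<S> :: nat and \<beta> D h p q :: real
begin

private abbreviation "m j \<equiv> site_mom \<S> \<beta> D h p q j"

definition "cA = Eeta (\<lambda>\<eta>. (m 2 \<eta> - (m 1 \<eta>)\<^sup>2)\<^sup>2)"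
definition "cD = Eeta (\<lambda>\<eta>. m 4 \<eta> - (m 2 \<eta>)\<^sup>2)"
definition "cF = Eeta (\<lambda>\<eta>. (m 2 \<eta>)\<^sup>2 - (m 1 \<eta>)\<^sup>2 * m 2 \<eta>)"
definition "cG = Eeta (\<lambda>\<eta>. (m 1 \<eta>)\<^sup>2 * (m 2 \<eta> - (m 1 \<eta>)\<^sup>2))"
definition "cE = Eeta (\<lambda>\<eta>. m 1 \<eta> * (m 3 \<eta> - m 1 \<eta> * m 2 \<eta>))"
definition "cI3 = Eeta (\<lambda>\<eta>. (m 1 \<eta>) ^ 4) - q\<^sup>2"
definition "cI5 = Eeta (\<lambda>\<eta>. (m 1 \<eta>)\<^sup>2 * m 2 \<eta>) - p * q"
definition "cK4 = Eeta (\<lambda>\<eta>. (m 2 \<eta>)\<^sup>2) - p\<^sup>2"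

definition "cM1 = 1 - \<beta>\<^sup>2 * (cF - 3 * cG)"
definition "cM2 = 1 - \<beta>\<^sup>2 / 2 * cD"
definition "cM3 = 1 - \<beta>\<^sup>2 * (cF - cG)"
definition "cM = cM1 * cM2 + \<beta> ^ 4 * cE\<^sup>2"

definition "A2sq (N::nat) = cA / (real N * (1 - \<beta>\<^sup>2 * cA))"
definition "A1sq (N::nat) = (cG * cM2 + \<beta>\<^sup>2 / 2 * cE\<^sup>2) / (real N * cM * cM3)"
definition "B1sq (N::nat) = (cD * cM1 - 2 * \<beta>\<^sup>2 * cE\<^sup>2) / (real N * cM)"
definition "C1sq (N::nat) = cE / (real N * cM)"

definition "A0sq (N::nat) =
    \<beta>\<^sup>2 / cM * (\<beta>\<^sup>2 * cE * cK4 + cM2 * cI5) * C1sq N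
  + 2 * \<beta>\<^sup>2 / cM * (\<beta>\<^sup>2 * cE * (cE - cI5) + cM2 * (2 * cG - cI3)) * A1sq N
  + \<beta>\<^sup>2 / cM * (\<beta>\<^sup>2 * cE * cI5 + cM2 * cI3) * A2sq N
  + 1 / (cM * real N) * (\<beta>\<^sup>2 * cE * cI5 + cM2 * cI3)"

definition "B0sq (N::nat) =
    \<beta>\<^sup>2 / (2 * cM) * (cM1 * cK4 - \<beta>\<^sup>2 * cE * cI5) * B1sq N
  + \<beta>\<^sup>2 / cM * (cM1 * (cE - cI5) - \<beta>\<^sup>2 * cE * (2 * cG - cI3)) * C1sq N
  + 1 / (cM * real N) * (cM1 * cK4 - \<beta>\<^sup>2 * cE * cI5)"

definition "C0sq (N::nat) =
    \<beta>\<^sup>2 / (2 * cM) * (cM2 * cI5 + \<beta>\<^sup>2 * cE * cK4) * B1sq N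
  + \<beta>\<^sup>2 / cM * (cM2 * (2 * cG - cI3) + \<beta>\<^sup>2 * cE * (cE - cI5)) * C1sq N
  + 1 / (cM * real N) * (cM2 * cI5 + \<beta>\<^sup>2 * cE * cK4)"

end

definition centered_gaussian_rv :: "'a measure \<Rightarrow> ('a \<Rightarrow> real) \<Rightarrow> real \<Rightarrow> bool" where
  "centered_gaussian_rv M X v \<longleftrightarrow> X \<in> borel_measurable M \<and> 0 \<le> v \<and>
     (if v = 0 then (AE x in M. X x = 0)
      else distributed M lborel X (normal_density 0 (sqrt v)))"

definition centered_gaussian_pair ::
  "'a measure \<Rightarrow> ('a \<Rightarrow> real) \<Rightarrow> ('a \<Rightarrow> real) \<Rightarrow> real \<Rightarrow> real \<Rightarrow> real \<Rightarrow> bool" where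
  "centered_gaussian_pair M X Y a c b \<longleftrightarrow> prob_space M \<and>
     X \<in> borel_measurable M \<and> Y \<in> borel_measurable M \<and>
     (\<forall>u w. centered_gaussian_rv M (\<lambda>x. u * X x + w * Y x)
              (u\<^sup>2 * a + 2 * u * w * c + w\<^sup>2 * b))"

end

(*
  The last-spin (cavity) argument, run along the path that replaces the couplings through a site i
  by one external Gaussian field of variance beta^2 q. Gaussian integration by parts gives the
  derivative along the path as a sum over pairs of replicas of eps_k eps_l (R_kl - Q_kl), with Q_kk = p
  and Q_kl = q otherwise, and at the decoupled end the spin at i is independent of the rest.

  For small beta, the off-centre terms can be absorbed, so induction on m bounds the moments
  E (sqrt N (R_kl - Q_kl))^(2m) uniformly in N. Taylor expansion to second order along the path then turns
  the moments of (R_kl - Q_kl) U, with U a product of overlaps of disjoint groups of replicas,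
  into a linear system with error O(N^(-1/2)) after rescaling. The system is
  triangular for the decomposition R_kl - Q_kl = T_kl + T_k + T_l + T, R_kk - p = S_k + S, with
  blocks of size 1, 2, 2 whose determinants are M_3, M, M. Eliminating T_kl, then (T_k, S_k), then (T, S)
  shows that E T^k S^k' satisfies, up to the error, the Stein recursion of the Gaussian moments.
*)
theory Submission
  imports Defs
begin

section \<open>Replica averages\<close>

text \<open>Moments of every order are wanted below a single threshold for \<beta>. Hence the a
  priori bound must not deteriorate with the power: passing between full and cavity overlaps costs a
  factor 2 whatever the exponent, and only four replicas occur in the absorption step.

  Scaling centred overlaps by sqrt N reduces all errors to the one order N^(-1/2), so no hierarchy
  of expansions is kept. The second order along the path is obtained without second derivatives:
  measured against (sin \<theta>)^2, Cauchy's mean value theorem turns sqrt N times the average of a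
  centred product into one exact average at an unknown angle, and a Lipschitz bound makes the choice
  of that angle irrelevant.

  T and S are Gibbs averages, so their powers are replica averages over disjoint blocks. The
  components T_kl, T_k, S_k are never defined as functions: a fresh replica stands for a Gibbs
  average, and each block of the system is a difference of cavity equations with old and fresh
  labels. On the Gaussian side only the laws of linear combinations are given, so mixed moments are
  found by comparing polynomial coefficients.\<close>

definition rav :: "'s set \<Rightarrow> ('s \<Rightarrow> real) \<Rightarrow> nat \<Rightarrow> ((nat \<Rightarrow> 's) \<Rightarrow> real) \<Rightarrow> real" where
  "rav \<Omega> P n f = (\<Sum>\<omega>\<in>PiE {..<n} (\<lambda>_. \<Omega>). f \<omega> * (\<Prod>k<n. P (\<omega> k)))"

text \<open>Points of \<open>PiE {..<n}\<close> are \<open>undefined\<close> from index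
  \<open>n\<close> on, so functions of infinitely many labels are evaluated at dummy values there.
  Locality is recorded separately because each derivative enlarges the number of replicas while the
  function stays the same.\<close>

definition depends_below :: "nat \<Rightarrow> ((nat \<Rightarrow> 's) \<Rightarrow> real) \<Rightarrow> bool" where
  "depends_below n f \<longleftrightarrow> (\<forall>\<omega> \<omega>'. (\<forall>k<n. \<omega> k = \<omega>' k) \<longrightarrow> f \<omega> = f \<omega>')"

definition is_weight :: "'s set \<Rightarrow> ('s \<Rightarrow> real) \<Rightarrow> bool" where
  "is_weight \<Omega> P \<longleftrightarrow> finite \<Omega> \<and> (\<forall>\<sigma>\<in>\<Omega>. 0 \<le> P \<sigma>) \<and> sum P \<Omega> = 1"

lemma depends_belowI:
  assumes "\<And>\<omega> \<omega>'. (\<And>k. k < n \<Longrightarrow> \<omega> k = \<omega>' k) \<Longrightarrow> f \<omega> = f \<omega>'"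
  shows "depends_below n f"
  using assms unfolding depends_below_def by blast

lemma depends_belowD: "depends_below n f \<Longrightarrow> (\<And>k. k < n \<Longrightarrow> \<omega> k = \<omega>' k) \<Longrightarrow> f \<omega> = f \<omega>'"
  unfolding depends_below_def by blast

lemma depends_below_mono: "depends_below n f \<Longrightarrow> n \<le> m \<Longrightarrow> depends_below m f"
  unfolding depends_below_def by (meson less_le_trans)

lemma depends_below_const: "depends_below n (\<lambda>_. c)"
  unfolding depends_below_def by blast

lemma depends_below_coord: "k < n \<Longrightarrow> depends_below n (\<lambda>\<omega>. F (\<omega> k))"
  unfolding depends_below_def by simp

lemma depends_below_comp: "depends_below n f \<Longrightarrow> depends_below n (\<lambda>\<omega>. F (f \<omega>))"
  unfolding depends_below_def by metis

lemma depends_below_mult: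
  "depends_below n f \<Longrightarrow> depends_below n g \<Longrightarrow> depends_below n (\<lambda>\<omega>. f \<omega> * g \<omega> :: real)"
  unfolding depends_below_def by metis

lemma depends_below_prod:
  "(\<And>i. i \<in> I \<Longrightarrow> depends_below n (f i)) \<Longrightarrow> depends_below n (\<lambda>\<omega>. \<Prod>i\<in>I. f i \<omega>)"
  by (rule depends_belowI, rule prod.cong[OF refl]) (blast intro: depends_belowD)

lemma rav_add: "rav \<Omega> P n (\<lambda>\<omega>. f \<omega> + g \<omega>) = rav \<Omega> P n f + rav \<Omega> P n g"
  by (simp add: rav_def distrib_right sum.distrib)

lemma rav_diff: "rav \<Omega> P n (\<lambda>\<omega>. f \<omega> - g \<omega>) = rav \<Omega> P n f - rav \<Omega> P n g"
  by (simp add: rav_def left_diff_distrib sum_subtractf)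

lemma rav_cmult: "rav \<Omega> P n (\<lambda>\<omega>. c * f \<omega>) = c * rav \<Omega> P n f"
  by (simp add: rav_def sum_distrib_left mult.assoc)

lemma rav_sum: "rav \<Omega> P n (\<lambda>\<omega>. \<Sum>i\<in>I. f i \<omega>) = (\<Sum>i\<in>I. rav \<Omega> P n (f i))"
  unfolding rav_def by (subst sum.swap) (simp add: sum_distrib_right)

lemma rav_cong:
  "(\<And>\<omega>. \<omega> \<in> PiE {..<n} (\<lambda>_. \<Omega>) \<Longrightarrow> f \<omega> = g \<omega>) \<Longrightarrow> rav \<Omega> P n f = rav \<Omega> P n g"
  unfolding rav_def by (rule sum.cong) auto

lemma rav_0 [simp]: "rav \<Omega> P 0 f = f (\<lambda>_. undefined)"
  by (simp add: rav_def)

lemma rav_const: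
  assumes "is_weight \<Omega> P" shows "rav \<Omega> P n (\<lambda>_. c) = c"
proof -
  have "(\<Sum>\<omega>\<in>PiE {..<n} (\<lambda>_. \<Omega>). \<Prod>k<n. P (\<omega> k)) = (\<Prod>k<n. \<Sum>\<sigma>\<in>\<Omega>. P \<sigma>)"
    using assms by (subst prod_sum_PiE) (auto simp: is_weight_def)
  then show ?thesis
    using assms by (simp add: rav_def is_weight_def flip: sum_distrib_left)
qed

lemma rav_weight_nonneg:
  assumes "is_weight \<Omega> P" "\<omega> \<in> PiE {..<n} (\<lambda>_. \<Omega>)" shows "0 \<le> (\<Prod>k<n. P (\<omega> k))"
  using assms by (intro prod_nonneg) (auto simp: is_weight_def PiE_iff)

lemma rav_mono:
  assumes "is_weight \<Omega> P" "\<And>\<omega>. \<omega> \<in> PiE {..<n} (\<lambda>_. \<Omega>) \<Longrightarrow> f \<omega> \<le> g \<omega>"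
  shows "rav \<Omega> P n f \<le> rav \<Omega> P n g"
  unfolding rav_def using assms rav_weight_nonneg[OF assms(1)]
  by (intro sum_mono mult_right_mono) auto

lemma rav_abs:
  assumes "is_weight \<Omega> P" shows "\<bar>rav \<Omega> P n f\<bar> \<le> rav \<Omega> P n (\<lambda>\<omega>. \<bar>f \<omega>\<bar>)"
proof -
  have "\<bar>rav \<Omega> P n f\<bar> \<le> (\<Sum>\<omega>\<in>PiE {..<n} (\<lambda>_. \<Omega>). \<bar>f \<omega> * (\<Prod>k<n. P (\<omega> k))\<bar>)"
    unfolding rav_def by (rule sum_abs)
  also have "\<dots> = rav \<Omega> P n (\<lambda>\<omega>. \<bar>f \<omega>\<bar>)"
    unfolding rav_def by (intro sum.cong refl) (simp add: abs_mult abs_of_nonneg[OF rav_weight_nonneg[OF assms]])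
  finally show ?thesis .
qed

text \<open>The last replica is averaged outermost. Since \<open>g n = undefined\<close> on the
  smaller space, \<open>g\<close> can be recovered from \<open>g(n := y)\<close>, which makes the
  sum over pairs a reindexing.\<close>

lemma rav_Suc:
  "rav \<Omega> P (Suc n) f = (\<Sum>\<sigma>\<in>\<Omega>. P \<sigma> * rav \<Omega> P n (\<lambda>\<omega>. f (\<omega> (n := \<sigma>))))"
proof -
  have inj: "inj_on (\<lambda>(y, g). g(n := y)) (\<Omega> \<times> PiE {..<n} (\<lambda>_. \<Omega>))"
  proof (rule inj_onI, clarify)
    fix y y' :: 'a and g g'
    assume g: "g \<in> PiE {..<n} (\<lambda>_. \<Omega>)" "g' \<in> PiE {..<n} (\<lambda>_. \<Omega>)" and e: "g(n := y) = g'(n := y')"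
    have "y = y'" using fun_cong[OF e, of n] by simp
    moreover have "g x = g' x" for x
      using fun_cong[OF e, of x] PiE_arb[OF g(1), of n] PiE_arb[OF g(2), of n] by (cases "x = n") auto
    ultimately show "y = y' \<and> g = g'" by auto
  qed
  have "rav \<Omega> P (Suc n) f
    = (\<Sum>(y, g)\<in>\<Omega> \<times> PiE {..<n} (\<lambda>_. \<Omega>). f (g(n := y)) * (\<Prod>k<Suc n. P ((g(n := y)) k)))"
    unfolding rav_def lessThan_Suc PiE_insert_eq
    by (subst sum.reindex[OF inj]) (simp add: case_prod_unfold)
  also have "\<dots> = (\<Sum>(y, g)\<in>\<Omega> \<times> PiE {..<n} (\<lambda>_. \<Omega>). P y * (f (g(n := y)) * (\<Prod>k<n. P (g k))))"
    by (intro sum.cong) (auto simp: mult_ac)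
  also have "\<dots> = (\<Sum>\<sigma>\<in>\<Omega>. P \<sigma> * rav \<Omega> P n (\<lambda>\<omega>. f (\<omega> (n := \<sigma>))))"
    by (simp add: rav_def sum_distrib_left sum.cartesian_product)
  finally show ?thesis .
qed

lemma rav_extend:
  assumes "is_weight \<Omega> P" "depends_below n f" "n \<le> m" shows "rav \<Omega> P m f = rav \<Omega> P n f"
  using assms(3)
proof (induction m rule: dec_induct)
  case (step m)
  have "rav \<Omega> P m (\<lambda>\<omega>. f (\<omega> (m := \<sigma>))) = rav \<Omega> P m f" for \<sigma>
    using step(1) by (intro rav_cong depends_belowD[OF assms(2)]) auto
  then show ?case using step assms(1)
    by (simp add: rav_Suc is_weight_def flip: sum_distrib_right)
qed simp

lemma rav_permute:
  assumes "bij_betw \<pi> {..<n} {..<n}" "depends_below n f"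
  shows "rav \<Omega> P n (\<lambda>\<omega>. f (\<lambda>k. \<omega> (\<pi> k))) = rav \<Omega> P n f"
proof -
  define \<rho> where "\<rho> = inv_into {..<n} \<pi>"
  have \<pi>: "\<pi> k < n" if "k < n" for k using assms(1) that by (auto simp: bij_betw_def)
  have \<rho>: "\<rho> k < n" if "k < n" for k
    using assms(1) that unfolding \<rho>_def bij_betw_def by (metis inv_into_into lessThan_iff)
  have \<pi>\<rho>: "\<pi> (\<rho> k) = k" if "k < n" for k
    using assms(1) that unfolding \<rho>_def bij_betw_def by (metis f_inv_into_f lessThan_iff)
  have \<rho>\<pi>: "\<rho> (\<pi> k) = k" if "k < n" for k
    using assms(1) that unfolding \<rho>_def bij_betw_def by (metis inv_into_f_f lessThan_iff)
  show ?thesis unfolding rav_def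
  \<comment> \<open>Composition with \<pi> leaves the extensional function space, so both witnesses
    restrict to \<open>{..<n}\<close>; the locality of \<open>f\<close> hides the
    restriction.\<close>
  proof (rule sum.reindex_bij_witness[where j = "\<lambda>\<omega>. \<lambda>k\<in>{..<n}. \<omega> (\<pi> k)" and i = "\<lambda>\<omega>. \<lambda>k\<in>{..<n}. \<omega> (\<rho> k)"])
    fix \<omega> assume w: "\<omega> \<in> PiE {..<n} (\<lambda>_. \<Omega>)"
    show "(\<lambda>k\<in>{..<n}. (\<lambda>k\<in>{..<n}. \<omega> (\<pi> k)) (\<rho> k)) = \<omega>"
      using w \<pi>\<rho> \<rho> by (intro ext) (auto simp: PiE_iff extensional_def)
    show "(\<lambda>k\<in>{..<n}. \<omega> (\<pi> k)) \<in> PiE {..<n} (\<lambda>_. \<Omega>)" using w \<pi> by (auto simp: PiE_iff)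
    show "(\<lambda>k\<in>{..<n}. (\<lambda>k\<in>{..<n}. \<omega> (\<rho> k)) (\<pi> k)) = \<omega>"
      using w \<rho>\<pi> \<pi> by (intro ext) (auto simp: PiE_iff extensional_def)
    show "(\<lambda>k\<in>{..<n}. \<omega> (\<rho> k)) \<in> PiE {..<n} (\<lambda>_. \<Omega>)" using w \<rho> by (auto simp: PiE_iff)
    have "f (\<lambda>k\<in>{..<n}. \<omega> (\<pi> k)) = f (\<lambda>k. \<omega> (\<pi> k))"
      by (rule depends_belowD[OF assms(2)]) auto
    moreover have "(\<Prod>k<n. P ((\<lambda>k\<in>{..<n}. \<omega> (\<pi> k)) k)) = (\<Prod>k<n. P (\<omega> k))"
      using prod.reindex_bij_betw[OF assms(1), of "\<lambda>k. P (\<omega> k)"] by simp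
    ultimately show "f (\<lambda>k\<in>{..<n}. \<omega> (\<pi> k)) * (\<Prod>k<n. P ((\<lambda>k\<in>{..<n}. \<omega> (\<pi> k)) k))
      = f (\<lambda>k. \<omega> (\<pi> k)) * (\<Prod>k<n. P (\<omega> k))" by simp
  qed
qed

text \<open>The injection extends to a permutation of \<open>{..<n}\<close> by matching the
  complements, which have equal size; the replicas from \<open>m\<close> on then integrate to 1.
  This is the exchangeability of replicas.\<close>

lemma rav_relabel:
  assumes P: "is_weight \<Omega> P" and f: "depends_below m f"
    and \<pi>: "inj_on \<pi> {..<m}" "\<And>k. k < m \<Longrightarrow> \<pi> k < n"
  shows "rav \<Omega> P n (\<lambda>\<omega>. f (\<lambda>k. \<omega> (\<pi> k))) = rav \<Omega> P m f"
proof -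
  have sub: "\<pi> ` {..<m} \<subseteq> {..<n}" using \<pi>(2) by auto
  have mn: "m \<le> n" using card_mono[OF finite_lessThan sub] card_image[OF \<pi>(1)] by simp
  have "card {m..<n} = card ({..<n} - \<pi> ` {..<m})"
    using sub card_image[OF \<pi>(1)] by (simp add: card_Diff_subset finite_subset)
  then obtain \<rho> where \<rho>: "bij_betw \<rho> {m..<n} ({..<n} - \<pi> ` {..<m})"
    using finite_same_card_bij by (metis finite_Diff finite_atLeastLessThan finite_lessThan)
  define \<tau> where "\<tau> k = (if k < m then \<pi> k else \<rho> k)" for k
  have "bij_betw \<tau> ({..<m} \<union> {m..<n}) (\<pi> ` {..<m} \<union> ({..<n} - \<pi> ` {..<m}))"
  proof (rule bij_betw_combine)
    show "bij_betw \<tau> {..<m} (\<pi> ` {..<m})"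
      using \<pi>(1) unfolding bij_betw_def \<tau>_def by (auto simp: inj_on_def)
    show "bij_betw \<tau> {m..<n} ({..<n} - \<pi> ` {..<m})"
      using \<rho> by (subst bij_betw_cong[of _ _ \<rho>]) (auto simp: \<tau>_def)
  qed auto
  moreover have "{..<m} \<union> {m..<n} = {..<n}" using mn by auto
  ultimately have \<tau>: "bij_betw \<tau> {..<n} {..<n}" using sub by (simp add: Un_absorb1)
  have "rav \<Omega> P n (\<lambda>\<omega>. f (\<lambda>k. \<omega> (\<pi> k))) = rav \<Omega> P n (\<lambda>\<omega>. f (\<lambda>k. \<omega> (\<tau> k)))"
    by (intro rav_cong depends_belowD[OF f]) (auto simp: \<tau>_def)
  also have "\<dots> = rav \<Omega> P n f"
    by (rule rav_permute[OF \<tau> depends_below_mono[OF f mn]])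
  also have "\<dots> = rav \<Omega> P m f" by (rule rav_extend[OF P f mn])
  finally show ?thesis .
qed

text \<open>Two independent copies of the replicas may exchange coordinates through the involution \<open>(\<omega>, \<omega>') \<mapsto> (A \<omega> \<omega>', A \<omega>' \<omega>)\<close>;
  this yields independence statements without splitting the configuration space.\<close>
lemma rav_swap:
  assumes inv: "\<And>\<omega> \<omega>'. \<omega> \<in> PiE {..<n} (\<lambda>_. \<Omega>) \<Longrightarrow> \<omega>' \<in> PiE {..<n} (\<lambda>_. \<Omega>) \<Longrightarrow>
      A \<omega> \<omega>' \<in> PiE {..<n} (\<lambda>_. \<Omega>) \<and> A (A \<omega> \<omega>') (A \<omega>' \<omega>) = \<omega>"
    and eq: "\<And>\<omega> \<omega>'. \<omega> \<in> PiE {..<n} (\<lambda>_. \<Omega>) \<Longrightarrow> \<omega>' \<in> PiE {..<n} (\<lambda>_. \<Omega>) \<Longrightarrow>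
      f \<omega> * h \<omega>' = f' (A \<omega> \<omega>') * h' (A \<omega>' \<omega>)"
    and weq: "\<And>\<omega> \<omega>'. \<omega> \<in> PiE {..<n} (\<lambda>_. \<Omega>) \<Longrightarrow> \<omega>' \<in> PiE {..<n} (\<lambda>_. \<Omega>) \<Longrightarrow>
      (\<Prod>k<n. P (\<omega> k)) * (\<Prod>k<n. R (\<omega>' k)) = (\<Prod>k<n. P' (A \<omega> \<omega>' k)) * (\<Prod>k<n. R' (A \<omega>' \<omega> k))"
  shows "rav \<Omega> P n f * rav \<Omega> R n h = rav \<Omega> P' n f' * rav \<Omega> R' n h'"
proof -
  let ?S = "PiE {..<n} (\<lambda>_. \<Omega>)"
  have prodsum: "rav \<Omega> P n f * rav \<Omega> R n h
    = (\<Sum>(\<omega>, \<omega>')\<in>?S \<times> ?S. (f \<omega> * h \<omega>') * ((\<Prod>k<n. P (\<omega> k)) * (\<Prod>k<n. R (\<omega>' k))))" for P R f h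
  proof -
    have "rav \<Omega> P n f * rav \<Omega> R n h
      = (\<Sum>(\<omega>, \<omega>')\<in>?S \<times> ?S. (f \<omega> * (\<Prod>k<n. P (\<omega> k))) * (h \<omega>' * (\<Prod>k<n. R (\<omega>' k))))"
      unfolding rav_def by (subst sum_product) (rule sum.cartesian_product)
    then show ?thesis by (simp only: mult_ac)
  qed
  show ?thesis unfolding prodsum
  proof (rule sum.reindex_bij_witness[where i = "\<lambda>(\<omega>, \<omega>'). (A \<omega> \<omega>', A \<omega>' \<omega>)" and j = "\<lambda>(\<omega>, \<omega>'). (A \<omega> \<omega>', A \<omega>' \<omega>)"])
    fix z assume "z \<in> ?S \<times> ?S"
    then obtain a b where z: "z = (a, b)" "a \<in> ?S" "b \<in> ?S" by auto
    have A: "A a b \<in> ?S" "A b a \<in> ?S" "A (A a b) (A b a) = a" "A (A b a) (A a b) = b"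
      using inv[OF z(2,3)] inv[OF z(3,2)] by blast+
    show "(case z of (\<omega>, \<omega>') \<Rightarrow> (A \<omega> \<omega>', A \<omega>' \<omega>)) \<in> ?S \<times> ?S"
      and "(case z of (\<omega>, \<omega>') \<Rightarrow> (A \<omega> \<omega>', A \<omega>' \<omega>)) \<in> ?S \<times> ?S"
      unfolding z(1) prod.case using A(1,2) by (rule SigmaI)+
    show "(case case z of (\<omega>, \<omega>') \<Rightarrow> (A \<omega> \<omega>', A \<omega>' \<omega>) of (\<omega>, \<omega>') \<Rightarrow> (A \<omega> \<omega>', A \<omega>' \<omega>)) = z"
      and "(case case z of (\<omega>, \<omega>') \<Rightarrow> (A \<omega> \<omega>', A \<omega>' \<omega>) of (\<omega>, \<omega>') \<Rightarrow> (A \<omega> \<omega>', A \<omega>' \<omega>)) = z"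
      unfolding z(1) prod.case A(3,4) by (rule refl)+
    show "(case case z of (\<omega>, \<omega>') \<Rightarrow> (A \<omega> \<omega>', A \<omega>' \<omega>) of
        (\<omega>, \<omega>') \<Rightarrow> (f' \<omega> * h' \<omega>') * ((\<Prod>k<n. P' (\<omega> k)) * (\<Prod>k<n. R' (\<omega>' k))))
      = (case z of (\<omega>, \<omega>') \<Rightarrow> (f \<omega> * h \<omega>') * ((\<Prod>k<n. P (\<omega> k)) * (\<Prod>k<n. R (\<omega>' k))))"
      unfolding z(1) prod.case eq[OF z(2,3)] weq[OF z(2,3)] ..
  qed
qed

text \<open>Exchanging the coordinates in \<open>B\<close> between two independent copies turns
  \<open>f\<close> on one copy and \<open>g\<close> on the other into \<open>f * g\<close> on one
  and the constant 1 on the other, with the same product weight.\<close>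

lemma rav_indep:
  assumes P: "is_weight \<Omega> P"
    and f: "\<And>\<omega> \<omega>'. (\<And>k. k \<notin> B \<Longrightarrow> \<omega> k = \<omega>' k) \<Longrightarrow> f \<omega> = f \<omega>'"
    and g: "\<And>\<omega> \<omega>'. (\<And>k. k \<in> B \<Longrightarrow> \<omega> k = \<omega>' k) \<Longrightarrow> g \<omega> = g \<omega>'"
  shows "rav \<Omega> P n (\<lambda>\<omega>. f \<omega> * g \<omega>) = rav \<Omega> P n f * rav \<Omega> P n g"
proof -
  define A where "A \<omega> \<omega>' = (\<lambda>k. if k \<in> B then \<omega>' k else \<omega> k)" for \<omega> \<omega>' :: "nat \<Rightarrow> 'a"
  have "rav \<Omega> P n f * rav \<Omega> P n g = rav \<Omega> P n (\<lambda>\<omega>. f \<omega> * g \<omega>) * rav \<Omega> P n (\<lambda>_. 1)"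
  proof (rule rav_swap[where A = A])
    fix \<omega> \<omega>' assume w: "\<omega> \<in> PiE {..<n} (\<lambda>_. \<Omega>)" "\<omega>' \<in> PiE {..<n} (\<lambda>_. \<Omega>)"
    show "A \<omega> \<omega>' \<in> PiE {..<n} (\<lambda>_. \<Omega>) \<and> A (A \<omega> \<omega>') (A \<omega>' \<omega>) = \<omega>"
      using w by (auto simp: A_def PiE_iff extensional_def)
    have "f \<omega> = f (A \<omega> \<omega>')" by (rule f) (simp add: A_def)
    moreover have "g \<omega>' = g (A \<omega> \<omega>')" by (rule g) (simp add: A_def)
    ultimately show "f \<omega> * g \<omega>' = f (A \<omega> \<omega>') * g (A \<omega> \<omega>') * 1" by simp
    show "(\<Prod>k<n. P (\<omega> k)) * (\<Prod>k<n. P (\<omega>' k)) = (\<Prod>k<n. P (A \<omega> \<omega>' k)) * (\<Prod>k<n. P (A \<omega>' \<omega> k))"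
      unfolding prod.distrib[symmetric] by (rule prod.cong) (auto simp: A_def)
  qed
  then show ?thesis by (simp add: rav_const[OF P])
qed

text \<open>Independent replicas pushed through \<kappa> stay independent, with the pushed-forward
  weight; grouping the outermost sum by the value of \<kappa> is the induction step. The intended
  \<kappa> reads the spin at one site, which reduces a decoupled site to a one-spin measure.\<close>

lemma rav_image:
  assumes fin: "finite \<Omega>" "finite S" and map: "\<And>\<sigma>. \<sigma> \<in> \<Omega> \<Longrightarrow> \<kappa> \<sigma> \<in> S"
    and r: "\<And>s. s \<in> S \<Longrightarrow> (\<Sum>\<sigma>\<in>{\<sigma>\<in>\<Omega>. \<kappa> \<sigma> = s}. P \<sigma>) = r s"
    and \<phi>: "depends_below n \<phi>"
  shows "rav \<Omega> P n (\<lambda>\<omega>. \<phi> (\<lambda>k. \<kappa> (\<omega> k))) = rav S r n \<phi>"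
  using \<phi>
proof (induction n arbitrary: \<phi>)
  case 0
  then show ?case unfolding rav_0 by (rule depends_belowD) simp
next
  case (Suc n)
  have dep: "depends_below n (\<lambda>\<omega>. \<phi> (\<omega> (n := s)))" for s
    by (rule depends_belowI, rule depends_belowD[OF Suc.prems]) auto
  have "rav \<Omega> P (Suc n) (\<lambda>\<omega>. \<phi> (\<lambda>k. \<kappa> (\<omega> k)))
    = (\<Sum>\<sigma>\<in>\<Omega>. P \<sigma> * rav \<Omega> P n (\<lambda>\<omega>. \<phi> (\<lambda>k. \<kappa> ((\<omega> (n := \<sigma>)) k))))" by (rule rav_Suc)
  also have "\<dots> = (\<Sum>\<sigma>\<in>\<Omega>. P \<sigma> * rav S r n (\<lambda>\<omega>. \<phi> (\<omega> (n := \<kappa> \<sigma>))))"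
  proof (intro sum.cong refl arg_cong2[where f = "(*)"])
    fix \<sigma>
    have "(\<lambda>k. \<kappa> ((\<omega> (n := \<sigma>)) k)) = (\<lambda>k. \<kappa> (\<omega> k))(n := \<kappa> \<sigma>)" for \<omega> by auto
    then show "rav \<Omega> P n (\<lambda>\<omega>. \<phi> (\<lambda>k. \<kappa> ((\<omega> (n := \<sigma>)) k))) = rav S r n (\<lambda>\<omega>. \<phi> (\<omega> (n := \<kappa> \<sigma>)))"
      using Suc.IH[OF dep, of "\<kappa> \<sigma>"] by (simp only: fun_upd_def)
  qed
  also have "\<dots> = (\<Sum>s\<in>S. \<Sum>\<sigma>\<in>{\<sigma>\<in>\<Omega>. \<kappa> \<sigma> = s}. P \<sigma> * rav S r n (\<lambda>\<omega>. \<phi> (\<omega> (n := \<kappa> \<sigma>))))"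
    using map by (intro sum.group[symmetric] fin) auto
  also have "\<dots> = (\<Sum>s\<in>S. r s * rav S r n (\<lambda>\<omega>. \<phi> (\<omega> (n := s))))"
    by (intro sum.cong refl) (simp flip: sum_distrib_right add: r)
  also have "\<dots> = rav S r (Suc n) \<phi>" by (rule rav_Suc[symmetric])
  finally show ?case .
qed

lemma rav_prod:
  assumes "finite \<Omega>"
  shows "rav \<Omega> P n (\<lambda>\<omega>. \<Prod>k<n. F k (\<omega> k)) = (\<Prod>k<n. \<Sum>\<sigma>\<in>\<Omega>. F k \<sigma> * P \<sigma>)"
  using assms by (subst prod_sum_PiE) (auto simp: rav_def prod.distrib)

definition gibbs :: "'s set \<Rightarrow> ('s \<Rightarrow> real) \<Rightarrow> 's \<Rightarrow> real" where
  "gibbs \<Omega> H \<sigma> = exp (H \<sigma>) / (\<Sum>\<tau>\<in>\<Omega>. exp (H \<tau>))"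

lemma partition_pos: "finite \<Omega> \<Longrightarrow> \<Omega> \<noteq> {} \<Longrightarrow> 0 < (\<Sum>\<tau>\<in>\<Omega>. exp (H \<tau> :: real))"
  by (intro sum_pos) auto

lemma is_weight_gibbs:
  assumes "finite \<Omega>" "\<Omega> \<noteq> {}" shows "is_weight \<Omega> (gibbs \<Omega> H)"
  using assms partition_pos[OF assms, of H]
  by (auto simp: is_weight_def gibbs_def simp flip: sum_divide_distrib)

definition replica_diff :: "nat \<Rightarrow> ('s \<Rightarrow> real) \<Rightarrow> (nat \<Rightarrow> 's) \<Rightarrow> real" where
  "replica_diff n v \<omega> = (\<Sum>k<n. v (\<omega> k)) - real n * v (\<omega> n)"

lemma depends_below_replica_diff: "depends_below (Suc n) (replica_diff n v)"
  by (rule depends_belowI) (simp add: replica_diff_def)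

text \<open>Each Gibbs weight has derivative \<open>P \<sigma> * (H' \<sigma> - ?m)\<close> with
  \<open>?m\<close> the Gibbs mean of \<open>H'\<close>. The \<open>n\<close> subtracted means are
  read off one new independent replica carrying the factor \<open>- n\<close>, so the derivative is
  again a replica average and can be treated in the same way.\<close>

lemma has_derivative_rav_gibbs:
  assumes fin: "finite \<Omega>" "\<Omega> \<noteq> {}" and f: "depends_below n f"
    and H: "\<And>\<sigma>. \<sigma> \<in> \<Omega> \<Longrightarrow> ((\<lambda>x. H x \<sigma>) has_real_derivative H' \<sigma>) (at x)"
  shows "((\<lambda>x. rav \<Omega> (gibbs \<Omega> (H x)) n f) has_real_derivative
    rav \<Omega> (gibbs \<Omega> (H x)) (Suc n) (\<lambda>\<omega>. f \<omega> * replica_diff n H' \<omega>)) (at x)"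
proof -
  let ?P = "gibbs \<Omega> (H x)"
  let ?m = "\<Sum>\<sigma>\<in>\<Omega>. ?P \<sigma> * H' \<sigma>"
  have P: "is_weight \<Omega> ?P" by (rule is_weight_gibbs[OF fin])
  have dP: "((\<lambda>x. gibbs \<Omega> (H x) \<sigma>) has_real_derivative ?P \<sigma> * (H' \<sigma> - ?m)) (at x)"
    if \<sigma>: "\<sigma> \<in> \<Omega>" for \<sigma>
  proof -
    let ?Z = "\<Sum>\<tau>\<in>\<Omega>. exp (H x \<tau>)"
    have Z: "?Z > 0" by (rule partition_pos[OF fin])
    have "((\<lambda>x. gibbs \<Omega> (H x) \<sigma>) has_real_derivative
      (exp (H x \<sigma>) * H' \<sigma> * ?Z - exp (H x \<sigma>) * (\<Sum>\<tau>\<in>\<Omega>. exp (H x \<tau>) * H' \<tau>)) / (?Z * ?Z)) (at x)"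
      unfolding gibbs_def
      by (rule DERIV_divide) (use Z \<sigma> in \<open>auto intro!: derivative_eq_intros H DERIV_sum\<close>)
    moreover have m: "?m = (\<Sum>\<tau>\<in>\<Omega>. exp (H x \<tau>) * H' \<tau>) / ?Z"
      by (simp add: gibbs_def sum_divide_distrib)
    have "(exp (H x \<sigma>) * H' \<sigma> * ?Z - exp (H x \<sigma>) * (\<Sum>\<tau>\<in>\<Omega>. exp (H x \<tau>) * H' \<tau>)) / (?Z * ?Z)
      = ?P \<sigma> * (H' \<sigma> - ?m)"
      unfolding m using Z by (simp add: gibbs_def divide_simps) (simp add: algebra_simps)
    ultimately show ?thesis by simp
  qed
  have dprod: "((\<lambda>x. \<Prod>k<m. gibbs \<Omega> (H x) (\<omega> k)) has_real_derivative
      (\<Prod>k<m. ?P (\<omega> k)) * (\<Sum>k<m. H' (\<omega> k) - ?m)) (at x)"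
    if "\<And>k. k < m \<Longrightarrow> \<omega> k \<in> \<Omega>" for m :: nat and \<omega>
    using that
  proof (induction m)
    case (Suc m)
    show ?case unfolding prod.lessThan_Suc sum.lessThan_Suc
      by (rule DERIV_cong, rule DERIV_mult[OF Suc.IH dP]) (auto simp: Suc.prems algebra_simps)
  qed auto
  have "((\<lambda>x. rav \<Omega> (gibbs \<Omega> (H x)) n f) has_real_derivative
    rav \<Omega> ?P n (\<lambda>\<omega>. f \<omega> * (\<Sum>k<n. H' (\<omega> k) - ?m))) (at x)"
    unfolding rav_def
    by (rule DERIV_sum, rule DERIV_cong, rule DERIV_cmult, rule dprod) (auto simp: PiE_iff)
  moreover have "rav \<Omega> ?P n (\<lambda>\<omega>. f \<omega> * (\<Sum>k<n. H' (\<omega> k) - ?m))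
    = rav \<Omega> ?P (Suc n) (\<lambda>\<omega>. f \<omega> * replica_diff n H' \<omega>)"
  proof -
    have "rav \<Omega> ?P (Suc n) (\<lambda>\<omega>. f \<omega> * replica_diff n H' \<omega>)
      = (\<Sum>\<sigma>\<in>\<Omega>. ?P \<sigma> * rav \<Omega> ?P n (\<lambda>\<omega>. f \<omega> * (\<Sum>k<n. H' (\<omega> k)) - real n * H' \<sigma> * f \<omega>))"
      unfolding rav_Suc
    proof (intro sum.cong refl arg_cong2[where f = "(*)"] rav_cong)
      fix \<sigma> \<omega>
      have "f (\<omega> (n := \<sigma>)) = f \<omega>" by (rule depends_belowD[OF f]) auto
      then show "f (\<omega> (n := \<sigma>)) * replica_diff n H' (\<omega> (n := \<sigma>))
        = f \<omega> * (\<Sum>k<n. H' (\<omega> k)) - real n * H' \<sigma> * f \<omega>"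
        by (simp add: replica_diff_def algebra_simps)
    qed
    also have "\<dots> = (\<Sum>\<sigma>\<in>\<Omega>. ?P \<sigma> * rav \<Omega> ?P n (\<lambda>\<omega>. f \<omega> * (\<Sum>k<n. H' (\<omega> k))) - (?P \<sigma> * H' \<sigma>) * (real n * rav \<Omega> ?P n f))"
      unfolding rav_diff rav_cmult by (intro sum.cong refl) (simp only: right_diff_distrib mult_ac)
    also have "\<dots> = rav \<Omega> ?P n (\<lambda>\<omega>. f \<omega> * (\<Sum>k<n. H' (\<omega> k))) - ?m * (real n * rav \<Omega> ?P n f)"
      unfolding sum_subtractf sum_distrib_right[symmetric] using P by (simp add: is_weight_def)
    also have "\<dots> = rav \<Omega> ?P n (\<lambda>\<omega>. f \<omega> * (\<Sum>k<n. H' (\<omega> k)) - (?m * real n) * f \<omega>)"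
      by (simp only: rav_diff rav_cmult mult.assoc)
    also have "\<dots> = rav \<Omega> ?P n (\<lambda>\<omega>. f \<omega> * (\<Sum>k<n. H' (\<omega> k) - ?m))"
      by (rule rav_cong) (simp add: sum_subtractf right_diff_distrib mult_ac)
    finally show ?thesis by simp
  qed
  ultimately show ?thesis by simp
qed

section \<open>Gaussian interpolation\<close>

abbreviation "gauss \<equiv> density lborel std_normal_density"

abbreviation gprod :: "'j set \<Rightarrow> ('j \<Rightarrow> real) measure" where
  "gprod J \<equiv> PiM J (\<lambda>_. gauss)"

lemma prob_space_gauss: "prob_space gauss"
  by (rule prob_space_normal_density) simp

interpretation gauss: prob_space gauss by (rule prob_space_gauss)

interpretation gprod: product_prob_space "\<lambda>_ :: 'j. gauss" J for J :: "'j set"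
  by standard

text \<open>Dominated convergence for the difference quotients along an arbitrary null sequence; by
  the mean value inequality \<open>w\<close> dominates them as well.\<close>

lemma has_derivative_integral:
  fixes f :: "real \<Rightarrow> 'a \<Rightarrow> real"
  assumes int: "\<And>\<theta>. integrable M (f \<theta>)" and w: "integrable M w"
    and d: "\<And>\<theta> x. x \<in> space M \<Longrightarrow> ((\<lambda>\<theta>. f \<theta> x) has_real_derivative f' \<theta> x) (at \<theta>)"
    and b: "\<And>\<theta> x. x \<in> space M \<Longrightarrow> \<bar>f' \<theta> x\<bar> \<le> w x"
    and meas: "\<And>\<theta>. f' \<theta> \<in> borel_measurable M"
  shows "((\<lambda>\<theta>. \<integral>x. f \<theta> x \<partial>M) has_real_derivative (\<integral>x. f' \<theta> x \<partial>M)) (at \<theta>)"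
  unfolding DERIV_def tendsto_at_iff_sequentially
proof (intro allI impI)
  fix h :: "nat \<Rightarrow> real" assume h: "\<forall>i. h i \<in> UNIV - {0}" "h \<longlonglongrightarrow> 0"
  let ?s = "\<lambda>i x. (f (\<theta> + h i) x - f \<theta> x) / h i"
  have "(\<lambda>i. \<integral>x. ?s i x \<partial>M) \<longlonglongrightarrow> (\<integral>x. f' \<theta> x \<partial>M)"
  proof (rule integral_dominated_convergence[OF meas _ w])
    show "?s i \<in> borel_measurable M" for i using int by (intro borel_measurable_divide borel_measurable_diff) auto
    show "AE x in M. (\<lambda>i. ?s i x) \<longlonglongrightarrow> f' \<theta> x"
    proof (rule AE_I2)
      fix x assume x: "x \<in> space M"
      show "(\<lambda>i. ?s i x) \<longlonglongrightarrow> f' \<theta> x"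
        using d[OF x, of \<theta>] h unfolding DERIV_def tendsto_at_iff_sequentially by (auto simp: comp_def)
    qed
    show "AE x in M. norm (?s i x) \<le> w x" for i
    proof (rule AE_I2)
      fix x assume x: "x \<in> space M"
      have "norm (f (\<theta> + h i) x - f \<theta> x) \<le> w x * norm (\<theta> + h i - \<theta>)"
        by (rule field_differentiable_bound[of UNIV "\<lambda>\<theta>. f \<theta> x" "\<lambda>\<theta>. f' \<theta> x"])
          (use d[OF x] b[OF x] in auto)
      then show "norm (?s i x) \<le> w x" using h(1) by (simp add: field_simps)
    qed
  qed
  moreover have "(\<lambda>i. \<integral>x. ?s i x \<partial>M) = (\<lambda>i. ((\<integral>x. f (\<theta> + h i) x \<partial>M) - (\<integral>x. f \<theta> x \<partial>M)) / h i)"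
    using int by simp
  ultimately show "((\<lambda>h. ((\<integral>x. f (\<theta> + h) x \<partial>M) - (\<integral>x. f \<theta> x \<partial>M)) / h) \<circ> h) \<longlonglongrightarrow> (\<integral>x. f' \<theta> x \<partial>M)"
    unfolding comp_def by (simp only:)
qed

section \<open>Gaussian integration by parts\<close>

lemma std_normal_density_lim: "(std_normal_density \<longlongrightarrow> 0) at_top" "(std_normal_density \<longlongrightarrow> 0) at_bot"
proof -
  have *: "((\<lambda>x::real. 1 / sqrt (2 * pi) * exp (- x\<^sup>2 / 2)) \<longlongrightarrow> 0) F" if "filterlim (\<lambda>x. x\<^sup>2) at_top F" for F
  proof (rule tendsto_mult_right_zero)
    have "filterlim (\<lambda>x. x\<^sup>2 * (1/2)) at_top F"
      by (subst mult.commute, rule filterlim_tendsto_pos_mult_at_top[OF tendsto_const _ that]) simp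
    then have "filterlim (\<lambda>x::real. - (x\<^sup>2 * (1/2))) at_bot F"
      by (simp add: filterlim_uminus_at_top)
    then have "((\<lambda>x. exp (- (x\<^sup>2 * (1/2)))) \<longlongrightarrow> 0) F"
      by (rule filterlim_compose[OF exp_at_bot])
    then show "((\<lambda>x. exp (- x\<^sup>2 / 2)) \<longlongrightarrow> 0) F" by simp
  qed
  show "(std_normal_density \<longlongrightarrow> 0) at_top"
    unfolding std_normal_density_def by (rule *, rule filterlim_pow_at_top) (auto simp: filterlim_ident)
  show "(std_normal_density \<longlongrightarrow> 0) at_bot"
    unfolding std_normal_density_def by (rule *, rule filterlim_pow_at_bot_even) (auto simp: filterlim_ident)
qed

lemma integrable_gauss_bounded:
  fixes f :: "real \<Rightarrow> real"
  assumes "f \<in> borel_measurable borel" "\<And>x. \<bar>f x\<bar> \<le> K"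
  shows "integrable gauss f"
  by (rule gauss.integrable_const_bound[of _ K]) (use assms in auto)

lemma integrable_gauss_id: "integrable gauss (\<lambda>x. x)"
  using integrable_std_normal_moment[of 1] by (subst integrable_density) auto

text \<open>With p the standard normal density, p' = - x p, so F p is an antiderivative of p F' - x
  p F, and it tends to 0 at both infinities because F is bounded. The fundamental theorem on the
  whole line equates the two integrals.\<close>

lemma gauss_ibp:
  fixes F :: "real \<Rightarrow> real"
  assumes d: "\<And>x. (F has_real_derivative F' x) (at x)" and c: "\<And>x. isCont F' x"
    and b: "\<And>x. \<bar>F x\<bar> \<le> K" "\<And>x. \<bar>F' x\<bar> \<le> K'"
  shows "(\<integral>x. x * F x \<partial>gauss) = (\<integral>x. F' x \<partial>gauss)"
proof -
  let ?p = std_normal_density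
  have cF: "isCont F x" for x using d by (rule DERIV_isCont)
  have mF[measurable]: "F \<in> borel_measurable borel"
    by (intro borel_measurable_continuous_onI continuous_at_imp_continuous_on ballI cF)
  have mF'[measurable]: "F' \<in> borel_measurable borel"
    by (intro borel_measurable_continuous_onI continuous_at_imp_continuous_on ballI c)
  have i1: "integrable gauss F'" by (rule integrable_gauss_bounded[OF mF' b(2)])
  have i2: "integrable gauss (\<lambda>x. x * F x)"
  proof (rule Bochner_Integration.integrable_bound)
    show "integrable gauss (\<lambda>x. K * x)" using integrable_gauss_id by simp
    show "AE x in gauss. norm (x * F x) \<le> norm (K * x)"
    proof (rule AE_I2)
      fix x
      have "\<bar>F x\<bar> \<le> \<bar>K\<bar>" using b(1)[of x] by linarith
      then have "\<bar>x\<bar> * \<bar>F x\<bar> \<le> \<bar>x\<bar> * \<bar>K\<bar>" by (rule mult_left_mono) simp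
      then show "norm (x * F x) \<le> norm (K * x)" by (simp add: abs_mult mult.commute)
    qed
  qed simp
  have i1': "integrable lborel (\<lambda>x. ?p x * F' x)" and i2': "integrable lborel (\<lambda>x. ?p x * (x * F x))"
    using i1 i2 by (simp_all add: integrable_density)
  let ?G = "\<lambda>x. F x * ?p x" and ?g = "\<lambda>x. ?p x * F' x - ?p x * (x * F x)"
  have ig: "integrable lborel ?g" using i1' i2' by simp
  have dp: "(?p has_real_derivative - (x * ?p x)) (at x)" for x
    unfolding std_normal_density_def
    by (rule DERIV_cong, rule DERIV_cmult, rule DERIV_chain2[OF DERIV_exp])
      (auto intro!: derivative_eq_intros simp: power2_eq_square)
  have cp: "isCont ?p x" for x using dp by (rule DERIV_isCont)
  have lim: "(?G \<longlongrightarrow> 0) A" if "(?p \<longlongrightarrow> 0) A" for A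
  proof (rule tendsto_0_le[OF that, of _ K])
    show "\<forall>\<^sub>F x in A. norm (F x * ?p x) \<le> norm (?p x) * K"
      using b(1) by (intro always_eventually allI) (auto simp: abs_mult mult.commute[of _ K] intro: mult_right_mono)
  qed
  have "(LBINT x=-\<infinity>..\<infinity>. ?g x) = 0 - 0"
  proof (rule interval_integral_FTC_integrable[where F = ?G])
    show "(?G has_vector_derivative ?g x) (at x)" for x
      unfolding has_real_derivative_iff_has_vector_derivative[symmetric]
      by (rule DERIV_cong, rule DERIV_mult[OF d dp]) (simp add: algebra_simps)
    show "isCont ?g x" for x
      by (intro continuous_intros cp c cF)
    show "set_integrable lborel (einterval (-\<infinity>) \<infinity>) ?g"
      using ig by (simp add: set_integrable_def einterval_eq)
    show "((?G \<circ> real_of_ereal) \<longlongrightarrow> 0) (at_right (-\<infinity>))"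
      using lim[OF std_normal_density_lim(2)] by (simp add: ereal_tendsto_simps)
    show "((?G \<circ> real_of_ereal) \<longlongrightarrow> 0) (at_left \<infinity>)"
      using lim[OF std_normal_density_lim(1)] by (simp add: ereal_tendsto_simps)
  qed simp
  moreover have "(LBINT x=-\<infinity>..\<infinity>. ?g x) = (\<integral>x. ?g x \<partial>lborel)"
    by (simp add: interval_lebesgue_integral_def set_lebesgue_integral_def einterval_eq)
  ultimately have "(\<integral>x. ?p x * F' x \<partial>lborel) = (\<integral>x. ?p x * (x * F x) \<partial>lborel)"
    using i1' i2' by simp
  then show ?thesis by (simp add: integral_density)
qed

lemma measurable_gprod_component: "j \<in> J \<Longrightarrow> (\<lambda>g. g j) \<in> borel_measurable (gprod J)"
  using measurable_component_singleton[of j J "\<lambda>_. gauss"] by simp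

text \<open>\<open>\<bar>g j\<bar>\<close> is a product over all of \<open>J\<close> whose factors
  away from \<open>j\<close> are 1, so integrability can be checked coordinate by
  coordinate.\<close>

lemma integrable_gprod_component:
  assumes "finite J" "j \<in> J" shows "integrable (gprod J) (\<lambda>g. \<bar>g j\<bar>)"
proof -
  have "integrable gauss (\<lambda>y. if i = j then \<bar>y\<bar> else 1)" for i
    using integrable_gauss_id by (cases "i = j") auto
  then have "integrable (gprod J) (\<lambda>g. \<Prod>i\<in>J. if i = j then \<bar>g i\<bar> else 1)"
    using gprod.product_integrable_prod[OF assms(1), of "\<lambda>i y. if i = j then \<bar>y\<bar> else 1"] by simp
  moreover have "(\<Prod>i\<in>J. if i = j then \<bar>g i\<bar> else 1) = \<bar>g j\<bar>" for g :: "'a \<Rightarrow> real"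
    using assms by (simp add: prod.If_cases Int_absorb1 Collect_conv_if)
  ultimately show ?thesis by simp
qed

lemma integrable_gprod_bounded:
  fixes f :: "('j \<Rightarrow> real) \<Rightarrow> real"
  assumes "f \<in> borel_measurable (gprod J)" "\<And>x. x \<in> space (gprod J) \<Longrightarrow> \<bar>f x\<bar> \<le> K"
  shows "integrable (gprod J) f"
  by (rule gprod.P.integrable_const_bound[of _ K]) (use assms in auto)

lemma integrable_gprod_component_mult:
  fixes f :: "('j \<Rightarrow> real) \<Rightarrow> real"
  assumes "finite J" "j \<in> J" and f: "f \<in> borel_measurable (gprod J)" "\<And>x. \<bar>f x\<bar> \<le> K"
  shows "integrable (gprod J) (\<lambda>g. g j * f g)"
proof (rule Bochner_Integration.integrable_bound)
  show "integrable (gprod J) (\<lambda>g. K * \<bar>g j\<bar>)" using integrable_gprod_component[OF assms(1,2)] by simp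
  show "(\<lambda>g. g j * f g) \<in> borel_measurable (gprod J)"
    by (intro borel_measurable_times f measurable_gprod_component assms)
  show "AE g in gprod J. norm (g j * f g) \<le> norm (K * \<bar>g j\<bar>)"
  proof (rule AE_I2)
    fix g :: "'j \<Rightarrow> real"
    have "\<bar>f g\<bar> \<le> \<bar>K\<bar>" using f(2)[of g] by linarith
    then have "\<bar>g j\<bar> * \<bar>f g\<bar> \<le> \<bar>g j\<bar> * \<bar>K\<bar>" by (rule mult_left_mono) simp
    then show "norm (g j * f g) \<le> norm (K * \<bar>g j\<bar>)" by (simp add: abs_mult mult.commute)
  qed
qed

lemma gprod_ibp:
  assumes J: "finite J" "j \<in> J"
    and d: "\<And>g y. ((\<lambda>y. F (g(j := y))) has_real_derivative F' (g(j := y))) (at y)"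
    and c: "\<And>g y. isCont (\<lambda>y. F' (g(j := y))) y"
    and b: "\<And>g. \<bar>F g\<bar> \<le> K" "\<And>g. \<bar>F' g\<bar> \<le> K'"
    and m: "F \<in> borel_measurable (gprod J)" "F' \<in> borel_measurable (gprod J)"
  shows "(\<integral>g. g j * F g \<partial>gprod J) = (\<integral>g. F' g \<partial>gprod J)"
proof -
  obtain I where I: "J = insert j I" "j \<notin> I" "finite I"
    using J by (metis finite_insert mk_disjoint_insert)
  have "(\<integral>g. g j * F g \<partial>gprod (insert j I)) = (\<integral>x. (\<integral>y. (x(j := y)) j * F (x(j := y)) \<partial>gauss) \<partial>gprod I)"
    by (rule gprod.product_integral_insert[OF I(3,2)])
      (use integrable_gprod_component_mult[OF J m(1) b(1)] I(1) in simp)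
  also have "\<dots> = (\<integral>x. (\<integral>y. F' (x(j := y)) \<partial>gauss) \<partial>gprod I)"
    by (simp add: gauss_ibp[OF d c b])
  also have "\<dots> = (\<integral>g. F' g \<partial>gprod (insert j I))"
    by (rule gprod.product_integral_insert[OF I(3,2), symmetric])
      (use integrable_gprod_bounded[OF m(2) b(2)] I(1) in simp)
  finally show ?thesis using I(1) by simp
qed

text \<open>The bound does not involve \<open>P\<close>, hence is uniform in the disorder. It grows
  with the number of configurations, which is harmless for its purpose: integrability and domination
  for a fixed system.\<close>

lemma rav_bound:
  assumes "is_weight \<Omega> P" shows "\<bar>rav \<Omega> P n f\<bar> \<le> (\<Sum>\<omega>\<in>PiE {..<n} (\<lambda>_. \<Omega>). \<bar>f \<omega>\<bar>)"
proof -
  have fin: "finite (PiE {..<n} (\<lambda>_. \<Omega>))"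
    using assms by (intro finite_PiE) (auto simp: is_weight_def)
  have "rav \<Omega> P n (\<lambda>\<omega>. \<bar>f \<omega>\<bar>) \<le> rav \<Omega> P n (\<lambda>_. \<Sum>\<omega>\<in>PiE {..<n} (\<lambda>_. \<Omega>). \<bar>f \<omega>\<bar>)"
    by (rule rav_mono[OF assms], rule member_le_sum) (use fin in auto)
  then show ?thesis using rav_abs[OF assms, of n f] by (simp add: rav_const[OF assms])
qed

text \<open>An energy linear in the Gaussians, whose strengths \<open>c j\<close> and deterministic
  part \<open>d\<close> move with \<theta>. The bound \<open>K\<close> on the speeds supplies the
  dominating function in \<open>nu_derivative\<close> and does not appear in the resulting
  formula.\<close>

locale gaussian_path =
  fixes J :: "'j set" and \<Omega> :: "'s set" and u :: "'j \<Rightarrow> 's \<Rightarrow> real"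
    and c c' :: "'j \<Rightarrow> real \<Rightarrow> real" and d d' :: "real \<Rightarrow> 's \<Rightarrow> real" and K :: real
  assumes finJ: "finite J" and fin\<Omega>: "finite \<Omega>" and ne\<Omega>: "\<Omega> \<noteq> {}"
    and dc: "\<And>j \<theta>. (c j has_real_derivative c' j \<theta>) (at \<theta>)"
    and dd: "\<And>\<sigma> \<theta>. ((\<lambda>\<theta>. d \<theta> \<sigma>) has_real_derivative d' \<theta> \<sigma>) (at \<theta>)"
    and bc: "\<And>j \<theta>. \<bar>c' j \<theta>\<bar> \<le> K" and bd: "\<And>\<sigma> \<theta>. \<sigma> \<in> \<Omega> \<Longrightarrow> \<bar>d' \<theta> \<sigma>\<bar> \<le> K"
begin

definition ham :: "real \<Rightarrow> ('j \<Rightarrow> real) \<Rightarrow> 's \<Rightarrow> real" where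
  "ham \<theta> g \<sigma> = (\<Sum>j\<in>J. c j \<theta> * g j * u j \<sigma>) + d \<theta> \<sigma>"

definition gav :: "real \<Rightarrow> ('j \<Rightarrow> real) \<Rightarrow> nat \<Rightarrow> ((nat \<Rightarrow> 's) \<Rightarrow> real) \<Rightarrow> real" where
  "gav \<theta> g = rav \<Omega> (gibbs \<Omega> (ham \<theta> g))"

definition nu :: "real \<Rightarrow> nat \<Rightarrow> ((nat \<Rightarrow> 's) \<Rightarrow> real) \<Rightarrow> real" where
  "nu \<theta> n f = (\<integral>g. gav \<theta> g n f \<partial>gprod J)"

lemma weight: "is_weight \<Omega> (gibbs \<Omega> (ham \<theta> g))"
  by (rule is_weight_gibbs[OF fin\<Omega> ne\<Omega>])

lemma gav_measurable: "(\<lambda>g. gav \<theta> g n f) \<in> borel_measurable (gprod J)"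
proof -
  have [measurable]: "(\<lambda>g. ham \<theta> g \<sigma>) \<in> borel_measurable (gprod J)" for \<sigma>
    unfolding ham_def
    by (intro borel_measurable_add borel_measurable_sum borel_measurable_times measurable_gprod_component) auto
  show ?thesis unfolding gav_def rav_def gibbs_def by measurable
qed

lemma gav_bound: "\<bar>gav \<theta> g n f\<bar> \<le> (\<Sum>\<omega>\<in>PiE {..<n} (\<lambda>_. \<Omega>). \<bar>f \<omega>\<bar>)"
  unfolding gav_def by (rule rav_bound[OF weight])

lemma gav_integrable: "integrable (gprod J) (\<lambda>g. gav \<theta> g n f)"
  by (rule integrable_gprod_bounded[OF gav_measurable gav_bound])

lemma gav_component_integrable: "j \<in> J \<Longrightarrow> integrable (gprod J) (\<lambda>g. g j * gav \<theta> g n f)"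
  by (rule integrable_gprod_component_mult[OF finJ _ gav_measurable gav_bound])

text \<open>The energy is linear in \<open>g j\<close> with slope \<open>c j \<theta> * u j\<close>,
  so integration by parts trades the factor \<open>g j\<close> for one more replica.\<close>

lemma nu_component:
  assumes f: "depends_below n f" and j: "j \<in> J"
  shows "(\<integral>g. g j * gav \<theta> g n f \<partial>gprod J)
    = c j \<theta> * nu \<theta> (Suc n) (\<lambda>\<omega>. f \<omega> * replica_diff n (u j) \<omega>)"
proof -
  have dham: "((\<lambda>y. ham \<theta> (g(j := y)) \<sigma>) has_real_derivative c j \<theta> * u j \<sigma>) (at y)" for g y \<sigma>
  proof -
    have "ham \<theta> (g(j := y)) \<sigma> = c j \<theta> * y * u j \<sigma> + (\<Sum>i\<in>J - {j}. c i \<theta> * g i * u i \<sigma>) + d \<theta> \<sigma>" for y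
      unfolding ham_def using finJ j by (subst sum.remove[of _ j]) auto
    then show ?thesis by (auto intro!: derivative_eq_intros)
  qed
  have der: "((\<lambda>y. gav \<theta> (g(j := y)) m f) has_real_derivative
      gav \<theta> (g(j := y)) (Suc m) (\<lambda>\<omega>. f \<omega> * replica_diff m (\<lambda>\<sigma>. c j \<theta> * u j \<sigma>) \<omega>)) (at y)"
    if "depends_below m f" for g y m f
    unfolding gav_def using has_derivative_rav_gibbs[OF fin\<Omega> ne\<Omega> that dham] .
  have dep: "depends_below (Suc n) (\<lambda>\<omega>. f \<omega> * replica_diff n (\<lambda>\<sigma>. c j \<theta> * u j \<sigma>) \<omega>)"
    by (intro depends_below_mult depends_below_mono[OF f] depends_below_replica_diff) simp
  have "(\<integral>g. g j * gav \<theta> g n f \<partial>gprod J)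
    = (\<integral>g. gav \<theta> g (Suc n) (\<lambda>\<omega>. f \<omega> * replica_diff n (\<lambda>\<sigma>. c j \<theta> * u j \<sigma>) \<omega>) \<partial>gprod J)"
    by (rule gprod_ibp[OF finJ j der[OF f] DERIV_isCont[OF der[OF dep]] gav_bound gav_bound
          gav_measurable gav_measurable])
  also have "\<dots> = (\<integral>g. c j \<theta> * gav \<theta> g (Suc n) (\<lambda>\<omega>. f \<omega> * replica_diff n (u j) \<omega>) \<partial>gprod J)"
  proof (rule Bochner_Integration.integral_cong[OF refl])
    have e: "f \<omega> * replica_diff n (\<lambda>\<sigma>. c j \<theta> * u j \<sigma>) \<omega> = c j \<theta> * (f \<omega> * replica_diff n (u j) \<omega>)" for \<omega>
      by (simp add: replica_diff_def algebra_simps flip: sum_distrib_left)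
    show "gav \<theta> g (Suc n) (\<lambda>\<omega>. f \<omega> * replica_diff n (\<lambda>\<sigma>. c j \<theta> * u j \<sigma>) \<omega>)
      = c j \<theta> * gav \<theta> g (Suc n) (\<lambda>\<omega>. f \<omega> * replica_diff n (u j) \<omega>)" for g
      unfolding gav_def e by (rule rav_cmult)
  qed
  finally show ?thesis by (simp add: nu_def)
qed

text \<open>Moving the strength of \<open>j\<close> produces \<open>c' j \<theta> * g j\<close> and
  a first new replica; integration by parts in \<open>g j\<close> then gives the factor
  \<open>c j \<theta>\<close> and a second one. The deterministic part creates only the first,
  whence the different replica numbers.\<close>

theorem nu_derivative:
  assumes f: "depends_below n f"
  shows "((\<lambda>\<theta>. nu \<theta> n f) has_real_derivative
    (\<Sum>j\<in>J. c j \<theta> * c' j \<theta> * nu \<theta> (Suc (Suc n)) (\<lambda>\<omega>. f \<omega> * replica_diff n (u j) \<omega> * replica_diff (Suc n) (u j) \<omega>))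
    + nu \<theta> (Suc n) (\<lambda>\<omega>. f \<omega> * replica_diff n (d' \<theta>) \<omega>)) (at \<theta>)"
proof -
  let ?u = "\<lambda>j \<omega>. f \<omega> * replica_diff n (u j) \<omega>" and ?d = "\<lambda>\<theta> \<omega>. f \<omega> * replica_diff n (d' \<theta>) \<omega>"
  define f' where "f' \<theta> g = (\<Sum>j\<in>J. c' j \<theta> * (g j * gav \<theta> g (Suc n) (?u j))) + gav \<theta> g (Suc n) (?d \<theta>)" for \<theta> g
  have der: "((\<lambda>\<theta>. gav \<theta> g n f) has_real_derivative f' \<theta> g) (at \<theta>)" for g \<theta>
  proof -
    let ?H' = "\<lambda>\<sigma>. (\<Sum>j\<in>J. c' j \<theta> * g j * u j \<sigma>) + d' \<theta> \<sigma>"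
    have "((\<lambda>\<theta>. ham \<theta> g \<sigma>) has_real_derivative ?H' \<sigma>) (at \<theta>)" for \<sigma>
      unfolding ham_def by (intro DERIV_add dd DERIV_sum) (auto intro!: derivative_eq_intros dc)
    then have "((\<lambda>\<theta>. gav \<theta> g n f) has_real_derivative gav \<theta> g (Suc n) (\<lambda>\<omega>. f \<omega> * replica_diff n ?H' \<omega>)) (at \<theta>)"
      unfolding gav_def by (rule has_derivative_rav_gibbs[OF fin\<Omega> ne\<Omega> f])
    moreover have "f \<omega> * replica_diff n ?H' \<omega> = (\<Sum>j\<in>J. (c' j \<theta> * g j) * ?u j \<omega>) + ?d \<theta> \<omega>" for \<omega>
    proof -
      have "replica_diff n ?H' \<omega> = (\<Sum>j\<in>J. (c' j \<theta> * g j) * replica_diff n (u j) \<omega>) + replica_diff n (d' \<theta>) \<omega>"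
        unfolding replica_diff_def sum.distrib
        by (subst sum.swap) (simp add: right_diff_distrib sum_subtractf sum_distrib_left distrib_left mult_ac)
      then show ?thesis by (simp add: distrib_left sum_distrib_left mult_ac)
    qed
    ultimately show ?thesis by (simp add: f'_def gav_def rav_add rav_sum rav_cmult mult.assoc)
  qed
  \<comment> \<open>\<open>B\<close> and \<open>B'\<close> bound the replica averages uniformly in
    the disorder and in \<theta>, so that \<open>\<bar>g j\<bar>\<close> is the only unbounded
    factor of the dominating function.\<close>
  define B where "B = (\<Sum>j\<in>J. \<Sum>\<omega>\<in>PiE {..<Suc n} (\<lambda>_. \<Omega>). \<bar>?u j \<omega>\<bar>)"
  define B' where "B' = (\<Sum>\<omega>\<in>PiE {..<Suc n} (\<lambda>_. \<Omega>). \<bar>f \<omega>\<bar> * (2 * real n * K))"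
  let ?w = "\<lambda>g. (\<Sum>j\<in>J. K * (\<bar>g j\<bar> * B)) + B'"
  have K0: "0 \<le> K" using bc[of undefined 0] by linarith
  have bu: "\<bar>gav \<theta> g (Suc n) (?u j)\<bar> \<le> B" if "j \<in> J" for j \<theta> g
    by (rule order_trans[OF gav_bound], unfold B_def, rule member_le_sum[OF that])
      (auto intro: sum_nonneg simp: finJ)
  have bd': "\<bar>gav \<theta> g (Suc n) (?d \<theta>)\<bar> \<le> B'" for \<theta> g
  proof (rule order_trans[OF gav_bound], unfold B'_def, rule sum_mono)
    fix \<omega> assume w: "\<omega> \<in> PiE {..<Suc n} (\<lambda>_. \<Omega>)"
    have "\<bar>replica_diff n (d' \<theta>) \<omega>\<bar> \<le> (\<Sum>k<n. \<bar>d' \<theta> (\<omega> k)\<bar>) + real n * \<bar>d' \<theta> (\<omega> n)\<bar>"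
      unfolding replica_diff_def by (rule order_trans[OF abs_triangle_ineq4]) (simp add: abs_mult)
    also have "\<dots> \<le> (\<Sum>k<n. K) + real n * K"
      by (intro add_mono sum_mono mult_left_mono bd PiE_mem[OF w]) auto
    finally show "\<bar>f \<omega> * replica_diff n (d' \<theta>) \<omega>\<bar> \<le> \<bar>f \<omega>\<bar> * (2 * real n * K)"
      unfolding abs_mult by (intro mult_left_mono) (auto simp: mult_ac)
  qed
  have "((\<lambda>\<theta>. \<integral>g. gav \<theta> g n f \<partial>gprod J) has_real_derivative (\<integral>g. f' \<theta> g \<partial>gprod J)) (at \<theta>)"
  proof (rule has_derivative_integral[OF gav_integrable _ der])
    show "integrable (gprod J) ?w"
      by (intro Bochner_Integration.integrable_add Bochner_Integration.integrable_sum integrable_mult_right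
          integrable_mult_left integrable_gprod_component finJ) auto
    show "\<bar>f' \<theta> g\<bar> \<le> ?w g" for \<theta> g
      unfolding f'_def
    proof (rule order_trans[OF abs_triangle_ineq], rule add_mono[OF _ bd'], rule order_trans[OF sum_abs], rule sum_mono)
      fix j assume "j \<in> J"
      then show "\<bar>c' j \<theta> * (g j * gav \<theta> g (Suc n) (?u j))\<bar> \<le> K * (\<bar>g j\<bar> * B)"
        unfolding abs_mult using K0 by (intro mult_mono bc bu order_refl) auto
    qed
    show "f' \<theta> \<in> borel_measurable (gprod J)" for \<theta>
      unfolding f'_def
      by (intro borel_measurable_add borel_measurable_sum borel_measurable_times borel_measurable_const
          gav_measurable measurable_gprod_component)
  qed
  moreover have "(\<integral>g. f' \<theta> g \<partial>gprod J)
    = (\<Sum>j\<in>J. c' j \<theta> * (\<integral>g. g j * gav \<theta> g (Suc n) (?u j) \<partial>gprod J)) + nu \<theta> (Suc n) (?d \<theta>)"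
    unfolding f'_def nu_def using gav_component_integrable gav_integrable
    by (subst Bochner_Integration.integral_add) auto
  moreover have "(\<integral>g. g j * gav \<theta> g (Suc n) (?u j) \<partial>gprod J)
    = c j \<theta> * nu \<theta> (Suc (Suc n)) (\<lambda>\<omega>. ?u j \<omega> * replica_diff (Suc n) (u j) \<omega>)" if "j \<in> J" for j
    by (rule nu_component[OF _ that])
      (intro depends_below_mult depends_below_mono[OF f] depends_below_replica_diff, simp)
  ultimately show ?thesis by (simp add: nu_def mult_ac)
qed

lemma nu_add: "nu \<theta> n (\<lambda>\<omega>. f \<omega> + g \<omega>) = nu \<theta> n f + nu \<theta> n g"
  unfolding nu_def gav_def rav_add using gav_integrable by (simp add: gav_def)

lemma nu_diff: "nu \<theta> n (\<lambda>\<omega>. f \<omega> - g \<omega>) = nu \<theta> n f - nu \<theta> n g"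
  unfolding nu_def gav_def rav_diff using gav_integrable by (simp add: gav_def)

lemma nu_cmult: "nu \<theta> n (\<lambda>\<omega>. a * f \<omega>) = a * nu \<theta> n f"
  unfolding nu_def gav_def rav_cmult by simp

lemma nu_sum: "nu \<theta> n (\<lambda>\<omega>. \<Sum>i\<in>I. f i \<omega>) = (\<Sum>i\<in>I. nu \<theta> n (f i))"
  unfolding nu_def gav_def rav_sum using gav_integrable by (simp add: gav_def)

lemma nu_const: "nu \<theta> n (\<lambda>_. a) = a"
  unfolding nu_def gav_def rav_const[OF weight] by (simp add: gprod.P.prob_space)

lemma nu_cong:
  "(\<And>\<omega>. \<omega> \<in> PiE {..<n} (\<lambda>_. \<Omega>) \<Longrightarrow> f \<omega> = g \<omega>) \<Longrightarrow> nu \<theta> n f = nu \<theta> n g"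
  unfolding nu_def gav_def by (metis rav_cong)

lemma nu_mono:
  "(\<And>\<omega>. \<omega> \<in> PiE {..<n} (\<lambda>_. \<Omega>) \<Longrightarrow> f \<omega> \<le> g \<omega>) \<Longrightarrow> nu \<theta> n f \<le> nu \<theta> n g"
  unfolding nu_def by (intro integral_mono gav_integrable) (simp add: gav_def rav_mono[OF weight])

lemma nu_abs: "\<bar>nu \<theta> n f\<bar> \<le> nu \<theta> n (\<lambda>\<omega>. \<bar>f \<omega>\<bar>)"
proof -
  have "\<bar>nu \<theta> n f\<bar> \<le> (\<integral>g. \<bar>gav \<theta> g n f\<bar> \<partial>gprod J)" unfolding nu_def by (rule integral_abs_bound)
  also have "\<dots> \<le> nu \<theta> n (\<lambda>\<omega>. \<bar>f \<omega>\<bar>)"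
    unfolding nu_def using gav_integrable by (intro integral_mono) (auto simp: gav_def rav_abs[OF weight])
  finally show ?thesis .
qed

lemma nu_extend: "depends_below n f \<Longrightarrow> n \<le> m \<Longrightarrow> nu \<theta> m f = nu \<theta> n f"
  unfolding nu_def gav_def by (rule Bochner_Integration.integral_cong[OF refl rav_extend[OF weight]])

lemma nu_relabel:
  assumes "depends_below m f" "inj_on \<pi> {..<m}" "\<And>k. k < m \<Longrightarrow> \<pi> k < n"
  shows "nu \<theta> n (\<lambda>\<omega>. f (\<lambda>k. \<omega> (\<pi> k))) = nu \<theta> m f"
  unfolding nu_def gav_def by (rule Bochner_Integration.integral_cong[OF refl rav_relabel[OF weight assms]])

end

section \<open>The cavity interpolation\<close>

lemma finite_spins: "finite (spins \<S>)" and spins_nonempty: "spins \<S> \<noteq> {}"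
  by (auto simp: spins_def)

lemma abs_spin_le: "s \<in> spins \<S> \<Longrightarrow> \<bar>s\<bar> \<le> real \<S>"
  by (auto simp: spins_def abs_le_iff)

lemma finite_configs: "finite (configs \<S> N)"
  unfolding configs_def by (intro finite_PiE) (auto simp: finite_spins)

lemma configs_nonempty: "configs \<S> N \<noteq> {}"
  using spins_nonempty by (auto simp: configs_def PiE_eq_empty_iff)

lemma configs_spin: "\<sigma> \<in> configs \<S> N \<Longrightarrow> b < N \<Longrightarrow> \<sigma> b \<in> spins \<S>"
  by (auto simp: configs_def)

lemma finite_pairs: "finite (pairs N)"
  by (rule finite_subset[of _ "{..<N} \<times> {..<N}"]) (auto simp: pairs_def)

text \<open>Coefficients of the derivative of a replica average: the last replica comes from the normalization.\<close>
definition alt_coeff :: "nat \<Rightarrow> nat \<Rightarrow> real" where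
  "alt_coeff n k = (if k < n then 1 else - real n)"

lemma replica_diff_eq_sum: "replica_diff n v \<omega> = (\<Sum>k<Suc n. alt_coeff n k * v (\<omega> k))"
  by (simp add: replica_diff_def alt_coeff_def)

lemma sum_abs_alt_coeff: "(\<Sum>k<Suc n. \<bar>alt_coeff n k\<bar>) = 2 * real n"
  by (simp add: alt_coeff_def)

definition overlap :: "nat \<Rightarrow> (nat \<Rightarrow> real) \<Rightarrow> (nat \<Rightarrow> real) \<Rightarrow> real" where
  "overlap N \<sigma> \<tau> = (\<Sum>b<N. \<sigma> b * \<tau> b) / real N"

text \<open>Division is by \<open>N\<close>, not \<open>N - 1\<close>: the difference to
  \<open>overlap\<close> is then exactly the spin product at \<open>i\<close> over \<open>N\<close>,
  and the normalization agrees with the variance of the couplings through \<open>i\<close>.\<close>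

definition cavity_overlap :: "nat \<Rightarrow> nat \<Rightarrow> (nat \<Rightarrow> real) \<Rightarrow> (nat \<Rightarrow> real) \<Rightarrow> real" where
  "cavity_overlap N i \<sigma> \<tau> = (\<Sum>b\<in>{..<N} - {i}. \<sigma> b * \<tau> b) / real N"

lemma overlap_eq_cavity: "i < N \<Longrightarrow> overlap N \<sigma> \<tau> = cavity_overlap N i \<sigma> \<tau> + \<sigma> i * \<tau> i / real N"
  unfolding overlap_def cavity_overlap_def
  by (subst sum.remove[of _ i]) (auto simp: add_divide_distrib)

lemma sum_pairs_through:
  fixes F :: "nat \<Rightarrow> nat \<Rightarrow> real"
  assumes "i < N" "\<And>a b. F a b = F b a"
  shows "(\<Sum>j\<in>{j \<in> pairs N. fst j = i \<or> snd j = i}. F (fst j) (snd j)) = (\<Sum>b\<in>{..<N} - {i}. F i b)"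
  by (rule sum.reindex_bij_witness[where i = "\<lambda>b. (min b i, max b i)"
        and j = "\<lambda>j. if fst j = i then snd j else fst j"])
    (use assms in \<open>auto simp: pairs_def min_def max_def\<close>)

locale ghatak_sherrington =
  fixes \<S> :: nat and \<beta> D h p q :: real
  assumes S_ge_1: "1 \<le> \<S>" and fixed_point: "fixed_point \<S> \<beta> D h p q"
begin

definition site_ham :: "real \<Rightarrow> real \<Rightarrow> real" where
  "site_ham \<eta> s = \<beta> * sqrt q * \<eta> * s + h * s + (D + \<beta>\<^sup>2 / 2 * (p - q)) * s\<^sup>2"

lemma site_weight: "is_weight (spins \<S>) (gibbs (spins \<S>) (site_ham \<eta>))"
  by (rule is_weight_gibbs[OF finite_spins spins_nonempty])

lemma site_mom_eq: "site_mom \<S> \<beta> D h p q j \<eta> = (\<Sum>s\<in>spins \<S>. s ^ j * gibbs (spins \<S>) (site_ham \<eta>) s)"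
  by (simp add: site_mom_def site_w_def gibbs_def site_ham_def sum_divide_distrib)

lemma site_mom_bound: "\<bar>site_mom \<S> \<beta> D h p q j \<eta>\<bar> \<le> real \<S> ^ j"
proof -
  have "\<bar>site_mom \<S> \<beta> D h p q j \<eta>\<bar> \<le> (\<Sum>s\<in>spins \<S>. real \<S> ^ j * gibbs (spins \<S>) (site_ham \<eta>) s)"
    unfolding site_mom_eq
  proof (rule order_trans[OF sum_abs], rule sum_mono)
    fix s assume s: "s \<in> spins \<S>"
    have "0 \<le> gibbs (spins \<S>) (site_ham \<eta>) s" using site_weight s by (auto simp: is_weight_def)
    then show "\<bar>s ^ j * gibbs (spins \<S>) (site_ham \<eta>) s\<bar> \<le> real \<S> ^ j * gibbs (spins \<S>) (site_ham \<eta>) s"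
      by (simp add: abs_mult power_abs mult_right_mono power_mono abs_spin_le[OF s])
  qed
  also have "\<dots> = real \<S> ^ j"
    using site_weight by (simp add: is_weight_def flip: sum_distrib_left)
  finally show ?thesis .
qed

lemma site_mom_measurable [measurable]: "site_mom \<S> \<beta> D h p q j \<in> borel_measurable borel"
  unfolding site_mom_def[abs_def] site_w_def by measurable

lemma Eeta_mono_bound:
  assumes "f \<in> borel_measurable borel" "\<And>x. \<bar>f x\<bar> \<le> K" shows "\<bar>Eeta f\<bar> \<le> K"
proof -
  have "\<bar>Eeta f\<bar> \<le> (\<integral>x. \<bar>f x\<bar> \<partial>gauss)" unfolding Eeta_def by (rule integral_abs_bound)
  also have "\<dots> \<le> (\<integral>x. K \<partial>gauss)"
    using integrable_gauss_bounded[OF assms] assms(2) by (intro integral_mono) auto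
  finally show ?thesis using gauss.prob_space by simp
qed

lemma q_bounds: "0 \<le> q" "q \<le> (real \<S>)\<^sup>2"
proof -
  have q: "q = Eeta (\<lambda>\<eta>. (site_mom \<S> \<beta> D h p q 1 \<eta>)\<^sup>2)" using fixed_point by (simp add: fixed_point_def)
  show "0 \<le> q" by (subst q) (simp add: Eeta_def)
  have "(site_mom \<S> \<beta> D h p q 1 \<eta>)\<^sup>2 \<le> (real \<S>)\<^sup>2" for \<eta>
    using site_mom_bound[of 1 \<eta>] by (metis abs_le_square_iff abs_of_nat power_one_right)
  then have "\<bar>Eeta (\<lambda>\<eta>. (site_mom \<S> \<beta> D h p q 1 \<eta>)\<^sup>2)\<bar> \<le> (real \<S>)\<^sup>2"
    by (intro Eeta_mono_bound) auto
  then show "q \<le> (real \<S>)\<^sup>2" using q by linarith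
qed

lemma p_bounds: "\<bar>p\<bar> \<le> (real \<S>)\<^sup>2"
proof -
  have p: "p = Eeta (\<lambda>\<eta>. site_mom \<S> \<beta> D h p q 2 \<eta>)" using fixed_point by (simp add: fixed_point_def)
  show ?thesis by (subst p, rule Eeta_mono_bound[OF _ site_mom_bound]) simp
qed

text \<open>The value around which an overlap concentrates. Treating self-overlaps
  (\<open>k = l\<close>) and overlaps of distinct replicas alike lets one cavity equation serve
  both.\<close>

definition centre :: "nat \<Rightarrow> nat \<Rightarrow> real" where
  "centre k l = (if k = l then p else q)"

lemma centre_bound: "\<bar>centre k l\<bar> \<le> (real \<S>)\<^sup>2"
  using p_bounds q_bounds by (auto simp: centre_def)

text \<open>The index \<open>(0, 0)\<close>, which is not a pair, carries the Gaussian \<open>\<eta>\<close> of the decoupled site.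
  The trigonometric parametrization is smooth at both ends of the path: \<open>\<theta> = 0\<close> decouples the site \<open>i\<close>,
  \<open>\<theta> = pi / 2\<close> is the original model.\<close>
definition coupling :: "nat \<Rightarrow> nat \<Rightarrow> nat \<times> nat \<Rightarrow> (nat \<Rightarrow> real) \<Rightarrow> real" where
  "coupling N i j \<sigma> = (if j = (0, 0) then \<beta> * sqrt q * \<sigma> i else \<beta> / sqrt (real N) * \<sigma> (fst j) * \<sigma> (snd j))"

definition strength :: "nat \<Rightarrow> nat \<times> nat \<Rightarrow> real \<Rightarrow> real" where
  "strength i j \<theta> = (if j = (0, 0) then cos \<theta> else if fst j = i \<or> snd j = i then sin \<theta> else 1)"

definition strength' :: "nat \<Rightarrow> nat \<times> nat \<Rightarrow> real \<Rightarrow> real" where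
  "strength' i j \<theta> = (if j = (0, 0) then - sin \<theta> else if fst j = i \<or> snd j = i then cos \<theta> else 0)"

text \<open>The last summand fades out the quadratic correction of the single-site weight as the
  site is coupled again. Its derivative supplies the difference p - q between the centres of
  self-overlaps and proper overlaps.\<close>

definition drift :: "nat \<Rightarrow> nat \<Rightarrow> real \<Rightarrow> (nat \<Rightarrow> real) \<Rightarrow> real" where
  "drift N i \<theta> \<sigma> = D * (\<Sum>b<N. (\<sigma> b)\<^sup>2) + h * (\<Sum>b<N. \<sigma> b) + (cos \<theta>)\<^sup>2 * (\<beta>\<^sup>2 / 2 * (p - q)) * (\<sigma> i)\<^sup>2"

definition drift' :: "nat \<Rightarrow> real \<Rightarrow> (nat \<Rightarrow> real) \<Rightarrow> real" where
  "drift' i \<theta> \<sigma> = - (sin \<theta> * cos \<theta> * (\<beta>\<^sup>2 * (p - q)) * (\<sigma> i)\<^sup>2)"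

abbreviation "gidx N \<equiv> insert (0, 0) (pairs N)"

lemma origin_notin_pairs: "(0, 0) \<notin> pairs N" by (simp add: pairs_def)

lemma path:
  assumes "i < N"
  shows "gaussian_path (gidx N) (configs \<S> N) (strength i) (strength' i) (drift N i) (drift' i)
    (1 + \<beta>\<^sup>2 * \<bar>p - q\<bar> * (real \<S>)\<^sup>2)"
proof
  show "finite (gidx N)" by (simp add: finite_pairs)
  show "finite (configs \<S> N)" "configs \<S> N \<noteq> {}" by (rule finite_configs configs_nonempty)+
  show "(strength i j has_real_derivative strength' i j \<theta>) (at \<theta>)" for j \<theta>
    unfolding strength_def[abs_def] strength'_def by (auto intro!: derivative_eq_intros)
  show "((\<lambda>\<theta>. drift N i \<theta> \<sigma>) has_real_derivative drift' i \<theta> \<sigma>) (at \<theta>)" for \<theta> \<sigma>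
    unfolding drift_def drift'_def by (auto intro!: derivative_eq_intros)
  show "\<bar>strength' i j \<theta>\<bar> \<le> 1 + \<beta>\<^sup>2 * \<bar>p - q\<bar> * (real \<S>)\<^sup>2" for j \<theta>
  proof -
    have "\<bar>strength' i j \<theta>\<bar> \<le> 1" by (auto simp: strength'_def)
    moreover have "0 \<le> \<beta>\<^sup>2 * \<bar>p - q\<bar> * (real \<S>)\<^sup>2" by simp
    ultimately show ?thesis by linarith
  qed
  show "\<bar>drift' i \<theta> \<sigma>\<bar> \<le> 1 + \<beta>\<^sup>2 * \<bar>p - q\<bar> * (real \<S>)\<^sup>2" if "\<sigma> \<in> configs \<S> N" for \<theta> \<sigma>
  proof -
    have "\<bar>sin \<theta> * cos \<theta>\<bar> \<le> 1 * 1" unfolding abs_mult by (intro mult_mono) auto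
    moreover have "(\<sigma> i)\<^sup>2 \<le> (real \<S>)\<^sup>2"
      using abs_spin_le[OF configs_spin[OF that assms]] by (metis abs_le_square_iff abs_of_nat)
    ultimately have "\<bar>sin \<theta> * cos \<theta>\<bar> * (\<beta>\<^sup>2 * \<bar>p - q\<bar> * (\<sigma> i)\<^sup>2) \<le> 1 * (\<beta>\<^sup>2 * \<bar>p - q\<bar> * (real \<S>)\<^sup>2)"
      by (intro mult_mono mult_left_mono) auto
    then show ?thesis by (simp add: drift'_def abs_mult mult_ac)
  qed
qed

definition cham :: "nat \<Rightarrow> nat \<Rightarrow> real \<Rightarrow> (nat \<times> nat \<Rightarrow> real) \<Rightarrow> (nat \<Rightarrow> real) \<Rightarrow> real" where
  "cham N i = gaussian_path.ham (gidx N) (coupling N i) (strength i) (drift N i)"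

definition cgav :: "nat \<Rightarrow> nat \<Rightarrow> real \<Rightarrow> (nat \<times> nat \<Rightarrow> real) \<Rightarrow> nat \<Rightarrow> ((nat \<Rightarrow> nat \<Rightarrow> real) \<Rightarrow> real) \<Rightarrow> real" where
  "cgav N i = gaussian_path.gav (gidx N) (configs \<S> N) (coupling N i) (strength i) (drift N i)"

definition cnu :: "nat \<Rightarrow> nat \<Rightarrow> real \<Rightarrow> nat \<Rightarrow> ((nat \<Rightarrow> nat \<Rightarrow> real) \<Rightarrow> real) \<Rightarrow> real" where
  "cnu N i = gaussian_path.nu (gidx N) (configs \<S> N) (coupling N i) (strength i) (drift N i)"

context
  fixes N i :: nat
  assumes i: "i < N"
begin

interpretation P: gaussian_path "gidx N" "configs \<S> N" "coupling N i" "strength i" "strength' i"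
  "drift N i" "drift' i" "1 + \<beta>\<^sup>2 * \<bar>p - q\<bar> * (real \<S>)\<^sup>2"
  by (rule path[OF i])

lemmas cham_eq = P.ham_def[folded cham_def]
lemmas cgav_eq = P.gav_def[folded cham_def cgav_def]
lemmas cnu_eq = P.nu_def[folded cgav_def cnu_def]
lemmas cnu_derivative = P.nu_derivative[folded cnu_def]
lemmas cnu_add = P.nu_add[folded cnu_def]
lemmas cnu_diff = P.nu_diff[folded cnu_def]
lemmas cnu_cmult = P.nu_cmult[folded cnu_def]
lemmas cnu_sum = P.nu_sum[folded cnu_def]
lemmas cnu_const = P.nu_const[folded cnu_def]
lemmas cnu_cong = P.nu_cong[folded cnu_def]
lemmas cnu_mono = P.nu_mono[folded cnu_def]
lemmas cnu_abs = P.nu_abs[folded cnu_def]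
lemmas cnu_extend = P.nu_extend[folded cnu_def]
lemmas cnu_relabel = P.nu_relabel[folded cnu_def]
lemmas cgav_integrable = P.gav_integrable[folded cgav_def]
lemmas cham_weight = P.weight[folded cham_def]

end

text \<open>The factor sqrt N is the scale on which moments stay bounded in \<open>N\<close>.
  Omitting site \<open>i\<close> makes \<open>cav\<close> independent of the spins at
  \<open>i\<close> at the decoupled end of the path.\<close>

definition cav :: "nat \<Rightarrow> nat \<Rightarrow> nat \<Rightarrow> nat \<Rightarrow> (nat \<Rightarrow> nat \<Rightarrow> real) \<Rightarrow> real" where
  "cav N i k l \<omega> = sqrt (real N) * (cavity_overlap N i (\<omega> k) (\<omega> l) - centre k l)"

definition ovl :: "nat \<Rightarrow> nat \<Rightarrow> nat \<Rightarrow> (nat \<Rightarrow> nat \<Rightarrow> real) \<Rightarrow> real" where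
  "ovl N k l \<omega> = sqrt (real N) * (overlap N (\<omega> k) (\<omega> l) - centre k l)"

lemma ovl_eq: "i < N \<Longrightarrow> ovl N k l \<omega> = cav N i k l \<omega> + \<omega> k i * \<omega> l i / sqrt (real N)"
  by (simp add: ovl_def cav_def overlap_eq_cavity algebra_simps real_div_sqrt)
    (simp add: field_simps flip: real_sqrt_mult)

text \<open>Up to the factor sqrt N, inserting \<open>force\<close> is differentiation with respect
  to (sin \<theta>)^2. The two index ranges differ because the path derivative adds replica
  \<open>n\<close> and integration by parts adds replica \<open>n + 1\<close>.\<close>

definition force :: "nat \<Rightarrow> nat \<Rightarrow> nat \<Rightarrow> (nat \<Rightarrow> nat \<Rightarrow> real) \<Rightarrow> real" where
  "force N i n \<omega> = \<beta>\<^sup>2 / 2 * (\<Sum>k<Suc n. \<Sum>l<Suc (Suc n).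
     alt_coeff n k * alt_coeff (Suc n) l * (\<omega> k i * \<omega> l i) * cav N i k l \<omega>)"

lemma depends_below_cav: "k < n \<Longrightarrow> l < n \<Longrightarrow> depends_below n (cav N i k l)"
  by (rule depends_belowI) (simp add: cav_def)

lemma depends_below_ovl: "k < n \<Longrightarrow> l < n \<Longrightarrow> depends_below n (ovl N k l)"
  by (rule depends_belowI) (simp add: ovl_def)

lemma coupling_cov:
  assumes "i < N"
  shows "(\<Sum>j\<in>{j \<in> pairs N. fst j = i \<or> snd j = i}. coupling N i j \<sigma> * coupling N i j \<tau>)
    = \<beta>\<^sup>2 * (\<sigma> i * \<tau> i) * cavity_overlap N i \<sigma> \<tau>"
proof -
  let ?F = "\<lambda>a b. \<beta>\<^sup>2 / real N * ((\<sigma> a * \<sigma> b) * (\<tau> a * \<tau> b))"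
  have "(\<Sum>j\<in>{j \<in> pairs N. fst j = i \<or> snd j = i}. coupling N i j \<sigma> * coupling N i j \<tau>)
    = (\<Sum>j\<in>{j \<in> pairs N. fst j = i \<or> snd j = i}. ?F (fst j) (snd j))"
  proof (rule sum.cong[OF refl])
    fix j assume "j \<in> {j \<in> pairs N. fst j = i \<or> snd j = i}"
    then have "j \<noteq> (0, 0)" using origin_notin_pairs by auto
    moreover have "\<beta> / sqrt (real N) * (\<beta> / sqrt (real N)) = \<beta>\<^sup>2 / real N"
      by (simp add: power2_eq_square times_divide_times_eq)
    ultimately show "coupling N i j \<sigma> * coupling N i j \<tau> = ?F (fst j) (snd j)"
      unfolding coupling_def by (simp only: if_False mult_ac)
  qed
  also have "\<dots> = (\<Sum>b\<in>{..<N} - {i}. ?F i b)"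
    by (rule sum_pairs_through[OF assms]) (simp add: mult_ac)
  also have "\<dots> = \<beta>\<^sup>2 * (\<sigma> i * \<tau> i) * cavity_overlap N i \<sigma> \<tau>"
    by (simp add: cavity_overlap_def sum_distrib_left sum_divide_distrib mult_ac)
  finally show ?thesis .
qed

text \<open>All contributions carry sin \<theta> cos \<theta>: the couplings through
  \<open>i\<close> gain weight and give cavity overlaps, the external field loses weight and
  subtracts q, and the drift corrects the diagonal from q to p. Hence every pair of replicas appears
  centred.\<close>

lemma cnu_deriv:
  assumes i: "i < N" and f: "depends_below n f"
  shows "((\<lambda>\<theta>. cnu N i \<theta> n f) has_real_derivative
    2 * sin \<theta> * cos \<theta> * (cnu N i \<theta> (Suc (Suc n)) (\<lambda>\<omega>. f \<omega> * force N i n \<omega>) / sqrt (real N))) (at \<theta>)"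
proof (rule DERIV_cong[OF cnu_derivative[OF i f]])
  let ?nu = "cnu N i \<theta> (Suc (Suc n))"
  let ?A = "{j \<in> pairs N. fst j = i \<or> snd j = i}"
  define DD where "DD j \<omega> = replica_diff n (coupling N i j) \<omega> * replica_diff (Suc n) (coupling N i j) \<omega>" for j \<omega>
  let ?ss = "\<lambda>F. \<Sum>k<Suc n. \<Sum>l<Suc (Suc n). alt_coeff n k * alt_coeff (Suc n) l * F k l"
  have DD: "DD j \<omega> = ?ss (\<lambda>k l. coupling N i j (\<omega> k) * coupling N i j (\<omega> l))" for j \<omega>
    unfolding DD_def replica_diff_eq_sum sum_product by (intro sum.cong refl) (simp only: mult_ac)
  have "(\<Sum>j\<in>gidx N. strength i j \<theta> * strength' i j \<theta> * ?nu (\<lambda>\<omega>. f \<omega> * DD j \<omega>))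
    = strength i (0, 0) \<theta> * strength' i (0, 0) \<theta> * ?nu (\<lambda>\<omega>. f \<omega> * DD (0, 0) \<omega>)
      + (\<Sum>j\<in>pairs N. strength i j \<theta> * strength' i j \<theta> * ?nu (\<lambda>\<omega>. f \<omega> * DD j \<omega>))"
    by (simp add: finite_pairs origin_notin_pairs)
  \<comment> \<open>Couplings that avoid \<open>i\<close> keep the constant strength 1 and drop
    out.\<close>
  also have "(\<Sum>j\<in>pairs N. strength i j \<theta> * strength' i j \<theta> * ?nu (\<lambda>\<omega>. f \<omega> * DD j \<omega>))
    = (\<Sum>j\<in>?A. strength i j \<theta> * strength' i j \<theta> * ?nu (\<lambda>\<omega>. f \<omega> * DD j \<omega>))"
    using origin_notin_pairs by (intro sum.mono_neutral_right finite_pairs) (auto simp: strength'_def)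
  also have "\<dots> = (\<Sum>j\<in>?A. sin \<theta> * cos \<theta> * ?nu (\<lambda>\<omega>. f \<omega> * DD j \<omega>))"
    by (rule sum.cong[OF refl]) (use origin_notin_pairs in \<open>auto simp: strength_def strength'_def\<close>)
  also have "\<dots> = sin \<theta> * cos \<theta> * ?nu (\<lambda>\<omega>. f \<omega> * (\<Sum>j\<in>?A. DD j \<omega>))"
    by (simp add: sum_distrib_left cnu_sum[OF i])
  finally have 1: "(\<Sum>j\<in>gidx N. strength i j \<theta> * strength' i j \<theta> * ?nu (\<lambda>\<omega>. f \<omega> * DD j \<omega>))
    = sin \<theta> * cos \<theta> * (?nu (\<lambda>\<omega>. f \<omega> * (\<Sum>j\<in>?A. DD j \<omega>)) - ?nu (\<lambda>\<omega>. f \<omega> * DD (0, 0) \<omega>))"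
    by (simp add: strength_def strength'_def algebra_simps)
  have "depends_below (Suc n) (\<lambda>\<omega>. f \<omega> * replica_diff n (drift' i \<theta>) \<omega>)"
    by (intro depends_below_mult depends_below_mono[OF f] depends_below_replica_diff) simp
  then have 2: "cnu N i \<theta> (Suc n) (\<lambda>\<omega>. f \<omega> * replica_diff n (drift' i \<theta>) \<omega>)
    = ?nu (\<lambda>\<omega>. f \<omega> * replica_diff n (drift' i \<theta>) \<omega>)"
    by (rule cnu_extend[OF i, symmetric]) simp
  \<comment> \<open>For \<open>k = l < Suc n\<close> the second coefficient is 1, so the single sum
    coming from the drift can be written as the diagonal part of the double sum.\<close>
  have drift: "replica_diff n (drift' i \<theta>) \<omega> =
    sin \<theta> * cos \<theta> * ?ss (\<lambda>k l. - (if k = l then \<beta>\<^sup>2 * (p - q) * (\<omega> k i * \<omega> l i) else 0))" for \<omega>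
  proof -
    have "(\<Sum>l<Suc (Suc n). alt_coeff n k * alt_coeff (Suc n) l * - (if k = l then \<beta>\<^sup>2 * (p - q) * (\<omega> k i * \<omega> l i) else 0))
      = alt_coeff n k * (- (\<beta>\<^sup>2 * (p - q) * (\<omega> k i)\<^sup>2))" if "k < Suc n" for k
    proof -
      have "(\<Sum>l<Suc (Suc n). alt_coeff n k * alt_coeff (Suc n) l * - (if k = l then \<beta>\<^sup>2 * (p - q) * (\<omega> k i * \<omega> l i) else 0))
        = (\<Sum>l<Suc (Suc n). if k = l then alt_coeff n k * alt_coeff (Suc n) k * - (\<beta>\<^sup>2 * (p - q) * (\<omega> k i * \<omega> k i)) else 0)"
        by (intro sum.cong) auto
      then show ?thesis using that by (simp add: sum.delta' power2_eq_square alt_coeff_def)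
    qed
    then have "?ss (\<lambda>k l. - (if k = l then \<beta>\<^sup>2 * (p - q) * (\<omega> k i * \<omega> l i) else 0))
      = (\<Sum>k<Suc n. alt_coeff n k * (- (\<beta>\<^sup>2 * (p - q) * (\<omega> k i)\<^sup>2)))"
      by (intro sum.cong) auto
    then show ?thesis unfolding replica_diff_eq_sum drift'_def
      by (simp only: sum_distrib_left) (intro sum.cong refl, simp only: mult_ac mult_minus_right)
  qed
  have key: "2 * force N i n \<omega> / sqrt (real N) = (\<Sum>j\<in>?A. DD j \<omega>) - DD (0, 0) \<omega>
      + ?ss (\<lambda>k l. - (if k = l then \<beta>\<^sup>2 * (p - q) * (\<omega> k i * \<omega> l i) else 0))" for \<omega>
  proof -
    have A: "(\<Sum>j\<in>?A. DD j \<omega>) = ?ss (\<lambda>k l. \<beta>\<^sup>2 * (\<omega> k i * \<omega> l i) * cavity_overlap N i (\<omega> k) (\<omega> l))"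
      unfolding DD by (subst sum.swap, rule sum.cong[OF refl], subst sum.swap, rule sum.cong[OF refl])
        (simp only: coupling_cov[OF i, symmetric] sum_distrib_left)
    have B: "DD (0, 0) \<omega> = ?ss (\<lambda>k l. \<beta>\<^sup>2 * q * (\<omega> k i * \<omega> l i))"
    proof -
      have "coupling N i (0, 0) (\<omega> k) * coupling N i (0, 0) (\<omega> l) = \<beta>\<^sup>2 * q * (\<omega> k i * \<omega> l i)" for k l
      proof -
        have "coupling N i (0, 0) (\<omega> k) * coupling N i (0, 0) (\<omega> l)
          = \<beta>\<^sup>2 * (sqrt q * sqrt q) * (\<omega> k i * \<omega> l i)"
          by (simp add: coupling_def power2_eq_square)
        then show ?thesis using q_bounds(1) by simp
      qed
      then show ?thesis unfolding DD by (simp only:)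
    qed
    have C: "2 * force N i n \<omega> / sqrt (real N) =
      ?ss (\<lambda>k l. \<beta>\<^sup>2 * (\<omega> k i * \<omega> l i) * (cavity_overlap N i (\<omega> k) (\<omega> l) - centre k l))"
      unfolding force_def cav_def sum_distrib_left sum_divide_distrib using i
      by (intro sum.cong refl) (simp add: field_simps)
    have E: "\<beta>\<^sup>2 * (\<omega> k i * \<omega> l i) * (cavity_overlap N i (\<omega> k) (\<omega> l) - centre k l)
      = \<beta>\<^sup>2 * (\<omega> k i * \<omega> l i) * cavity_overlap N i (\<omega> k) (\<omega> l) - \<beta>\<^sup>2 * q * (\<omega> k i * \<omega> l i)
        + - (if k = l then \<beta>\<^sup>2 * (p - q) * (\<omega> k i * \<omega> l i) else 0)" for k l
      by (simp add: centre_def algebra_simps)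
    show ?thesis unfolding A B C unfolding E
      by (simp only: distrib_left right_diff_distrib sum.distrib sum_subtractf)
  qed
  have "(\<Sum>j\<in>gidx N. strength i j \<theta> * strength' i j \<theta> *
      ?nu (\<lambda>\<omega>. f \<omega> * replica_diff n (coupling N i j) \<omega> * replica_diff (Suc n) (coupling N i j) \<omega>))
      + cnu N i \<theta> (Suc n) (\<lambda>\<omega>. f \<omega> * replica_diff n (drift' i \<theta>) \<omega>)
    = sin \<theta> * cos \<theta> * (?nu (\<lambda>\<omega>. f \<omega> * (\<Sum>j\<in>?A. DD j \<omega>)) - ?nu (\<lambda>\<omega>. f \<omega> * DD (0, 0) \<omega>))
      + ?nu (\<lambda>\<omega>. (sin \<theta> * cos \<theta>) * (f \<omega> * ?ss (\<lambda>k l. - (if k = l then \<beta>\<^sup>2 * (p - q) * (\<omega> k i * \<omega> l i) else 0))))"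
    unfolding 2 unfolding 1[symmetric] drift unfolding DD_def by (simp only: mult_ac)
  also have "\<dots> = sin \<theta> * cos \<theta> * ?nu (\<lambda>\<omega>. f \<omega> * ((\<Sum>j\<in>?A. DD j \<omega>) - DD (0, 0) \<omega>
      + ?ss (\<lambda>k l. - (if k = l then \<beta>\<^sup>2 * (p - q) * (\<omega> k i * \<omega> l i) else 0))))"
    by (simp only: cnu_cmult[OF i] cnu_add[OF i] cnu_diff[OF i] distrib_left right_diff_distrib)
  also have "\<dots> = sin \<theta> * cos \<theta> * ?nu (\<lambda>\<omega>. (2 / sqrt (real N)) * (f \<omega> * force N i n \<omega>))"
    unfolding key[symmetric] by (simp add: mult_ac)
  also have "\<dots> = 2 * sin \<theta> * cos \<theta> * (?nu (\<lambda>\<omega>. f \<omega> * force N i n \<omega>) / sqrt (real N))"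
    unfolding cnu_cmult[OF i] by simp
  finally show "(\<Sum>j\<in>gidx N. strength i j \<theta> * strength' i j \<theta> *
      ?nu (\<lambda>\<omega>. f \<omega> * replica_diff n (coupling N i j) \<omega> * replica_diff (Suc n) (coupling N i j) \<omega>))
      + cnu N i \<theta> (Suc n) (\<lambda>\<omega>. f \<omega> * replica_diff n (drift' i \<theta>) \<omega>)
    = 2 * sin \<theta> * cos \<theta> * (?nu (\<lambda>\<omega>. f \<omega> * force N i n \<omega>) / sqrt (real N))" .
qed

end

section \<open>Comparison of averages along the path\<close>

context ghatak_sherrington begin

lemma spin_bound:
  assumes "\<omega> \<in> PiE {..<n} (\<lambda>_. configs \<S> N)" "k < n" "b < N"
  shows "\<bar>\<omega> k b\<bar> \<le> real \<S>"
  by (rule abs_spin_le[OF configs_spin[OF PiE_mem[OF assms(1)] assms(3)]]) (simp add: assms(2))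

lemma spin_prod_bound:
  assumes "\<omega> \<in> PiE {..<n} (\<lambda>_. configs \<S> N)" "k < n" "l < n" "b < N"
  shows "\<bar>\<omega> k b * \<omega> l b\<bar> \<le> (real \<S>)\<^sup>2"
  unfolding abs_mult power2_eq_square
  by (intro mult_mono spin_bound[OF assms(1)] assms) auto

lemma cav_bound:
  assumes w: "\<omega> \<in> PiE {..<n} (\<lambda>_. configs \<S> N)" "k < n" "l < n" and i: "i < N"
  shows "\<bar>cav N i k l \<omega>\<bar> \<le> 2 * (real \<S>)\<^sup>2 * sqrt (real N)"
proof -
  have "\<bar>\<Sum>b\<in>{..<N} - {i}. \<omega> k b * \<omega> l b\<bar> \<le> (\<Sum>b\<in>{..<N} - {i}. (real \<S>)\<^sup>2)"
    by (rule order_trans[OF sum_abs sum_mono], rule spin_prod_bound[OF w]) auto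
  also have "\<dots> \<le> real N * (real \<S>)\<^sup>2" using i by (simp add: card_Diff_singleton mult_right_mono)
  finally have "\<bar>cavity_overlap N i (\<omega> k) (\<omega> l)\<bar> \<le> (real \<S>)\<^sup>2"
    using i by (simp add: cavity_overlap_def divide_simps mult.commute)
  then have "\<bar>cavity_overlap N i (\<omega> k) (\<omega> l) - centre k l\<bar> \<le> 2 * (real \<S>)\<^sup>2"
    using centre_bound[of k l] by linarith
  then have "sqrt (real N) * \<bar>cavity_overlap N i (\<omega> k) (\<omega> l) - centre k l\<bar> \<le> sqrt (real N) * (2 * (real \<S>)\<^sup>2)"
    by (rule mult_left_mono) simp
  then show ?thesis by (simp add: cav_def abs_mult mult_ac)
qed

lemma force_le:
  assumes w: "\<omega> \<in> PiE {..<Suc (Suc n)} (\<lambda>_. configs \<S> N)" and i: "i < N"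
  shows "\<bar>force N i n \<omega>\<bar> \<le> \<beta>\<^sup>2 / 2 * (real \<S>)\<^sup>2 *
    (\<Sum>k<Suc n. \<Sum>l<Suc (Suc n). \<bar>alt_coeff n k\<bar> * \<bar>alt_coeff (Suc n) l\<bar> * \<bar>cav N i k l \<omega>\<bar>)"
proof -
  have "\<bar>force N i n \<omega>\<bar> \<le> \<beta>\<^sup>2 / 2 * (\<Sum>k<Suc n. \<Sum>l<Suc (Suc n).
      (real \<S>)\<^sup>2 * (\<bar>alt_coeff n k\<bar> * \<bar>alt_coeff (Suc n) l\<bar> * \<bar>cav N i k l \<omega>\<bar>))"
    unfolding force_def abs_mult[of "\<beta>\<^sup>2 / 2"]
  proof (intro mult_mono order_trans[OF sum_abs sum_mono] order_trans[OF sum_abs sum_mono])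
    fix k l assume kl: "k \<in> {..<Suc n}" "l \<in> {..<Suc (Suc n)}"
    have "\<bar>\<omega> k i * \<omega> l i\<bar> \<le> (real \<S>)\<^sup>2" by (rule spin_prod_bound[OF w _ _ i]) (use kl in auto)
    then have "\<bar>\<omega> k i * \<omega> l i\<bar> * (\<bar>alt_coeff n k\<bar> * \<bar>alt_coeff (Suc n) l\<bar> * \<bar>cav N i k l \<omega>\<bar>)
      \<le> (real \<S>)\<^sup>2 * (\<bar>alt_coeff n k\<bar> * \<bar>alt_coeff (Suc n) l\<bar> * \<bar>cav N i k l \<omega>\<bar>)"
      by (rule mult_right_mono) auto
    then show "\<bar>alt_coeff n k * alt_coeff (Suc n) l * (\<omega> k i * \<omega> l i) * cav N i k l \<omega>\<bar>
      \<le> (real \<S>)\<^sup>2 * (\<bar>alt_coeff n k\<bar> * \<bar>alt_coeff (Suc n) l\<bar> * \<bar>cav N i k l \<omega>\<bar>)"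
      by (simp only: abs_mult mult_ac)
  qed auto
  then show ?thesis by (simp add: sum_distrib_left mult_ac del: sum.lessThan_Suc)
qed

text \<open>The product of \<beta>^2 / 2, the bound S^2 for a spin product, the total coefficient
  weight 2 n times 2 (n + 1), and the crude bound 2 S^2 for a cavity overlap minus its
  centre.\<close>

definition force_const :: "nat \<Rightarrow> real" where
  "force_const n = 4 * \<beta>\<^sup>2 * real \<S> ^ 4 * real n * (real n + 1)"

lemma sum_alt_coeff_const:
  "(\<Sum>k<Suc n. \<Sum>l<Suc (Suc n). \<bar>alt_coeff n k\<bar> * \<bar>alt_coeff (Suc n) l\<bar> * C) = 4 * real n * (real n + 1) * C"
proof -
  have "(\<Sum>k<Suc n. \<Sum>l<Suc (Suc n). \<bar>alt_coeff n k\<bar> * \<bar>alt_coeff (Suc n) l\<bar> * C)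
    = (\<Sum>k<Suc n. \<bar>alt_coeff n k\<bar>) * (\<Sum>l<Suc (Suc n). \<bar>alt_coeff (Suc n) l\<bar>) * C"
    by (simp only: sum_distrib_left sum_distrib_right mult.assoc) (rule sum.swap)
  then show ?thesis unfolding sum_abs_alt_coeff by (simp add: algebra_simps)
qed

lemma force_bound:
  assumes w: "\<omega> \<in> PiE {..<Suc (Suc n)} (\<lambda>_. configs \<S> N)" and i: "i < N"
  shows "\<bar>force N i n \<omega>\<bar> / sqrt (real N) \<le> force_const n"
proof -
  have "\<bar>force N i n \<omega>\<bar> \<le> \<beta>\<^sup>2 / 2 * (real \<S>)\<^sup>2 * (4 * real n * (real n + 1) * (2 * (real \<S>)\<^sup>2 * sqrt (real N)))"
    unfolding sum_alt_coeff_const[symmetric]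
    by (rule order_trans[OF force_le[OF w i]], intro mult_left_mono sum_mono cav_bound[OF w _ _ i]) auto
  also have "\<dots> = force_const n * sqrt (real N)"
    by (simp add: force_const_def power4_eq_xxxx power2_eq_square)
  finally show ?thesis using i by (simp add: divide_simps)
qed

lemma cnu_force_bound:
  assumes i: "i < N" and f: "depends_below n f"
    and f0: "\<And>\<omega>. \<omega> \<in> PiE {..<n} (\<lambda>_. configs \<S> N) \<Longrightarrow> 0 \<le> f \<omega>"
  shows "\<bar>cnu N i \<theta> (Suc (Suc n)) (\<lambda>\<omega>. f \<omega> * force N i n \<omega>) / sqrt (real N)\<bar> \<le> force_const n * cnu N i \<theta> n f"
proof -
  \<comment> \<open>The sign is known on points with \<open>n\<close> replicas; restriction and
    locality transfer it to the larger space.\<close>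
  have f0': "0 \<le> f \<omega>" if w: "\<omega> \<in> PiE {..<Suc (Suc n)} (\<lambda>_. configs \<S> N)" for \<omega>
  proof -
    have "restrict \<omega> {..<n} \<in> PiE {..<n} (\<lambda>_. configs \<S> N)"
      by (intro restrict_PiE_iff[THEN iffD2] ballI PiE_mem[OF w]) auto
    then have "0 \<le> f (restrict \<omega> {..<n})" by (rule f0)
    also have "f (restrict \<omega> {..<n}) = f \<omega>" by (rule depends_belowD[OF f]) auto
    finally show ?thesis .
  qed
  have "\<bar>cnu N i \<theta> (Suc (Suc n)) (\<lambda>\<omega>. f \<omega> * force N i n \<omega>) / sqrt (real N)\<bar>
    = \<bar>cnu N i \<theta> (Suc (Suc n)) (\<lambda>\<omega>. (1 / sqrt (real N)) * (f \<omega> * force N i n \<omega>))\<bar>"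
    unfolding cnu_cmult[OF i] by simp
  also have "\<dots> \<le> cnu N i \<theta> (Suc (Suc n)) (\<lambda>\<omega>. \<bar>(1 / sqrt (real N)) * (f \<omega> * force N i n \<omega>)\<bar>)"
    by (rule cnu_abs[OF i])
  also have "\<dots> \<le> cnu N i \<theta> (Suc (Suc n)) (\<lambda>\<omega>. force_const n * f \<omega>)"
  proof (rule cnu_mono[OF i])
    fix \<omega> assume w: "\<omega> \<in> PiE {..<Suc (Suc n)} (\<lambda>_. configs \<S> N)"
    have "f \<omega> * (\<bar>force N i n \<omega>\<bar> / sqrt (real N)) \<le> f \<omega> * force_const n"
      by (rule mult_left_mono[OF force_bound[OF w i] f0'[OF w]])
    then show "\<bar>(1 / sqrt (real N)) * (f \<omega> * force N i n \<omega>)\<bar> \<le> force_const n * f \<omega>"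
      using f0'[OF w] by (simp add: abs_mult mult_ac)
  qed
  also have "\<dots> = force_const n * cnu N i \<theta> n f"
    unfolding cnu_cmult[OF i] using cnu_extend[OF i f, where m = "Suc (Suc n)"] by simp
  finally show ?thesis .
qed

lemma force_const_nonneg: "0 \<le> force_const n"
  by (simp add: force_const_def)

lemma cnu_nonneg:
  assumes i: "i < N" and f0: "\<And>\<omega>. \<omega> \<in> PiE {..<n} (\<lambda>_. configs \<S> N) \<Longrightarrow> 0 \<le> f \<omega>"
  shows "0 \<le> cnu N i \<theta> n f"
  using cnu_mono[OF i f0, where \<theta> = \<theta>] by (simp add: cnu_const[OF i])

text \<open>Gronwall's argument in the variable (sin \<theta>)^2: the relative rate of change is at
  most \<open>force_const n\<close>, so the average times exp (\<plusminus> force_const n (sin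
  \<theta>)^2) is monotone on the path. The factor does not depend on \<open>N\<close>.\<close>

lemma cnu_compare:
  assumes i: "i < N" and f: "depends_below n f"
    and f0: "\<And>\<omega>. \<omega> \<in> PiE {..<n} (\<lambda>_. configs \<S> N) \<Longrightarrow> 0 \<le> f \<omega>"
    and ab: "0 \<le> a" "a \<le> pi / 2" "0 \<le> b" "b \<le> pi / 2"
  shows "cnu N i a n f \<le> exp (force_const n) * cnu N i b n f"
proof -
  let ?\<phi> = "\<lambda>\<epsilon> \<theta>. cnu N i \<theta> n f * exp (\<epsilon> * force_const n * (sin \<theta>)\<^sup>2)"
  let ?d = "\<lambda>\<theta>. cnu N i \<theta> (Suc (Suc n)) (\<lambda>\<omega>. f \<omega> * force N i n \<omega>) / sqrt (real N)"
  have d: "(?\<phi> \<epsilon> has_real_derivative 2 * (sin \<theta> * cos \<theta>) * (?d \<theta> + \<epsilon> * (force_const n * cnu N i \<theta> n f))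
      * exp (\<epsilon> * force_const n * (sin \<theta>)\<^sup>2)) (at \<theta>)" for \<epsilon> \<theta>
    by (rule DERIV_cong, rule DERIV_mult[OF cnu_deriv[OF i f]])
      (auto intro!: derivative_eq_intros simp: algebra_simps)
  have sc: "0 \<le> 2 * (sin \<theta> * cos \<theta>)" if "0 \<le> \<theta>" "\<theta> \<le> pi / 2" for \<theta>
    using that by (simp add: sin_ge_zero cos_ge_zero)
  have mono: "cnu N i x n f \<le> exp (force_const n) * cnu N i y n f \<and> cnu N i y n f \<le> exp (force_const n) * cnu N i x n f"
    if xy: "0 \<le> x" "x \<le> y" "y \<le> pi / 2" for x y
  proof -
    note bnd = cnu_force_bound[OF i f f0]
    have 1: "?\<phi> 1 x \<le> ?\<phi> 1 y"
    proof (rule DERIV_nonneg_imp_nondecreasing[OF xy(2)], intro exI conjI)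
      fix \<theta> assume t: "x \<le> \<theta>" "\<theta> \<le> y"
      show "(?\<phi> 1 has_real_derivative 2 * (sin \<theta> * cos \<theta>) * (?d \<theta> + 1 * (force_const n * cnu N i \<theta> n f))
        * exp (1 * force_const n * (sin \<theta>)\<^sup>2)) (at \<theta>)" by (rule d)
      show "0 \<le> 2 * (sin \<theta> * cos \<theta>) * (?d \<theta> + 1 * (force_const n * cnu N i \<theta> n f)) * exp (1 * force_const n * (sin \<theta>)\<^sup>2)"
      proof (intro mult_nonneg_nonneg[OF mult_nonneg_nonneg[OF sc]])
        show "0 \<le> ?d \<theta> + 1 * (force_const n * cnu N i \<theta> n f)" using bnd[of \<theta>] by linarith
      qed (use t xy in auto)
    qed
    have 2: "?\<phi> (-1) y \<le> ?\<phi> (-1) x"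
    proof (rule DERIV_nonpos_imp_nonincreasing[OF xy(2)], intro exI conjI)
      fix \<theta> assume t: "x \<le> \<theta>" "\<theta> \<le> y"
      show "(?\<phi> (-1) has_real_derivative 2 * (sin \<theta> * cos \<theta>) * (?d \<theta> + (-1) * (force_const n * cnu N i \<theta> n f))
        * exp ((-1) * force_const n * (sin \<theta>)\<^sup>2)) (at \<theta>)" by (rule d)
      show "2 * (sin \<theta> * cos \<theta>) * (?d \<theta> + (-1) * (force_const n * cnu N i \<theta> n f)) * exp ((-1) * force_const n * (sin \<theta>)\<^sup>2) \<le> 0"
      proof (intro mult_nonpos_nonneg[OF mult_nonneg_nonpos[OF sc]])
        show "?d \<theta> + (-1) * (force_const n * cnu N i \<theta> n f) \<le> 0" using bnd[of \<theta>] by linarith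
      qed (use t xy in auto)
    qed
    have sx: "(sin x)\<^sup>2 \<le> 1" "(sin y)\<^sup>2 \<le> 1" by (simp_all add: abs_square_le_1)
    have e: "1 \<le> exp (force_const n * (sin z)\<^sup>2)" "exp (force_const n * (sin z)\<^sup>2) \<le> exp (force_const n)" if "(sin z)\<^sup>2 \<le> 1" for z
      using force_const_nonneg[of n] that mult_left_mono[OF that force_const_nonneg[of n]] by auto
    have pos: "0 \<le> cnu N i z n f" for z by (rule cnu_nonneg[OF i f0])
    have "cnu N i x n f \<le> cnu N i x n f * exp (force_const n * (sin x)\<^sup>2)"
      using mult_left_mono[OF e(1)[OF sx(1)] pos[of x]] by simp
    also have "\<dots> \<le> cnu N i y n f * exp (force_const n * (sin y)\<^sup>2)" using 1 by simp
    also have "\<dots> \<le> exp (force_const n) * cnu N i y n f"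
      using mult_left_mono[OF e(2)[OF sx(2)] pos[of y]] by (simp add: mult.commute)
    finally have A: "cnu N i x n f \<le> exp (force_const n) * cnu N i y n f" .
    have inv: "cnu N i z n f * exp (- (force_const n * (sin z)\<^sup>2)) * exp (force_const n * (sin z)\<^sup>2) = cnu N i z n f" for z
      by (simp add: exp_minus)
    have "cnu N i y n f = cnu N i y n f * exp (- (force_const n * (sin y)\<^sup>2)) * exp (force_const n * (sin y)\<^sup>2)"
      by (rule inv[symmetric])
    also have "\<dots> \<le> cnu N i x n f * exp (- (force_const n * (sin x)\<^sup>2)) * exp (force_const n)"
      by (rule mult_mono[OF _ e(2)[OF sx(2)]]) (use 2 pos[of x] in auto)
    also have "\<dots> \<le> cnu N i x n f * 1 * exp (force_const n)"
      using pos[of x] force_const_nonneg[of n] by (intro mult_right_mono mult_left_mono) auto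
    finally show ?thesis using A by (simp add: mult.commute)
  qed
  show ?thesis
  proof (cases "a \<le> b")
    case True then show ?thesis using mono[of a b] ab by simp
  next
    case False then show ?thesis using mono[of b a] ab by simp
  qed
qed

text \<open>Cauchy's mean value theorem against (sin \<theta>)^2, whose total increment is 1. Both
  derivatives contain 2 sin \<theta> cos \<theta>, positive inside the interval, so it cancels; sqrt
  N clears the denominator and an exact identity remains.\<close>

lemma cnu_mvt:
  assumes i: "i < N" and f: "depends_below n f"
  shows "\<exists>\<theta>. 0 \<le> \<theta> \<and> \<theta> \<le> pi / 2 \<and>
    sqrt (real N) * (cnu N i (pi / 2) n f - cnu N i 0 n f) = cnu N i \<theta> (Suc (Suc n)) (\<lambda>\<omega>. f \<omega> * force N i n \<omega>)"
proof -
  let ?d = "\<lambda>\<theta>. cnu N i \<theta> (Suc (Suc n)) (\<lambda>\<omega>. f \<omega> * force N i n \<omega>) / sqrt (real N)"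
  have d: "((\<lambda>\<theta>. (sin \<theta>)\<^sup>2) has_real_derivative 2 * sin \<theta> * cos \<theta>) (at \<theta>)" for \<theta> :: real
    by (auto intro!: derivative_eq_intros)
  obtain \<theta> where t: "0 < \<theta>" "\<theta> < pi / 2"
    and e: "(cnu N i (pi / 2) n f - cnu N i 0 n f) * (2 * sin \<theta> * cos \<theta>)
      = ((sin (pi / 2))\<^sup>2 - (sin 0)\<^sup>2) * (2 * sin \<theta> * cos \<theta> * ?d \<theta>)"
    using GMVT'[of 0 "pi / 2" "\<lambda>\<theta>. cnu N i \<theta> n f" "\<lambda>\<theta>. (sin \<theta>)\<^sup>2" "\<lambda>\<theta>. 2 * sin \<theta> * cos \<theta>" "\<lambda>\<theta>. 2 * sin \<theta> * cos \<theta> * ?d \<theta>"]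
      DERIV_isCont[OF cnu_deriv[OF i f]] DERIV_isCont[OF d] cnu_deriv[OF i f] d pi_gt_zero by auto
  have cancel: "A = d" if "A * (2 * s * c) = ((1::real)\<^sup>2 - 0\<^sup>2) * (2 * s * c * d)" "s * c > 0" for A d s c
  proof -
    have "(A - d) * (s * c) = 0" using that(1) by (simp add: algebra_simps)
    then show ?thesis using that(2) by auto
  qed
  have "sin \<theta> * cos \<theta> > 0" using t sin_gt_zero2 cos_gt_zero by simp
  then have "cnu N i (pi / 2) n f - cnu N i 0 n f = ?d \<theta>"
    by (rule cancel[OF e[unfolded sin_pi_half sin_zero]])
  then show ?thesis using t i by (intro exI[of _ \<theta>]) auto
qed

lemma cnu_lipschitz:
  assumes i: "i < N" and f: "depends_below n f"
    and C: "\<And>\<theta>. 0 \<le> \<theta> \<Longrightarrow> \<theta> \<le> pi / 2 \<Longrightarrow> \<bar>cnu N i \<theta> (Suc (Suc n)) (\<lambda>\<omega>. f \<omega> * force N i n \<omega>)\<bar> \<le> C"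
    and ab: "0 \<le> a" "a \<le> pi / 2" "0 \<le> b" "b \<le> pi / 2"
  shows "\<bar>cnu N i a n f - cnu N i b n f\<bar> \<le> 4 * C / sqrt (real N)"
proof -
  let ?d = "\<lambda>\<theta>. 2 * sin \<theta> * cos \<theta> * (cnu N i \<theta> (Suc (Suc n)) (\<lambda>\<omega>. f \<omega> * force N i n \<omega>) / sqrt (real N))"
  have "norm (cnu N i a n f - cnu N i b n f) \<le> 2 * C / sqrt (real N) * norm (a - b)"
  proof (rule field_differentiable_bound[of "{0..pi/2}" "\<lambda>\<theta>. cnu N i \<theta> n f" ?d])
    fix \<theta> assume t: "\<theta> \<in> {0..pi/2}"
    show "((\<lambda>\<theta>. cnu N i \<theta> n f) has_field_derivative ?d \<theta>) (at \<theta> within {0..pi/2})"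
      by (rule has_field_derivative_at_within[OF cnu_deriv[OF i f]])
    have "\<bar>sin \<theta> * cos \<theta>\<bar> \<le> 1 * 1" unfolding abs_mult by (intro mult_mono) auto
    then have "\<bar>sin \<theta> * cos \<theta>\<bar> * \<bar>cnu N i \<theta> (Suc (Suc n)) (\<lambda>\<omega>. f \<omega> * force N i n \<omega>)\<bar> \<le> 1 * C"
      using C[of \<theta>] t by (intro mult_mono) auto
    then have "2 * (\<bar>sin \<theta> * cos \<theta>\<bar> * \<bar>cnu N i \<theta> (Suc (Suc n)) (\<lambda>\<omega>. f \<omega> * force N i n \<omega>)\<bar>) / sqrt (real N) \<le> 2 * C / sqrt (real N)"
      by (intro divide_right_mono) auto
    then show "norm (?d \<theta>) \<le> 2 * C / sqrt (real N)" by (simp add: abs_mult mult_ac)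
  qed (use ab in auto)
  \<comment> \<open>The path has length pi / 2 < 2, which turns the bound 2 C / sqrt N for the
    derivative into the stated constant 4.\<close>
  also have "\<dots> \<le> 2 * C / sqrt (real N) * 2"
  proof (rule mult_left_mono)
    show "norm (a - b) \<le> 2" using ab pi_less_4 by (auto simp: abs_le_iff)
    have "0 \<le> C" using C[of 0] by (simp add: order_trans[OF abs_ge_zero])
    then show "0 \<le> 2 * C / sqrt (real N)" by simp
  qed
  finally show ?thesis by simp
qed

section \<open>The two ends of the path\<close>

definition nu :: "nat \<Rightarrow> nat \<Rightarrow> ((nat \<Rightarrow> nat \<Rightarrow> real) \<Rightarrow> real) \<Rightarrow> real" where
  "nu N n f = (\<integral>g. rav (configs \<S> N) (gibbs (configs \<S> N) (hamiltonian N \<beta> D h g)) n f \<partial>disorder N)"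

text \<open>cos (pi / 2) = 0 switches off the field and the quadratic correction, so the auxiliary
  Gaussian at \<open>(0, 0)\<close> integrates out. The value is the same for every
  \<open>i\<close>, which is why the sites may be averaged later.\<close>

lemma cnu_half_pi:
  assumes i: "i < N" shows "cnu N i (pi / 2) n f = nu N n f"
proof -
  have ham: "cham N i (pi / 2) g = hamiltonian N \<beta> D h g" for g
  proof
    fix \<sigma>
    have "cham N i (pi / 2) g \<sigma> = (\<Sum>j\<in>pairs N. \<beta> / sqrt (real N) * (g j * \<sigma> (fst j) * \<sigma> (snd j))) + drift N i (pi / 2) \<sigma>"
      unfolding cham_eq[OF i] using origin_notin_pairs
      by (subst sum.insert[OF finite_pairs origin_notin_pairs])
        (auto simp: strength_def coupling_def intro!: sum.cong)
    then show "cham N i (pi / 2) g \<sigma> = hamiltonian N \<beta> D h g \<sigma>"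
      by (simp add: hamiltonian_def drift_def case_prod_unfold sum_distrib_left sum_divide_distrib)
  qed
  have upd: "hamiltonian N \<beta> D h (g((0, 0) := y)) = hamiltonian N \<beta> D h g" for g y
  proof
    have "(\<Sum>j\<in>pairs N. (g((0, 0) := y)) j * \<sigma> (fst j) * \<sigma> (snd j)) = (\<Sum>j\<in>pairs N. g j * \<sigma> (fst j) * \<sigma> (snd j))" for \<sigma> :: "nat \<Rightarrow> real"
      using origin_notin_pairs by (intro sum.cong) auto
    then show "hamiltonian N \<beta> D h (g((0, 0) := y)) \<sigma> = hamiltonian N \<beta> D h g \<sigma>" for \<sigma>
      by (simp add: hamiltonian_def case_prod_unfold del: fun_upd_apply)
  qed
  have "cnu N i (pi / 2) n f = (\<integral>x. \<integral>y. cgav N i (pi / 2) (x((0, 0) := y)) n f \<partial>gauss \<partial>gprod (pairs N))"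
    unfolding cnu_eq[OF i]
    by (rule gprod.product_integral_insert[OF finite_pairs origin_notin_pairs cgav_integrable[OF i]])
  also have "\<dots> = nu N n f"
    unfolding cgav_eq[OF i] ham upd nu_def disorder_def using gauss.prob_space by simp
  finally show ?thesis .
qed

definition site_av :: "nat \<Rightarrow> ((nat \<Rightarrow> real) \<Rightarrow> real) \<Rightarrow> real" where
  "site_av n \<phi> = Eeta (\<lambda>\<eta>. rav (spins \<S>) (gibbs (spins \<S>) (site_ham \<eta>)) n \<phi>)"

text \<open>At \<theta> = 0 the energy is \<open>site_ham\<close> of the spin at \<open>i\<close>,
  driven by \<open>g (0, 0)\<close>, plus \<open>rest\<close>, which sees neither. For fixed
  disorder the spins at \<open>i\<close> are independent of the others (\<open>fact\<close>), the
  average of \<open>Y\<close> ignores the field (\<open>indep\<close>), and the law of the spins at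
  \<open>i\<close> ignores the couplings (\<open>marg\<close>). Integrating over the field then
  splits the average.\<close>

lemma cnu_zero_factor:
  assumes i: "i < N" and \<phi>: "depends_below n \<phi>"
    and Y: "\<And>\<omega> \<omega>'. (\<And>k b. b \<noteq> i \<Longrightarrow> \<omega> k b = \<omega>' k b) \<Longrightarrow> Y \<omega> = Y \<omega>'"
  shows "cnu N i 0 n (\<lambda>\<omega>. \<phi> (\<lambda>k. \<omega> k i) * Y \<omega>) = site_av n \<phi> * cnu N i 0 n Y"
proof -
  let ?\<Omega> = "configs \<S> N"
  let ?P = "PiE {..<n} (\<lambda>_. ?\<Omega>)"
  define rest where "rest g \<sigma> = (\<Sum>j\<in>{j \<in> pairs N. fst j \<noteq> i \<and> snd j \<noteq> i}. \<beta> / sqrt (real N) * g j * (\<sigma> (fst j) * \<sigma> (snd j)))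
    + (\<Sum>b\<in>{..<N} - {i}. D * (\<sigma> b)\<^sup>2 + h * \<sigma> b)" for g \<sigma>
  have ham: "cham N i 0 g \<sigma> = site_ham (g (0, 0)) (\<sigma> i) + rest g \<sigma>" for g \<sigma>
  proof -
    have "(\<Sum>j\<in>pairs N. strength i j 0 * g j * coupling N i j \<sigma>)
      = (\<Sum>j\<in>{j \<in> pairs N. fst j \<noteq> i \<and> snd j \<noteq> i}. \<beta> / sqrt (real N) * g j * (\<sigma> (fst j) * \<sigma> (snd j)))"
      using origin_notin_pairs
      by (intro sum.mono_neutral_cong_right finite_pairs) (auto simp: strength_def coupling_def)
    moreover have "drift N i 0 \<sigma> = (D + \<beta>\<^sup>2 / 2 * (p - q)) * (\<sigma> i)\<^sup>2 + h * \<sigma> i + (\<Sum>b\<in>{..<N} - {i}. D * (\<sigma> b)\<^sup>2 + h * \<sigma> b)"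
      unfolding drift_def using i
      by (simp add: sum.remove[of "{..<N}" i "\<lambda>b. (\<sigma> b)\<^sup>2"] sum.remove[of "{..<N}" i \<sigma>] sum.distrib
          sum_distrib_left algebra_simps)
    ultimately show ?thesis
      unfolding cham_eq[OF i] sum.insert[OF finite_pairs origin_notin_pairs]
      by (simp add: rest_def site_ham_def strength_def coupling_def algebra_simps)
  qed
  have rest_upd: "rest g (\<sigma>(i := s)) = rest g \<sigma>" "rest (g((0, 0) := y)) \<sigma> = rest g \<sigma>" for g \<sigma> s y
    using origin_notin_pairs unfolding rest_def by (auto intro!: arg_cong2[where f = "(+)"] sum.cong)
  let ?G = "\<lambda>g. gibbs ?\<Omega> (cham N i 0 g)"
  \<comment> \<open>Two configurations exchange everything except their spins at \<open>i\<close>.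
    The total energy is preserved if the rests agree, and the normalizations on both sides are the
    same. Allowing different \<open>g\<close> and \<open>g'\<close> prepares the change of field in
    \<open>indep\<close>.\<close>
  have swap: "?G g \<sigma> * ?G g' \<tau> = ?G g (\<tau>(i := \<sigma> i)) * ?G g' (\<sigma>(i := \<tau> i))"
    if "rest g = rest g'" for g g' \<sigma> \<tau>
    using that by (simp add: gibbs_def ham rest_upd exp_add)
  have upd: "\<tau>(i := \<sigma> i) \<in> ?\<Omega>" if "\<sigma> \<in> ?\<Omega>" "\<tau> \<in> ?\<Omega>" for \<sigma> \<tau>
    using that i unfolding configs_def by (auto simp: PiE_iff extensional_def)
  have updP: "(\<lambda>k. (\<omega>' k)(i := \<omega> k i)) \<in> ?P" if "\<omega> \<in> ?P" "\<omega>' \<in> ?P" for \<omega> \<omega>'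
  proof (rule PiE_I)
    show "(\<omega>' k)(i := \<omega> k i) \<in> ?\<Omega>" if "k \<in> {..<n}" for k
      using upd PiE_mem[OF \<open>\<omega> \<in> ?P\<close> that] PiE_mem[OF \<open>\<omega>' \<in> ?P\<close> that] by blast
    show "(\<omega>' k)(i := \<omega> k i) = undefined" if "k \<notin> {..<n}" for k
      using PiE_arb[OF \<open>\<omega> \<in> ?P\<close> that] PiE_arb[OF \<open>\<omega>' \<in> ?P\<close> that] by simp
  qed
  have fact: "cgav N i 0 g n (\<lambda>\<omega>. \<phi> (\<lambda>k. \<omega> k i) * Y \<omega>) = cgav N i 0 g n (\<lambda>\<omega>. \<phi> (\<lambda>k. \<omega> k i)) * cgav N i 0 g n Y" for g
  proof -
    have "rav ?\<Omega> (?G g) n (\<lambda>\<omega>. \<phi> (\<lambda>k. \<omega> k i)) * rav ?\<Omega> (?G g) n Y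
      = rav ?\<Omega> (?G g) n (\<lambda>\<omega>. \<phi> (\<lambda>k. \<omega> k i) * Y \<omega>) * rav ?\<Omega> (?G g) n (\<lambda>_. 1)"
    proof (rule rav_swap[where A = "\<lambda>\<omega> \<omega>' k. (\<omega>' k)(i := \<omega> k i)"])
      fix \<omega> \<omega>' assume w: "\<omega> \<in> ?P" "\<omega>' \<in> ?P"
      show "(\<lambda>k. (\<omega>' k)(i := \<omega> k i)) \<in> ?P \<and> (\<lambda>k. ((\<omega> k)(i := \<omega>' k i))(i := ((\<omega>' k)(i := \<omega> k i)) i)) = \<omega>"
        using updP[OF w] by simp
      have "Y \<omega>' = Y (\<lambda>k. (\<omega>' k)(i := \<omega> k i))" by (rule Y) simp
      then show "\<phi> (\<lambda>k. \<omega> k i) * Y \<omega>' = \<phi> (\<lambda>k. ((\<omega>' k)(i := \<omega> k i)) i) * Y (\<lambda>k. (\<omega>' k)(i := \<omega> k i)) * 1"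
        by simp
      show "(\<Prod>k<n. ?G g (\<omega> k)) * (\<Prod>k<n. ?G g (\<omega>' k))
        = (\<Prod>k<n. ?G g ((\<omega>' k)(i := \<omega> k i))) * (\<Prod>k<n. ?G g ((\<omega> k)(i := \<omega>' k i)))"
        unfolding prod.distrib[symmetric] by (rule prod.cong[OF refl], rule swap) simp
    qed
    then show ?thesis by (simp add: cgav_eq[OF i] rav_const[OF cham_weight[OF i]])
  qed
  have indep: "cgav N i 0 (g((0, 0) := y)) n Y = cgav N i 0 g n Y" for g y
  proof -
    let ?g = "g((0, 0) := y)"
    have "rav ?\<Omega> (?G g) n Y * rav ?\<Omega> (?G ?g) n (\<lambda>_. 1) = rav ?\<Omega> (?G ?g) n Y * rav ?\<Omega> (?G g) n (\<lambda>_. 1)"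
    proof (rule rav_swap[where A = "\<lambda>\<omega> \<omega>' k. (\<omega> k)(i := \<omega>' k i)"])
      fix \<omega> \<omega>' assume w: "\<omega> \<in> ?P" "\<omega>' \<in> ?P"
      show "(\<lambda>k. (\<omega> k)(i := \<omega>' k i)) \<in> ?P \<and> (\<lambda>k. ((\<omega> k)(i := \<omega>' k i))(i := ((\<omega>' k)(i := \<omega> k i)) i)) = \<omega>"
        using updP[OF w(2,1)] by simp
      have "Y \<omega> = Y (\<lambda>k. (\<omega> k)(i := \<omega>' k i))" by (rule Y) simp
      then show "Y \<omega> * 1 = Y (\<lambda>k. (\<omega> k)(i := \<omega>' k i)) * 1" by simp
      show "(\<Prod>k<n. ?G g (\<omega> k)) * (\<Prod>k<n. ?G ?g (\<omega>' k))
        = (\<Prod>k<n. ?G ?g ((\<omega> k)(i := \<omega>' k i))) * (\<Prod>k<n. ?G g ((\<omega>' k)(i := \<omega> k i)))"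
        unfolding prod.distrib[symmetric]
      proof (rule prod.cong[OF refl])
        fix k
        have "rest g = rest ?g" using rest_upd(2) by auto
        from swap[OF this, of "\<omega> k" "\<omega>' k"]
        show "?G g (\<omega> k) * ?G ?g (\<omega>' k) = ?G ?g ((\<omega> k)(i := \<omega>' k i)) * ?G g ((\<omega>' k)(i := \<omega> k i))"
          by (simp only: mult.commute)
      qed
    qed
    then show ?thesis by (simp add: cgav_eq[OF i] rav_const[OF cham_weight[OF i]])
  qed
  have marg: "cgav N i 0 g n (\<lambda>\<omega>. \<phi> (\<lambda>k. \<omega> k i)) = rav (spins \<S>) (gibbs (spins \<S>) (site_ham (g (0, 0)))) n \<phi>" for g
    unfolding cgav_eq[OF i]
  proof (rule rav_image[OF finite_configs finite_spins _ _ \<phi>])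
    show "\<sigma> i \<in> spins \<S>" if "\<sigma> \<in> ?\<Omega>" for \<sigma> using configs_spin[OF that i] .
    \<comment> \<open>\<open>c s\<close> is the partition function of the rest with the spin at
      \<open>i\<close> pinned to \<open>s\<close>; resetting that spin shows that it does not depend
      on \<open>s\<close>, so it cancels.\<close>
    define c where "c s = (\<Sum>\<sigma>\<in>{\<sigma> \<in> ?\<Omega>. \<sigma> i = s}. exp (rest g \<sigma>))" for s
    have c: "c s = c s'" if s: "s \<in> spins \<S>" "s' \<in> spins \<S>" for s s'
      unfolding c_def
    proof (rule sum.reindex_bij_witness[where i = "\<lambda>\<sigma>. \<sigma>(i := s)" and j = "\<lambda>\<sigma>. \<sigma>(i := s')"])
    qed (use s i in \<open>auto simp: configs_def PiE_iff extensional_def rest_upd\<close>)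
    have num: "(\<Sum>\<sigma>\<in>{\<sigma> \<in> ?\<Omega>. \<sigma> i = s}. exp (cham N i 0 g \<sigma>)) = exp (site_ham (g (0, 0)) s) * c s" for s
      unfolding c_def sum_distrib_left by (intro sum.cong) (auto simp: ham exp_add)
    have Z: "(\<Sum>\<sigma>\<in>?\<Omega>. exp (cham N i 0 g \<sigma>)) = (\<Sum>s\<in>spins \<S>. exp (site_ham (g (0, 0)) s) * c s)"
      unfolding num[symmetric] using configs_spin[OF _ i]
      by (intro sum.group[symmetric] finite_configs finite_spins) auto
    fix s assume s: "s \<in> spins \<S>"
    have Z': "(\<Sum>\<sigma>\<in>?\<Omega>. exp (cham N i 0 g \<sigma>)) = (\<Sum>s\<in>spins \<S>. exp (site_ham (g (0, 0)) s)) * c s"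
      unfolding Z sum_distrib_right using c[OF _ s] by (intro sum.cong) auto
    moreover have "(\<Sum>\<sigma>\<in>?\<Omega>. exp (cham N i 0 g \<sigma>)) > 0"
      by (rule partition_pos[OF finite_configs configs_nonempty])
    ultimately have "c s \<noteq> 0" by auto
    then show "(\<Sum>\<sigma>\<in>{\<sigma> \<in> ?\<Omega>. \<sigma> i = s}. ?G g \<sigma>) = gibbs (spins \<S>) (site_ham (g (0, 0))) s"
      unfolding gibbs_def sum_divide_distrib[symmetric] num Z' by simp
  qed
  let ?\<psi> = "\<lambda>\<eta>. rav (spins \<S>) (gibbs (spins \<S>) (site_ham \<eta>)) n \<phi>"
  have "cnu N i 0 n (\<lambda>\<omega>. \<phi> (\<lambda>k. \<omega> k i) * Y \<omega>)
    = (\<integral>x. \<integral>y. cgav N i 0 (x((0, 0) := y)) n (\<lambda>\<omega>. \<phi> (\<lambda>k. \<omega> k i) * Y \<omega>) \<partial>gauss \<partial>gprod (pairs N))"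
    unfolding cnu_eq[OF i]
    by (rule gprod.product_integral_insert[OF finite_pairs origin_notin_pairs cgav_integrable[OF i]])
  also have "\<dots> = (\<integral>x. \<integral>y. ?\<psi> y * cgav N i 0 x n Y \<partial>gauss \<partial>gprod (pairs N))"
    unfolding fact marg indep by simp
  also have "\<dots> = site_av n \<phi> * (\<integral>x. cgav N i 0 x n Y \<partial>gprod (pairs N))"
    by (simp add: site_av_def Eeta_def)
  also have "(\<integral>x. cgav N i 0 x n Y \<partial>gprod (pairs N)) = (\<integral>x. \<integral>y. cgav N i 0 (x((0, 0) := y)) n Y \<partial>gauss \<partial>gprod (pairs N))"
    unfolding indep using gauss.prob_space by simp
  also have "\<dots> = cnu N i 0 n Y"
    unfolding cnu_eq[OF i]
    by (rule gprod.product_integral_insert[OF finite_pairs origin_notin_pairs cgav_integrable[OF i], symmetric])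
  finally show ?thesis .
qed

end

section \<open>Moments of the overlaps at high temperature\<close>

text \<open>The coefficient 2 is the same for every power \<open>j\<close>. If K \<le> \<epsilon>
  |x|, the perturbation is absorbed into (1 + \<epsilon>)^j \<le> exp (j \<epsilon>) \<le> 2;
  otherwise \<open>x + y\<close> is bounded. A coefficient growing with \<open>j\<close> would make
  the threshold for \<beta> depend on the order of the moment.\<close>

lemma abs_add_power_le:
  fixes K :: real
  assumes "0 \<le> K"
  shows "\<exists>c\<ge>0. \<forall>x y::real. \<bar>y\<bar> \<le> K \<longrightarrow> \<bar>x + y\<bar> ^ j \<le> 2 * \<bar>x\<bar> ^ j + c"
proof -
  define \<epsilon> :: real where "\<epsilon> = 1 / (2 * (real j + 1))"
  have \<epsilon>: "0 < \<epsilon>" "real j * \<epsilon> \<le> 1 / 2" by (auto simp: \<epsilon>_def field_simps)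
  have "(exp (1/2 :: real))\<^sup>2 = exp 1" by (simp add: power2_eq_square flip: exp_add)
  also have "\<dots> \<le> 2\<^sup>2" using exp_le by simp
  finally have e2: "exp (1/2 :: real) \<le> 2" by (rule power2_le_imp_le) simp
  have "(1 + \<epsilon>) ^ j \<le> exp \<epsilon> ^ j" using \<epsilon>(1) by (intro power_mono exp_ge_add_one_self) auto
  also have "\<dots> = exp (real j * \<epsilon>)" by (simp add: exp_of_nat_mult)
  also have "\<dots> \<le> exp (1/2)" using \<epsilon>(2) by simp
  finally have pj: "(1 + \<epsilon>) ^ j \<le> 2" using e2 by simp
  have "\<bar>x + y\<bar> ^ j \<le> 2 * \<bar>x\<bar> ^ j + (K / \<epsilon> + K) ^ j" if y: "\<bar>y\<bar> \<le> K" for x y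
  proof (cases "K \<le> \<epsilon> * \<bar>x\<bar>")
    case True
    have "\<bar>x + y\<bar> \<le> \<bar>x\<bar> * (1 + \<epsilon>)" using True y by (simp add: algebra_simps)
    then have "\<bar>x + y\<bar> ^ j \<le> (\<bar>x\<bar> * (1 + \<epsilon>)) ^ j" by (rule power_mono) simp
    also have "\<dots> \<le> \<bar>x\<bar> ^ j * 2" unfolding power_mult_distrib by (rule mult_left_mono[OF pj]) simp
    finally show ?thesis using assms \<epsilon>(1) by (simp add: add_increasing2 mult.commute)
  next
    case False
    then have "\<bar>x\<bar> \<le> K / \<epsilon>" using \<epsilon>(1) by (simp add: field_simps)
    then have "\<bar>x + y\<bar> \<le> K / \<epsilon> + K" using y by linarith
    then have "\<bar>x + y\<bar> ^ j \<le> (K / \<epsilon> + K) ^ j" by (rule power_mono) simp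
    then show ?thesis by (simp add: add_increasing)
  qed
  moreover have "0 \<le> (K / \<epsilon> + K) ^ j" using assms \<epsilon>(1) by simp
  ultimately show ?thesis by blast
qed

lemma abs_power_diff_le:
  fixes a b :: real
  shows "\<bar>a ^ Suc n - b ^ Suc n\<bar> \<le> \<bar>a - b\<bar> * (real (Suc n) * (\<bar>a\<bar> ^ n + \<bar>b\<bar> ^ n))"
proof -
  have "\<bar>\<Sum>i<Suc n. b ^ (Suc n - Suc i) * a ^ i\<bar> \<le> (\<Sum>i<Suc n. \<bar>a\<bar> ^ n + \<bar>b\<bar> ^ n)"
  proof (rule order_trans[OF sum_abs sum_mono])
    fix i assume i: "i \<in> {..<Suc n}"
    let ?M = "max \<bar>a\<bar> \<bar>b\<bar>"
    have "\<bar>b\<bar> ^ (n - i) * \<bar>a\<bar> ^ i \<le> ?M ^ (n - i) * ?M ^ i"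
      by (intro mult_mono power_mono) auto
    also have "\<dots> = ?M ^ n" using i by (simp flip: power_add)
    also have "\<dots> \<le> \<bar>a\<bar> ^ n + \<bar>b\<bar> ^ n" by (simp add: max_def)
    finally show "\<bar>b ^ (Suc n - Suc i) * a ^ i\<bar> \<le> \<bar>a\<bar> ^ n + \<bar>b\<bar> ^ n"
      by (simp add: abs_mult power_abs)
  qed
  then have "\<bar>a - b\<bar> * \<bar>\<Sum>i<Suc n. b ^ (Suc n - Suc i) * a ^ i\<bar> \<le> \<bar>a - b\<bar> * (\<Sum>i<Suc n. \<bar>a\<bar> ^ n + \<bar>b\<bar> ^ n)"
    by (rule mult_left_mono) simp
  then show ?thesis unfolding power_diff_sumr2 abs_mult by simp
qed

text \<open>Both factors are at most the larger of |x| and |y|, whose even power is one of the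
  summands. This separates a cavity power from the overlap inserted by the force without raising the
  total degree.\<close>

lemma abs_power_mult_le:
  fixes x y :: real
  shows "\<bar>x\<bar> ^ Suc (2 * m) * \<bar>y\<bar> \<le> x ^ (2 * Suc m) + y ^ (2 * Suc m)"
proof -
  let ?M = "max \<bar>x\<bar> \<bar>y\<bar>"
  have "\<bar>x\<bar> ^ Suc (2 * m) * \<bar>y\<bar> \<le> ?M ^ Suc (2 * m) * ?M" by (intro mult_mono power_mono) auto
  also have "\<dots> = ?M ^ (2 * Suc m)" by simp
  also have "\<dots> \<le> \<bar>x\<bar> ^ (2 * Suc m) + \<bar>y\<bar> ^ (2 * Suc m)" by (simp add: max_def)
  finally show ?thesis by (simp add: power_even_abs)
qed

lemma power_one_plus_sum_le:
  fixes y :: "'j \<Rightarrow> real"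
  assumes "finite A"
  shows "(1 + (\<Sum>j\<in>A. \<bar>y j\<bar>)) ^ m \<le> (1 + real (card A)) ^ m * (1 + (\<Sum>j\<in>A. \<bar>y j\<bar> ^ m))"
proof -
  define t where "t = Max (insert 1 ((\<lambda>j. \<bar>y j\<bar>) ` A))"
  have fin: "finite (insert 1 ((\<lambda>j. \<bar>y j\<bar>) ` A))" using assms by simp
  have t1: "1 \<le> t" unfolding t_def using fin by (intro Max_ge) auto
  have ty: "\<bar>y j\<bar> \<le> t" if "j \<in> A" for j unfolding t_def using fin that by (intro Max_ge) auto
  have "1 + (\<Sum>j\<in>A. \<bar>y j\<bar>) \<le> (1 + real (card A)) * t"
    using t1 sum_bounded_above[of A "\<lambda>j. \<bar>y j\<bar>" t] ty by (simp add: algebra_simps)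
  then have "(1 + (\<Sum>j\<in>A. \<bar>y j\<bar>)) ^ m \<le> ((1 + real (card A)) * t) ^ m"
    by (rule power_mono) (simp add: sum_nonneg add_nonneg_nonneg)
  also have "\<dots> = (1 + real (card A)) ^ m * t ^ m" by (rule power_mult_distrib)
  also have "\<dots> \<le> (1 + real (card A)) ^ m * (1 + (\<Sum>j\<in>A. \<bar>y j\<bar> ^ m))"
  proof (rule mult_left_mono)
    have "t \<in> insert 1 ((\<lambda>j. \<bar>y j\<bar>) ` A)" unfolding t_def by (rule Max_in[OF fin]) simp
    then show "t ^ m \<le> 1 + (\<Sum>j\<in>A. \<bar>y j\<bar> ^ m)"
    proof
      assume "t = 1" then show ?thesis by (simp add: sum_nonneg)
    next
      assume "t \<in> (\<lambda>j. \<bar>y j\<bar>) ` A"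
      then obtain j where "j \<in> A" "t = \<bar>y j\<bar>" by auto
      then show ?thesis using member_le_sum[of j A "\<lambda>j. \<bar>y j\<bar> ^ m"] assms by simp
    qed
  qed simp
  finally show ?thesis .
qed

text \<open>The constant 2000 leaves room for three uses:
  \<open>exp (force_const 4) \<le> 3\<close>, the coefficient 288 \<beta>^2 S^4 \<le> 1/4 in
  \<open>ovl_moment_step\<close>, and the nonvanishing of \<open>cM\<close> and \<open>cM3\<close>.
  The condition involves neither \<open>h\<close> nor \<open>D\<close> nor the order of a
  moment.\<close>

locale high_temperature = ghatak_sherrington +
  assumes small: "2000 * \<beta>\<^sup>2 * real \<S> ^ 4 \<le> 1"
begin

context
  fixes N :: nat
  assumes N: "0 < N"
begin

text \<open>The original model is the end of the path of every site; site 0 exists as soon as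
  \<open>0 < N\<close> and transports the rules for path averages to \<open>nu\<close>.\<close>

lemmas nu_add = cnu_add[OF N, where \<theta> = "pi / 2", unfolded cnu_half_pi[OF N]]
lemmas nu_diff = cnu_diff[OF N, where \<theta> = "pi / 2", unfolded cnu_half_pi[OF N]]
lemmas nu_cmult = cnu_cmult[OF N, where \<theta> = "pi / 2", unfolded cnu_half_pi[OF N]]
lemmas nu_sum = cnu_sum[OF N, where \<theta> = "pi / 2", unfolded cnu_half_pi[OF N]]
lemmas nu_const = cnu_const[OF N, where \<theta> = "pi / 2", unfolded cnu_half_pi[OF N]]
lemmas nu_cong = cnu_cong[OF N, where \<theta> = "pi / 2", unfolded cnu_half_pi[OF N]]
lemmas nu_mono = cnu_mono[OF N, where \<theta> = "pi / 2", unfolded cnu_half_pi[OF N]]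
lemmas nu_abs = cnu_abs[OF N, where \<theta> = "pi / 2", unfolded cnu_half_pi[OF N]]
lemmas nu_extend = cnu_extend[OF N, where \<theta> = "pi / 2", unfolded cnu_half_pi[OF N]]
lemmas nu_relabel = cnu_relabel[OF N, where \<theta> = "pi / 2", unfolded cnu_half_pi[OF N]]
lemmas nu_nonneg = cnu_nonneg[OF N, where \<theta> = "pi / 2", unfolded cnu_half_pi[OF N]]

text \<open>By exchangeability only whether \<open>k = l\<close> matters;
  \<open>of_bool (k \<noteq> l)\<close> is the second label of the representative pair.\<close>

lemma nu_ovl:
  assumes "k < n" "l < n"
  shows "nu N n (\<lambda>\<omega>. F (ovl N k l \<omega>)) = nu N 2 (\<lambda>\<omega>. F (ovl N 0 (of_bool (k \<noteq> l)) \<omega>))"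
proof (cases "k = l")
  case True
  have dep: "depends_below 1 (\<lambda>\<omega>. F (ovl N 0 0 \<omega>))"
    by (rule depends_below_comp[OF depends_below_ovl]) auto
  have "nu N n (\<lambda>\<omega>. (\<lambda>\<omega>. F (ovl N 0 0 \<omega>)) (\<lambda>j. \<omega> ((\<lambda>_. k) j))) = nu N 1 (\<lambda>\<omega>. F (ovl N 0 0 \<omega>))"
    by (rule nu_relabel[OF dep]) (use assms in \<open>auto simp: inj_on_def\<close>)
  also have "\<dots> = nu N 2 (\<lambda>\<omega>. F (ovl N 0 0 \<omega>))"
    by (rule nu_extend[OF dep, symmetric]) simp
  finally show ?thesis using True by (simp add: ovl_def centre_def)
next
  case False
  have dep: "depends_below 2 (\<lambda>\<omega>. F (ovl N 0 1 \<omega>))"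
    by (rule depends_below_comp[OF depends_below_ovl]) auto
  have "nu N n (\<lambda>\<omega>. (\<lambda>\<omega>. F (ovl N 0 1 \<omega>)) (\<lambda>j. \<omega> ((\<lambda>j. if j = 0 then k else l) j))) = nu N 2 (\<lambda>\<omega>. F (ovl N 0 1 \<omega>))"
    by (rule nu_relabel[OF dep]) (use assms False in \<open>auto simp: inj_on_def less_2_cases_iff\<close>)
  then show ?thesis using False by (simp add: ovl_def centre_def)
qed

end

section \<open>Averages over the decoupled site\<close>

lemma prod_list_eq_prod_count:
  fixes s :: "nat \<Rightarrow> real"
  assumes "finite A" "set ks \<subseteq> A"
  shows "prod_list (map s ks) = (\<Prod>j\<in>A. s j ^ count_list ks j)"
  using assms(2)
proof (induction ks)
  case (Cons a ks)
  have "(\<Prod>j\<in>A. s j ^ count_list (a # ks) j) = (\<Prod>j\<in>A. (if j = a then s j else 1) * s j ^ count_list ks j)"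
    by (rule prod.cong) auto
  then show ?case using Cons assms(1) by (simp add: prod.distrib prod.delta)
qed simp

lemma site_mom_0: "site_mom \<S> \<beta> D h p q 0 \<eta> = 1"
  unfolding site_mom_eq using site_weight by (simp add: is_weight_def)

text \<open>A spin monomial is encoded by the list of its replica labels. Given \<eta>, spins of
  different replicas are independent, so each label contributes the moment of its
  multiplicity.\<close>

lemma rav_site_monomial:
  assumes "set ks \<subseteq> {..<n}"
  shows "rav (spins \<S>) (gibbs (spins \<S>) (site_ham \<eta>)) n (\<lambda>s. prod_list (map s ks))
    = (\<Prod>j\<in>set ks. site_mom \<S> \<beta> D h p q (count_list ks j) \<eta>)"
proof -
  have "rav (spins \<S>) (gibbs (spins \<S>) (site_ham \<eta>)) n (\<lambda>s. prod_list (map s ks))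
    = rav (spins \<S>) (gibbs (spins \<S>) (site_ham \<eta>)) n (\<lambda>s. \<Prod>j<n. s j ^ count_list ks j)"
    by (rule rav_cong, rule prod_list_eq_prod_count) (use assms in auto)
  also have "\<dots> = (\<Prod>j<n. site_mom \<S> \<beta> D h p q (count_list ks j) \<eta>)"
    unfolding site_mom_eq by (rule rav_prod[OF finite_spins])
  also have "\<dots> = (\<Prod>j\<in>set ks. site_mom \<S> \<beta> D h p q (count_list ks j) \<eta>)"
    using assms by (intro prod.mono_neutral_right) (auto simp: site_mom_0 count_list_0_iff)
  finally show ?thesis .
qed

lemma site_av_monomial:
  "set ks \<subseteq> {..<n} \<Longrightarrow>
    site_av n (\<lambda>s. prod_list (map s ks)) = Eeta (\<lambda>\<eta>. \<Prod>j\<in>set ks. site_mom \<S> \<beta> D h p q (count_list ks j) \<eta>)"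
  unfolding site_av_def by (simp add: rav_site_monomial)

lemma mom_prod_integrable:
  "integrable gauss (\<lambda>\<eta>. \<Prod>j\<in>I. site_mom \<S> \<beta> D h p q (c j) \<eta>)"
proof (rule integrable_gauss_bounded)
  show "\<bar>\<Prod>j\<in>I. site_mom \<S> \<beta> D h p q (c j) \<eta>\<bar> \<le> (\<Prod>j\<in>I. real \<S> ^ c j)" for \<eta>
    unfolding abs_prod by (intro prod_mono conjI site_mom_bound) auto
qed simp

text \<open>The fixed-point equations enter here: p and q are precisely the averages of
  \<open>s k * s l\<close> at the decoupled end. Thus the zeroth order of the cavity expansion
  vanishes.\<close>

lemma site_av_pair: 
  assumes "k < n" "l < n"
  shows "site_av n (\<lambda>s. s k * s l - centre k l) = 0"
proof -
  have "rav (spins \<S>) (gibbs (spins \<S>) (site_ham \<eta>)) n (\<lambda>s. s k * s l - centre k l)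
    = (\<Prod>j\<in>set [k, l]. site_mom \<S> \<beta> D h p q (count_list [k, l] j) \<eta>) - centre k l" for \<eta>
    using rav_site_monomial[of "[k, l]" n \<eta>] assms by (simp add: rav_diff rav_const[OF site_weight])
  then have "site_av n (\<lambda>s. s k * s l - centre k l)
    = Eeta (\<lambda>\<eta>. \<Prod>j\<in>set [k, l]. site_mom \<S> \<beta> D h p q (count_list [k, l] j) \<eta>) - centre k l"
    unfolding site_av_def Eeta_def using mom_prod_integrable[of "\<lambda>j. count_list [k, l] j" "set [k, l]"] gauss.prob_space
    by simp
  also have "\<dots> = 0"
    using fixed_point
    by (cases "k = l") (auto simp: fixed_point_def centre_def power2_eq_square numeral_2_eq_2)
  finally show ?thesis .
qed

lemma centred_pair_bound:
  assumes "\<omega> \<in> PiE {..<n} (\<lambda>_. configs \<S> N)" "k < n" "l < n" "i < N"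
  shows "\<bar>\<omega> k i * \<omega> l i - centre k l\<bar> \<le> 2 * (real \<S>)\<^sup>2"
  using spin_prod_bound[OF assms] centre_bound[of k l] by linarith

lemma ovl_cav_diff:
  assumes "\<omega> \<in> PiE {..<n} (\<lambda>_. configs \<S> N)" "k < n" "l < n" "i < N"
  shows "\<bar>ovl N k l \<omega> - cav N i k l \<omega>\<bar> \<le> (real \<S>)\<^sup>2 / sqrt (real N)"
  using spin_prod_bound[OF assms] by (simp add: ovl_eq[OF assms(4)] divide_right_mono)

lemma inverse_sqrt_le_1: "0 < N \<Longrightarrow> 1 / sqrt (real N) \<le> 1"
  by (simp add: Suc_leI)

lemma ovl_cav_diff_const:
  assumes "\<omega> \<in> PiE {..<n} (\<lambda>_. configs \<S> N)" "k < n" "l < n" "i < N"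
  shows "\<bar>ovl N k l \<omega> - cav N i k l \<omega>\<bar> \<le> (real \<S>)\<^sup>2"
proof -
  have "(real \<S>)\<^sup>2 * (1 / sqrt (real N)) \<le> (real \<S>)\<^sup>2 * 1"
    using assms(4) by (intro mult_left_mono inverse_sqrt_le_1) auto
  then show ?thesis using ovl_cav_diff[OF assms] by simp
qed

lemma cav_power_le:
  "\<exists>c\<ge>0. \<forall>N n i k l \<omega>. \<omega> \<in> PiE {..<n} (\<lambda>_. configs \<S> N) \<longrightarrow> k < n \<longrightarrow> l < n \<longrightarrow> i < N \<longrightarrow>
    cav N i k l \<omega> ^ (2 * m) \<le> 2 * ovl N k l \<omega> ^ (2 * m) + c"
proof -
  obtain c :: real where c: "c \<ge> 0"
    "\<forall>x y::real. \<bar>y\<bar> \<le> (real \<S>)\<^sup>2 \<longrightarrow> \<bar>x + y\<bar> ^ (2 * m) \<le> 2 * \<bar>x\<bar> ^ (2 * m) + c"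
    using abs_add_power_le[of "(real \<S>)\<^sup>2" "2 * m"] by auto
  have "cav N i k l \<omega> ^ (2 * m) \<le> 2 * ovl N k l \<omega> ^ (2 * m) + c"
    if w: "\<omega> \<in> PiE {..<n} (\<lambda>_. configs \<S> N)" "k < n" "l < n" "i < N" for N n i k l \<omega>
  proof -
    have "\<bar>cav N i k l \<omega> - ovl N k l \<omega>\<bar> \<le> (real \<S>)\<^sup>2" using ovl_cav_diff_const[OF w] by linarith
    then have "\<bar>ovl N k l \<omega> + (cav N i k l \<omega> - ovl N k l \<omega>)\<bar> ^ (2 * m) \<le> 2 * \<bar>ovl N k l \<omega>\<bar> ^ (2 * m) + c"
      using c(2) by blast
    then show ?thesis by (simp add: power_even_abs)
  qed
  then show ?thesis using c(1) by blast
qed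

text \<open>Both kinds of moments are bounded together because the derivative along the path mixes
  overlaps and self-overlaps.\<close>

definition ovl_moment :: "nat \<Rightarrow> nat \<Rightarrow> real" where
  "ovl_moment N m = nu N 2 (\<lambda>\<omega>. ovl N 0 1 \<omega> ^ (2 * m)) + nu N 2 (\<lambda>\<omega>. ovl N 0 0 \<omega> ^ (2 * m))"

lemma nu_ovl_moment:
  assumes "0 < N" "k < n" "l < n"
  shows "0 \<le> nu N n (\<lambda>\<omega>. ovl N k l \<omega> ^ (2 * m))" "nu N n (\<lambda>\<omega>. ovl N k l \<omega> ^ (2 * m)) \<le> ovl_moment N m"
proof -
  have nn: "0 \<le> nu N n' (\<lambda>\<omega>. ovl N k l \<omega> ^ (2 * m))" for n' k l
    by (rule nu_nonneg[OF assms(1)]) simp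
  show "0 \<le> nu N n (\<lambda>\<omega>. ovl N k l \<omega> ^ (2 * m))" by (rule nn)
  show "nu N n (\<lambda>\<omega>. ovl N k l \<omega> ^ (2 * m)) \<le> ovl_moment N m"
    unfolding nu_ovl[OF assms, of "\<lambda>x. x ^ (2 * m)"] ovl_moment_def
    using nn[of 2 0 0] nn[of 2 0 1] by (cases "k = l") auto
qed

text \<open>First the average is moved to the end of the path, then cavity overlaps are replaced by
  full ones. Neither factor, exp (force_const n) nor 2, depends on \<open>m\<close>.\<close>

lemma cnu_cav_moment:
  "\<exists>c\<ge>0. \<forall>N n i k l \<theta>. k < n \<longrightarrow> l < n \<longrightarrow> i < N \<longrightarrow> 0 \<le> \<theta> \<longrightarrow> \<theta> \<le> pi / 2 \<longrightarrow>
    cnu N i \<theta> n (\<lambda>\<omega>. cav N i k l \<omega> ^ (2 * m)) \<le> exp (force_const n) * (2 * ovl_moment N m + c)"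
proof -
  obtain c where c: "c \<ge> 0" "\<forall>N n i k l \<omega>. \<omega> \<in> PiE {..<n} (\<lambda>_. configs \<S> N) \<longrightarrow> k < n \<longrightarrow> l < n \<longrightarrow> i < N \<longrightarrow>
    cav N i k l \<omega> ^ (2 * m) \<le> 2 * ovl N k l \<omega> ^ (2 * m) + c" using cav_power_le by blast
  have "cnu N i \<theta> n (\<lambda>\<omega>. cav N i k l \<omega> ^ (2 * m)) \<le> exp (force_const n) * (2 * ovl_moment N m + c)"
    if k: "k < n" "l < n" and i: "i < N" and t: "0 \<le> \<theta>" "\<theta> \<le> pi / 2" for N n i k l \<theta>
  proof -
    have N: "0 < N" using i by simp
    have "cnu N i \<theta> n (\<lambda>\<omega>. cav N i k l \<omega> ^ (2 * m)) \<le> exp (force_const n) * cnu N i (pi / 2) n (\<lambda>\<omega>. cav N i k l \<omega> ^ (2 * m))"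
      by (rule cnu_compare[OF i depends_below_comp[OF depends_below_cav[OF k]]]) (use t in auto)
    also have "cnu N i (pi / 2) n (\<lambda>\<omega>. cav N i k l \<omega> ^ (2 * m)) \<le> nu N n (\<lambda>\<omega>. 2 * ovl N k l \<omega> ^ (2 * m) + c)"
      unfolding cnu_half_pi[OF i] by (rule nu_mono[OF N]) (use c(2) k i in blast)
    also have "\<dots> \<le> 2 * ovl_moment N m + c"
      using nu_ovl_moment(2)[OF N k, of m] by (simp add: nu_add[OF N] nu_cmult[OF N] nu_const[OF N])
    finally show ?thesis by simp
  qed
  then show ?thesis using c(1) by blast
qed

text \<open>Four replicas: the two of an overlap and the two added by the derivative.\<close>

lemma force_const_4: "exp (force_const 4) \<le> 3"
proof -
  have "force_const 4 \<le> 1" using small by (simp add: force_const_def)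
  then have "exp (force_const 4) \<le> exp 1" by simp
  then show ?thesis using exp_le by linarith
qed

text \<open>One factor of the power becomes an average over sites of centred spin products. At each
  site, passing to the cavity power leaves only powers \<open>2 * m\<close>, hence
  \<open>ovl_moment N m\<close> (\<open>A\<close>); the rest vanishes at \<theta> = 0 and equals a
  force insertion (\<open>B\<close>), whose factor \<beta>^2 makes the coefficient of the top moment
  small.\<close>

lemma ovl_moment_step:
  "\<exists>c\<ge>0. \<forall>N k l. 0 < N \<longrightarrow> k < 2 \<longrightarrow> l < 2 \<longrightarrow>
    nu N 2 (\<lambda>\<omega>. ovl N k l \<omega> ^ (2 * Suc m)) \<le> ovl_moment N (Suc m) / 4 + c * (1 + ovl_moment N m)"
proof -
  let ?s = "(real \<S>)\<^sup>2"
  obtain c1 where c1: "c1 \<ge> 0" "\<forall>N n i k l \<omega>. \<omega> \<in> PiE {..<n} (\<lambda>_. configs \<S> N) \<longrightarrow> k < n \<longrightarrow> l < n \<longrightarrow> i < N \<longrightarrow>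
    cav N i k l \<omega> ^ (2 * m) \<le> 2 * ovl N k l \<omega> ^ (2 * m) + c1" using cav_power_le by blast
  obtain c2 where c2: "c2 \<ge> 0" "\<forall>N n i k l \<theta>. k < n \<longrightarrow> l < n \<longrightarrow> i < N \<longrightarrow> 0 \<le> \<theta> \<longrightarrow> \<theta> \<le> pi / 2 \<longrightarrow>
    cnu N i \<theta> n (\<lambda>\<omega>. cav N i k l \<omega> ^ (2 * Suc m)) \<le> exp (force_const n) * (2 * ovl_moment N (Suc m) + c2)"
    using cnu_cav_moment by blast
  let ?C1 = "2 * ?s * (?s * (real (Suc (2 * m)) * (3 + c1)))" and ?C2 = "144 * \<beta>\<^sup>2 * real \<S> ^ 4 * c2"
  let ?c = "?C1 + ?C2"
  have c0: "0 \<le> ?c" using c1(1) c2(1) by (intro add_nonneg_nonneg mult_nonneg_nonneg) auto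
  have "nu N 2 (\<lambda>\<omega>. ovl N k l \<omega> ^ (2 * Suc m)) \<le> ovl_moment N (Suc m) / 4 + ?c * (1 + ovl_moment N m)"
    if N: "0 < N" and k: "k < 2" "l < 2" for N k l
  proof -
    let ?r = "sqrt (real N)"
    have r: "0 < ?r" "?r * ?r = real N" using N by auto
    have mom0: "0 \<le> ovl_moment N j" for j using nu_ovl_moment[OF N k, of j] by linarith
    have site: "?r * nu N 2 (\<lambda>\<omega>. (\<omega> k i * \<omega> l i - centre k l) * ovl N k l \<omega> ^ Suc (2 * m))
      \<le> ovl_moment N (Suc m) / 4 + ?c * (1 + ovl_moment N m)" if i: "i < N" for i
    proof -
      let ?f = "\<lambda>\<omega>. \<omega> k i * \<omega> l i - centre k l"
      have A: "\<bar>?r * nu N 2 (\<lambda>\<omega>. ?f \<omega> * (ovl N k l \<omega> ^ Suc (2 * m) - cav N i k l \<omega> ^ Suc (2 * m)))\<bar>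
        \<le> ?C1 * (1 + ovl_moment N m)"
      proof -
        have "\<bar>?r * nu N 2 (\<lambda>\<omega>. ?f \<omega> * (ovl N k l \<omega> ^ Suc (2 * m) - cav N i k l \<omega> ^ Suc (2 * m)))\<bar>
          \<le> nu N 2 (\<lambda>\<omega>. \<bar>?r * (?f \<omega> * (ovl N k l \<omega> ^ Suc (2 * m) - cav N i k l \<omega> ^ Suc (2 * m)))\<bar>)"
          unfolding nu_cmult[OF N, symmetric] by (rule nu_abs[OF N])
        also have "\<dots> \<le> nu N 2 (\<lambda>\<omega>. 2 * ?s * (?s * (real (Suc (2 * m)) * (3 * ovl N k l \<omega> ^ (2 * m) + c1))))"
        proof (rule nu_mono[OF N])
          fix \<omega> :: "nat \<Rightarrow> nat \<Rightarrow> real" assume w: "\<omega> \<in> PiE {..<2} (\<lambda>_. configs \<S> N)"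
          have "\<bar>ovl N k l \<omega> ^ Suc (2 * m) - cav N i k l \<omega> ^ Suc (2 * m)\<bar>
            \<le> \<bar>ovl N k l \<omega> - cav N i k l \<omega>\<bar> * (real (Suc (2 * m)) * (\<bar>ovl N k l \<omega>\<bar> ^ (2 * m) + \<bar>cav N i k l \<omega>\<bar> ^ (2 * m)))"
            by (rule abs_power_diff_le)
          also have "\<dots> \<le> ?s / ?r * (real (Suc (2 * m)) * (3 * ovl N k l \<omega> ^ (2 * m) + c1))"
          proof (intro mult_mono ovl_cav_diff[OF w k i])
            have "cav N i k l \<omega> ^ (2 * m) \<le> 2 * ovl N k l \<omega> ^ (2 * m) + c1" using c1(2) w k i by blast
            then show "\<bar>ovl N k l \<omega>\<bar> ^ (2 * m) + \<bar>cav N i k l \<omega>\<bar> ^ (2 * m) \<le> 3 * ovl N k l \<omega> ^ (2 * m) + c1"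
              by (simp add: power_even_abs)
          qed auto
          finally have d: "\<bar>ovl N k l \<omega> ^ Suc (2 * m) - cav N i k l \<omega> ^ Suc (2 * m)\<bar>
            \<le> ?s / ?r * (real (Suc (2 * m)) * (3 * ovl N k l \<omega> ^ (2 * m) + c1))" .
          have "?r * (\<bar>?f \<omega>\<bar> * \<bar>ovl N k l \<omega> ^ Suc (2 * m) - cav N i k l \<omega> ^ Suc (2 * m)\<bar>)
            \<le> ?r * (2 * ?s * (?s / ?r * (real (Suc (2 * m)) * (3 * ovl N k l \<omega> ^ (2 * m) + c1))))"
            by (intro mult_left_mono mult_mono centred_pair_bound[OF w k i] d) auto
          also have "\<dots> = 2 * ?s * (?s * (real (Suc (2 * m)) * (3 * ovl N k l \<omega> ^ (2 * m) + c1)))"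
            using r(1) by (simp add: field_simps)
          finally show "\<bar>?r * (?f \<omega> * (ovl N k l \<omega> ^ Suc (2 * m) - cav N i k l \<omega> ^ Suc (2 * m)))\<bar>
            \<le> 2 * ?s * (?s * (real (Suc (2 * m)) * (3 * ovl N k l \<omega> ^ (2 * m) + c1)))"
            by (simp only: abs_mult) simp
        qed
        also have "\<dots> = 2 * ?s * (?s * (real (Suc (2 * m)) * (3 * nu N 2 (\<lambda>\<omega>. ovl N k l \<omega> ^ (2 * m)) + c1)))"
          by (simp only: nu_cmult[OF N] nu_add[OF N] nu_const[OF N])
        also have "\<dots> \<le> 2 * ?s * (?s * (real (Suc (2 * m)) * ((3 + c1) * (1 + ovl_moment N m))))"
        proof (intro mult_left_mono)
          have "3 * nu N 2 (\<lambda>\<omega>. ovl N k l \<omega> ^ (2 * m)) + c1 \<le> 3 * ovl_moment N m + c1"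
            using nu_ovl_moment(2)[OF N k, of m] by simp
          also have "\<dots> \<le> (3 + c1) * (1 + ovl_moment N m)"
            using mult_nonneg_nonneg[OF c1(1) mom0[of m]] by (simp add: algebra_simps)
          finally show "3 * nu N 2 (\<lambda>\<omega>. ovl N k l \<omega> ^ (2 * m)) + c1 \<le> (3 + c1) * (1 + ovl_moment N m)" .
        qed auto
        finally show ?thesis by (simp only: mult.assoc)
      qed
      have B: "\<bar>?r * nu N 2 (\<lambda>\<omega>. ?f \<omega> * cav N i k l \<omega> ^ Suc (2 * m))\<bar> \<le> ovl_moment N (Suc m) / 4 + ?C2"
      proof -
        let ?F = "\<lambda>\<omega>. ?f \<omega> * cav N i k l \<omega> ^ Suc (2 * m)"
        have depf: "depends_below 2 ?f"
          by (rule depends_belowI) (use k in simp)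
        have dep: "depends_below 2 ?F"
          by (intro depends_below_mult depf depends_below_comp[OF depends_below_cav[OF k]])
        have "cnu N i 0 2 ?F = site_av 2 (\<lambda>s. s k * s l - centre k l) * cnu N i 0 2 (\<lambda>\<omega>. cav N i k l \<omega> ^ Suc (2 * m))"
        proof (rule cnu_zero_factor[OF i])
          show "depends_below 2 (\<lambda>s. s k * s l - centre k l)" by (rule depends_belowI) (use k in simp)
          show "cav N i k l \<omega> ^ Suc (2 * m) = cav N i k l \<omega>' ^ Suc (2 * m)" if "\<And>k b. b \<noteq> i \<Longrightarrow> \<omega> k b = \<omega>' k b" for \<omega> \<omega>' :: "nat \<Rightarrow> nat \<Rightarrow> real"
            using that by (simp add: cav_def cavity_overlap_def)
        qed
        then have z: "cnu N i 0 2 ?F = 0" by (simp add: site_av_pair[OF k])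
        obtain \<theta> where t: "0 \<le> \<theta>" "\<theta> \<le> pi / 2"
          "?r * (cnu N i (pi / 2) 2 ?F - cnu N i 0 2 ?F) = cnu N i \<theta> (Suc (Suc 2)) (\<lambda>\<omega>. ?F \<omega> * force N i 2 \<omega>)"
          using cnu_mvt[OF i dep] by blast
        have e: "?r * nu N 2 ?F = cnu N i \<theta> (Suc (Suc 2)) (\<lambda>\<omega>. ?F \<omega> * force N i 2 \<omega>)"
          using t(3) unfolding z cnu_half_pi[OF i] diff_zero .
        have "\<bar>?r * nu N 2 ?F\<bar> \<le> cnu N i \<theta> (Suc (Suc 2)) (\<lambda>\<omega>. \<bar>?F \<omega> * force N i 2 \<omega>\<bar>)"
          unfolding e by (rule cnu_abs[OF i])
        also have "\<dots> \<le> cnu N i \<theta> (Suc (Suc 2)) (\<lambda>\<omega>. \<beta>\<^sup>2 * real \<S> ^ 4 * (\<Sum>a<Suc 2. \<Sum>b<Suc (Suc 2).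
            \<bar>alt_coeff 2 a\<bar> * \<bar>alt_coeff (Suc 2) b\<bar> * (cav N i k l \<omega> ^ (2 * Suc m) + cav N i a b \<omega> ^ (2 * Suc m))))"
        proof (rule cnu_mono[OF i])
          fix \<omega> assume w: "\<omega> \<in> PiE {..<Suc (Suc 2)} (\<lambda>_. configs \<S> N)"
          let ?y = "\<bar>cav N i k l \<omega>\<bar> ^ Suc (2 * m)"
          have "\<bar>?f \<omega>\<bar> \<le> 2 * ?s" by (rule centred_pair_bound[OF w _ _ i]) (use k in auto)
          then have "(\<bar>?f \<omega>\<bar> * ?y) * \<bar>force N i 2 \<omega>\<bar> \<le> (2 * ?s * ?y) * (\<beta>\<^sup>2 / 2 * ?s *
            (\<Sum>a<Suc 2. \<Sum>b<Suc (Suc 2). \<bar>alt_coeff 2 a\<bar> * \<bar>alt_coeff (Suc 2) b\<bar> * \<bar>cav N i a b \<omega>\<bar>))"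
            by (intro mult_mono mult_right_mono force_le[OF w i]) auto
          also have "\<dots> = \<beta>\<^sup>2 * real \<S> ^ 4 * (\<Sum>a<Suc 2. \<Sum>b<Suc (Suc 2).
            \<bar>alt_coeff 2 a\<bar> * \<bar>alt_coeff (Suc 2) b\<bar> * (?y * \<bar>cav N i a b \<omega>\<bar>))"
          proof -
            have s4: "real \<S> ^ 4 = ?s * ?s" by (simp add: power4_eq_xxxx power2_eq_square)
            have "(\<Sum>a<Suc 2. \<Sum>b<Suc (Suc 2). \<bar>alt_coeff 2 a\<bar> * \<bar>alt_coeff (Suc 2) b\<bar> * (?y * \<bar>cav N i a b \<omega>\<bar>))
              = ?y * (\<Sum>a<Suc 2. \<Sum>b<Suc (Suc 2). \<bar>alt_coeff 2 a\<bar> * \<bar>alt_coeff (Suc 2) b\<bar> * \<bar>cav N i a b \<omega>\<bar>)"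
              by (simp only: sum_distrib_left) (simp only: mult_ac)
            then show ?thesis unfolding s4 by (simp only: mult_ac) simp
          qed
          also have "\<dots> \<le> \<beta>\<^sup>2 * real \<S> ^ 4 * (\<Sum>a<Suc 2. \<Sum>b<Suc (Suc 2).
            \<bar>alt_coeff 2 a\<bar> * \<bar>alt_coeff (Suc 2) b\<bar> * (cav N i k l \<omega> ^ (2 * Suc m) + cav N i a b \<omega> ^ (2 * Suc m)))"
            by (intro mult_left_mono sum_mono abs_power_mult_le) auto
          finally show "\<bar>?F \<omega> * force N i 2 \<omega>\<bar> \<le> \<beta>\<^sup>2 * real \<S> ^ 4 * (\<Sum>a<Suc 2. \<Sum>b<Suc (Suc 2).
            \<bar>alt_coeff 2 a\<bar> * \<bar>alt_coeff (Suc 2) b\<bar> * (cav N i k l \<omega> ^ (2 * Suc m) + cav N i a b \<omega> ^ (2 * Suc m)))"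
            by (simp only: abs_mult power_abs)
        qed
        also have "\<dots> = \<beta>\<^sup>2 * real \<S> ^ 4 * (\<Sum>a<Suc 2. \<Sum>b<Suc (Suc 2). \<bar>alt_coeff 2 a\<bar> * \<bar>alt_coeff (Suc 2) b\<bar> *
            (cnu N i \<theta> (Suc (Suc 2)) (\<lambda>\<omega>. cav N i k l \<omega> ^ (2 * Suc m)) + cnu N i \<theta> (Suc (Suc 2)) (\<lambda>\<omega>. cav N i a b \<omega> ^ (2 * Suc m))))"
          by (simp only: cnu_cmult[OF i] cnu_sum[OF i] cnu_add[OF i])
        also have "\<dots> \<le> \<beta>\<^sup>2 * real \<S> ^ 4 * (\<Sum>a<Suc 2. \<Sum>b<Suc (Suc 2). \<bar>alt_coeff 2 a\<bar> * \<bar>alt_coeff (Suc 2) b\<bar> *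
            (6 * (2 * ovl_moment N (Suc m) + c2)))"
        proof (intro mult_left_mono sum_mono)
          have "cnu N i \<theta> (Suc (Suc 2)) (\<lambda>\<omega>. cav N i a b \<omega> ^ (2 * Suc m)) \<le> 3 * (2 * ovl_moment N (Suc m) + c2)"
            if "a < 4" "b < 4" for a b
          proof -
            have "cnu N i \<theta> (Suc (Suc 2)) (\<lambda>\<omega>. cav N i a b \<omega> ^ (2 * Suc m)) \<le> exp (force_const (Suc (Suc 2))) * (2 * ovl_moment N (Suc m) + c2)"
              using c2(2)[rule_format, of a "Suc (Suc 2)" b i N \<theta>] that i t by simp
            also have "\<dots> \<le> 3 * (2 * ovl_moment N (Suc m) + c2)"
              using force_const_4 mom0[of "Suc m"] c2(1) by (intro mult_right_mono) auto
            finally show ?thesis .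
          qed
          note bnd = this
          fix a b assume ab: "a \<in> {..<Suc 2}" "b \<in> {..<Suc (Suc 2)}"
          have "cnu N i \<theta> (Suc (Suc 2)) (\<lambda>\<omega>. cav N i k l \<omega> ^ (2 * Suc m))
              + cnu N i \<theta> (Suc (Suc 2)) (\<lambda>\<omega>. cav N i a b \<omega> ^ (2 * Suc m))
            \<le> 3 * (2 * ovl_moment N (Suc m) + c2) + 3 * (2 * ovl_moment N (Suc m) + c2)"
            by (intro add_mono bnd) (use k ab in auto)
          also have "\<dots> = 6 * (2 * ovl_moment N (Suc m) + c2)" by simp
          finally show "cnu N i \<theta> (Suc (Suc 2)) (\<lambda>\<omega>. cav N i k l \<omega> ^ (2 * Suc m))
              + cnu N i \<theta> (Suc (Suc 2)) (\<lambda>\<omega>. cav N i a b \<omega> ^ (2 * Suc m))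
            \<le> 6 * (2 * ovl_moment N (Suc m) + c2)" .
        qed auto
        \<comment> \<open>24 is the coefficient weight 4 n (n + 1) for n = 2, 6 is twice the
          comparison factor 3, and the inner 2 comes from replacing cavity overlaps by full ones:
          together 288.\<close>
        also have "\<dots> = \<beta>\<^sup>2 * real \<S> ^ 4 * (24 * (6 * (2 * ovl_moment N (Suc m) + c2)))"
          unfolding sum_alt_coeff_const by simp
        also have "\<dots> = 288 * (\<beta>\<^sup>2 * real \<S> ^ 4) * ovl_moment N (Suc m) + ?C2" by (simp add: algebra_simps)
        also have "288 * (\<beta>\<^sup>2 * real \<S> ^ 4) * ovl_moment N (Suc m) \<le> 1 / 4 * ovl_moment N (Suc m)"
          by (rule mult_right_mono[OF _ mom0]) (use small in simp)
        finally show ?thesis by simp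
      qed
      have "?r * nu N 2 (\<lambda>\<omega>. ?f \<omega> * ovl N k l \<omega> ^ Suc (2 * m))
        = ?r * nu N 2 (\<lambda>\<omega>. ?f \<omega> * (ovl N k l \<omega> ^ Suc (2 * m) - cav N i k l \<omega> ^ Suc (2 * m)))
          + ?r * nu N 2 (\<lambda>\<omega>. ?f \<omega> * cav N i k l \<omega> ^ Suc (2 * m))"
        by (simp only: right_diff_distrib nu_diff[OF N])
      moreover have "?C2 \<le> ?C2 * (1 + ovl_moment N m)"
        using mom0[of m] c2(1) by (simp add: distrib_left)
      ultimately show ?thesis using A B unfolding distrib_right by linarith
    qed
    have ovl_sum: "ovl N k l \<omega> = 1 / ?r * (\<Sum>i<N. \<omega> k i * \<omega> l i - centre k l)" for \<omega>
    proof -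
      have "s * (X / (s * s) - c) = 1 / s * (X - s * s * c)" if "0 < s" for s X c :: real
        using that by (simp add: field_simps)
      from this[OF r(1)] show ?thesis
        unfolding r(2) by (simp add: ovl_def overlap_def sum_subtractf)
    qed
    have "ovl N k l \<omega> ^ (2 * Suc m) = 1 / ?r * (\<Sum>i<N. (\<omega> k i * \<omega> l i - centre k l) * ovl N k l \<omega> ^ Suc (2 * m))" for \<omega>
    proof -
      have "ovl N k l \<omega> ^ (2 * Suc m) = ovl N k l \<omega> * ovl N k l \<omega> ^ Suc (2 * m)" by simp
      also have "\<dots> = 1 / ?r * (\<Sum>i<N. \<omega> k i * \<omega> l i - centre k l) * ovl N k l \<omega> ^ Suc (2 * m)"
        by (subst ovl_sum) (rule refl)
      finally show ?thesis by (simp only: mult.assoc sum_distrib_right)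
    qed
    then have "nu N 2 (\<lambda>\<omega>. ovl N k l \<omega> ^ (2 * Suc m))
      = 1 / ?r * (\<Sum>i<N. nu N 2 (\<lambda>\<omega>. (\<omega> k i * \<omega> l i - centre k l) * ovl N k l \<omega> ^ Suc (2 * m)))"
      by (simp only: nu_cmult[OF N] nu_sum[OF N])
    also have "\<dots> = 1 / real N * (\<Sum>i<N. ?r * nu N 2 (\<lambda>\<omega>. (\<omega> k i * \<omega> l i - centre k l) * ovl N k l \<omega> ^ Suc (2 * m)))"
    proof -
      have inv: "1 / ?r = 1 / real N * ?r"
        using r by (auto simp: divide_simps)
      show ?thesis unfolding sum_distrib_left[symmetric] inv by (simp only: mult.assoc)
    qed
    also have "\<dots> \<le> 1 / real N * (\<Sum>i<N. ovl_moment N (Suc m) / 4 + ?c * (1 + ovl_moment N m))"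
      by (intro mult_left_mono sum_mono site) auto
    also have "\<dots> = ovl_moment N (Suc m) / 4 + ?c * (1 + ovl_moment N m)" using N by simp
    finally show ?thesis .
  qed
  then show ?thesis using c0 by blast
qed

text \<open>Each of the two moments is at most a quarter of their sum plus lower order, so the sum
  is at most half of itself plus lower order and can be solved for.\<close>

theorem ovl_moment_bounded: "\<exists>C\<ge>0. \<forall>N>0. ovl_moment N m \<le> C"
proof (induction m)
  case 0
  have "ovl_moment N 0 \<le> 2" if "0 < N" for N
    by (simp add: ovl_moment_def nu_const[OF that])
  then show ?case by (intro exI[of _ 2]) auto
next
  case (Suc m)
  then obtain C where C: "C \<ge> 0" "\<forall>N>0. ovl_moment N m \<le> C" by blast
  obtain c where c: "c \<ge> 0" "\<forall>N k l. 0 < N \<longrightarrow> k < 2 \<longrightarrow> l < 2 \<longrightarrow>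
    nu N 2 (\<lambda>\<omega>. ovl N k l \<omega> ^ (2 * Suc m)) \<le> ovl_moment N (Suc m) / 4 + c * (1 + ovl_moment N m)"
    using ovl_moment_step by blast
  have "ovl_moment N (Suc m) \<le> 4 * (c * (1 + C))" if N: "0 < N" for N
  proof -
    have "c * (1 + ovl_moment N m) \<le> c * (1 + C)" using c(1) C(2) N by (intro mult_left_mono) auto
    moreover have "ovl_moment N (Suc m) \<le> 2 * (ovl_moment N (Suc m) / 4 + c * (1 + ovl_moment N m))"
      using c(2)[rule_format, OF N, of 0 1] c(2)[rule_format, OF N, of 0 0]
      unfolding of_bool_def by (subst ovl_moment_def) (simp only: mult_2, rule add_mono, simp_all)
    moreover have "X \<le> 4 * b" if "X \<le> 2 * (X / 4 + a)" "a \<le> b" for X a b :: real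
      using that by simp
    ultimately show ?thesis by blast
  qed
  then show ?case using c(1) C(1) by (intro exI[of _ "4 * (c * (1 + C))"]) auto
qed

text \<open>A common majorant of all cavity overlaps among \<open>n\<close> replicas. The summand 1
  makes lower powers dominated by higher ones, so estimates need only count factors.\<close>

definition cav_size :: "nat \<Rightarrow> nat \<Rightarrow> nat \<Rightarrow> (nat \<Rightarrow> nat \<Rightarrow> real) \<Rightarrow> real" where
  "cav_size N i n \<omega> = 1 + (\<Sum>(a, b)\<in>{..<n} \<times> {..<n}. \<bar>cav N i a b \<omega>\<bar>)"

lemma cav_size_ge_1: "1 \<le> cav_size N i n \<omega>"
  by (auto simp: cav_size_def intro!: sum_nonneg)

lemma cav_le_cav_size: "a < n \<Longrightarrow> b < n \<Longrightarrow> \<bar>cav N i a b \<omega>\<bar> \<le> cav_size N i n \<omega>"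
  using member_le_sum[of "(a, b)" "{..<n} \<times> {..<n}" "\<lambda>(a, b). \<bar>cav N i a b \<omega>\<bar>"]
  by (auto simp: cav_size_def)

theorem cav_size_moment:
  "\<exists>C\<ge>0. \<forall>N i \<theta>. i < N \<longrightarrow> 0 \<le> \<theta> \<longrightarrow> \<theta> \<le> pi / 2 \<longrightarrow> cnu N i \<theta> n (\<lambda>\<omega>. cav_size N i n \<omega> ^ m) \<le> C"
proof -
  obtain C where C: "C \<ge> 0" "\<forall>N>0. ovl_moment N m \<le> C" using ovl_moment_bounded by blast
  obtain c where c: "c \<ge> 0" "\<forall>N n i k l \<theta>. k < n \<longrightarrow> l < n \<longrightarrow> i < N \<longrightarrow> 0 \<le> \<theta> \<longrightarrow> \<theta> \<le> pi / 2 \<longrightarrow>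
    cnu N i \<theta> n (\<lambda>\<omega>. cav N i k l \<omega> ^ (2 * m)) \<le> exp (force_const n) * (2 * ovl_moment N m + c)"
    using cnu_cav_moment by blast
  let ?A = "{..<n} \<times> {..<n}"
  let ?B = "(1 + real (card ?A)) ^ m * (1 + (\<Sum>x\<in>?A. 1 + exp (force_const n) * (2 * C + c)))"
  have "cnu N i \<theta> n (\<lambda>\<omega>. cav_size N i n \<omega> ^ m) \<le> ?B" if i: "i < N" and t: "0 \<le> \<theta>" "\<theta> \<le> pi / 2" for N i \<theta>
  proof -
    have "cnu N i \<theta> n (\<lambda>\<omega>. cav_size N i n \<omega> ^ m) \<le> cnu N i \<theta> n (\<lambda>\<omega>. (1 + real (card ?A)) ^ m * (1 + (\<Sum>x\<in>?A. 1 + cav N i (fst x) (snd x) \<omega> ^ (2 * m))))"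
    proof (rule cnu_mono[OF i])
      fix \<omega>
      have "cav_size N i n \<omega> ^ m \<le> (1 + real (card ?A)) ^ m * (1 + (\<Sum>x\<in>?A. \<bar>cav N i (fst x) (snd x) \<omega>\<bar> ^ m))"
        unfolding cav_size_def split_beta by (rule power_one_plus_sum_le) simp
      also have "\<dots> \<le> (1 + real (card ?A)) ^ m * (1 + (\<Sum>x\<in>?A. 1 + cav N i (fst x) (snd x) \<omega> ^ (2 * m)))"
      proof (intro mult_left_mono add_left_mono sum_mono)
        fix x
        define z where "z = \<bar>cav N i (fst x) (snd x) \<omega>\<bar> ^ m"
        have "z\<^sup>2 = cav N i (fst x) (snd x) \<omega> ^ (2 * m)"
          unfolding z_def power_mult[symmetric] mult.commute[of m] by (simp add: power_even_abs)
        \<comment> \<open>This yields z \<le> 1 + z^2, which reduces an arbitrary power to an even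
          one.\<close>
        moreover have "0 \<le> (z - 1/2)\<^sup>2" by simp
        ultimately show "\<bar>cav N i (fst x) (snd x) \<omega>\<bar> ^ m \<le> 1 + cav N i (fst x) (snd x) \<omega> ^ (2 * m)"
          unfolding z_def[symmetric] by (simp add: power2_diff power_divide)
      qed simp
      finally show "cav_size N i n \<omega> ^ m \<le> (1 + real (card ?A)) ^ m * (1 + (\<Sum>x\<in>?A. 1 + cav N i (fst x) (snd x) \<omega> ^ (2 * m)))" .
    qed
    also have "\<dots> = (1 + real (card ?A)) ^ m * (1 + (\<Sum>x\<in>?A. 1 + cnu N i \<theta> n (\<lambda>\<omega>. cav N i (fst x) (snd x) \<omega> ^ (2 * m))))"
      by (simp only: cnu_cmult[OF i] cnu_add[OF i] cnu_sum[OF i] cnu_const[OF i])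
    also have "\<dots> \<le> (1 + real (card ?A)) ^ m * (1 + (\<Sum>x\<in>?A. 1 + exp (force_const n) * (2 * C + c)))"
    proof (intro mult_left_mono add_left_mono sum_mono)
      fix x assume x: "x \<in> ?A"
      have "cnu N i \<theta> n (\<lambda>\<omega>. cav N i (fst x) (snd x) \<omega> ^ (2 * m)) \<le> exp (force_const n) * (2 * ovl_moment N m + c)"
        using c(2) x i t by auto
      also have "\<dots> \<le> exp (force_const n) * (2 * C + c)" using C(2) i by simp
      finally show "cnu N i \<theta> n (\<lambda>\<omega>. cav N i (fst x) (snd x) \<omega> ^ (2 * m)) \<le> exp (force_const n) * (2 * C + c)" .
    qed simp
    finally show ?thesis .
  qed
  moreover have "0 \<le> ?B" using C(1) c(1) by (intro mult_nonneg_nonneg add_nonneg_nonneg sum_nonneg) auto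
  ultimately show ?thesis by blast
qed

end

section \<open>The cavity equation for overlap moments\<close>

text \<open>First-order expansion of a product in \<delta>. A new factor x_a + \<delta> e_a adds the
  remainders x_a R, \<delta>^2 e_a \<Sigma> and \<delta> e_a R to the old one;
  \<open>1 \<le> B\<close> allows all of them to be measured by the same power of
  \<open>B\<close>.\<close>

lemma prod_perturb:
  fixes s :: real
  assumes "finite I" "0 \<le> s"
  shows "\<exists>c\<ge>0. \<forall>(x::'j \<Rightarrow> real) e \<delta> B. 0 \<le> \<delta> \<longrightarrow> \<delta> \<le> 1 \<longrightarrow> 1 \<le> B \<longrightarrow>
    (\<forall>j\<in>I. \<bar>x j\<bar> \<le> B) \<longrightarrow> (\<forall>j\<in>I. \<bar>e j\<bar> \<le> s) \<longrightarrow>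
    \<bar>(\<Prod>j\<in>I. x j + \<delta> * e j) - (\<Prod>j\<in>I. x j) - \<delta> * (\<Sum>j\<in>I. e j * (\<Prod>i\<in>I - {j}. x i))\<bar> \<le> \<delta>\<^sup>2 * (c * B ^ card I)"
  using assms(1)
proof (induction I)
  case empty
  show ?case by (intro exI[of _ 0]) auto
next
  case (insert a I)
  then obtain c where c: "c \<ge> 0" "\<forall>(x::'j \<Rightarrow> real) e \<delta> B. 0 \<le> \<delta> \<longrightarrow> \<delta> \<le> 1 \<longrightarrow> 1 \<le> B \<longrightarrow>
    (\<forall>j\<in>I. \<bar>x j\<bar> \<le> B) \<longrightarrow> (\<forall>j\<in>I. \<bar>e j\<bar> \<le> s) \<longrightarrow>
    \<bar>(\<Prod>j\<in>I. x j + \<delta> * e j) - (\<Prod>j\<in>I. x j) - \<delta> * (\<Sum>j\<in>I. e j * (\<Prod>i\<in>I - {j}. x i))\<bar> \<le> \<delta>\<^sup>2 * (c * B ^ card I)"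
    by blast
  let ?c = "c + s * (real (card I) * s) + s * c"
  have "\<bar>(\<Prod>j\<in>insert a I. x j + \<delta> * e j) - (\<Prod>j\<in>insert a I. x j) - \<delta> * (\<Sum>j\<in>insert a I. e j * (\<Prod>i\<in>insert a I - {j}. x i))\<bar>
      \<le> \<delta>\<^sup>2 * (?c * B ^ card (insert a I))"
    if d: "0 \<le> \<delta>" "\<delta> \<le> 1" "1 \<le> B" and x: "\<forall>j\<in>insert a I. \<bar>x j\<bar> \<le> B" and e: "\<forall>j\<in>insert a I. \<bar>e j\<bar> \<le> s"
    for x e :: "'j \<Rightarrow> real" and \<delta> B
  proof -
    define P where "P = (\<Prod>j\<in>I. x j)"
    define \<Sigma> where "\<Sigma> = (\<Sum>j\<in>I. e j * (\<Prod>i\<in>I - {j}. x i))"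
    define R where "R = (\<Prod>j\<in>I. x j + \<delta> * e j) - P - \<delta> * \<Sigma>"
    let ?n = "card I"
    have R: "\<bar>R\<bar> \<le> \<delta>\<^sup>2 * (c * B ^ ?n)"
      unfolding R_def P_def \<Sigma>_def using c(2) d x e by blast
    have "\<bar>\<Sigma>\<bar> \<le> (\<Sum>j\<in>I. s * B ^ ?n)"
      unfolding \<Sigma>_def
    proof (rule order_trans[OF sum_abs sum_mono])
      fix j assume j: "j \<in> I"
      have "\<bar>\<Prod>i\<in>I - {j}. x i\<bar> \<le> (\<Prod>i\<in>I - {j}. B)"
        unfolding abs_prod using x by (intro prod_mono) auto
      also have "\<dots> \<le> B ^ ?n" using d(3) by (simp add: power_increasing card_Diff1_le)
      finally show "\<bar>e j * (\<Prod>i\<in>I - {j}. x i)\<bar> \<le> s * B ^ ?n"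
        unfolding abs_mult using e j by (intro mult_mono) (auto simp: assms)
    qed
    then have \<Sigma>: "\<bar>\<Sigma>\<bar> \<le> real ?n * s * B ^ ?n" by simp
    have "(\<Sum>j\<in>I. e j * (\<Prod>i\<in>insert a I - {j}. x i)) = x a * \<Sigma>"
      unfolding \<Sigma>_def sum_distrib_left
    proof (rule sum.cong[OF refl])
      fix j assume j: "j \<in> I"
      then have "insert a I - {j} = insert a (I - {j})" using insert.hyps by auto
      then show "e j * (\<Prod>i\<in>insert a I - {j}. x i) = x a * (e j * (\<Prod>i\<in>I - {j}. x i))"
        using insert.hyps by simp
    qed
    moreover have "insert a I - {a} = I" using insert.hyps by auto
    ultimately have S: "(\<Sum>j\<in>insert a I. e j * (\<Prod>i\<in>insert a I - {j}. x i)) = e a * P + x a * \<Sigma>"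
      using insert.hyps by (simp add: P_def)
    have "(\<Prod>j\<in>I. x j + \<delta> * e j) = P + \<delta> * \<Sigma> + R" by (simp add: R_def)
    then have "(\<Prod>j\<in>insert a I. x j + \<delta> * e j) - (\<Prod>j\<in>insert a I. x j) - \<delta> * (e a * P + x a * \<Sigma>)
      = x a * R + \<delta>\<^sup>2 * (e a * \<Sigma>) + \<delta> * (e a * R)"
      using insert.hyps by (simp add: P_def[symmetric] algebra_simps power2_eq_square)
    also have "\<bar>\<dots>\<bar> \<le> \<bar>x a\<bar> * \<bar>R\<bar> + \<delta>\<^sup>2 * (\<bar>e a\<bar> * \<bar>\<Sigma>\<bar>) + \<delta> * (\<bar>e a\<bar> * \<bar>R\<bar>)"
      using d(1) by (intro order_trans[OF abs_triangle_ineq] add_mono) (auto simp: abs_mult)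
    also have "\<dots> \<le> B * (\<delta>\<^sup>2 * (c * B ^ ?n)) + \<delta>\<^sup>2 * (s * (real ?n * s * B ^ ?n)) + 1 * (s * (\<delta>\<^sup>2 * (c * B ^ ?n)))"
      using R \<Sigma> x e d assms(2) by (intro add_mono mult_mono mult_left_mono mult_nonneg_nonneg) auto
    also have "\<dots> = B * (\<delta>\<^sup>2 * (c * B ^ ?n)) + (\<delta>\<^sup>2 * (s * (real ?n * s) + s * c)) * B ^ ?n" by (simp add: algebra_simps)
    also have "\<dots> \<le> B * (\<delta>\<^sup>2 * (c * B ^ ?n)) + (\<delta>\<^sup>2 * (s * (real ?n * s) + s * c)) * B ^ Suc ?n"
      using d(3) c(1) assms(2) by (intro add_left_mono mult_left_mono power_increasing) auto
    also have "\<dots> = \<delta>\<^sup>2 * (?c * B ^ card (insert a I))"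
      using insert.hyps by (simp add: algebra_simps)
    finally show ?thesis unfolding S .
  qed
  moreover have "0 \<le> ?c" using c(1) assms(2) by (intro add_nonneg_nonneg mult_nonneg_nonneg) auto
  ultimately show ?case by blast
qed

text \<open>Order N^(-1/2). As the scaled moments carry sqrt N for each overlap, this becomes the
  required error after division by N^((k + k') / 2).\<close>

definition vanishing :: "(nat \<Rightarrow> real) \<Rightarrow> bool" where
  "vanishing F \<longleftrightarrow> (\<exists>C. \<forall>N>0. \<bar>F N\<bar> \<le> C / sqrt (real N))"

lemma vanishing_add: "vanishing F \<Longrightarrow> vanishing G \<Longrightarrow> vanishing (\<lambda>N. F N + G N)"
  unfolding vanishing_def
proof (elim exE)
  fix C C' assume "\<forall>N>0. \<bar>F N\<bar> \<le> C / sqrt (real N)" "\<forall>N>0. \<bar>G N\<bar> \<le> C' / sqrt (real N)"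
  then show "\<exists>C. \<forall>N>0. \<bar>F N + G N\<bar> \<le> C / sqrt (real N)"
    by (intro exI[of _ "C + C'"]) (auto simp: add_divide_distrib intro: order_trans[OF abs_triangle_ineq] add_mono)
qed

lemma vanishing_cmult: "vanishing F \<Longrightarrow> vanishing (\<lambda>N. c * F N)"
  unfolding vanishing_def
proof (elim exE)
  fix C assume "\<forall>N>0. \<bar>F N\<bar> \<le> C / sqrt (real N)"
  then have "\<bar>c\<bar> * \<bar>F N\<bar> \<le> \<bar>c\<bar> * (C / sqrt (real N))" if "N > 0" for N
    using that by (intro mult_left_mono) auto
  then show "\<exists>C. \<forall>N>0. \<bar>c * F N\<bar> \<le> C / sqrt (real N)"
    by (intro exI[of _ "\<bar>c\<bar> * C"]) (auto simp: abs_mult)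
qed

lemma vanishing_diff: "vanishing F \<Longrightarrow> vanishing G \<Longrightarrow> vanishing (\<lambda>N. F N - G N)"
  using vanishing_add[of F "\<lambda>N. -1 * G N"] vanishing_cmult[of G "-1"] by simp

lemma vanishing_zero: "vanishing (\<lambda>_. 0)"
  unfolding vanishing_def by (intro exI[of _ 0]) simp

lemma vanishing_sum: "(\<And>i. i \<in> A \<Longrightarrow> vanishing (F i)) \<Longrightarrow> vanishing (\<lambda>N. \<Sum>i\<in>A. F i N)"
  by (induction A rule: infinite_finite_induct) (auto intro: vanishing_add vanishing_zero)

lemma vanishing_cong: "vanishing F \<Longrightarrow> (\<And>N. 0 < N \<Longrightarrow> F N = G N) \<Longrightarrow> vanishing G"
  unfolding vanishing_def by metis

text \<open>Uniformity in the angle is needed because the mean value theorem does not tell which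
  angle occurs, uniformity in \<open>i\<close> because the errors are averaged over the
  sites.\<close>

definition vanishing_path :: "(nat \<Rightarrow> nat \<Rightarrow> real \<Rightarrow> real) \<Rightarrow> bool" where
  "vanishing_path F \<longleftrightarrow> (\<exists>C. \<forall>N i \<theta>. i < N \<longrightarrow> 0 \<le> \<theta> \<longrightarrow> \<theta> \<le> pi / 2 \<longrightarrow> \<bar>F N i \<theta>\<bar> \<le> C / sqrt (real N))"

lemma vanishing_path_add:
  "vanishing_path F \<Longrightarrow> vanishing_path G \<Longrightarrow> vanishing_path (\<lambda>N i \<theta>. F N i \<theta> + G N i \<theta>)"
  unfolding vanishing_path_def
proof (elim exE)
  fix C C' assume "\<forall>N i \<theta>. i < N \<longrightarrow> 0 \<le> \<theta> \<longrightarrow> \<theta> \<le> pi / 2 \<longrightarrow> \<bar>F N i \<theta>\<bar> \<le> C / sqrt (real N)"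
    "\<forall>N i \<theta>. i < N \<longrightarrow> 0 \<le> \<theta> \<longrightarrow> \<theta> \<le> pi / 2 \<longrightarrow> \<bar>G N i \<theta>\<bar> \<le> C' / sqrt (real N)"
  then have "\<bar>F N i \<theta> + G N i \<theta>\<bar> \<le> (C + C') / sqrt (real N)" if "i < N" "0 \<le> \<theta>" "\<theta> \<le> pi / 2" for N i \<theta>
    unfolding add_divide_distrib using that by (intro order_trans[OF abs_triangle_ineq] add_mono) blast+
  then show "\<exists>C. \<forall>N i \<theta>. i < N \<longrightarrow> 0 \<le> \<theta> \<longrightarrow> \<theta> \<le> pi / 2 \<longrightarrow> \<bar>F N i \<theta> + G N i \<theta>\<bar> \<le> C / sqrt (real N)"
    by blast
qed

lemma vanishing_path_cmult: "vanishing_path F \<Longrightarrow> vanishing_path (\<lambda>N i \<theta>. c * F N i \<theta>)"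
  unfolding vanishing_path_def
proof (elim exE)
  fix C assume C: "\<forall>N i \<theta>. i < N \<longrightarrow> 0 \<le> \<theta> \<longrightarrow> \<theta> \<le> pi / 2 \<longrightarrow> \<bar>F N i \<theta>\<bar> \<le> C / sqrt (real N)"
  have "\<bar>c\<bar> * \<bar>F N i \<theta>\<bar> \<le> \<bar>c\<bar> * (C / sqrt (real N))" if "i < N" "0 \<le> \<theta>" "\<theta> \<le> pi / 2" for N i \<theta>
    using that C by (intro mult_left_mono) auto
  then show "\<exists>C. \<forall>N i \<theta>. i < N \<longrightarrow> 0 \<le> \<theta> \<longrightarrow> \<theta> \<le> pi / 2 \<longrightarrow> \<bar>c * F N i \<theta>\<bar> \<le> C / sqrt (real N)"
    by (intro exI[of _ "\<bar>c\<bar> * C"]) (auto simp: abs_mult)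
qed

lemma vanishing_path_sum:
  "(\<And>j. j \<in> A \<Longrightarrow> vanishing_path (F j)) \<Longrightarrow> vanishing_path (\<lambda>N i \<theta>. \<Sum>j\<in>A. F j N i \<theta>)"
proof (induction A rule: infinite_finite_induct)
  case (insert a A)
  then show ?case by (auto intro!: vanishing_path_add)
qed (auto simp: vanishing_path_def intro!: exI[of _ 0])

lemma vanishing_path_cong:
  assumes F: "vanishing_path F" and eq: "\<And>N i \<theta>. i < N \<Longrightarrow> F N i \<theta> = G N i \<theta>"
  shows "vanishing_path G"
proof -
  obtain C where "\<forall>N i \<theta>. i < N \<longrightarrow> 0 \<le> \<theta> \<longrightarrow> \<theta> \<le> pi / 2 \<longrightarrow> \<bar>F N i \<theta>\<bar> \<le> C / sqrt (real N)"
    using F unfolding vanishing_path_def by blast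
  then show ?thesis unfolding vanishing_path_def by (intro exI[of _ C]) (simp add: eq)
qed

section \<open>Products of overlaps and their cavity equation\<close>

context high_temperature begin

text \<open>Factors are indexed by \<open>I\<close> through \<open>pr\<close> rather than collected
  in a set of pairs: repetitions are allowed, and single factors can be removed or added.\<close>

definition cav_prod :: "nat \<Rightarrow> nat \<Rightarrow> (nat \<Rightarrow> nat \<times> nat) \<Rightarrow> nat set \<Rightarrow> (nat \<Rightarrow> nat \<Rightarrow> real) \<Rightarrow> real" where
  "cav_prod N i pr I \<omega> = (\<Prod>j\<in>I. cav N i (fst (pr j)) (snd (pr j)) \<omega>)"

definition ovl_prod :: "nat \<Rightarrow> (nat \<Rightarrow> nat \<times> nat) \<Rightarrow> nat set \<Rightarrow> (nat \<Rightarrow> nat \<Rightarrow> real) \<Rightarrow> real" where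
  "ovl_prod N pr I \<omega> = (\<Prod>j\<in>I. ovl N (fst (pr j)) (snd (pr j)) \<omega>)"

definition replicas_below :: "nat \<Rightarrow> (nat \<Rightarrow> nat \<times> nat) \<Rightarrow> nat set \<Rightarrow> bool" where
  "replicas_below n pr I \<longleftrightarrow> finite I \<and> (\<forall>j\<in>I. fst (pr j) < n \<and> snd (pr j) < n)"

lemma replicas_below_mono: "replicas_below n pr I \<Longrightarrow> n \<le> m \<Longrightarrow> replicas_below m pr I"
  by (auto simp: replicas_below_def)

lemma depends_below_cav_prod: "replicas_below n pr I \<Longrightarrow> depends_below n (cav_prod N i pr I)"
  unfolding cav_prod_def[abs_def]
  by (rule depends_below_prod, rule depends_below_cav) (auto simp: replicas_below_def)

lemma depends_below_ovl_prod: "replicas_below n pr I \<Longrightarrow> depends_below n (ovl_prod N pr I)"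
  unfolding ovl_prod_def[abs_def]
  by (rule depends_below_prod, rule depends_below_ovl) (auto simp: replicas_below_def)

lemma cav_prod_le:
  assumes "replicas_below n pr I" shows "\<bar>cav_prod N i pr I \<omega>\<bar> \<le> cav_size N i n \<omega> ^ card I"
proof -
  have "\<bar>cav_prod N i pr I \<omega>\<bar> \<le> (\<Prod>j\<in>I. cav_size N i n \<omega>)"
    unfolding cav_prod_def abs_prod
    by (rule prod_mono) (use assms in \<open>auto simp: replicas_below_def intro!: cav_le_cav_size\<close>)
  then show ?thesis by simp
qed

text \<open>The bound is uniform in \<open>N\<close> and \<open>i\<close> because only the finitely
  many \<open>n\<close>-tuples of spin values can occur at a site.\<close>

lemma spin_fun_bound:
  assumes \<phi>: "depends_below n \<phi>"
  shows "\<exists>K\<ge>0. \<forall>N i \<omega>. i < N \<longrightarrow> \<omega> \<in> PiE {..<n} (\<lambda>_. configs \<S> N) \<longrightarrow> \<bar>\<phi> (\<lambda>k. \<omega> k i)\<bar> \<le> K"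
proof -
  let ?S = "PiE {..<n} (\<lambda>_. spins \<S>)"
  have fin: "finite ?S" by (intro finite_PiE) (auto simp: finite_spins)
  have "\<bar>\<phi> (\<lambda>k. \<omega> k i)\<bar> \<le> (\<Sum>s\<in>?S. \<bar>\<phi> s\<bar>)" if i: "i < N" and w: "\<omega> \<in> PiE {..<n} (\<lambda>_. configs \<S> N)" for N i \<omega>
  proof -
    have "restrict (\<lambda>k. \<omega> k i) {..<n} \<in> ?S"
      by (intro restrict_PiE_iff[THEN iffD2] ballI configs_spin[OF PiE_mem[OF w] i]) auto
    then have "\<bar>\<phi> (restrict (\<lambda>k. \<omega> k i) {..<n})\<bar> \<le> (\<Sum>s\<in>?S. \<bar>\<phi> s\<bar>)"
      by (rule member_le_sum[OF _ _ fin]) simp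
    also have "\<phi> (restrict (\<lambda>k. \<omega> k i) {..<n}) = \<phi> (\<lambda>k. \<omega> k i)"
      by (rule depends_belowD[OF \<phi>]) auto
    finally show ?thesis .
  qed
  then show ?thesis by (intro exI[of _ "\<Sum>s\<in>?S. \<bar>\<phi> s\<bar>"]) (auto intro: sum_nonneg)
qed

lemma force_le_cav_size:
  assumes w: "\<omega> \<in> PiE {..<Suc (Suc n)} (\<lambda>_. configs \<S> N)" and i: "i < N"
  shows "\<bar>force N i n \<omega>\<bar> \<le> \<beta>\<^sup>2 / 2 * (real \<S>)\<^sup>2 * (4 * real n * (real n + 1)) * cav_size N i (Suc (Suc n)) \<omega>"
proof -
  have "\<bar>force N i n \<omega>\<bar> \<le> \<beta>\<^sup>2 / 2 * (real \<S>)\<^sup>2 * (\<Sum>k<Suc n. \<Sum>l<Suc (Suc n).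
      \<bar>alt_coeff n k\<bar> * \<bar>alt_coeff (Suc n) l\<bar> * cav_size N i (Suc (Suc n)) \<omega>)"
    by (rule order_trans[OF force_le[OF w i]], intro mult_left_mono sum_mono cav_le_cav_size) auto
  then show ?thesis unfolding sum_alt_coeff_const by (simp only: mult.assoc)
qed

lemma depends_below_spin: "depends_below n \<phi> \<Longrightarrow> depends_below n (\<lambda>\<omega>. \<phi> (\<lambda>k. \<omega> k i))"
  by (rule depends_belowI) (auto intro: depends_belowD)

text \<open>The derivative along the path inserts one force, so it is controlled by the moment of
  order \<open>card I + 1\<close> of \<open>cav_size\<close>, divided by sqrt N.\<close>

lemma cav_prod_path_vanishing:
  assumes \<phi>: "depends_below n \<phi>" and I: "replicas_below n pr I"
  shows "vanishing_path (\<lambda>N i \<theta>. cnu N i \<theta> n (\<lambda>\<omega>. \<phi> (\<lambda>k. \<omega> k i) * cav_prod N i pr I \<omega>)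
    - cnu N i 0 n (\<lambda>\<omega>. \<phi> (\<lambda>k. \<omega> k i) * cav_prod N i pr I \<omega>))"
proof -
  obtain K where K: "0 \<le> K" "\<forall>N i \<omega>. i < N \<longrightarrow> \<omega> \<in> PiE {..<Suc (Suc n)} (\<lambda>_. configs \<S> N) \<longrightarrow> \<bar>\<phi> (\<lambda>k. \<omega> k i)\<bar> \<le> K"
    using spin_fun_bound[OF depends_below_mono[OF \<phi>, of "Suc (Suc n)"]] by auto
  obtain C where C: "C \<ge> 0" "\<forall>N i \<theta>. i < N \<longrightarrow> 0 \<le> \<theta> \<longrightarrow> \<theta> \<le> pi / 2 \<longrightarrow>
    cnu N i \<theta> (Suc (Suc n)) (\<lambda>\<omega>. cav_size N i (Suc (Suc n)) \<omega> ^ Suc (card I)) \<le> C"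
    using cav_size_moment by blast
  let ?k = "\<beta>\<^sup>2 / 2 * (real \<S>)\<^sup>2 * (4 * real n * (real n + 1))"
  have k: "0 \<le> ?k" by simp
  have "\<bar>cnu N i \<theta> (Suc (Suc n)) (\<lambda>\<omega>. \<phi> (\<lambda>k. \<omega> k i) * cav_prod N i pr I \<omega> * force N i n \<omega>)\<bar> \<le> K * ?k * C"
    if i: "i < N" and t: "0 \<le> \<theta>" "\<theta> \<le> pi / 2" for N i \<theta>
  proof -
    have "\<bar>cnu N i \<theta> (Suc (Suc n)) (\<lambda>\<omega>. \<phi> (\<lambda>k. \<omega> k i) * cav_prod N i pr I \<omega> * force N i n \<omega>)\<bar>
      \<le> cnu N i \<theta> (Suc (Suc n)) (\<lambda>\<omega>. \<bar>\<phi> (\<lambda>k. \<omega> k i) * cav_prod N i pr I \<omega> * force N i n \<omega>\<bar>)"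
      by (rule cnu_abs[OF i])
    also have "\<dots> \<le> cnu N i \<theta> (Suc (Suc n)) (\<lambda>\<omega>. K * ?k * cav_size N i (Suc (Suc n)) \<omega> ^ Suc (card I))"
    proof (rule cnu_mono[OF i])
      fix \<omega> :: "nat \<Rightarrow> nat \<Rightarrow> real" assume w: "\<omega> \<in> PiE {..<Suc (Suc n)} (\<lambda>_. configs \<S> N)"
      let ?B = "cav_size N i (Suc (Suc n)) \<omega>"
      have B: "0 \<le> ?B" using cav_size_ge_1[of N i "Suc (Suc n)" \<omega>] by linarith
      have "\<bar>\<phi> (\<lambda>k. \<omega> k i)\<bar> * \<bar>cav_prod N i pr I \<omega>\<bar> * \<bar>force N i n \<omega>\<bar> \<le> K * ?B ^ card I * (?k * ?B)"
      proof (intro mult_mono)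
        show "\<bar>\<phi> (\<lambda>k. \<omega> k i)\<bar> \<le> K" using K(2) i w by blast
        show "\<bar>cav_prod N i pr I \<omega>\<bar> \<le> ?B ^ card I"
          by (rule cav_prod_le[OF replicas_below_mono[OF I]]) simp
        show "\<bar>force N i n \<omega>\<bar> \<le> ?k * ?B" by (rule force_le_cav_size[OF w i])
      qed (use K(1) B in auto)
      then show "\<bar>\<phi> (\<lambda>k. \<omega> k i) * cav_prod N i pr I \<omega> * force N i n \<omega>\<bar> \<le> K * ?k * ?B ^ Suc (card I)"
        by (simp only: abs_mult power_Suc mult_ac)
    qed
    also have "\<dots> \<le> K * ?k * C"
      unfolding cnu_cmult[OF i] by (rule mult_left_mono) (use C(2) i t K(1) in auto)
    finally show ?thesis .
  qed
  then have "\<bar>cnu N i \<theta> n (\<lambda>\<omega>. \<phi> (\<lambda>k. \<omega> k i) * cav_prod N i pr I \<omega>)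
    - cnu N i 0 n (\<lambda>\<omega>. \<phi> (\<lambda>k. \<omega> k i) * cav_prod N i pr I \<omega>)\<bar> \<le> 4 * (K * ?k * C) / sqrt (real N)"
    if "i < N" "0 \<le> \<theta>" "\<theta> \<le> pi / 2" for N i \<theta>
    using that by (intro cnu_lipschitz depends_below_mult depends_below_spin \<phi> depends_below_cav_prod I) auto
  then show ?thesis unfolding vanishing_path_def by blast
qed

lemma cav_prod_zero_factor:
  assumes i: "i < N" and \<phi>: "depends_below n \<phi>"
  shows "cnu N i 0 n (\<lambda>\<omega>. \<phi> (\<lambda>k. \<omega> k i) * cav_prod N i pr I \<omega>) = site_av n \<phi> * cnu N i 0 n (cav_prod N i pr I)"
proof (rule cnu_zero_factor[OF i \<phi>])
  show "cav_prod N i pr I \<omega> = cav_prod N i pr I \<omega>'" if "\<And>(k::nat) b. b \<noteq> i \<Longrightarrow> \<omega> k b = \<omega>' k b" for \<omega> \<omega>'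
    using that by (simp add: cav_prod_def cav_def cavity_overlap_def)
qed

lemma ovl_prod_expansion:
  assumes I: "replicas_below n pr I"
  shows "\<exists>c\<ge>0. \<forall>N i \<omega>. i < N \<longrightarrow> \<omega> \<in> PiE {..<n} (\<lambda>_. configs \<S> N) \<longrightarrow>
    \<bar>ovl_prod N pr I \<omega> - cav_prod N i pr I \<omega> - 1 / sqrt (real N) *
      (\<Sum>j\<in>I. \<omega> (fst (pr j)) i * \<omega> (snd (pr j)) i * cav_prod N i pr (I - {j}) \<omega>)\<bar>
    \<le> 1 / real N * (c * cav_size N i n \<omega> ^ card I)"
proof -
  obtain c where c: "c \<ge> 0" "\<forall>(x::nat \<Rightarrow> real) e \<delta> B. 0 \<le> \<delta> \<longrightarrow> \<delta> \<le> 1 \<longrightarrow> 1 \<le> B \<longrightarrow>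
    (\<forall>j\<in>I. \<bar>x j\<bar> \<le> B) \<longrightarrow> (\<forall>j\<in>I. \<bar>e j\<bar> \<le> (real \<S>)\<^sup>2) \<longrightarrow>
    \<bar>(\<Prod>j\<in>I. x j + \<delta> * e j) - (\<Prod>j\<in>I. x j) - \<delta> * (\<Sum>j\<in>I. e j * (\<Prod>i\<in>I - {j}. x i))\<bar> \<le> \<delta>\<^sup>2 * (c * B ^ card I)"
    using prod_perturb[of I "(real \<S>)\<^sup>2"] I by (auto simp: replicas_below_def)
  have "\<bar>ovl_prod N pr I \<omega> - cav_prod N i pr I \<omega> - 1 / sqrt (real N) *
      (\<Sum>j\<in>I. \<omega> (fst (pr j)) i * \<omega> (snd (pr j)) i * cav_prod N i pr (I - {j}) \<omega>)\<bar>
    \<le> 1 / real N * (c * cav_size N i n \<omega> ^ card I)"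
    if i: "i < N" and w: "\<omega> \<in> PiE {..<n} (\<lambda>_. configs \<S> N)" for N i \<omega>
  proof -
    have d: "0 \<le> 1 / sqrt (real N)" "1 / sqrt (real N) \<le> 1" using inverse_sqrt_le_1[of N] i by auto
    have d2: "(1 / sqrt (real N))\<^sup>2 = 1 / real N" by (simp add: power_divide)
    have o: "ovl_prod N pr I \<omega> = (\<Prod>j\<in>I. cav N i (fst (pr j)) (snd (pr j)) \<omega> + 1 / sqrt (real N) * (\<omega> (fst (pr j)) i * \<omega> (snd (pr j)) i))"
      unfolding ovl_prod_def ovl_eq[OF i] by simp
    have "\<forall>j\<in>I. \<bar>cav N i (fst (pr j)) (snd (pr j)) \<omega>\<bar> \<le> cav_size N i n \<omega>"
      using I by (auto simp: replicas_below_def intro!: cav_le_cav_size)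
    moreover have "\<forall>j\<in>I. \<bar>\<omega> (fst (pr j)) i * \<omega> (snd (pr j)) i\<bar> \<le> (real \<S>)\<^sup>2"
      using I by (auto simp: replicas_below_def intro!: spin_prod_bound[OF w _ _ i])
    ultimately show ?thesis
      using c(2)[rule_format, OF d cav_size_ge_1[of N i n \<omega>],
          where x = "\<lambda>j. cav N i (fst (pr j)) (snd (pr j)) \<omega>" and e = "\<lambda>j. \<omega> (fst (pr j)) i * \<omega> (snd (pr j)) i"]
      unfolding o cav_prod_def d2 by simp
  qed
  then show ?thesis using c(1) by blast
qed

text \<open>Restoring site \<open>i\<close> changes the product by the first-order terms of
  \<open>ovl_prod_expansion\<close>, of size 1 / sqrt N. No angle occurs; the form suits addition to
  estimates along the path.\<close>

lemma ovl_cav_prod_path_vanishing: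
  assumes I: "replicas_below n pr I"
  shows "vanishing_path (\<lambda>N i \<theta>. nu N n (cav_prod N i pr I) - nu N n (ovl_prod N pr I))"
proof -
  obtain c where c: "c \<ge> 0" "\<forall>N i \<omega>. i < N \<longrightarrow> \<omega> \<in> PiE {..<n} (\<lambda>_. configs \<S> N) \<longrightarrow>
    \<bar>ovl_prod N pr I \<omega> - cav_prod N i pr I \<omega> - 1 / sqrt (real N) *
      (\<Sum>j\<in>I. \<omega> (fst (pr j)) i * \<omega> (snd (pr j)) i * cav_prod N i pr (I - {j}) \<omega>)\<bar>
    \<le> 1 / real N * (c * cav_size N i n \<omega> ^ card I)" using ovl_prod_expansion[OF I] by blast
  obtain C where C: "C \<ge> 0" "\<forall>N i \<theta>. i < N \<longrightarrow> 0 \<le> \<theta> \<longrightarrow> \<theta> \<le> pi / 2 \<longrightarrow>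
    cnu N i \<theta> n (\<lambda>\<omega>. cav_size N i n \<omega> ^ card I) \<le> C"
    using cav_size_moment by blast
  let ?K = "real (card I) * (real \<S>)\<^sup>2 + c"
  have "\<bar>nu N n (cav_prod N i pr I) - nu N n (ovl_prod N pr I)\<bar> \<le> ?K * C / sqrt (real N)"
    if i: "i < N" for N i
  proof -
    have N: "0 < N" using i by simp
    have "\<bar>nu N n (cav_prod N i pr I) - nu N n (ovl_prod N pr I)\<bar> = \<bar>nu N n (\<lambda>\<omega>. cav_prod N i pr I \<omega> - ovl_prod N pr I \<omega>)\<bar>"
      unfolding nu_diff[OF N] ..
    also have "\<dots> \<le> nu N n (\<lambda>\<omega>. \<bar>cav_prod N i pr I \<omega> - ovl_prod N pr I \<omega>\<bar>)" by (rule nu_abs[OF N])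
    also have "\<dots> \<le> nu N n (\<lambda>\<omega>. 1 / sqrt (real N) * (?K * cav_size N i n \<omega> ^ card I))"
    proof (rule nu_mono[OF N])
      fix \<omega> :: "nat \<Rightarrow> nat \<Rightarrow> real" assume w: "\<omega> \<in> PiE {..<n} (\<lambda>_. configs \<S> N)"
      let ?B = "cav_size N i n \<omega> ^ card I"
      let ?\<Sigma> = "\<Sum>j\<in>I. \<omega> (fst (pr j)) i * \<omega> (snd (pr j)) i * cav_prod N i pr (I - {j}) \<omega>"
      have B: "1 \<le> ?B" using cav_size_ge_1[of N i n \<omega>] by simp
      have "\<bar>?\<Sigma>\<bar> \<le> (\<Sum>j\<in>I. (real \<S>)\<^sup>2 * ?B)"
      proof (rule order_trans[OF sum_abs sum_mono])
        fix j assume j: "j \<in> I"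
        have "replicas_below n pr (I - {j})" using I by (auto simp: replicas_below_def)
        then have "\<bar>cav_prod N i pr (I - {j}) \<omega>\<bar> \<le> cav_size N i n \<omega> ^ card (I - {j})" by (rule cav_prod_le)
        also have "\<dots> \<le> ?B" using cav_size_ge_1[of N i n \<omega>] I
          by (intro power_increasing) (auto simp: replicas_below_def card_Diff1_le)
        finally show "\<bar>\<omega> (fst (pr j)) i * \<omega> (snd (pr j)) i * cav_prod N i pr (I - {j}) \<omega>\<bar> \<le> (real \<S>)\<^sup>2 * ?B"
          unfolding abs_mult[of _ "cav_prod _ _ _ _ _"]
          using I j by (intro mult_mono spin_prod_bound[OF w _ _ i]) (auto simp: replicas_below_def)
      qed
      then have S: "1 / sqrt (real N) * \<bar>?\<Sigma>\<bar> \<le> 1 / sqrt (real N) * (real (card I) * (real \<S>)\<^sup>2 * ?B)"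
        by (intro mult_left_mono) auto
      have "1 / real N \<le> 1 / sqrt (real N)"
        using N by (intro divide_left_mono) (auto simp: sqrt_le_D real_le_lsqrt power2_eq_square)
      then have "1 / real N * (c * ?B) \<le> 1 / sqrt (real N) * (c * ?B)"
        using c(1) B by (intro mult_right_mono) auto
      moreover have "\<bar>ovl_prod N pr I \<omega> - cav_prod N i pr I \<omega> - 1 / sqrt (real N) * ?\<Sigma>\<bar> \<le> 1 / real N * (c * ?B)"
        using c(2) i w by blast
      moreover have "\<bar>1 / sqrt (real N) * ?\<Sigma>\<bar> = 1 / sqrt (real N) * \<bar>?\<Sigma>\<bar>" by (simp add: abs_mult)
      moreover have "1 / sqrt (real N) * (?K * ?B) = 1 / sqrt (real N) * (real (card I) * (real \<S>)\<^sup>2 * ?B) + 1 / sqrt (real N) * (c * ?B)"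
        by (simp only: distrib_left distrib_right)
      ultimately show "\<bar>cav_prod N i pr I \<omega> - ovl_prod N pr I \<omega>\<bar> \<le> 1 / sqrt (real N) * (?K * ?B)"
        using S by linarith
    qed
    also have "\<dots> = 1 / sqrt (real N) * (?K * nu N n (\<lambda>\<omega>. cav_size N i n \<omega> ^ card I))"
      by (simp only: nu_cmult[OF N])
    also have "\<dots> \<le> 1 / sqrt (real N) * (?K * C)"
      using C(2)[rule_format, OF i, of "pi / 2"] c(1) by (intro mult_left_mono) (auto simp: cnu_half_pi[OF i])
    finally show ?thesis by simp
  qed
  then show ?thesis unfolding vanishing_path_def by blast
qed

text \<open>Go from \<theta> to 0, split off the spins at \<open>i\<close>, return with the cavity
  product alone to pi / 2, and restore site \<open>i\<close> there. Each move costs N^(-1/2), and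
  the resulting main term depends neither on \<open>i\<close> nor on \<theta>.\<close>

theorem cavity_factorization:
  assumes \<phi>: "depends_below n \<phi>" and I: "replicas_below n pr I"
  shows "vanishing_path (\<lambda>N i \<theta>. cnu N i \<theta> n (\<lambda>\<omega>. \<phi> (\<lambda>k. \<omega> k i) * cav_prod N i pr I \<omega>)
    - site_av n \<phi> * nu N n (ovl_prod N pr I))"
proof -
  have 1: "vanishing_path (\<lambda>N i \<theta>. cnu N i \<theta> n (\<lambda>\<omega>. 1 * cav_prod N i pr I \<omega>) - cnu N i 0 n (\<lambda>\<omega>. 1 * cav_prod N i pr I \<omega>))"
    using cav_prod_path_vanishing[OF depends_below_const[of n 1] I] .
  have 2: "vanishing_path (\<lambda>N i \<theta>. nu N n (cav_prod N i pr I) - cnu N i 0 n (cav_prod N i pr I))"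
    unfolding vanishing_path_def
  proof -
    obtain C where "\<forall>N i \<theta>. i < N \<longrightarrow> 0 \<le> \<theta> \<longrightarrow> \<theta> \<le> pi / 2 \<longrightarrow>
      \<bar>cnu N i \<theta> n (cav_prod N i pr I) - cnu N i 0 n (cav_prod N i pr I)\<bar> \<le> C / sqrt (real N)"
      using 1 by (auto simp: vanishing_path_def)
    then have "\<bar>cnu N i (pi / 2) n (cav_prod N i pr I) - cnu N i 0 n (cav_prod N i pr I)\<bar> \<le> C / sqrt (real N)" if "i < N" for N i
      using that by auto
    then show "\<exists>C. \<forall>N i \<theta>. i < N \<longrightarrow> 0 \<le> \<theta> \<longrightarrow> \<theta> \<le> pi / 2 \<longrightarrow>
      \<bar>nu N n (cav_prod N i pr I) - cnu N i 0 n (cav_prod N i pr I)\<bar> \<le> C / sqrt (real N)"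
      by (intro exI[of _ C]) (auto simp: cnu_half_pi)
  qed
  have "vanishing_path (\<lambda>N i \<theta>. (cnu N i \<theta> n (\<lambda>\<omega>. \<phi> (\<lambda>k. \<omega> k i) * cav_prod N i pr I \<omega>)
      - cnu N i 0 n (\<lambda>\<omega>. \<phi> (\<lambda>k. \<omega> k i) * cav_prod N i pr I \<omega>))
    + (site_av n \<phi> * (- 1 * (nu N n (cav_prod N i pr I) - cnu N i 0 n (cav_prod N i pr I))
      + (nu N n (cav_prod N i pr I) - nu N n (ovl_prod N pr I)))))" (is "vanishing_path ?F")
    by (intro vanishing_path_add vanishing_path_cmult cav_prod_path_vanishing[OF \<phi> I] 2 ovl_cav_prod_path_vanishing[OF I])
  then show ?thesis
  proof (rule vanishing_path_cong)
    show "?F N i \<theta> = cnu N i \<theta> n (\<lambda>\<omega>. \<phi> (\<lambda>k. \<omega> k i) * cav_prod N i pr I \<omega>) - site_av n \<phi> * nu N n (ovl_prod N pr I)"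
      if "i < N" for N i \<theta>
      unfolding cav_prod_zero_factor[OF that \<phi>] by (simp add: algebra_simps)
  qed
qed

text \<open>Since the first factor is centred, this is the covariance of two pair products at the
  decoupled site. It is the coefficient of both the force terms and the source terms of the cavity
  equation.\<close>

definition corr :: "nat \<Rightarrow> nat \<Rightarrow> nat \<Rightarrow> nat \<Rightarrow> nat \<Rightarrow> real" where
  "corr n k l a b = site_av n (\<lambda>s. (s k * s l - centre k l) * (s a * s b))"

lemma depends_below_corr:
  "k < n \<Longrightarrow> l < n \<Longrightarrow> a < n \<Longrightarrow> b < n \<Longrightarrow>
    depends_below n (\<lambda>s :: nat \<Rightarrow> real. (s k * s l - centre k l) * (s a * s b))"
  by (rule depends_belowI) simp

text \<open>\<open>ovl N k l\<close> is replaced by an average over sites of centred spin products.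
  Expanding the other factors around the site separates three terms: the cavity product, turned into
  a force by the mean value theorem; the first-order corrections, which give the sum over removed
  factors; and a remainder of order 1 / N, still small after multiplication by sqrt N.\<close>

theorem cavity_equation:
  assumes k: "k < n" "l < n" and I: "replicas_below n pr I"
  shows "vanishing (\<lambda>N. nu N (Suc (Suc n)) (\<lambda>\<omega>. ovl N k l \<omega> * ovl_prod N pr I \<omega>)
    - \<beta>\<^sup>2 / 2 * (\<Sum>a<Suc n. \<Sum>b<Suc (Suc n). alt_coeff n a * alt_coeff (Suc n) b *
        (corr (Suc (Suc n)) k l a b * nu N (Suc (Suc n)) (\<lambda>\<omega>. ovl N a b \<omega> * ovl_prod N pr I \<omega>)))
    - (\<Sum>j\<in>I. corr (Suc (Suc n)) k l (fst (pr j)) (snd (pr j)) * nu N (Suc (Suc n)) (ovl_prod N pr (I - {j}))))"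
proof -
  let ?n = "Suc (Suc n)"
  let ?f = "\<lambda>s :: nat \<Rightarrow> real. s k * s l - centre k l"
  define L where "L N = \<beta>\<^sup>2 / 2 * (\<Sum>a<Suc n. \<Sum>b<Suc (Suc n). alt_coeff n a * alt_coeff (Suc n) b *
        (corr ?n k l a b * nu N ?n (\<lambda>\<omega>. ovl N a b \<omega> * ovl_prod N pr I \<omega>)))" for N
  define Q where "Q N = (\<Sum>j\<in>I. corr ?n k l (fst (pr j)) (snd (pr j)) * nu N ?n (ovl_prod N pr (I - {j})))" for N
  have fI: "finite I" using I by (simp add: replicas_below_def)
  have I': "replicas_below ?n pr I" by (rule replicas_below_mono[OF I]) simp
  have k': "k < ?n" "l < ?n" using k by auto
  \<comment> \<open>A spare index for the overlap that the force adds to the product.\<close>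
  obtain j0 where j0: "j0 \<notin> I" using ex_new_if_finite[OF infinite_UNIV_nat fI] by blast
  have force_term: "vanishing_path (\<lambda>N i \<theta>. cnu N i \<theta> ?n (\<lambda>\<omega>. (?f (\<lambda>k. \<omega> k i) * cav_prod N i pr I \<omega>) * force N i n \<omega>) - L N)"
  proof -
    have summand: "vanishing_path (\<lambda>N i \<theta>. cnu N i \<theta> ?n (\<lambda>\<omega>. (?f (\<lambda>k. \<omega> k i) * (\<omega> a i * \<omega> b i)) * (cav N i a b \<omega> * cav_prod N i pr I \<omega>))
      - corr ?n k l a b * nu N ?n (\<lambda>\<omega>. ovl N a b \<omega> * ovl_prod N pr I \<omega>))" if ab: "a < ?n" "b < ?n" for a b
    proof -
      let ?pr = "pr(j0 := (a, b))"
      have "replicas_below ?n ?pr (insert j0 I)" using I' ab by (auto simp: replicas_below_def)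
      from cavity_factorization[OF depends_below_corr[OF k' ab] this]
      have "vanishing_path (\<lambda>N i \<theta>. cnu N i \<theta> ?n (\<lambda>\<omega>. ?f (\<lambda>k. \<omega> k i) * (\<omega> a i * \<omega> b i) * cav_prod N i ?pr (insert j0 I) \<omega>)
        - corr ?n k l a b * nu N ?n (ovl_prod N ?pr (insert j0 I)))" unfolding corr_def .
      moreover have "cav_prod N i ?pr (insert j0 I) = (\<lambda>\<omega>. cav N i a b \<omega> * cav_prod N i pr I \<omega>)" for N i
      proof
        fix \<omega>
        have "(\<Prod>j\<in>I. cav N i (fst (?pr j)) (snd (?pr j)) \<omega>) = cav_prod N i pr I \<omega>"
          unfolding cav_prod_def using j0 by (intro prod.cong) auto
        then show "cav_prod N i ?pr (insert j0 I) \<omega> = cav N i a b \<omega> * cav_prod N i pr I \<omega>"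
          unfolding cav_prod_def[of N i ?pr] using fI j0 by simp
      qed
      moreover have "ovl_prod N ?pr (insert j0 I) = (\<lambda>\<omega>. ovl N a b \<omega> * ovl_prod N pr I \<omega>)" for N
      proof
        fix \<omega>
        have "(\<Prod>j\<in>I. ovl N (fst (?pr j)) (snd (?pr j)) \<omega>) = ovl_prod N pr I \<omega>"
          unfolding ovl_prod_def using j0 by (intro prod.cong) auto
        then show "ovl_prod N ?pr (insert j0 I) \<omega> = ovl N a b \<omega> * ovl_prod N pr I \<omega>"
          unfolding ovl_prod_def[of N ?pr] using fI j0 by simp
      qed
      ultimately show ?thesis by simp
    qed
    have "vanishing_path (\<lambda>N i \<theta>. \<beta>\<^sup>2 / 2 * (\<Sum>a<Suc n. \<Sum>b<Suc (Suc n). alt_coeff n a * alt_coeff (Suc n) b *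
      (cnu N i \<theta> ?n (\<lambda>\<omega>. (?f (\<lambda>k. \<omega> k i) * (\<omega> a i * \<omega> b i)) * (cav N i a b \<omega> * cav_prod N i pr I \<omega>))
      - corr ?n k l a b * nu N ?n (\<lambda>\<omega>. ovl N a b \<omega> * ovl_prod N pr I \<omega>))))" (is "vanishing_path ?F")
      by (intro vanishing_path_cmult vanishing_path_sum summand) auto
    then show ?thesis
    proof (rule vanishing_path_cong)
      fix N i :: nat and \<theta> :: real
      assume i: "i < N"
      show "?F N i \<theta> = cnu N i \<theta> ?n (\<lambda>\<omega>. (?f (\<lambda>k. \<omega> k i) * cav_prod N i pr I \<omega>) * force N i n \<omega>) - L N"
      proof -
      have "(?f (\<lambda>k. \<omega> k i) * cav_prod N i pr I \<omega>) * force N i n \<omega> = \<beta>\<^sup>2 / 2 * (\<Sum>a<Suc n. \<Sum>b<Suc (Suc n).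
        alt_coeff n a * alt_coeff (Suc n) b * ((?f (\<lambda>k. \<omega> k i) * (\<omega> a i * \<omega> b i)) * (cav N i a b \<omega> * cav_prod N i pr I \<omega>)))" for \<omega>
        unfolding force_def mult.left_commute[of _ "\<beta>\<^sup>2 / 2"] sum_distrib_left by (intro sum.cong refl) (simp only: mult_ac)
      then have "cnu N i \<theta> ?n (\<lambda>\<omega>. (?f (\<lambda>k. \<omega> k i) * cav_prod N i pr I \<omega>) * force N i n \<omega>)
        = \<beta>\<^sup>2 / 2 * (\<Sum>a<Suc n. \<Sum>b<Suc (Suc n). alt_coeff n a * alt_coeff (Suc n) b *
          cnu N i \<theta> ?n (\<lambda>\<omega>. (?f (\<lambda>k. \<omega> k i) * (\<omega> a i * \<omega> b i)) * (cav N i a b \<omega> * cav_prod N i pr I \<omega>)))"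
        by (simp only: cnu_cmult[OF i] cnu_sum[OF i])
      then show ?thesis unfolding L_def by (simp only: right_diff_distrib sum_subtractf)
      qed
    qed
  qed
  have source_term: "vanishing_path (\<lambda>N i \<theta>. (\<Sum>j\<in>I. cnu N i \<theta> ?n (\<lambda>\<omega>. ?f (\<lambda>k. \<omega> k i) * (\<omega> (fst (pr j)) i * \<omega> (snd (pr j)) i) * cav_prod N i pr (I - {j}) \<omega>)
      - corr ?n k l (fst (pr j)) (snd (pr j)) * nu N ?n (ovl_prod N pr (I - {j}))))"
  proof (rule vanishing_path_sum)
    fix j assume j: "j \<in> I"
    then have ab: "fst (pr j) < ?n" "snd (pr j) < ?n" and "replicas_below ?n pr (I - {j})"
      using I' by (auto simp: replicas_below_def)
    from cavity_factorization[OF depends_below_corr[OF k' ab] this(3)]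
    show "vanishing_path (\<lambda>N i \<theta>. cnu N i \<theta> ?n (\<lambda>\<omega>. ?f (\<lambda>k. \<omega> k i) * (\<omega> (fst (pr j)) i * \<omega> (snd (pr j)) i) * cav_prod N i pr (I - {j}) \<omega>)
      - corr ?n k l (fst (pr j)) (snd (pr j)) * nu N ?n (ovl_prod N pr (I - {j})))"
      unfolding corr_def .
  qed
  obtain C1 where C1: "\<forall>N i \<theta>. i < N \<longrightarrow> 0 \<le> \<theta> \<longrightarrow> \<theta> \<le> pi / 2 \<longrightarrow>
    \<bar>cnu N i \<theta> ?n (\<lambda>\<omega>. (?f (\<lambda>k. \<omega> k i) * cav_prod N i pr I \<omega>) * force N i n \<omega>) - L N\<bar> \<le> C1 / sqrt (real N)"
    using force_term unfolding vanishing_path_def by blast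
  obtain C2 where C2: "\<forall>N i \<theta>. i < N \<longrightarrow> 0 \<le> \<theta> \<longrightarrow> \<theta> \<le> pi / 2 \<longrightarrow>
    \<bar>\<Sum>j\<in>I. cnu N i \<theta> ?n (\<lambda>\<omega>. ?f (\<lambda>k. \<omega> k i) * (\<omega> (fst (pr j)) i * \<omega> (snd (pr j)) i) * cav_prod N i pr (I - {j}) \<omega>)
      - corr ?n k l (fst (pr j)) (snd (pr j)) * nu N ?n (ovl_prod N pr (I - {j}))\<bar> \<le> C2 / sqrt (real N)"
    using source_term unfolding vanishing_path_def by blast
  obtain c where c: "c \<ge> 0" "\<forall>N i \<omega>. i < N \<longrightarrow> \<omega> \<in> PiE {..<?n} (\<lambda>_. configs \<S> N) \<longrightarrow>
    \<bar>ovl_prod N pr I \<omega> - cav_prod N i pr I \<omega> - 1 / sqrt (real N) *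
      (\<Sum>j\<in>I. \<omega> (fst (pr j)) i * \<omega> (snd (pr j)) i * cav_prod N i pr (I - {j}) \<omega>)\<bar>
    \<le> 1 / real N * (c * cav_size N i ?n \<omega> ^ card I)" using ovl_prod_expansion[OF I'] by blast
  obtain C3 where C3: "C3 \<ge> 0" "\<forall>N i \<theta>. i < N \<longrightarrow> 0 \<le> \<theta> \<longrightarrow> \<theta> \<le> pi / 2 \<longrightarrow>
    cnu N i \<theta> ?n (\<lambda>\<omega>. cav_size N i ?n \<omega> ^ card I) \<le> C3"
    using cav_size_moment by blast
  let ?C = "C1 + C2 + 2 * (real \<S>)\<^sup>2 * (c * C3)"
  have "\<bar>nu N ?n (\<lambda>\<omega>. ovl N k l \<omega> * ovl_prod N pr I \<omega>) - L N - Q N\<bar> \<le> ?C / sqrt (real N)" if N: "0 < N" for N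
  proof -
    let ?r = "sqrt (real N)"
    have r: "0 < ?r" "?r * ?r = real N" using N by auto
    have site: "\<bar>?r * nu N ?n (\<lambda>\<omega>. ?f (\<lambda>k. \<omega> k i) * ovl_prod N pr I \<omega>) - (L N + Q N)\<bar> \<le> ?C / ?r" if i: "i < N" for i
    proof -
      let ?R = "\<lambda>\<omega>. ovl_prod N pr I \<omega> - cav_prod N i pr I \<omega> - 1 / ?r *
        (\<Sum>j\<in>I. \<omega> (fst (pr j)) i * \<omega> (snd (pr j)) i * cav_prod N i pr (I - {j}) \<omega>)"
      let ?P = "\<lambda>j \<omega>. ?f (\<lambda>k. \<omega> k i) * (\<omega> (fst (pr j)) i * \<omega> (snd (pr j)) i) * cav_prod N i pr (I - {j}) \<omega>"
      have split: "?f (\<lambda>k. \<omega> k i) * ovl_prod N pr I \<omega>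
        = ?f (\<lambda>k. \<omega> k i) * cav_prod N i pr I \<omega> + 1 / ?r * (\<Sum>j\<in>I. ?P j \<omega>) + ?f (\<lambda>k. \<omega> k i) * ?R \<omega>" for \<omega>
      proof -
        have "(\<Sum>j\<in>I. ?P j \<omega>) = ?f (\<lambda>k. \<omega> k i) * (\<Sum>j\<in>I. \<omega> (fst (pr j)) i * \<omega> (snd (pr j)) i * cav_prod N i pr (I - {j}) \<omega>)"
          unfolding sum_distrib_left by (intro sum.cong refl) (simp only: mult.assoc)
        moreover have "f * p = f * c + r * (f * S) + f * (p - c - r * S)" for f p c r S :: real
          by (simp add: algebra_simps)
        ultimately show ?thesis by (simp only:)
      qed
      have T1: "\<exists>\<theta>. 0 \<le> \<theta> \<and> \<theta> \<le> pi / 2 \<and> ?r * nu N ?n (\<lambda>\<omega>. ?f (\<lambda>k. \<omega> k i) * cav_prod N i pr I \<omega>)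
        = cnu N i \<theta> ?n (\<lambda>\<omega>. (?f (\<lambda>k. \<omega> k i) * cav_prod N i pr I \<omega>) * force N i n \<omega>)"
      proof -
        have depf: "depends_below n ?f" by (rule depends_belowI) (use k in simp)
        have dep: "depends_below n (\<lambda>\<omega>. ?f (\<lambda>k. \<omega> k i) * cav_prod N i pr I \<omega>)"
          by (rule depends_below_mult[OF depends_below_spin[OF depf] depends_below_cav_prod[OF I]])
        have z: "cnu N i 0 n (\<lambda>\<omega>. ?f (\<lambda>k. \<omega> k i) * cav_prod N i pr I \<omega>) = 0"
          unfolding cav_prod_zero_factor[OF i depf] site_av_pair[OF k] by simp
        \<comment> \<open>Only \<open>n\<close> replicas occur in the function, so the average is
          first cut down to \<open>n\<close>; the force then brings the number back to exactly
          \<open>?n\<close>.\<close>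
        have "nu N ?n (\<lambda>\<omega>. ?f (\<lambda>k. \<omega> k i) * cav_prod N i pr I \<omega>) = cnu N i (pi / 2) n (\<lambda>\<omega>. ?f (\<lambda>k. \<omega> k i) * cav_prod N i pr I \<omega>)"
          unfolding cnu_half_pi[OF i] by (rule nu_extend[OF N dep]) simp
        then show ?thesis using cnu_mvt[OF i dep] unfolding z diff_zero by simp
      qed
      then obtain \<theta> where t: "0 \<le> \<theta>" "\<theta> \<le> pi / 2" and e: "?r * nu N ?n (\<lambda>\<omega>. ?f (\<lambda>k. \<omega> k i) * cav_prod N i pr I \<omega>)
        = cnu N i \<theta> ?n (\<lambda>\<omega>. (?f (\<lambda>k. \<omega> k i) * cav_prod N i pr I \<omega>) * force N i n \<omega>)" by blast
      have E1: "\<bar>?r * nu N ?n (\<lambda>\<omega>. ?f (\<lambda>k. \<omega> k i) * cav_prod N i pr I \<omega>) - L N\<bar> \<le> C1 / ?r"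
        unfolding e by (rule C1[rule_format, OF i t])
      have E2: "\<bar>(\<Sum>j\<in>I. nu N ?n (?P j)) - Q N\<bar> \<le> C2 / ?r"
        using C2[rule_format, OF i, of "pi / 2"] by (simp add: Q_def sum_subtractf cnu_half_pi[OF i])
      have E3: "\<bar>?r * nu N ?n (\<lambda>\<omega>. ?f (\<lambda>k. \<omega> k i) * ?R \<omega>)\<bar> \<le> 2 * (real \<S>)\<^sup>2 * (c * C3) / ?r"
      proof -
        have "\<bar>?r * nu N ?n (\<lambda>\<omega>. ?f (\<lambda>k. \<omega> k i) * ?R \<omega>)\<bar> \<le> nu N ?n (\<lambda>\<omega>. \<bar>?r * (?f (\<lambda>k. \<omega> k i) * ?R \<omega>)\<bar>)"
          unfolding nu_cmult[OF N, symmetric] by (rule nu_abs[OF N])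
        also have "\<dots> \<le> nu N ?n (\<lambda>\<omega>. 1 / ?r * (2 * (real \<S>)\<^sup>2 * (c * cav_size N i ?n \<omega> ^ card I)))"
        proof (rule nu_mono[OF N])
          fix \<omega> :: "nat \<Rightarrow> nat \<Rightarrow> real" assume w: "\<omega> \<in> PiE {..<?n} (\<lambda>_. configs \<S> N)"
          have "?r * (\<bar>?f (\<lambda>k. \<omega> k i)\<bar> * \<bar>?R \<omega>\<bar>) \<le> ?r * ((2 * (real \<S>)\<^sup>2) * (1 / real N * (c * cav_size N i ?n \<omega> ^ card I)))"
            using c(2) i w by (intro mult_left_mono mult_mono centred_pair_bound[OF w k' i]) auto
          also have "\<dots> = 1 / ?r * (2 * (real \<S>)\<^sup>2 * (c * cav_size N i ?n \<omega> ^ card I))"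
          proof -
            have inv: "?r * (1 / real N) = 1 / ?r" using r by (simp add: field_simps)
            show ?thesis unfolding inv[symmetric] by (simp only: mult_ac)
          qed
          finally show "\<bar>?r * (?f (\<lambda>k. \<omega> k i) * ?R \<omega>)\<bar> \<le> 1 / ?r * (2 * (real \<S>)\<^sup>2 * (c * cav_size N i ?n \<omega> ^ card I))"
            using r(1) by (simp only: abs_mult abs_of_pos)
        qed
        also have "\<dots> = 1 / ?r * (2 * (real \<S>)\<^sup>2 * (c * nu N ?n (\<lambda>\<omega>. cav_size N i ?n \<omega> ^ card I)))"
          by (simp only: nu_cmult[OF N])
        also have "\<dots> \<le> 1 / ?r * (2 * (real \<S>)\<^sup>2 * (c * C3))"
          using C3(2)[rule_format, OF i, of "pi / 2"] c(1)
          by (intro mult_left_mono) (auto simp: cnu_half_pi[OF i])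
        finally show ?thesis by simp
      qed
      have "?r * nu N ?n (\<lambda>\<omega>. ?f (\<lambda>k. \<omega> k i) * ovl_prod N pr I \<omega>)
        = ?r * nu N ?n (\<lambda>\<omega>. ?f (\<lambda>k. \<omega> k i) * cav_prod N i pr I \<omega>) + (\<Sum>j\<in>I. nu N ?n (?P j))
          + ?r * nu N ?n (\<lambda>\<omega>. ?f (\<lambda>k. \<omega> k i) * ?R \<omega>)"
      proof -
        have "nu N ?n (\<lambda>\<omega>. ?f (\<lambda>k. \<omega> k i) * ovl_prod N pr I \<omega>)
          = nu N ?n (\<lambda>\<omega>. ?f (\<lambda>k. \<omega> k i) * cav_prod N i pr I \<omega>) + 1 / ?r * (\<Sum>j\<in>I. nu N ?n (?P j))
            + nu N ?n (\<lambda>\<omega>. ?f (\<lambda>k. \<omega> k i) * ?R \<omega>)"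
          unfolding split by (simp only: nu_add[OF N] nu_cmult[OF N] nu_sum[OF N])
        moreover have "?r * (1 / ?r * x) = x" for x using r(1) by simp
        ultimately show ?thesis by (simp only: distrib_left)
      qed
      moreover have "?C / ?r = C1 / ?r + C2 / ?r + 2 * (real \<S>)\<^sup>2 * (c * C3) / ?r" by (simp only: add_divide_distrib)
      ultimately show ?thesis using E1 E2 E3 by linarith
    qed
    have ovl_sum: "ovl N k l \<omega> = 1 / ?r * (\<Sum>i<N. ?f (\<lambda>k. \<omega> k i))" for \<omega>
    proof -
      have "s * (X / (s * s) - c) = 1 / s * (X - s * s * c)" if "0 < s" for s X c :: real
        using that by (simp add: field_simps)
      from this[OF r(1)] show ?thesis
        unfolding r(2) by (simp add: ovl_def overlap_def sum_subtractf)
    qed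
    have inv: "1 / ?r = 1 / real N * ?r" using r by (auto simp: divide_simps)
    have av: "nu N ?n (\<lambda>\<omega>. ovl N k l \<omega> * ovl_prod N pr I \<omega>)
      = 1 / real N * (\<Sum>i<N. ?r * nu N ?n (\<lambda>\<omega>. ?f (\<lambda>k. \<omega> k i) * ovl_prod N pr I \<omega>))"
      unfolding ovl_sum mult.assoc sum_distrib_right
      unfolding nu_cmult[OF N] nu_sum[OF N] unfolding inv sum_distrib_left[symmetric] by (simp only: mult.assoc)
    have "nu N ?n (\<lambda>\<omega>. ovl N k l \<omega> * ovl_prod N pr I \<omega>) - (L N + Q N) = 1 / real N * (\<Sum>i<N. ?r * nu N ?n (\<lambda>\<omega>. ?f (\<lambda>k. \<omega> k i) * ovl_prod N pr I \<omega>) - (L N + Q N))"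
      unfolding av sum_subtractf using N by (simp add: right_diff_distrib)
    moreover have "\<bar>1 / real N * (\<Sum>i<N. ?r * nu N ?n (\<lambda>\<omega>. ?f (\<lambda>k. \<omega> k i) * ovl_prod N pr I \<omega>) - (L N + Q N))\<bar>
      \<le> 1 / real N * (\<Sum>i<N. ?C / ?r)"
    proof -
      have "\<bar>\<Sum>i<N. ?r * nu N ?n (\<lambda>\<omega>. ?f (\<lambda>k. \<omega> k i) * ovl_prod N pr I \<omega>) - (L N + Q N)\<bar> \<le> (\<Sum>i<N. ?C / ?r)"
        by (rule order_trans[OF sum_abs sum_mono], rule site) simp
      moreover have "\<bar>1 / real N * x\<bar> \<le> 1 / real N * y" if "\<bar>x\<bar> \<le> y" for x y
        using mult_left_mono[OF that, of "1 / real N"] by (simp add: abs_mult)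
      ultimately show ?thesis by blast
    qed
    moreover have "1 / real N * (\<Sum>i<N. ?C / ?r) = ?C / ?r" using N by simp
    ultimately show ?thesis by (simp only: diff_diff_eq)
  qed
  then show ?thesis unfolding vanishing_def L_def Q_def by blast
qed

end

section \<open>The linear system satisfied by overlap moments\<close>

text \<open>Covariance of \<open>s k * s l\<close> with \<open>s i * s j\<close> for spins that are independent given the field;
  \<open>F, G, E, D, I3, I5, K4\<close> are the constants of the paper.\<close>
definition pair_corr :: "real \<Rightarrow> real \<Rightarrow> real \<Rightarrow> real \<Rightarrow> real \<Rightarrow> real \<Rightarrow> real \<Rightarrow> nat \<Rightarrow> nat \<Rightarrow> nat \<Rightarrow> nat \<Rightarrow> real" where
  "pair_corr F G E D I3 I5 K4 k l i j = (if k = l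
    then I5 + E * of_bool (i = k) + E * of_bool (j = k)
      + (K4 - I5) * of_bool (i = j) + (D - 2 * E) * (of_bool (i = j) * of_bool (i = k))
    else I3 + G * of_bool (i = k) + G * of_bool (i = l) + G * of_bool (j = k) + G * of_bool (j = l)
      + (F - G) * (of_bool (i = k) * of_bool (j = l)) + (F - G) * (of_bool (i = l) * of_bool (j = k))
      + (I5 - I3) * of_bool (i = j) + (E - 2 * G) * (of_bool (i = j) * of_bool (i = k))
      + (E - 2 * G) * (of_bool (i = j) * of_bool (i = l)))"

text \<open>\<open>x i j\<close> stands for the moment of \<open>R i j - Q i j\<close> times a product of overlaps of the replicas below \<open>n0\<close>;
  the replicas from \<open>n0\<close> on are fresh, hence exchangeable.\<close>
locale cavity_system =
  fixes n0 :: nat and x :: "nat \<Rightarrow> nat \<Rightarrow> real" and z :: "nat \<Rightarrow> real" and X Y :: real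
    and b F G E D I3 I5 K4 :: real and J :: "nat set" and pr :: "nat \<Rightarrow> nat \<times> nat" and W :: "nat \<Rightarrow> real"
  assumes sym: "\<And>i j. x i j = x j i"
    and old_fresh: "\<And>i f. i < n0 \<Longrightarrow> n0 \<le> f \<Longrightarrow> f < n0 + 4 \<Longrightarrow> x i f = z i"
    and fresh_fresh: "\<And>f g. n0 \<le> f \<Longrightarrow> f < n0 + 4 \<Longrightarrow> n0 \<le> g \<Longrightarrow> g < n0 + 4 \<Longrightarrow> f \<noteq> g \<Longrightarrow> x f g = X"
    and fresh_diag: "\<And>f. n0 \<le> f \<Longrightarrow> f < n0 + 4 \<Longrightarrow> x f f = Y"
    and finJ: "finite J" and prJ: "\<And>j. j \<in> J \<Longrightarrow> fst (pr j) < n0 \<and> snd (pr j) < n0"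
begin

text \<open>Two fresh replicas, \<open>u\<close> and \<open>v\<close> below, are available on the
  left of the cavity equations; the force adds two more, whence the range up to
  \<open>n0 + 4\<close> in the locale.\<close>

abbreviation "n \<equiv> n0 + 2"

abbreviation "C \<equiv> pair_corr F G E D I3 I5 K4"

text \<open>The double sum of the cavity equation as a linear functional of its coefficients.
  Writing \<open>pair_corr\<close> with indicators reduces it to rows, columns, single entries and
  the diagonal of \<open>x\<close>.\<close>

definition dsum :: "(nat \<Rightarrow> nat \<Rightarrow> real) \<Rightarrow> real" where
  "dsum f = (\<Sum>i<Suc n. \<Sum>j<Suc (Suc n). alt_coeff n i * alt_coeff (Suc n) j * (f i j * x i j))"

lemma dsum_add: "dsum (\<lambda>i j. f i j + g i j) = dsum f + dsum g"
  by (simp only: dsum_def distrib_right distrib_left sum.distrib)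

lemma dsum_cmult: "dsum (\<lambda>i j. c * f i j) = c * dsum f"
  by (simp only: dsum_def sum_distrib_left mult_ac)

lemma dsum_const: "dsum (\<lambda>i j. c) = c * dsum (\<lambda>i j. 1)"
  using dsum_cmult[of c "\<lambda>i j. 1"] by simp

definition row :: "nat \<Rightarrow> real" where "row k = (\<Sum>j<Suc (Suc n). alt_coeff (Suc n) j * x k j)"

lemma dsum_left: assumes "k < n" shows "dsum (\<lambda>i j. of_bool (i = k)) = row k"
proof -
  have "dsum (\<lambda>i j. of_bool (i = k)) = (\<Sum>i<Suc n. if i = k then alt_coeff n k * row k else 0)"
    unfolding dsum_def row_def sum_distrib_left by (intro sum.cong refl) (auto simp: mult_ac)
  then show ?thesis using assms by (simp add: sum.delta alt_coeff_def)
qed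

lemma dsum_right: assumes "k < n" shows "dsum (\<lambda>i j. of_bool (j = k)) = (\<Sum>i<Suc n. alt_coeff n i * x i k)"
proof -
  have "(\<Sum>j<Suc (Suc n). alt_coeff n i * alt_coeff (Suc n) j * (of_bool (j = k) * x i j))
    = (\<Sum>j<Suc (Suc n). if j = k then alt_coeff n i * alt_coeff (Suc n) k * x i k else 0)" for i
    by (intro sum.cong refl) auto
  also have "\<dots> i = alt_coeff n i * x i k" for i
    using assms by (simp add: sum.delta alt_coeff_def del: sum.lessThan_Suc)
  finally show ?thesis unfolding dsum_def by simp
qed

lemma dsum_point:
  assumes "k < n" "l < n" shows "dsum (\<lambda>i j. of_bool (i = k) * of_bool (j = l)) = x k l"
proof -
  have "(\<Sum>j<Suc (Suc n). alt_coeff n i * alt_coeff (Suc n) j * (of_bool (i = k) * of_bool (j = l) * x i j))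
    = (\<Sum>j<Suc (Suc n). if j = l then of_bool (i = k) * (alt_coeff n i * alt_coeff (Suc n) l * x i l) else 0)" for i
    by (intro sum.cong refl) auto
  also have "\<dots> i = (if i = k then alt_coeff n k * x k l else 0)" for i
    using assms by (simp add: sum.delta alt_coeff_def del: sum.lessThan_Suc)
  finally show ?thesis unfolding dsum_def using assms
    by (simp add: sum.delta alt_coeff_def del: sum.lessThan_Suc)
qed

lemma dsum_diag: "dsum (\<lambda>i j. of_bool (i = j)) = (\<Sum>i<Suc n. alt_coeff n i * x i i)"
  unfolding dsum_def
proof (rule sum.cong[OF refl])
  fix i assume i: "i \<in> {..<Suc n}"
  have "(\<Sum>j<Suc (Suc n). alt_coeff n i * alt_coeff (Suc n) j * (of_bool (i = j) * x i j))
    = (\<Sum>j<Suc (Suc n). if j = i then alt_coeff n i * alt_coeff (Suc n) i * x i i else 0)"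
    by (intro sum.cong refl) auto
  then show "(\<Sum>j<Suc (Suc n). alt_coeff n i * alt_coeff (Suc n) j * (of_bool (i = j) * x i j)) = alt_coeff n i * x i i"
    using i by (simp add: sum.delta alt_coeff_def del: sum.lessThan_Suc)
qed

lemma dsum_diag_point: assumes "k < n" shows "dsum (\<lambda>i j. of_bool (i = j) * of_bool (i = k)) = x k k"
proof -
  have "(\<lambda>i j. of_bool (i = j) * of_bool (i = k) :: real) = (\<lambda>i j. of_bool (i = k) * of_bool (j = k))"
    by (intro ext) auto
  then show ?thesis using dsum_point[OF assms assms] by (simp only:)
qed

text \<open>In the decomposition \<open>T k l + T k + T l + T\<close>, \<open>S k + S\<close> of the overlaps, \<open>O1 k\<close> sums the moments involving
  \<open>T k l\<close> over \<open>l\<close>, while \<open>t k\<close>, \<open>s k\<close>, \<open>X\<close>, \<open>Y\<close> belong to \<open>T k\<close>, \<open>S k\<close>, \<open>T\<close>, \<open>S\<close>.\<close>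
definition "Zs = (\<Sum>k<n0. z k)"
definition "\<rho> = Zs + Y - (real n0 + 1) * X"
definition "t k = z k - X"
definition "s k = x k k - Y"
definition "O1 k = (\<Sum>l<n0. x k l - z k - z l + X) - (x k k - 2 * z k + X)"
definition "\<tau> = (\<Sum>k<n0. t k)"
definition "\<sigma> = (\<Sum>k<n0. s k)"
definition "O2 = (\<Sum>k<n0. O1 k)"

lemma row_old: assumes "k < n0" shows "row k = \<rho> + O1 k + s k - 2 * t k"
proof -
  have "row k = (\<Sum>j<n0. x k j) - real n0 * z k"
    unfolding row_def using assms old_fresh[of k]
    by (simp add: numeral_2_eq_2 alt_coeff_def algebra_simps)
  moreover have "O1 k = (\<Sum>j<n0. x k j) - real n0 * z k - Zs + real n0 * X - (x k k - 2 * z k + X)"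
    by (simp add: O1_def Zs_def sum.distrib sum_subtractf)
  ultimately show ?thesis by (simp add: \<rho>_def s_def t_def algebra_simps)
qed

lemma row_fresh: assumes "n0 \<le> f" "f < n0 + 3" shows "row f = \<rho>"
proof -
  have old: "(\<Sum>j<n0. alt_coeff (Suc n) j * x f j) = Zs"
    unfolding Zs_def using assms old_fresh[of _ f] sym[of f] by (intro sum.cong) (auto simp: alt_coeff_def)
  have "row f = Zs + x f n0 + x f (Suc n0) + x f (Suc (Suc n0)) - (real n0 + 3) * x f (Suc (Suc (Suc n0)))"
    unfolding row_def numeral_2_eq_2 using old by (simp add: alt_coeff_def numeral_2_eq_2 algebra_simps)
  moreover have "f = n0 \<or> f = Suc n0 \<or> f = Suc (Suc n0)" using assms by auto
  ultimately show ?thesis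
    using fresh_fresh[of f n0] fresh_fresh[of f "Suc n0"] fresh_fresh[of f "Suc (Suc n0)"] fresh_fresh[of f "Suc (Suc (Suc n0))"]
      fresh_diag[of f] by (auto simp: \<rho>_def algebra_simps)
qed

text \<open>A column has one entry fewer than a row, but the last two fresh replicas have equal
  entries, and the weight - (n0 + 2) equals 1 - (n0 + 3).\<close>

lemma col_eq_row: assumes "k < n" shows "(\<Sum>i<Suc n. alt_coeff n i * x i k) = row k"
proof -
  have eq: "x k (Suc (Suc n0)) = x k (Suc (Suc (Suc n0)))"
  proof (cases "k < n0")
    case True then show ?thesis using old_fresh[of k] by simp
  next
    case False then show ?thesis using fresh_fresh[of k] assms by simp
  qed
  have "(\<Sum>i<n0. alt_coeff n i * x i k) = (\<Sum>i<n0. alt_coeff (Suc n) i * x k i)"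
    using sym by (intro sum.cong) (auto simp: alt_coeff_def)
  then show ?thesis unfolding row_def numeral_2_eq_2
    using eq sym[of k n0] sym[of k "Suc n0"] sym[of k "Suc (Suc n0)"]
    by (simp add: alt_coeff_def numeral_2_eq_2 algebra_simps)
qed

text \<open>The outer coefficients add up to 0, so the part \<rho> common to all rows
  cancels.\<close>

lemma dsum_one: "dsum (\<lambda>i j. 1) = O2 + \<sigma> - 2 * \<tau>"
proof -
  have "dsum (\<lambda>i j. 1) = (\<Sum>i<Suc n. alt_coeff n i * row i)"
    unfolding dsum_def row_def sum_distrib_left by (simp only: mult_1 mult.assoc)
  also have "\<dots> = (\<Sum>k<n0. row k) + row n0 + row (Suc n0) - (real n0 + 2) * row (Suc (Suc n0))"
    by (simp add: alt_coeff_def numeral_2_eq_2 algebra_simps)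
  also have "\<dots> = (\<Sum>k<n0. \<rho> + O1 k + s k - 2 * t k) - real n0 * \<rho>"
    by (simp add: row_fresh row_old algebra_simps)
  also have "\<dots> = O2 + \<sigma> - 2 * \<tau>"
    by (simp add: O2_def \<sigma>_def \<tau>_def sum.distrib sum_subtractf sum_distrib_left)
  finally show ?thesis .
qed

lemma diag_sum: "(\<Sum>i<Suc n. alt_coeff n i * x i i) = \<sigma>"
proof -
  have "(\<Sum>i<Suc n. alt_coeff n i * x i i) = (\<Sum>k<n0. x k k) - real n0 * Y"
    using fresh_diag[of n0] fresh_diag[of "Suc n0"] fresh_diag[of "Suc (Suc n0)"]
    by (simp add: alt_coeff_def numeral_2_eq_2 algebra_simps)
  then show ?thesis by (simp add: \<sigma>_def s_def sum_subtractf)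
qed

lemma dsum_off:
  assumes "k < n" "l < n" "k \<noteq> l"
  shows "dsum (C k l) = I3 * (O2 + \<sigma> - 2 * \<tau>) + 2 * G * (row k + row l) + 2 * (F - G) * x k l
    + (I5 - I3) * \<sigma> + (E - 2 * G) * (x k k + x l l)"
proof -
  have "C k l = (\<lambda>i j. I3 + G * of_bool (i = k) + G * of_bool (i = l) + G * of_bool (j = k) + G * of_bool (j = l)
      + (F - G) * (of_bool (i = k) * of_bool (j = l)) + (F - G) * (of_bool (i = l) * of_bool (j = k))
      + (I5 - I3) * of_bool (i = j) + (E - 2 * G) * (of_bool (i = j) * of_bool (i = k))
      + (E - 2 * G) * (of_bool (i = j) * of_bool (i = l)))"
    using assms(3) by (intro ext) (simp add: pair_corr_def)
  then show ?thesis
    using assms sym[of l k]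
    by (simp only: dsum_add dsum_cmult dsum_const[of I3] dsum_left dsum_right dsum_point dsum_diag dsum_diag_point
        col_eq_row dsum_one diag_sum) (simp only: algebra_simps)
qed

lemma dsum_same:
  assumes "k < n"
  shows "dsum (C k k) = I5 * (O2 + \<sigma> - 2 * \<tau>) + 2 * E * row k + (K4 - I5) * \<sigma> + (D - 2 * E) * x k k"
proof -
  have "C k k = (\<lambda>i j. I5 + E * of_bool (i = k) + E * of_bool (j = k)
      + (K4 - I5) * of_bool (i = j) + (D - 2 * E) * (of_bool (i = j) * of_bool (i = k)))"
    by (intro ext) (simp add: pair_corr_def)
  then show ?thesis
    using assms
    by (simp only: dsum_add dsum_cmult dsum_const[of I5] dsum_left dsum_right dsum_diag dsum_diag_point
        col_eq_row dsum_one diag_sum)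
qed

definition "Q k l = (\<Sum>j\<in>J. C k l (fst (pr j)) (snd (pr j)) * W j)"
text \<open>\<open>W j\<close> stands for the moment with factor \<open>j\<close> removed; the
  removed factor is a proper overlap in \<open>WT\<close> and a self-overlap in
  \<open>WS\<close>.\<close>

definition "WT = (\<Sum>j\<in>J. of_bool (fst (pr j) \<noteq> snd (pr j)) * W j)"
definition "WS = (\<Sum>j\<in>J. of_bool (fst (pr j) = snd (pr j)) * W j)"
text \<open>The defect in the cavity equation for the pair (k, l). The identities below are exact in
  the defects, so their smallness can be inserted once, at the end.\<close>

definition "\<epsilon> k l = x k l - b / 2 * dsum (C k l) - Q k l"

abbreviation "u \<equiv> n0"
abbreviation "v \<equiv> Suc n0"

lemma fresh_vals: "x u v = X" "x u u = Y" "x v v = Y" "k < n0 \<Longrightarrow> x k u = z k" "k < n0 \<Longrightarrow> x u k = z k" "k < n0 \<Longrightarrow> x k v = z k"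
  using fresh_fresh[of u v] fresh_diag[of u] fresh_diag[of v] old_fresh[of k u] old_fresh[of k v] sym[of u k] by auto

text \<open>Subtracting the values with \<open>k\<close> or \<open>l\<close> replaced by a fresh
  replica isolates T_kl. In \<open>dsum\<close> as in the sources only the F - G terms of
  \<open>pair_corr\<close> survive, so this block is scalar.\<close>

lemma system_off_diag:
  assumes "k < n0" "l < n0" "k \<noteq> l"
  shows "\<epsilon> k l - \<epsilon> k v - \<epsilon> u l + \<epsilon> u v = (1 - b * (F - G)) * (x k l - z k - z l + X)
    - (F - G) * (\<Sum>j\<in>J. (of_bool (fst (pr j) = k) * of_bool (snd (pr j) = l) + of_bool (fst (pr j) = l) * of_bool (snd (pr j) = k)) * W j)"
proof -
  have "Q k l - Q k v - Q u l + Q u v = (F - G) * (\<Sum>j\<in>J. (of_bool (fst (pr j) = k) * of_bool (snd (pr j) = l)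
      + of_bool (fst (pr j) = l) * of_bool (snd (pr j) = k)) * W j)"
    unfolding Q_def sum_distrib_left sum_subtractf[symmetric] sum.distrib[symmetric]
  proof (rule sum.cong[OF refl])
    fix j assume "j \<in> J"
    then have "fst (pr j) < n0" "snd (pr j) < n0" using prJ by auto
    then show "C k l (fst (pr j)) (snd (pr j)) * W j - C k v (fst (pr j)) (snd (pr j)) * W j - C u l (fst (pr j)) (snd (pr j)) * W j
        + C u v (fst (pr j)) (snd (pr j)) * W j
      = (F - G) * ((of_bool (fst (pr j) = k) * of_bool (snd (pr j) = l) + of_bool (fst (pr j) = l) * of_bool (snd (pr j) = k)) * W j)"
      using assms unfolding pair_corr_def by (simp add: algebra_simps)
  qed
  moreover define R where "R = (\<Sum>j\<in>J. (of_bool (fst (pr j) = k) * of_bool (snd (pr j) = l)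
      + of_bool (fst (pr j) = l) * of_bool (snd (pr j) = k)) * W j)"
  ultimately have "Q k l = Q k v + Q u l - Q u v + (F - G) * R" by simp
  then show ?thesis
    unfolding \<epsilon>_def R_def[symmetric] using assms
    by (simp add: dsum_off fresh_vals row_fresh) (simp add: field_simps)
qed

text \<open>Replacing \<open>k\<close> by the fresh \<open>u\<close> isolates T_k. The terms with
  \<open>I3\<close> and \<open>I5\<close> cancel, \<open>E\<close> couples T_k to S_k, and
  \<open>G\<close> feeds in the block of T_kl through \<open>O1\<close>.\<close>

lemma system_T:
  assumes "k < n0"
  shows "\<epsilon> k v - \<epsilon> u v = t k - b / 2 * ((2 * F - 6 * G) * t k + E * s k + 2 * G * O1 k)
    - (\<Sum>j\<in>J. (G * (of_bool (fst (pr j) = k) + of_bool (snd (pr j) = k))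
        + (E - 2 * G) * (of_bool (fst (pr j) = snd (pr j)) * of_bool (fst (pr j) = k))) * W j)"
proof -
  have "Q k v - Q u v = (\<Sum>j\<in>J. (G * (of_bool (fst (pr j) = k) + of_bool (snd (pr j) = k))
        + (E - 2 * G) * (of_bool (fst (pr j) = snd (pr j)) * of_bool (fst (pr j) = k))) * W j)"
    unfolding Q_def sum_subtractf[symmetric]
  proof (rule sum.cong[OF refl])
    fix j assume "j \<in> J"
    then have "fst (pr j) < n0" "snd (pr j) < n0" using prJ by auto
    then show "C k v (fst (pr j)) (snd (pr j)) * W j - C u v (fst (pr j)) (snd (pr j)) * W j
      = (G * (of_bool (fst (pr j) = k) + of_bool (snd (pr j) = k))
        + (E - 2 * G) * (of_bool (fst (pr j) = snd (pr j)) * of_bool (fst (pr j) = k))) * W j"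
      using assms unfolding pair_corr_def by (simp add: algebra_simps)
  qed
  then show ?thesis
    unfolding \<epsilon>_def using assms
    by (simp add: dsum_off fresh_vals row_fresh row_old) (simp add: s_def t_def field_simps)
qed

lemma system_S:
  assumes "k < n0"
  shows "\<epsilon> k k - \<epsilon> u u = s k - b / 2 * (D * s k - 4 * E * t k + 2 * E * O1 k)
    - (\<Sum>j\<in>J. (E * (of_bool (fst (pr j) = k) + of_bool (snd (pr j) = k))
        + (D - 2 * E) * (of_bool (fst (pr j) = snd (pr j)) * of_bool (fst (pr j) = k))) * W j)"
proof -
  have "Q k k - Q u u = (\<Sum>j\<in>J. (E * (of_bool (fst (pr j) = k) + of_bool (snd (pr j) = k))
        + (D - 2 * E) * (of_bool (fst (pr j) = snd (pr j)) * of_bool (fst (pr j) = k))) * W j)"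
    unfolding Q_def sum_subtractf[symmetric]
  proof (rule sum.cong[OF refl])
    fix j assume "j \<in> J"
    then have "fst (pr j) < n0" "snd (pr j) < n0" using prJ by auto
    then show "C k k (fst (pr j)) (snd (pr j)) * W j - C u u (fst (pr j)) (snd (pr j)) * W j
      = (E * (of_bool (fst (pr j) = k) + of_bool (snd (pr j) = k))
        + (D - 2 * E) * (of_bool (fst (pr j) = snd (pr j)) * of_bool (fst (pr j) = k))) * W j"
      using assms unfolding pair_corr_def by (simp add: algebra_simps)
  qed
  then show ?thesis
    unfolding \<epsilon>_def using assms
    by (simp add: dsum_same fresh_vals row_fresh row_old) (simp add: s_def t_def field_simps)
qed

text \<open>Free \<open>G'\<close> and \<open>E'\<close> make one computation serve two equations:
  (G, E) for T_k and (E, D) for S_k.\<close>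

lemma source_sums:
  shows "(\<Sum>k<n0. \<Sum>j\<in>J. (G' * (of_bool (fst (pr j) = k) + of_bool (snd (pr j) = k))
        + (E' - 2 * G') * (of_bool (fst (pr j) = snd (pr j)) * of_bool (fst (pr j) = k))) * W j)
      = 2 * G' * WT + E' * WS"
proof -
  have "(\<Sum>k<n0. (G' * (of_bool (fst (pr j) = k) + of_bool (snd (pr j) = k))
        + (E' - 2 * G') * (of_bool (fst (pr j) = snd (pr j)) * of_bool (fst (pr j) = k))) * W j)
    = 2 * G' * (of_bool (fst (pr j) \<noteq> snd (pr j)) * W j) + E' * (of_bool (fst (pr j) = snd (pr j)) * W j)" if j: "j \<in> J" for j
  proof -
    have d: "(\<Sum>k<n0. of_bool (i = k) :: real) = 1" if "i < n0" for i
      using that by (simp add: of_bool_def sum.delta')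
    have "(\<Sum>k<n0. (G' * (of_bool (fst (pr j) = k) + of_bool (snd (pr j) = k))
        + (E' - 2 * G') * (of_bool (fst (pr j) = snd (pr j)) * of_bool (fst (pr j) = k))) * W j)
      = (G' * ((\<Sum>k<n0. of_bool (fst (pr j) = k)) + (\<Sum>k<n0. of_bool (snd (pr j) = k)))
        + (E' - 2 * G') * (of_bool (fst (pr j) = snd (pr j)) * (\<Sum>k<n0. of_bool (fst (pr j) = k)))) * W j"
      by (simp only: sum_distrib_left sum_distrib_right sum.distrib distrib_left distrib_right)
    then show ?thesis using prJ[OF j] by (simp add: d)
  qed
  then show ?thesis
    by (subst sum.swap) (simp add: WT_def WS_def sum.distrib sum_distrib_left)
qed

text \<open>The sum runs over ordered pairs of distinct labels, so a factor with distinct replicas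
  is met in both orders; this is the 2 in front of \<open>WT\<close>.\<close>

lemma system_1:
  "(\<Sum>k<n0. \<Sum>l\<in>{..<n0} - {k}. \<epsilon> k l - \<epsilon> k v - \<epsilon> u l + \<epsilon> u v) = (1 - b * (F - G)) * O2 - 2 * (F - G) * WT"
proof -
  have O1: "O1 k = (\<Sum>l\<in>{..<n0} - {k}. x k l - z k - z l + X)" if "k < n0" for k
    unfolding O1_def using that by (subst sum.remove[of _ k]) auto
  have WTs: "(\<Sum>k<n0. \<Sum>l\<in>{..<n0} - {k}. \<Sum>j\<in>J. (of_bool (fst (pr j) = k) * of_bool (snd (pr j) = l) + of_bool (fst (pr j) = l) * of_bool (snd (pr j) = k)) * W j)
    = 2 * WT"
  proof -
    have inner: "(\<Sum>l\<in>{..<n0} - {k}. (of_bool (fst (pr j) = k) * of_bool (snd (pr j) = l) + of_bool (fst (pr j) = l) * of_bool (snd (pr j) = k)) * W j)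
      = (of_bool (fst (pr j) = k) + of_bool (snd (pr j) = k)) * (of_bool (fst (pr j) \<noteq> snd (pr j)) * W j)" if j: "j \<in> J" and k: "k < n0" for j k
    proof -
      have d: "(\<Sum>l\<in>{..<n0} - {k}. of_bool (i = l) :: real) = of_bool (i \<noteq> k)" if "i < n0" for i
        using that by (simp add: of_bool_def sum.delta')
      have "(\<Sum>l\<in>{..<n0} - {k}. (of_bool (fst (pr j) = k) * of_bool (snd (pr j) = l) + of_bool (fst (pr j) = l) * of_bool (snd (pr j) = k)) * W j)
        = (of_bool (fst (pr j) = k) * (\<Sum>l\<in>{..<n0} - {k}. of_bool (snd (pr j) = l)) + (\<Sum>l\<in>{..<n0} - {k}. of_bool (fst (pr j) = l)) * of_bool (snd (pr j) = k)) * W j"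
        by (simp only: sum_distrib_left sum_distrib_right sum.distrib distrib_left distrib_right)
      then show ?thesis using prJ[OF j] by (auto simp: d)
    qed
    have "(\<Sum>k<n0. \<Sum>l\<in>{..<n0} - {k}. \<Sum>j\<in>J. (of_bool (fst (pr j) = k) * of_bool (snd (pr j) = l) + of_bool (fst (pr j) = l) * of_bool (snd (pr j) = k)) * W j)
      = (\<Sum>k<n0. \<Sum>j\<in>J. (1 * (of_bool (fst (pr j) = k) + of_bool (snd (pr j) = k))
        + (2 - 2 * 1) * (of_bool (fst (pr j) = snd (pr j)) * of_bool (fst (pr j) = k))) * (of_bool (fst (pr j) \<noteq> snd (pr j)) * W j))"
    proof (rule sum.cong[OF refl])
      fix k assume k: "k \<in> {..<n0}"
      show "(\<Sum>l\<in>{..<n0} - {k}. \<Sum>j\<in>J. (of_bool (fst (pr j) = k) * of_bool (snd (pr j) = l) + of_bool (fst (pr j) = l) * of_bool (snd (pr j) = k)) * W j)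
        = (\<Sum>j\<in>J. (1 * (of_bool (fst (pr j) = k) + of_bool (snd (pr j) = k))
        + (2 - 2 * 1) * (of_bool (fst (pr j) = snd (pr j)) * of_bool (fst (pr j) = k))) * (of_bool (fst (pr j) \<noteq> snd (pr j)) * W j))"
        using k by (subst sum.swap) (simp add: inner)
    qed
    also have "\<dots> = (\<Sum>j\<in>J. 2 * (of_bool (fst (pr j) \<noteq> snd (pr j)) * W j))"
    proof (subst sum.swap, rule sum.cong[OF refl])
      fix j assume j: "j \<in> J"
      have d: "(\<Sum>k<n0. of_bool (i = k) :: real) = 1" if "i < n0" for i
        using that by (simp add: of_bool_def sum.delta')
      have "(\<Sum>k<n0. (1 * (of_bool (fst (pr j) = k) + of_bool (snd (pr j) = k))
        + (2 - 2 * 1) * (of_bool (fst (pr j) = snd (pr j)) * of_bool (fst (pr j) = k))) * (of_bool (fst (pr j) \<noteq> snd (pr j)) * W j))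
        = ((\<Sum>k<n0. of_bool (fst (pr j) = k)) + (\<Sum>k<n0. of_bool (snd (pr j) = k))) * (of_bool (fst (pr j) \<noteq> snd (pr j)) * W j)"
        by (simp add: sum.distrib flip: sum_distrib_right)
      then show "(\<Sum>k<n0. (1 * (of_bool (fst (pr j) = k) + of_bool (snd (pr j) = k))
        + (2 - 2 * 1) * (of_bool (fst (pr j) = snd (pr j)) * of_bool (fst (pr j) = k))) * (of_bool (fst (pr j) \<noteq> snd (pr j)) * W j))
        = 2 * (of_bool (fst (pr j) \<noteq> snd (pr j)) * W j)" using prJ[OF j] by (simp add: d)
    qed
    finally show ?thesis by (simp only: WT_def sum_distrib_left)
  qed
  have "(\<Sum>k<n0. \<Sum>l\<in>{..<n0} - {k}. \<epsilon> k l - \<epsilon> k v - \<epsilon> u l + \<epsilon> u v)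
    = (\<Sum>k<n0. \<Sum>l\<in>{..<n0} - {k}. (1 - b * (F - G)) * (x k l - z k - z l + X) - (F - G) *
        (\<Sum>j\<in>J. (of_bool (fst (pr j) = k) * of_bool (snd (pr j) = l) + of_bool (fst (pr j) = l) * of_bool (snd (pr j) = k)) * W j))"
    by (intro sum.cong refl system_off_diag) auto
  also have "\<dots> = (1 - b * (F - G)) * (\<Sum>k<n0. \<Sum>l\<in>{..<n0} - {k}. x k l - z k - z l + X) - (F - G) *
      (\<Sum>k<n0. \<Sum>l\<in>{..<n0} - {k}. \<Sum>j\<in>J. (of_bool (fst (pr j) = k) * of_bool (snd (pr j) = l) + of_bool (fst (pr j) = l) * of_bool (snd (pr j) = k)) * W j)"
    by (simp only: sum_subtractf sum_distrib_left[symmetric])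
  also have "(\<Sum>k<n0. \<Sum>l\<in>{..<n0} - {k}. x k l - z k - z l + X) = O2"
    unfolding O2_def by (rule sum.cong[OF refl]) (simp add: O1)
  finally show ?thesis unfolding WTs by simp
qed

lemma system_2:
  "(\<Sum>k<n0. \<epsilon> k v - \<epsilon> u v) = (1 - b * (F - 3 * G)) * \<tau> - b / 2 * E * \<sigma> - b * G * O2 - (2 * G * WT + E * WS)"
proof -
  have "(\<Sum>k<n0. \<epsilon> k v - \<epsilon> u v) = (\<Sum>k<n0. t k - b / 2 * ((2 * F - 6 * G) * t k + E * s k + 2 * G * O1 k)
    - (\<Sum>j\<in>J. (G * (of_bool (fst (pr j) = k) + of_bool (snd (pr j) = k))
        + (E - 2 * G) * (of_bool (fst (pr j) = snd (pr j)) * of_bool (fst (pr j) = k))) * W j))"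
    by (intro sum.cong refl system_T) auto
  also have "\<dots> = \<tau> - b / 2 * ((2 * F - 6 * G) * \<tau> + E * \<sigma> + 2 * G * O2) - (2 * G * WT + E * WS)"
    unfolding source_sums[symmetric] \<tau>_def \<sigma>_def O2_def
    by (simp only: sum_subtractf sum.distrib sum_distrib_left[symmetric])
  finally show ?thesis by (simp add: field_simps)
qed

lemma system_3:
  "(\<Sum>k<n0. \<epsilon> k k - \<epsilon> u u) = (1 - b / 2 * D) * \<sigma> + 2 * b * E * \<tau> - b * E * O2 - (2 * E * WT + D * WS)"
proof -
  have "(\<Sum>k<n0. \<epsilon> k k - \<epsilon> u u) = (\<Sum>k<n0. s k - b / 2 * (D * s k - 4 * E * t k + 2 * E * O1 k)
    - (\<Sum>j\<in>J. (E * (of_bool (fst (pr j) = k) + of_bool (snd (pr j) = k))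
        + (D - 2 * E) * (of_bool (fst (pr j) = snd (pr j)) * of_bool (fst (pr j) = k))) * W j))"
    by (intro sum.cong refl system_S) auto
  also have "\<dots> = \<sigma> - b / 2 * (D * \<sigma> - 4 * E * \<tau> + 2 * E * O2) - (2 * E * WT + D * WS)"
    unfolding source_sums[symmetric] \<tau>_def \<sigma>_def O2_def
    by (simp only: sum_subtractf sum.distrib sum_distrib_left[symmetric])
  finally show ?thesis by (simp add: field_simps)
qed

lemma row_u: "row u = Y - X + \<tau>" "row v = Y - X + \<tau>"
  by (simp_all add: row_fresh \<rho>_def Zs_def \<tau>_def t_def sum_subtractf algebra_simps)

text \<open>For two fresh replicas no difference is taken: \<open>I3\<close> and \<open>I5\<close>
  survive, and the sums \<tau>, \<sigma>, \<open>O2\<close> belonging to the other blocks act as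
  sources.\<close>

lemma system_4:
  "\<epsilon> u v = (1 - b * (F - 3 * G)) * X - b * E * Y - (I3 * WT + I5 * WS)
    - b * ((2 * G - I3) * \<tau> + I5 / 2 * \<sigma> + I3 / 2 * O2)"
proof -
  have "Q u v = I3 * WT + I5 * WS"
    unfolding Q_def WT_def WS_def sum_distrib_left sum.distrib[symmetric]
  proof (rule sum.cong[OF refl])
    fix j assume "j \<in> J"
    then have "fst (pr j) < n0" "snd (pr j) < n0" using prJ by auto
    then show "C u v (fst (pr j)) (snd (pr j)) * W j
      = I3 * (of_bool (fst (pr j) \<noteq> snd (pr j)) * W j) + I5 * (of_bool (fst (pr j) = snd (pr j)) * W j)"
      unfolding pair_corr_def by simp
  qed
  then show ?thesis
    unfolding \<epsilon>_def by (simp add: dsum_off fresh_vals row_u) (simp add: field_simps)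
qed

lemma system_5:
  "\<epsilon> u u = (1 - b / 2 * D) * Y + b * E * X - (I5 * WT + K4 * WS)
    - b * ((E - I5) * \<tau> + K4 / 2 * \<sigma> + I5 / 2 * O2)"
proof -
  have "Q u u = I5 * WT + K4 * WS"
    unfolding Q_def WT_def WS_def sum_distrib_left sum.distrib[symmetric]
  proof (rule sum.cong[OF refl])
    fix j assume "j \<in> J"
    then have "fst (pr j) < n0" "snd (pr j) < n0" using prJ by auto
    then show "C u u (fst (pr j)) (snd (pr j)) * W j
      = I5 * (of_bool (fst (pr j) \<noteq> snd (pr j)) * W j) + K4 * (of_bool (fst (pr j) = snd (pr j)) * W j)"
      unfolding pair_corr_def by simp
  qed
  then show ?thesis
    unfolding \<epsilon>_def by (simp add: dsum_same fresh_vals row_u) (simp add: field_simps)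
qed

end

text \<open>Back substitution with errors carried along: \<open>r1\<close> gives \<open>O2\<close>,
  Cramer's rule on \<open>r2\<close>, \<open>r3\<close> gives \<tau> and \<sigma>, and Cramer's rule
  on \<open>r4\<close>, \<open>r5\<close> gives \<open>X\<close> and \<open>Y\<close>, both times
  with determinant \<open>M\<close>. The coefficient \<kappa> stays unspecified because the equation
  for \<open>Y\<close> is eventually applied with no factor T present, where \<open>WT\<close> is
  zero.\<close>

lemma solve_cavity_system:
  fixes O2 \<tau> \<sigma> X Y WT WS :: "nat \<Rightarrow> real" and b F G E D I3 I5 K4 M1 M2 M3 M a1 a2 b1 c1 :: real
  assumes M1: "M1 = 1 - b * (F - 3 * G)" and M2: "M2 = 1 - b / 2 * D" and M3: "M3 = 1 - b * (F - G)"
    and M: "M = M1 * M2 + b\<^sup>2 * E\<^sup>2" and nz: "M \<noteq> 0" "M3 \<noteq> 0"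
    and a2: "a2 = (F - G) / M3" and a1: "a1 = (G * M2 + b / 2 * E\<^sup>2) / (M * M3)"
    and b1: "b1 = (D * M1 - 2 * b * E\<^sup>2) / M" and c1: "c1 = E / M"
    and r1: "vanishing (\<lambda>N. M3 * O2 N - 2 * (F - G) * WT N)"
    and r2: "vanishing (\<lambda>N. M1 * \<tau> N - b / 2 * E * \<sigma> N - b * G * O2 N - (2 * G * WT N + E * WS N))"
    and r3: "vanishing (\<lambda>N. M2 * \<sigma> N + 2 * b * E * \<tau> N - b * E * O2 N - (2 * E * WT N + D * WS N))"
    and r4: "vanishing (\<lambda>N. M1 * X N - b * E * Y N - (I3 * WT N + I5 * WS N)
      - b * ((2 * G - I3) * \<tau> N + I5 / 2 * \<sigma> N + I3 / 2 * O2 N))"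
    and r5: "vanishing (\<lambda>N. M2 * Y N + b * E * X N - (I5 * WT N + K4 * WS N)
      - b * ((E - I5) * \<tau> N + K4 / 2 * \<sigma> N + I5 / 2 * O2 N))"
  defines "a0 \<equiv> b / M * (b * E * K4 + M2 * I5) * c1 + 2 * b / M * (b * E * (E - I5) + M2 * (2 * G - I3)) * a1
      + b / M * (b * E * I5 + M2 * I3) * a2 + 1 / M * (b * E * I5 + M2 * I3)"
    and "b0 \<equiv> b / (2 * M) * (M1 * K4 - b * E * I5) * b1 + b / M * (M1 * (E - I5) - b * E * (2 * G - I3)) * c1
      + 1 / M * (M1 * K4 - b * E * I5)"
    and "c0 \<equiv> b / (2 * M) * (M2 * I5 + b * E * K4) * b1 + b / M * (M2 * (2 * G - I3) + b * E * (E - I5)) * c1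
      + 1 / M * (M2 * I5 + b * E * K4)"
  shows "vanishing (\<lambda>N. X N - a0 * WT N - c0 * WS N)" "\<exists>\<kappa>. vanishing (\<lambda>N. Y N - \<kappa> * WT N - b0 * WS N)"
proof -
  \<comment> \<open>Deviations from the leading-order solutions; each will be a combination of the
    given errors.\<close>
  define dO where "dO N = O2 N - 2 * a2 * WT N" for N
  define dT where "dT N = \<tau> N - 2 * a1 * WT N - c1 * WS N" for N
  define dS where "dS N = \<sigma> N - 2 * c1 * WT N - b1 * WS N" for N
  let ?r1 = "\<lambda>N. M3 * O2 N - 2 * (F - G) * WT N"
  let ?r2 = "\<lambda>N. M1 * \<tau> N - b / 2 * E * \<sigma> N - b * G * O2 N - (2 * G * WT N + E * WS N)"
  let ?r3 = "\<lambda>N. M2 * \<sigma> N + 2 * b * E * \<tau> N - b * E * O2 N - (2 * E * WT N + D * WS N)"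
  let ?r4 = "\<lambda>N. M1 * X N - b * E * Y N - (I3 * WT N + I5 * WS N) - b * ((2 * G - I3) * \<tau> N + I5 / 2 * \<sigma> N + I3 / 2 * O2 N)"
  let ?r5 = "\<lambda>N. M2 * Y N + b * E * X N - (I5 * WT N + K4 * WS N) - b * ((E - I5) * \<tau> N + K4 / 2 * \<sigma> N + I5 / 2 * O2 N)"
  have e2: "M3 * a2 = F - G" using nz by (simp add: a2)
  \<comment> \<open>Feeding 2 a2 \<open>WT\<close> for \<open>O2\<close> into \<open>r2\<close> and
    \<open>r3\<close> multiplies their \<open>WT\<close> sources by 1 + b a2; this identity turns
    that factor into the 1 / M3 of the closed form of \<open>a1\<close>.\<close>
  have k: "1 + b * a2 = 1 / M3"
  proof -
    have "M3 * (1 + b * a2) = M3 + b * (M3 * a2)" by (simp add: algebra_simps)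
    also have "\<dots> = 1" unfolding e2 by (simp add: M3)
    finally show ?thesis using nz(2) by (simp add: eq_divide_eq mult.commute)
  qed
  have e1: "M * a1 = (G * M2 + b / 2 * E\<^sup>2) * (1 + b * a2)" unfolding k a1 using nz by simp
  have ec: "M * c1 = E" using nz by (simp add: c1)
  \<comment> \<open>\<open>c1\<close> is the \<open>WS\<close> coefficient of \<tau> and, doubled,
    the \<open>WT\<close> coefficient of \<sigma>; \<open>ec2\<close> and \<open>ec3\<close> match
    its closed form with these two computations.\<close>
  have ec2: "M * c1 = M2 * E + b / 2 * E * D" unfolding ec M2 by (simp add: algebra_simps)
  have eb: "M * b1 = D * M1 - 2 * b * E\<^sup>2" using nz by (simp add: b1)
  have ec3: "M * c1 = (E * M1 - 2 * b * E * G) * (1 + b * a2)"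
  proof -
    have "E * M1 - 2 * b * E * G = E * M3" unfolding M1 M3 by (simp add: algebra_simps)
    then show ?thesis unfolding k ec using nz by simp
  qed
  have vO: "vanishing dO"
  proof -
    have "vanishing (\<lambda>N. 1 / M3 * ?r1 N)" by (rule vanishing_cmult[OF r1])
    then show ?thesis
    proof (rule vanishing_cong)
      show "1 / M3 * ?r1 N = dO N" for N
        unfolding e2[symmetric] dO_def using nz by (simp add: field_simps)
    qed
  qed
  have vT: "vanishing dT"
  proof -
    have "vanishing (\<lambda>N. 1 / M * (M2 * (?r2 N + b * G * dO N) + b / 2 * E * (?r3 N + b * E * dO N)))"
      by (intro vanishing_cmult vanishing_add r2 r3 vO)
    then show ?thesis
    proof (rule vanishing_cong)
      fix N
      have "M * dT N - (M2 * (?r2 N + b * G * dO N) + b / 2 * E * (?r3 N + b * E * dO N))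
        = - 2 * WT N * (M * a1 - (G * M2 + b / 2 * E\<^sup>2) * (1 + b * a2)) - WS N * (M * c1 - (M2 * E + b / 2 * E * D))"
        unfolding dT_def dO_def M by (simp add: field_simps power2_eq_square)
      then have "M * dT N = M2 * (?r2 N + b * G * dO N) + b / 2 * E * (?r3 N + b * E * dO N)"
        unfolding e1 ec2 diff_self mult_zero_right right_minus_eq .
      then show "1 / M * (M2 * (?r2 N + b * G * dO N) + b / 2 * E * (?r3 N + b * E * dO N)) = dT N"
        using nz by (metis nonzero_mult_div_cancel_left times_divide_eq_left mult_1)
    qed
  qed
  have vS: "vanishing dS"
  proof -
    have "vanishing (\<lambda>N. 1 / M * (M1 * (?r3 N + b * E * dO N) - 2 * b * E * (?r2 N + b * G * dO N)))"
      by (intro vanishing_cmult vanishing_add vanishing_diff r2 r3 vO)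
    then show ?thesis
    proof (rule vanishing_cong)
      fix N
      have "M * dS N - (M1 * (?r3 N + b * E * dO N) - 2 * b * E * (?r2 N + b * G * dO N))
        = - 2 * WT N * (M * c1 - (E * M1 - 2 * b * E * G) * (1 + b * a2)) - WS N * (M * b1 - (D * M1 - 2 * b * E\<^sup>2))"
        unfolding dS_def dO_def M by (simp add: algebra_simps power2_eq_square)
      then have "M * dS N = M1 * (?r3 N + b * E * dO N) - 2 * b * E * (?r2 N + b * G * dO N)"
        unfolding ec3 eb diff_self mult_zero_right right_minus_eq .
      then show "1 / M * (M1 * (?r3 N + b * E * dO N) - 2 * b * E * (?r2 N + b * G * dO N)) = dS N"
        using nz by (metis nonzero_mult_div_cancel_left times_divide_eq_left mult_1)
    qed
  qed
  let ?u = "\<lambda>N. ?r4 N + b * ((2 * G - I3) * dT N + I5 / 2 * dS N + I3 / 2 * dO N)"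
  let ?w = "\<lambda>N. ?r5 N + b * ((E - I5) * dT N + K4 / 2 * dS N + I5 / 2 * dO N)"
  have vu: "vanishing ?u" and vw: "vanishing ?w"
    by (intro vanishing_cmult vanishing_add r4 r5 vO vT vS)+
  \<comment> \<open>Effective sources of the last block once \<tau>, \<sigma> and \<open>O2\<close>
    are replaced by their leading terms.\<close>
  define p1 where "p1 = I3 + b * ((2 * G - I3) * (2 * a1) + I5 / 2 * (2 * c1) + I3 / 2 * (2 * a2))"
  define p2 where "p2 = I5 + b * ((2 * G - I3) * c1 + I5 / 2 * b1)"
  define p3 where "p3 = I5 + b * ((E - I5) * (2 * a1) + K4 / 2 * (2 * c1) + I5 / 2 * (2 * a2))"
  define p4 where "p4 = K4 + b * ((E - I5) * c1 + K4 / 2 * b1)"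
  have u: "?u N = M1 * X N - b * E * Y N - p1 * WT N - p2 * WS N" for N
    unfolding dT_def dS_def dO_def p1_def p2_def by (simp add: algebra_simps)
  have w: "?w N = M2 * Y N + b * E * X N - p3 * WT N - p4 * WS N" for N
    unfolding dT_def dS_def dO_def p3_def p4_def by (simp add: algebra_simps)
  have a0: "a0 = 1 / M * (M2 * p1 + b * E * p3)"
    unfolding a0_def p1_def p3_def using nz by (simp add: field_simps)
  have c0: "c0 = 1 / M * (M2 * p2 + b * E * p4)"
    unfolding c0_def p2_def p4_def using nz by (simp add: field_simps)
  have b0: "b0 = 1 / M * (M1 * p4 - b * E * p2)"
    unfolding b0_def p2_def p4_def using nz by (simp add: field_simps)
  have "vanishing (\<lambda>N. 1 / M * (M2 * ?u N + b * E * ?w N))"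
    by (intro vanishing_cmult vanishing_add vu vw)
  then show "vanishing (\<lambda>N. X N - a0 * WT N - c0 * WS N)"
  proof (rule vanishing_cong)
    fix N
    have "M2 * ?u N + b * E * ?w N = M * X N - (M2 * p1 + b * E * p3) * WT N - (M2 * p2 + b * E * p4) * WS N"
      unfolding u w M by (simp add: algebra_simps power2_eq_square)
    then show "1 / M * (M2 * ?u N + b * E * ?w N) = X N - a0 * WT N - c0 * WS N"
      unfolding a0 c0 using nz by (simp add: diff_divide_distrib)
  qed
  have "vanishing (\<lambda>N. 1 / M * (M1 * ?w N - b * E * ?u N))"
    by (intro vanishing_cmult vanishing_diff vu vw)
  then have "vanishing (\<lambda>N. Y N - 1 / M * (M1 * p3 - b * E * p1) * WT N - b0 * WS N)"
  proof (rule vanishing_cong)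
    fix N
    have "M1 * ?w N - b * E * ?u N = M * Y N - (M1 * p3 - b * E * p1) * WT N - (M1 * p4 - b * E * p2) * WS N"
      unfolding u w M by (simp add: algebra_simps power2_eq_square)
    then show "1 / M * (M1 * ?w N - b * E * ?u N) = Y N - 1 / M * (M1 * p3 - b * E * p1) * WT N - b0 * WS N"
      unfolding b0 using nz by (simp add: diff_divide_distrib left_diff_distrib)
  qed
  then show "\<exists>\<kappa>. vanishing (\<lambda>N. Y N - \<kappa> * WT N - b0 * WS N)" by blast
qed

section \<open>The constants as fourth-order moments of the decoupled site\<close>

context ghatak_sherrington begin

abbreviation "mom j \<equiv> site_mom \<S> \<beta> D h p q j"

text \<open>The digits list the multiplicities of the replica labels in a spin monomial of degree
  four: the five partitions of 4.\<close>

definition "e4 = Eeta (mom 4)"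
definition "e31 = Eeta (\<lambda>\<eta>. mom 3 \<eta> * mom 1 \<eta>)"
definition "e22 = Eeta (\<lambda>\<eta>. mom 2 \<eta> * mom 2 \<eta>)"
definition "e211 = Eeta (\<lambda>\<eta>. mom 2 \<eta> * (mom 1 \<eta> * mom 1 \<eta>))"
definition "e1111 = Eeta (\<lambda>\<eta>. mom 1 \<eta> * (mom 1 \<eta> * (mom 1 \<eta> * mom 1 \<eta>)))"

lemma mom_bounds:
  "\<bar>mom 4 \<eta>\<bar> \<le> real \<S> ^ 4" "\<bar>mom 3 \<eta> * mom 1 \<eta>\<bar> \<le> real \<S> ^ 4" "\<bar>mom 2 \<eta> * mom 2 \<eta>\<bar> \<le> real \<S> ^ 4"
  "\<bar>mom 2 \<eta> * (mom 1 \<eta> * mom 1 \<eta>)\<bar> \<le> real \<S> ^ 4"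
  "\<bar>mom 1 \<eta> * (mom 1 \<eta> * (mom 1 \<eta> * mom 1 \<eta>))\<bar> \<le> real \<S> ^ 4"
proof -
  have m: "\<bar>mom i \<eta>\<bar> \<le> real \<S> ^ i" for i by (rule site_mom_bound)
  have mult: "\<bar>x * y\<bar> \<le> real \<S> ^ (i + j)" if "\<bar>x\<bar> \<le> real \<S> ^ i" "\<bar>y\<bar> \<le> real \<S> ^ j" for x y i j
    unfolding abs_mult power_add by (intro mult_mono that) auto
  note m11 = mult[OF m[of 1] m[of 1]]
  show "\<bar>mom 4 \<eta>\<bar> \<le> real \<S> ^ 4" by (rule m)
  show "\<bar>mom 3 \<eta> * mom 1 \<eta>\<bar> \<le> real \<S> ^ 4" using mult[OF m[of 3] m[of 1]] by simp
  show "\<bar>mom 2 \<eta> * mom 2 \<eta>\<bar> \<le> real \<S> ^ 4" using mult[OF m[of 2] m[of 2]] by simp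
  show "\<bar>mom 2 \<eta> * (mom 1 \<eta> * mom 1 \<eta>)\<bar> \<le> real \<S> ^ 4" using mult[OF m[of 2] m11] by simp
  show "\<bar>mom 1 \<eta> * (mom 1 \<eta> * (mom 1 \<eta> * mom 1 \<eta>))\<bar> \<le> real \<S> ^ 4"
    using mult[OF m[of 1] mult[OF m[of 1] m11]] by (simp add: numeral_eq_Suc)
qed

lemma mom_integrable:
  "integrable gauss (mom 4)" "integrable gauss (\<lambda>\<eta>. mom 3 \<eta> * mom 1 \<eta>)" "integrable gauss (\<lambda>\<eta>. mom 2 \<eta> * mom 2 \<eta>)"
  "integrable gauss (\<lambda>\<eta>. mom 2 \<eta> * (mom 1 \<eta> * mom 1 \<eta>))"
  "integrable gauss (\<lambda>\<eta>. mom 1 \<eta> * (mom 1 \<eta> * (mom 1 \<eta> * mom 1 \<eta>)))"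
  by (rule integrable_gauss_bounded[OF _ mom_bounds(1)] integrable_gauss_bounded[OF _ mom_bounds(2)]
      integrable_gauss_bounded[OF _ mom_bounds(3)] integrable_gauss_bounded[OF _ mom_bounds(4)]
      integrable_gauss_bounded[OF _ mom_bounds(5)]; measurable)+

lemma e_bounds: "\<bar>e4\<bar> \<le> real \<S> ^ 4" "\<bar>e31\<bar> \<le> real \<S> ^ 4" "\<bar>e22\<bar> \<le> real \<S> ^ 4" "\<bar>e211\<bar> \<le> real \<S> ^ 4" "\<bar>e1111\<bar> \<le> real \<S> ^ 4"
  unfolding e4_def e31_def e22_def e211_def e1111_def
  by (rule Eeta_mono_bound[OF _ mom_bounds(1)] Eeta_mono_bound[OF _ mom_bounds(2)] Eeta_mono_bound[OF _ mom_bounds(3)]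
      Eeta_mono_bound[OF _ mom_bounds(4)] Eeta_mono_bound[OF _ mom_bounds(5)]; measurable)+

lemma const_eqs:
  "cA \<S> \<beta> D h p q = e22 - 2 * e211 + e1111" "cD \<S> \<beta> D h p q = e4 - e22" "cF \<S> \<beta> D h p q = e22 - e211"
  "cG \<S> \<beta> D h p q = e211 - e1111" "cE \<S> \<beta> D h p q = e31 - e211" "cI3 \<S> \<beta> D h p q = e1111 - q\<^sup>2"
  "cI5 \<S> \<beta> D h p q = e211 - p * q" "cK4 \<S> \<beta> D h p q = e22 - p\<^sup>2"
proof -
  note i = mom_integrable
  have "cA \<S> \<beta> D h p q = Eeta (\<lambda>\<eta>. mom 2 \<eta> * mom 2 \<eta> - 2 * (mom 2 \<eta> * (mom 1 \<eta> * mom 1 \<eta>)) + mom 1 \<eta> * (mom 1 \<eta> * (mom 1 \<eta> * mom 1 \<eta>)))"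
    unfolding cA_def by (rule arg_cong[where f = Eeta]) (simp add: power2_eq_square algebra_simps)
  then show "cA \<S> \<beta> D h p q = e22 - 2 * e211 + e1111" using i by (simp add: Eeta_def e22_def e211_def e1111_def)
  show "cD \<S> \<beta> D h p q = e4 - e22" using i by (simp add: cD_def Eeta_def e4_def e22_def power2_eq_square)
  have "cF \<S> \<beta> D h p q = Eeta (\<lambda>\<eta>. mom 2 \<eta> * mom 2 \<eta> - mom 2 \<eta> * (mom 1 \<eta> * mom 1 \<eta>))"
    unfolding cF_def by (rule arg_cong[where f = Eeta]) (simp add: power2_eq_square algebra_simps)
  then show "cF \<S> \<beta> D h p q = e22 - e211" using i by (simp add: Eeta_def e22_def e211_def)
  have "cG \<S> \<beta> D h p q = Eeta (\<lambda>\<eta>. mom 2 \<eta> * (mom 1 \<eta> * mom 1 \<eta>) - mom 1 \<eta> * (mom 1 \<eta> * (mom 1 \<eta> * mom 1 \<eta>)))"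
    unfolding cG_def by (rule arg_cong[where f = Eeta]) (simp add: power2_eq_square algebra_simps)
  then show "cG \<S> \<beta> D h p q = e211 - e1111" using i by (simp add: Eeta_def e211_def e1111_def)
  have "cE \<S> \<beta> D h p q = Eeta (\<lambda>\<eta>. mom 3 \<eta> * mom 1 \<eta> - mom 2 \<eta> * (mom 1 \<eta> * mom 1 \<eta>))"
    unfolding cE_def by (rule arg_cong[where f = Eeta]) (simp add: algebra_simps)
  then show "cE \<S> \<beta> D h p q = e31 - e211" using i by (simp add: Eeta_def e31_def e211_def)
  show "cI3 \<S> \<beta> D h p q = e1111 - q\<^sup>2" by (simp add: cI3_def e1111_def power4_eq_xxxx mult.assoc)
  show "cI5 \<S> \<beta> D h p q = e211 - p * q" by (simp add: cI5_def e211_def power2_eq_square mult_ac)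
  show "cK4 \<S> \<beta> D h p q = e22 - p\<^sup>2" by (simp add: cK4_def e22_def power2_eq_square)
qed

end

context high_temperature begin

lemma site_av_four:
  assumes "k < n" "l < n" "i < n" "j < n"
  shows "site_av n (\<lambda>s. s k * s l * (s i * s j)) =
    (if k = l then
       (if i = j then (if i = k then e4 else e22)
        else if i = k \<or> j = k then e31 else e211)
     else if i = j then (if i = k \<or> i = l then e31 else e211)
     else if (i = k \<and> j = l) \<or> (i = l \<and> j = k) then e22
     else if i = k \<or> i = l \<or> j = k \<or> j = l then e211 else e1111)"
proof -
  have "site_av n (\<lambda>s. s k * s l * (s i * s j)) = Eeta (\<lambda>\<eta>. \<Prod>r\<in>set [k, l, i, j]. mom (count_list [k, l, i, j] r) \<eta>)"
    using site_av_monomial[of "[k, l, i, j]" n] assms by (simp add: mult.assoc)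
  then show ?thesis
    unfolding e4_def e31_def e22_def e211_def e1111_def
    by (cases "k = l"; cases "i = j"; cases "i = k"; cases "i = l"; cases "j = k"; cases "j = l")
      (simp_all add: numeral_eq_Suc insert_commute mult_ac eq_commute)
qed

lemma site_av_two:
  assumes "i < n" "j < n" shows "site_av n (\<lambda>s. s i * s j) = centre i j"
proof -
  have "site_av n (\<lambda>s. s i * s j) = Eeta (\<lambda>\<eta>. \<Prod>r\<in>set [i, j]. mom (count_list [i, j] r) \<eta>)"
    using site_av_monomial[of "[i, j]" n] assms by simp
  also have "\<dots> = centre i j"
    using fixed_point by (cases "i = j") (auto simp: fixed_point_def centre_def power2_eq_square numeral_2_eq_2)
  finally show ?thesis .
qed

text \<open>With all constants written through the five moments, both sides agree in each
  coincidence pattern of the four labels.\<close>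

lemma corr_eq:
  assumes "k < n" "l < n" "i < n" "j < n"
  shows "corr n k l i j = pair_corr (cF \<S> \<beta> D h p q) (cG \<S> \<beta> D h p q) (cE \<S> \<beta> D h p q) (cD \<S> \<beta> D h p q)
    (cI3 \<S> \<beta> D h p q) (cI5 \<S> \<beta> D h p q) (cK4 \<S> \<beta> D h p q) k l i j"
proof -
  have "corr n k l i j = site_av n (\<lambda>s. s k * s l * (s i * s j)) - centre k l * site_av n (\<lambda>s. s i * s j)"
  proof -
    have "rav (spins \<S>) P n (\<lambda>s. (s k * s l - centre k l) * (s i * s j))
      = rav (spins \<S>) P n (\<lambda>s. s k * s l * (s i * s j)) - centre k l * rav (spins \<S>) P n (\<lambda>s. s i * s j)" for P
      unfolding left_diff_distrib rav_diff rav_cmult ..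
    moreover have "integrable gauss (\<lambda>\<eta>. rav (spins \<S>) (gibbs (spins \<S>) (site_ham \<eta>)) n (\<lambda>s. s k * s l * (s i * s j)))"
      using rav_site_monomial[of "[k, l, i, j]" n] mom_prod_integrable[of "\<lambda>r. count_list [k, l, i, j] r" "set [k, l, i, j]"] assms
      by (simp add: mult.assoc)
    moreover have "integrable gauss (\<lambda>\<eta>. rav (spins \<S>) (gibbs (spins \<S>) (site_ham \<eta>)) n (\<lambda>s. s i * s j))"
      using rav_site_monomial[of "[i, j]" n] mom_prod_integrable[of "\<lambda>r. count_list [i, j] r" "set [i, j]"] assms
      by simp
    ultimately show ?thesis unfolding corr_def site_av_def Eeta_def by simp
  qed
  also have "\<dots> = (if k = l then
       (if i = j then (if i = k then e4 else e22)
        else if i = k \<or> j = k then e31 else e211)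
     else if i = j then (if i = k \<or> i = l then e31 else e211)
     else if (i = k \<and> j = l) \<or> (i = l \<and> j = k) then e22
     else if i = k \<or> i = l \<or> j = k \<or> j = l then e211 else e1111) - centre k l * centre i j"
    unfolding site_av_four[OF assms] site_av_two[OF assms(3,4)] ..
  also have "\<dots> = pair_corr (cF \<S> \<beta> D h p q) (cG \<S> \<beta> D h p q) (cE \<S> \<beta> D h p q) (cD \<S> \<beta> D h p q)
    (cI3 \<S> \<beta> D h p q) (cI5 \<S> \<beta> D h p q) (cK4 \<S> \<beta> D h p q) k l i j"
    unfolding pair_corr_def const_eqs centre_def
    by (auto simp: power2_eq_square)
  finally show ?thesis .
qed

end

section \<open>Moments of a Gaussian pair\<close>

text \<open>Stein's recursion for \<open>E (X ^ k * Y ^ m)\<close>; where the truncated subtraction is not genuine, the coefficient is \<open>0\<close>.\<close>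
fun wick :: "real \<Rightarrow> real \<Rightarrow> real \<Rightarrow> nat \<Rightarrow> nat \<Rightarrow> real" where
  "wick a c b 0 0 = 1"
| "wick a c b 0 (Suc m) = b * (real m * wick a c b 0 (m - 1))"
| "wick a c b (Suc k) m = a * (real k * wick a c b (k - 1) m) + c * (real m * wick a c b k (m - 1))"

text \<open>Stein's recursion in the other variable, that is, the symmetry of \<open>wick\<close>,
  whose definition prefers the first. One factor of the first kind is removed, the induction
  hypothesis is applied to what remains, and the terms are regrouped.\<close>

lemma wick_Suc_right:
  "wick a c b k (Suc m) = b * (real m * wick a c b k (m - 1)) + c * (real k * wick a c b (k - 1) m)"
proof (induction k arbitrary: m rule: less_induct)
  case (less k)
  show ?case
  proof (cases k)
    case (Suc k')
    let ?w = "wick a c b"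
    have ih1: "real k' * ?w (k' - 1) (Suc m) = real k' * (b * (real m * ?w (k' - 1) (m - 1)) + c * (real (k' - 1) * ?w (k' - 1 - 1) m))"
      using less.IH[of "k' - 1" m] Suc by simp
    have row: "real k' * ?w k' m = real k' * (a * (real (k' - 1) * ?w (k' - 1 - 1) m) + c * (real m * ?w (k' - 1) (m - 1)))"
      by (cases k') auto
    have col: "real m * ?w k' m = real m * (b * (real (m - 1) * ?w k' (m - 1 - 1)) + c * (real k' * ?w (k' - 1) (m - 1)))"
      using less.IH[of k' "m - 1"] Suc by (cases m) auto
    have low: "real m * ?w (Suc k') (m - 1) = real m * (a * (real k' * ?w (k' - 1) (m - 1)) + c * (real (m - 1) * ?w k' (m - 1 - 1)))"
      by simp
    have "?w k (Suc m) = a * (real k' * ?w (k' - 1) (Suc m)) + c * (real (Suc m) * ?w k' m)"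
      unfolding Suc by simp
    \<comment> \<open>A term with c * c is added and subtracted so that the right side of
      \<open>row\<close> occurs.\<close>
    also have "\<dots> = a * b * real k' * real m * ?w (k' - 1) (m - 1)
        + c * (real k' * (a * (real (k' - 1) * ?w (k' - 1 - 1) m) + c * (real m * ?w (k' - 1) (m - 1))))
        - c * c * real k' * real m * ?w (k' - 1) (m - 1) + c * (real m * ?w k' m) + c * ?w k' m"
      unfolding ih1 by (simp add: algebra_simps)
    also have "\<dots> = a * b * real k' * real m * ?w (k' - 1) (m - 1) + c * (real k' * ?w k' m)
        - c * c * real k' * real m * ?w (k' - 1) (m - 1)
        + c * (real m * (b * (real (m - 1) * ?w k' (m - 1 - 1)) + c * (real k' * ?w (k' - 1) (m - 1)))) + c * ?w k' m"
      unfolding row[symmetric] col[symmetric] ..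
    also have "\<dots> = b * (real m * (a * (real k' * ?w (k' - 1) (m - 1)) + c * (real (m - 1) * ?w k' (m - 1 - 1)))) + c * (real (Suc k') * ?w k' m)"
      by (simp add: algebra_simps)
    finally show ?thesis unfolding low[symmetric] Suc by simp
  qed simp
qed

lemma wick_scale: "wick (r\<^sup>2 * a) (r\<^sup>2 * c) (r\<^sup>2 * b) k m = r ^ (k + m) * wick a c b k m"
proof (induction a c b k m rule: wick.induct)
  case (1 a c b)
  show ?case by simp
next
  case (2 a c b m)
  then show ?case by (cases m) (auto simp: power2_eq_square)
next
  case (3 a c b k m)
  have k: "r\<^sup>2 * a * (real k * wick (r\<^sup>2 * a) (r\<^sup>2 * c) (r\<^sup>2 * b) (k - 1) m)
    = r ^ (Suc k + m) * (a * (real k * wick a c b (k - 1) m))"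
    unfolding 3(1) by (cases k) (auto simp: power2_eq_square)
  have m: "r\<^sup>2 * c * (real m * wick (r\<^sup>2 * a) (r\<^sup>2 * c) (r\<^sup>2 * b) k (m - 1))
    = r ^ (Suc k + m) * (c * (real m * wick a c b k (m - 1)))"
    unfolding 3(2) by (cases m) (auto simp: power2_eq_square)
  show ?case unfolding wick.simps(3) k m by (simp only: distrib_left)
qed

text \<open>If \<open>f k m\<close> is the mixed moment of X and Y of orders \<open>k\<close> and
  \<open>m\<close>, this is the \<open>n\<close>-th moment of X + Y. \<open>binsum_Suc\<close> is
  Pascal's rule; \<open>binsum_left\<close> and \<open>binsum_right\<close> are absorption
  identities for binomial coefficients.\<close>

definition binsum :: "(nat \<Rightarrow> nat \<Rightarrow> real) \<Rightarrow> nat \<Rightarrow> real" where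
  "binsum f n = (\<Sum>k\<le>n. real (n choose k) * f k (n - k))"

lemma binsum_Suc: "binsum f (Suc n) = binsum (\<lambda>k m. f (Suc k) m) n + binsum (\<lambda>k m. f k (Suc m)) n"
proof -
  have "binsum f (Suc n) = f 0 (Suc n) + (\<Sum>k\<le>n. real (Suc n choose Suc k) * f (Suc k) (n - k))"
    unfolding binsum_def by (subst sum.atMost_Suc_shift) simp
  also have "(\<Sum>k\<le>n. real (Suc n choose Suc k) * f (Suc k) (n - k))
    = binsum (\<lambda>k m. f (Suc k) m) n + (\<Sum>k\<le>n. real (n choose Suc k) * f (Suc k) (n - k))"
    by (simp add: binsum_def distrib_right sum.distrib)
  also have "f 0 (Suc n) + (binsum (\<lambda>k m. f (Suc k) m) n + (\<Sum>k\<le>n. real (n choose Suc k) * f (Suc k) (n - k)))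
    = binsum (\<lambda>k m. f (Suc k) m) n + (\<Sum>k\<le>Suc n. real (n choose k) * f k (Suc n - k))"
    by (subst sum.atMost_Suc_shift) simp
  also have "(\<Sum>k\<le>Suc n. real (n choose k) * f k (Suc n - k)) = binsum (\<lambda>k m. f k (Suc m)) n"
    unfolding binsum_def by (simp add: Suc_diff_le)
  finally show ?thesis .
qed

lemma binsum_left: "binsum (\<lambda>k m. real k * f (k - 1) m) (Suc n) = real (Suc n) * binsum f n"
proof -
  have "binsum (\<lambda>k m. real k * f (k - 1) m) (Suc n) = (\<Sum>k\<le>n. real (Suc n choose Suc k) * (real (Suc k) * f k (n - k)))"
    unfolding binsum_def by (subst sum.atMost_Suc_shift) simp
  also have "\<dots> = (\<Sum>k\<le>n. real (Suc n) * (real (n choose k) * f k (n - k)))"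
  proof (rule sum.cong[OF refl])
    fix k
    have "real (Suc k) * real (Suc n choose Suc k) = real (Suc n) * real (n choose k)"
      unfolding of_nat_mult[symmetric] Suc_times_binomial ..
    then show "real (Suc n choose Suc k) * (real (Suc k) * f k (n - k)) = real (Suc n) * (real (n choose k) * f k (n - k))"
      by (metis mult.assoc mult.commute)
  qed
  finally show ?thesis by (simp only: binsum_def sum_distrib_left)
qed

lemma binsum_right: "binsum (\<lambda>k m. real m * f k (m - 1)) (Suc n) = real (Suc n) * binsum f n"
proof -
  have "binsum (\<lambda>k m. real m * f k (m - 1)) (Suc n) = (\<Sum>k\<le>n. real (Suc n choose k) * (real (Suc n - k) * f k (n - k)))"
    unfolding binsum_def by simp
  also have "\<dots> = (\<Sum>k\<le>n. real (Suc n) * (real (n choose k) * f k (n - k)))"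
  proof (rule sum.cong[OF refl])
    fix k
    have "real (Suc n - k) * real (Suc n choose k) = real (Suc n) * real (n choose k)"
      unfolding of_nat_mult[symmetric] using binomial_absorb_comp[of "Suc n" k] by simp
    then show "real (Suc n choose k) * (real (Suc n - k) * f k (n - k)) = real (Suc n) * (real (n choose k) * f k (n - k))"
      by (metis mult.assoc mult.commute)
  qed
  finally show ?thesis by (simp only: binsum_def sum_distrib_left)
qed

lemma binsum_add: "binsum (\<lambda>k m. f k m + g k m) n = binsum f n + binsum g n"
  by (simp add: binsum_def distrib_left sum.distrib)

lemma binsum_cmult: "binsum (\<lambda>k m. c * f k m) n = c * binsum f n"
  by (simp add: binsum_def sum_distrib_left mult.left_commute)

text \<open>a u^2 + 2 c u + b is the variance of u X + Y. Pascal's rule and Stein's recursion in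
  either variable give the right side the two-step recursion of the one-variable moments.\<close>

lemma wick_linear_combination:
  "wick 0 0 (a * u\<^sup>2 + 2 * c * u + b) 0 n = binsum (\<lambda>k m. u ^ k * wick a c b k m) n"
proof (induction n rule: less_induct)
  case (less n)
  consider "n = 0" | "n = 1" | n' where "n = Suc (Suc n')" by (metis One_nat_def not0_implies_Suc)
  then show ?case
  proof cases
    case 3
    let ?f = "\<lambda>k m. u ^ k * wick a c b k m"
    have 1: "(\<lambda>k m. ?f (Suc k) m) = (\<lambda>k m. (a * u\<^sup>2) * (real k * ?f (k - 1) m) + (c * u) * (real m * ?f k (m - 1)))"
    proof (intro ext)
      fix k m
      have "real k * (u ^ Suc k * x) = real k * (u\<^sup>2 * (u ^ (k - 1) * x))" for x
        by (cases k) (auto simp: power2_eq_square)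
      from this[of "a * wick a c b (k - 1) m"]
      show "?f (Suc k) m = (a * u\<^sup>2) * (real k * ?f (k - 1) m) + (c * u) * (real m * ?f k (m - 1))"
        by (simp add: algebra_simps)
    qed
    have 2: "(\<lambda>k m. ?f k (Suc m)) = (\<lambda>k m. b * (real m * ?f k (m - 1)) + (c * u) * (real k * ?f (k - 1) m))"
    proof (intro ext)
      fix k m
      have "real k * (u ^ k * x) = real k * (u * (u ^ (k - 1) * x))" for x
        by (cases k) auto
      from this[of "c * wick a c b (k - 1) m"]
      show "?f k (Suc m) = b * (real m * ?f k (m - 1)) + (c * u) * (real k * ?f (k - 1) m)"
        unfolding wick_Suc_right by (simp add: algebra_simps)
    qed
    have "binsum ?f n = (a * u\<^sup>2) * (real (Suc n') * binsum ?f n') + (c * u) * (real (Suc n') * binsum ?f n')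
      + (b * (real (Suc n') * binsum ?f n') + (c * u) * (real (Suc n') * binsum ?f n'))"
      unfolding 3 binsum_Suc[of ?f] 1 2 binsum_add binsum_cmult
        binsum_left[of ?f] binsum_right[of ?f] ..
    then show ?thesis using less.IH[of n'] 3 by (simp add: algebra_simps)
  qed (simp_all add: binsum_def)
qed

text \<open>Brings (2 k - 1)!! v^k into the form of the moment formula for a normal density of
  variance \<open>v\<close>.\<close>

lemma wick_even: "0 < v \<Longrightarrow> wick 0 0 v 0 (2 * k) = fact (2 * k) / ((2 / v) ^ k * fact k)"
proof (induction k)
  case (Suc k)
  let ?P = "(2 / v) ^ k * fact k"
  have P: "?P \<noteq> 0" using Suc.prems by simp
  have w: "wick 0 0 v 0 (2 * Suc k) = v * ((2 * real k + 1) * wick 0 0 v 0 (2 * k))" by simp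
  have num: "fact (2 * Suc k) = (2 * (real k + 1)) * ((2 * real k + 1) * fact (2 * k))"
    by (simp add: algebra_simps)
  have den: "(2 / v) ^ Suc k * fact (Suc k) = (2 * (real k + 1)) * (?P / v)" by simp
  have "0 < 2 * (real k + 1)" by simp
  then have "2 * (real k + 1) \<noteq> 0" by simp
  then have "fact (2 * Suc k) / ((2 / v) ^ Suc k * fact (Suc k)) = ((2 * real k + 1) * fact (2 * k)) / (?P / v)"
    unfolding num den by (rule mult_divide_mult_cancel_left)
  also have "\<dots> = v * ((2 * real k + 1) * (fact (2 * k) / ?P))" by simp
  finally show ?case unfolding w Suc.IH[OF Suc.prems] ..
qed simp

lemma wick_odd: "wick 0 0 v 0 (2 * k + 1) = 0"
  by (induction k) auto

lemma wick_zero_variance: "wick 0 0 0 0 m = 0 ^ m"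
  by (cases m) auto

section \<open>Mixed moments from the laws of linear combinations\<close>

lemma centered_gaussian_moment:
  assumes M: "prob_space M" and Z: "centered_gaussian_rv M Z v"
  shows "integrable M (\<lambda>x. Z x ^ m)" "(\<integral>x. Z x ^ m \<partial>M) = wick 0 0 v 0 m"
proof -
  interpret prob_space M by (rule M)
  have meas: "Z \<in> borel_measurable M" using Z by (simp add: centered_gaussian_rv_def)
  have "integrable M (\<lambda>x. Z x ^ m) \<and> (\<integral>x. Z x ^ m \<partial>M) = wick 0 0 v 0 m"
  proof (cases "v = 0")
    \<comment> \<open>Variance 0 means a point mass at 0; \<open>0 ^ 0 = 1\<close> keeps the moment
      of order 0 right.\<close>
    case True
    then have Z0: "AE x in M. Z x = 0" using Z by (simp add: centered_gaussian_rv_def)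
    then have ae: "AE x in M. Z x ^ m = 0 ^ m" by eventually_elim simp
    have "integrable M (\<lambda>x. Z x ^ m)"
      by (subst integrable_cong_AE[OF _ _ ae]) (use meas in auto)
    moreover have "(\<integral>x. Z x ^ m \<partial>M) = (\<integral>x. 0 ^ m \<partial>M)"
      by (rule integral_cong_AE[OF _ _ ae]) (use meas in auto)
    ultimately show ?thesis using True by (simp add: wick_zero_variance prob_space)
  next
    case False
    then have v: "0 < v" and dist: "distributed M lborel Z (normal_density 0 (sqrt v))"
      using Z by (auto simp: centered_gaussian_rv_def)
    have s: "0 < sqrt v" using v by simp
    have "integrable M (\<lambda>x. Z x ^ m) \<longleftrightarrow> integrable lborel (\<lambda>x. normal_density 0 (sqrt v) x * x ^ m)"
      using distributed_integrable[OF dist, of "\<lambda>x. x ^ m"] by simp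
    moreover have "integrable lborel (\<lambda>x. normal_density 0 (sqrt v) x * x ^ m)"
      using integrable_normal_moment[OF s, of 0 m] by simp
    moreover have e: "(\<integral>x. Z x ^ m \<partial>M) = (\<integral>x. normal_density 0 (sqrt v) x * x ^ m \<partial>lborel)"
      using distributed_integral[OF dist, of "\<lambda>x. x ^ m"] by simp
    moreover have "(\<integral>x. normal_density 0 (sqrt v) x * x ^ m \<partial>lborel) = wick 0 0 v 0 m"
    proof (cases "even m")
      case True
      then obtain k where k: "m = 2 * k" by (elim evenE)
      show ?thesis unfolding k wick_even[OF v] using integral_normal_moment_even[OF s, of 0 k] v by simp
    next
      case False
      then obtain k where k: "m = 2 * k + 1" by (elim oddE)
      show ?thesis unfolding k wick_odd using integral_normal_moment_odd[OF s, of 0 k] by simp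
    qed
    ultimately show ?thesis by simp
  qed
  then show "integrable M (\<lambda>x. Z x ^ m)" "(\<integral>x. Z x ^ m \<partial>M) = wick 0 0 v 0 m" by auto
qed

text \<open>The (k + m)-th moment of u X + Y is a polynomial in u whose coefficients are binomial
  multiples of mixed moments; comparison with \<open>wick_linear_combination\<close> identifies each
  of them.\<close>

theorem gaussian_pair_moment:
  assumes pair: "centered_gaussian_pair M X Y a c b"
  shows "(\<integral>x. X x ^ k * Y x ^ m \<partial>M) = wick a c b k m"
proof -
  have M: "prob_space M" and mX: "X \<in> borel_measurable M" and mY: "Y \<in> borel_measurable M"
    and lin: "\<And>u w. centered_gaussian_rv M (\<lambda>x. u * X x + w * Y x) (u\<^sup>2 * a + 2 * u * w * c + w\<^sup>2 * b)"
    using pair by (auto simp: centered_gaussian_pair_def)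
  interpret prob_space M by (rule M)
  have iX: "integrable M (\<lambda>x. X x ^ j)" for j
    using centered_gaussian_moment(1)[OF M lin[of 1 0], of j] by simp
  have iY: "integrable M (\<lambda>x. Y x ^ j)" for j
    using centered_gaussian_moment(1)[OF M lin[of 0 1], of j] by simp
  have int: "integrable M (\<lambda>x. X x ^ i * Y x ^ j)" for i j
  proof (rule Bochner_Integration.integrable_bound)
    show "integrable M (\<lambda>x. X x ^ (2 * i) + Y x ^ (2 * j))" using iX iY by simp
    show "(\<lambda>x. X x ^ i * Y x ^ j) \<in> borel_measurable M" using mX mY by measurable
    show "AE x in M. norm (X x ^ i * Y x ^ j) \<le> norm (X x ^ (2 * i) + Y x ^ (2 * j))"
    proof (rule AE_I2)
      fix x
      have AB: "A * B \<le> A\<^sup>2 + B\<^sup>2" if "0 \<le> A" "0 \<le> B" for A B :: real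
      proof -
        have "0 \<le> (A - B)\<^sup>2" "0 \<le> A * B" using that by simp_all
        then show ?thesis by (simp add: power2_diff)
      qed
      have "X x ^ (2 * i) = \<bar>X x ^ i\<bar>\<^sup>2" "Y x ^ (2 * j) = \<bar>Y x ^ j\<bar>\<^sup>2"
        by (simp_all add: power_mult power2_eq_square flip: power_mult_distrib)
      then show "norm (X x ^ i * Y x ^ j) \<le> norm (X x ^ (2 * i) + Y x ^ (2 * j))"
        using AB[of "\<bar>X x ^ i\<bar>" "\<bar>Y x ^ j\<bar>"] by (simp add: abs_mult)
    qed
  qed
  let ?n = "k + m"
  have "(\<Sum>i\<le>?n. (real (?n choose i) * (\<integral>x. X x ^ i * Y x ^ (?n - i) \<partial>M)) * u ^ i)
    = (\<Sum>i\<le>?n. (real (?n choose i) * wick a c b i (?n - i)) * u ^ i)" for u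
  proof -
    have "(\<integral>x. (u * X x + 1 * Y x) ^ ?n \<partial>M) = wick 0 0 (u\<^sup>2 * a + 2 * u * 1 * c + 1\<^sup>2 * b) 0 ?n"
      by (rule centered_gaussian_moment(2)[OF M lin])
    also have "u\<^sup>2 * a + 2 * u * 1 * c + 1\<^sup>2 * b = a * u\<^sup>2 + 2 * c * u + b" by (simp add: algebra_simps)
    also have "wick 0 0 (a * u\<^sup>2 + 2 * c * u + b) 0 ?n = (\<Sum>i\<le>?n. (real (?n choose i) * wick a c b i (?n - i)) * u ^ i)"
      unfolding wick_linear_combination binsum_def by (intro sum.cong refl) (simp only: mult_ac)
    also have "(\<integral>x. (u * X x + 1 * Y x) ^ ?n \<partial>M)
      = (\<integral>x. (\<Sum>i\<le>?n. (real (?n choose i) * u ^ i) * (X x ^ i * Y x ^ (?n - i))) \<partial>M)"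
      by (rule Bochner_Integration.integral_cong[OF refl])
        (simp only: binomial_ring mult_1 power_mult_distrib mult_ac)
    also have "\<dots> = (\<Sum>i\<le>?n. (real (?n choose i) * u ^ i) * (\<integral>x. X x ^ i * Y x ^ (?n - i) \<partial>M))"
      using int by simp
    finally show ?thesis by (simp only: mult_ac)
  qed
  then have "\<forall>i\<le>?n. real (?n choose i) * (\<integral>x. X x ^ i * Y x ^ (?n - i) \<partial>M) = real (?n choose i) * wick a c b i (?n - i)"
    using polyfun_eq_coeffs[of "\<lambda>i. real (?n choose i) * (\<integral>x. X x ^ i * Y x ^ (?n - i) \<partial>M)" ?n
        "\<lambda>i. real (?n choose i) * wick a c b i (?n - i)"] by blast
  then have "real (?n choose k) * (\<integral>x. X x ^ k * Y x ^ (?n - k) \<partial>M) = real (?n choose k) * wick a c b k (?n - k)"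
    using le_add1[of k m] by blast
  moreover have "?n - k = m" "real (?n choose k) \<noteq> 0" by simp_all
  ultimately show ?thesis by simp
qed

section \<open>Limiting moments of the overlaps\<close>

context high_temperature begin

definition smom :: "nat \<Rightarrow> nat \<Rightarrow> nat \<Rightarrow> real" where
  "smom N k m = (\<integral>g. (sqrt (real N) * overlapT \<S> N \<beta> D h q g) ^ k * (sqrt (real N) * overlapS \<S> N \<beta> D h p g) ^ m \<partial>disorder N)"

text \<open>At fixed disorder, disjoint blocks of replicas are independent under the Gibbs measure.
  Two distinct replicas average to squared magnetizations, hence to T; a repeated replica gives
  S.\<close>

lemma nu_ovl_prod_blocks:
  assumes N: "0 < N" and I: "replicas_below m pr I"
    and disj: "\<And>i j. i \<in> I \<Longrightarrow> j \<in> I \<Longrightarrow> i \<noteq> j \<Longrightarrow> {fst (pr i), snd (pr i)} \<inter> {fst (pr j), snd (pr j)} = {}"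
  shows "nu N m (ovl_prod N pr I) = smom N (card {j \<in> I. fst (pr j) \<noteq> snd (pr j)}) (card {j \<in> I. fst (pr j) = snd (pr j)})"
proof -
  let ?\<Omega> = "configs \<S> N"
  have "rav ?\<Omega> (gibbs ?\<Omega> (hamiltonian N \<beta> D h g)) m (ovl_prod N pr I)
    = (sqrt (real N) * overlapT \<S> N \<beta> D h q g) ^ card {j \<in> I. fst (pr j) \<noteq> snd (pr j)}
      * (sqrt (real N) * overlapS \<S> N \<beta> D h p g) ^ card {j \<in> I. fst (pr j) = snd (pr j)}" for g
  proof -
    let ?P = "gibbs ?\<Omega> (hamiltonian N \<beta> D h g)"
    let ?av = "gibbs_avg \<S> N \<beta> D h g"
    have P: "is_weight ?\<Omega> ?P" by (rule is_weight_gibbs[OF finite_configs configs_nonempty])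
    have one: "rav ?\<Omega> ?P m (\<lambda>\<omega>. f (\<omega> a)) = ?av f" if "a < m" for f a
    proof -
      have "rav ?\<Omega> ?P m (\<lambda>\<omega>. (\<lambda>\<omega>. f (\<omega> 0)) (\<lambda>k. \<omega> ((\<lambda>_. a) k))) = rav ?\<Omega> ?P 1 (\<lambda>\<omega>. f (\<omega> 0))"
        by (rule rav_relabel[OF P depends_below_coord]) (use that in \<open>auto simp: inj_on_def\<close>)
      also have "\<dots> = (\<Sum>\<sigma>\<in>?\<Omega>. ?P \<sigma> * f \<sigma>)" by (simp add: rav_Suc)
      also have "\<dots> = ?av f"
        by (simp add: gibbs_avg_def gibbs_def sum_divide_distrib mult.commute)
      finally show ?thesis by simp
    qed
    have two: "rav ?\<Omega> ?P m (\<lambda>\<omega>. \<omega> a i * \<omega> b i) = ?av (\<lambda>\<sigma>. \<sigma> i) * ?av (\<lambda>\<sigma>. \<sigma> i)" if "a < m" "b < m" "a \<noteq> b" for a b i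
    proof -
      have "rav ?\<Omega> ?P m (\<lambda>\<omega>. \<omega> a i * \<omega> b i) = rav ?\<Omega> ?P m (\<lambda>\<omega>. \<omega> a i) * rav ?\<Omega> ?P m (\<lambda>\<omega>. \<omega> b i)"
        by (rule rav_indep[OF P, where B = "{b}"]) (use that in auto)
      then show ?thesis using one[OF that(1), of "\<lambda>\<sigma>. \<sigma> i"] one[OF that(2), of "\<lambda>\<sigma>. \<sigma> i"] by simp
    qed
    have ovl_lin: "rav ?\<Omega> ?P m (ovl N a b) = sqrt (real N) * ((\<Sum>i<N. rav ?\<Omega> ?P m (\<lambda>\<omega>. \<omega> a i * \<omega> b i)) / real N - centre a b)" for a b
    proof -
      have "ovl N a b = (\<lambda>\<omega>. sqrt (real N) * (1 / real N * (\<Sum>i<N. \<omega> a i * \<omega> b i) - centre a b))"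
        by (intro ext) (simp add: ovl_def overlap_def)
      then show ?thesis by (simp only: rav_cmult rav_diff rav_sum rav_const[OF P]) simp
    qed
    have T: "rav ?\<Omega> ?P m (ovl N a b) = sqrt (real N) * overlapT \<S> N \<beta> D h q g" if "a < m" "b < m" "a \<noteq> b" for a b
      unfolding ovl_lin using that by (simp add: two overlapT_def centre_def power2_eq_square)
    have S: "rav ?\<Omega> ?P m (ovl N a a) = sqrt (real N) * overlapS \<S> N \<beta> D h p g" if "a < m" for a
    proof -
      have "rav ?\<Omega> ?P m (\<lambda>\<omega>. \<omega> a i * \<omega> a i) = ?av (\<lambda>\<sigma>. (\<sigma> i)\<^sup>2)" for i
        using one[OF that, of "\<lambda>\<sigma>. \<sigma> i * \<sigma> i"] by (simp add: power2_eq_square)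
      then show ?thesis unfolding ovl_lin by (simp add: overlapS_def centre_def)
    qed
    have "finite I" using I by (simp add: replicas_below_def)
    then have prod: "rav ?\<Omega> ?P m (ovl_prod N pr I) = (\<Prod>j\<in>I. rav ?\<Omega> ?P m (ovl N (fst (pr j)) (snd (pr j))))"
      using disj
    proof (induction I)
      case empty
      show ?case by (simp add: ovl_prod_def[abs_def] rav_const[OF P])
    next
      case (insert a I)
      let ?B = "\<Union>j\<in>I. {fst (pr j), snd (pr j)}"
      have e: "ovl_prod N pr (insert a I) = (\<lambda>\<omega>. ovl N (fst (pr a)) (snd (pr a)) \<omega> * ovl_prod N pr I \<omega>)"
        using insert.hyps by (intro ext) (simp add: ovl_prod_def)
      have nB: "fst (pr a) \<notin> ?B" "snd (pr a) \<notin> ?B"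
        using insert.prems[of a] insert.hyps by fastforce+
      have "rav ?\<Omega> ?P m (ovl_prod N pr (insert a I)) = rav ?\<Omega> ?P m (ovl N (fst (pr a)) (snd (pr a))) * rav ?\<Omega> ?P m (ovl_prod N pr I)"
        unfolding e
      proof (rule rav_indep[OF P, where B = ?B])
        show "ovl N (fst (pr a)) (snd (pr a)) \<omega> = ovl N (fst (pr a)) (snd (pr a)) \<omega>'" if "\<And>k. k \<notin> ?B \<Longrightarrow> \<omega> k = \<omega>' k" for \<omega> \<omega>'
          unfolding ovl_def using that[OF nB(1)] that[OF nB(2)] by simp
        show "ovl_prod N pr I \<omega> = ovl_prod N pr I \<omega>'" if w: "\<And>k. k \<in> ?B \<Longrightarrow> \<omega> k = \<omega>' k" for \<omega> \<omega>'
          unfolding ovl_prod_def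
        proof (rule prod.cong[OF refl])
          fix j assume "j \<in> I"
          then have "\<omega> (fst (pr j)) = \<omega>' (fst (pr j))" "\<omega> (snd (pr j)) = \<omega>' (snd (pr j))" by (auto intro!: w)
          then show "ovl N (fst (pr j)) (snd (pr j)) \<omega> = ovl N (fst (pr j)) (snd (pr j)) \<omega>'" by (simp add: ovl_def)
        qed
      qed
      moreover have "rav ?\<Omega> ?P m (ovl_prod N pr I) = (\<Prod>j\<in>I. rav ?\<Omega> ?P m (ovl N (fst (pr j)) (snd (pr j))))"
        by (rule insert.IH) (use insert.prems in blast)
      ultimately show ?case using insert.hyps by simp
    qed
    also have "\<dots> = (\<Prod>j\<in>I. if fst (pr j) = snd (pr j) then sqrt (real N) * overlapS \<S> N \<beta> D h p g else sqrt (real N) * overlapT \<S> N \<beta> D h q g)"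
      using I by (intro prod.cong refl) (auto simp: replicas_below_def T S)
    also have "\<dots> = (sqrt (real N) * overlapS \<S> N \<beta> D h p g) ^ card (I \<inter> {j. fst (pr j) = snd (pr j)})
      * (sqrt (real N) * overlapT \<S> N \<beta> D h q g) ^ card (I \<inter> - {j. fst (pr j) = snd (pr j)})"
      using \<open>finite I\<close> by (simp add: prod.If_cases)
    also have "I \<inter> {j. fst (pr j) = snd (pr j)} = {j \<in> I. fst (pr j) = snd (pr j)}" by auto
    also have "I \<inter> - {j. fst (pr j) = snd (pr j)} = {j \<in> I. fst (pr j) \<noteq> snd (pr j)}" by auto
    finally show ?thesis by (simp add: mult.commute)
  qed
  then show ?thesis unfolding nu_def smom_def by simp
qed

text \<open>\<open>k\<close> pairs (0, 1), (2, 3), ... followed by singletons: \<open>k + j\<close>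
  with j \<ge> k starts at 2 k, just behind the pairs.\<close>

definition block :: "nat \<Rightarrow> nat \<Rightarrow> nat \<times> nat" where
  "block k j = (if j < k then (2 * j, 2 * j + 1) else (k + j, k + j))"

lemma block_disjoint: "i \<noteq> j \<Longrightarrow> {fst (block k i), snd (block k i)} \<inter> {fst (block k j), snd (block k j)} = {}"
  by (auto simp: block_def)

lemma fst_block_eq_snd: "fst (block k j) = snd (block k j) \<longleftrightarrow> k \<le> j"
  by (auto simp: block_def)

lemma replicas_below_block: "replicas_below (2 * k + m) (block k) {..<k + m}"
  by (auto simp: replicas_below_def block_def)

abbreviation "\<kappa>A \<equiv> cA \<S> \<beta> D h p q"
abbreviation "\<kappa>F \<equiv> cF \<S> \<beta> D h p q"
abbreviation "\<kappa>G \<equiv> cG \<S> \<beta> D h p q"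
abbreviation "\<kappa>E \<equiv> cE \<S> \<beta> D h p q"
abbreviation "\<kappa>D \<equiv> cD \<S> \<beta> D h p q"
abbreviation "\<kappa>I3 \<equiv> cI3 \<S> \<beta> D h p q"
abbreviation "\<kappa>I5 \<equiv> cI5 \<S> \<beta> D h p q"
abbreviation "\<kappa>K4 \<equiv> cK4 \<S> \<beta> D h p q"
abbreviation "\<kappa>M1 \<equiv> cM1 \<S> \<beta> D h p q"
abbreviation "\<kappa>M2 \<equiv> cM2 \<S> \<beta> D h p q"
abbreviation "\<kappa>M3 \<equiv> cM3 \<S> \<beta> D h p q"
abbreviation "\<kappa>M \<equiv> cM \<S> \<beta> D h p q"

text \<open>The constants are combinations of moments bounded by S^4, so M_1, M_2, M_3 stay positive
  for small \<beta>; in \<open>cM\<close> the square of \<open>cE\<close> enters with a plus sign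
  and cannot cancel the product M_1 M_2.\<close>

lemma denominators: "\<kappa>M \<noteq> 0" "\<kappa>M3 \<noteq> 0"
proof -
  let ?s = "real \<S> ^ 4"
  note e = e_bounds[unfolded abs_le_iff]
  have b: "0 \<le> \<beta>\<^sup>2" by simp
  have le: "\<beta>\<^sup>2 * x \<le> 1 / 2" if "x \<le> 8 * ?s" for x
  proof -
    have "\<beta>\<^sup>2 * x \<le> \<beta>\<^sup>2 * (8 * ?s)" by (rule mult_left_mono[OF that b])
    also have "\<dots> \<le> 1 / 2" using small by simp
    finally show ?thesis .
  qed
  have "\<beta>\<^sup>2 * (\<kappa>F - \<kappa>G) \<le> 1 / 2" by (rule le) (use e in \<open>simp add: const_eqs\<close>)
  then show "\<kappa>M3 \<noteq> 0" unfolding cM3_def by linarith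
  have "\<beta>\<^sup>2 * (\<kappa>F - 3 * \<kappa>G) \<le> 1 / 2" by (rule le) (use e in \<open>simp add: const_eqs\<close>)
  then have M1: "0 < \<kappa>M1" unfolding cM1_def by linarith
  have "\<beta>\<^sup>2 * \<kappa>D \<le> 1 / 2" by (rule le) (use e in \<open>simp add: const_eqs\<close>)
  then have M2: "0 < \<kappa>M2" unfolding cM2_def by simp
  have "0 \<le> \<beta> ^ 4 * \<kappa>E\<^sup>2" by simp
  then show "\<kappa>M \<noteq> 0" unfolding cM_def using mult_pos_pos[OF M1 M2] by linarith
qed

text \<open>The product underlying the linear system is T^k S^m, realized on n0 = 2 k + m replicas.
  \<open>X\<close> and \<open>Y\<close> carry one factor more, \<open>W\<close> one factor less, and
  counting the removed factors gives the multiplicities k and m of Stein's recursion. Evaluating the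
  covariances at N = 1 strips their factor 1 / N.\<close>

theorem smom_recursion:
  "vanishing (\<lambda>N. smom N (Suc k) m - A0sq \<S> \<beta> D h p q 1 * (real k * smom N (k - 1) m)
    - C0sq \<S> \<beta> D h p q 1 * (real m * smom N k (m - 1)))" (is ?T)
  "\<exists>\<kappa>. vanishing (\<lambda>N. smom N k (Suc m) - \<kappa> * (real k * smom N (k - 1) m)
    - B0sq \<S> \<beta> D h p q 1 * (real m * smom N k (m - 1)))" (is ?S)
proof -
  define n0 where "n0 = 2 * k + m"
  define J where "J = {..<k + m}"
  let ?pr = "block k" and ?n = "Suc (Suc (n0 + 2))" and ?b = "\<beta>\<^sup>2"
  define x where "x N i j = nu N ?n (\<lambda>\<omega>. ovl N i j \<omega> * ovl_prod N ?pr J \<omega>)" for N i j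
  define z where "z N i = nu N (n0 + 1) (\<lambda>\<omega>. ovl N i n0 \<omega> * ovl_prod N ?pr J \<omega>)" for N i
  define X where "X N = nu N (n0 + 2) (\<lambda>\<omega>. ovl N n0 (n0 + 1) \<omega> * ovl_prod N ?pr J \<omega>)" for N
  define Y where "Y N = nu N (n0 + 1) (\<lambda>\<omega>. ovl N n0 n0 \<omega> * ovl_prod N ?pr J \<omega>)" for N
  define W where "W N j = nu N ?n (ovl_prod N ?pr (J - {j}))" for N j
  have J: "replicas_below n0 ?pr J" unfolding n0_def J_def by (rule replicas_below_block)
  have prJ: "fst (?pr j) < n0 \<and> snd (?pr j) < n0" if "j \<in> J" for j
    using J that by (auto simp: replicas_below_def)
  let ?C = "pair_corr \<kappa>F \<kappa>G \<kappa>E \<kappa>D \<kappa>I3 \<kappa>I5 \<kappa>K4"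
  define \<epsilon> where "\<epsilon> N i j = x N i j - ?b / 2 * (\<Sum>a<Suc (n0 + 2). \<Sum>c<Suc (Suc (n0 + 2)).
      alt_coeff (n0 + 2) a * alt_coeff (Suc (n0 + 2)) c * (?C i j a c * x N a c))
    - (\<Sum>r\<in>J. ?C i j (fst (?pr r)) (snd (?pr r)) * W N r)" for N i j
  have eps: "vanishing (\<lambda>N. \<epsilon> N i j)" if ij: "i < n0 + 2" "j < n0 + 2" for i j
  proof (rule vanishing_cong)
    show "vanishing (\<lambda>N. nu N ?n (\<lambda>\<omega>. ovl N i j \<omega> * ovl_prod N ?pr J \<omega>)
      - \<beta>\<^sup>2 / 2 * (\<Sum>a<Suc (n0 + 2). \<Sum>c<Suc (Suc (n0 + 2)). alt_coeff (n0 + 2) a * alt_coeff (Suc (n0 + 2)) c *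
          (corr ?n i j a c * nu N ?n (\<lambda>\<omega>. ovl N a c \<omega> * ovl_prod N ?pr J \<omega>)))
      - (\<Sum>r\<in>J. corr ?n i j (fst (?pr r)) (snd (?pr r)) * nu N ?n (ovl_prod N ?pr (J - {r}))))"
      by (rule cavity_equation[OF ij replicas_below_mono[OF J]]) simp
    show "nu N ?n (\<lambda>\<omega>. ovl N i j \<omega> * ovl_prod N ?pr J \<omega>)
      - \<beta>\<^sup>2 / 2 * (\<Sum>a<Suc (n0 + 2). \<Sum>c<Suc (Suc (n0 + 2)). alt_coeff (n0 + 2) a * alt_coeff (Suc (n0 + 2)) c *
          (corr ?n i j a c * nu N ?n (\<lambda>\<omega>. ovl N a c \<omega> * ovl_prod N ?pr J \<omega>)))
      - (\<Sum>r\<in>J. corr ?n i j (fst (?pr r)) (snd (?pr r)) * nu N ?n (ovl_prod N ?pr (J - {r}))) = \<epsilon> N i j" for N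
    proof -
      have "(\<Sum>a<Suc (n0 + 2). \<Sum>c<Suc (Suc (n0 + 2)). alt_coeff (n0 + 2) a * alt_coeff (Suc (n0 + 2)) c *
          (corr ?n i j a c * nu N ?n (\<lambda>\<omega>. ovl N a c \<omega> * ovl_prod N ?pr J \<omega>)))
        = (\<Sum>a<Suc (n0 + 2). \<Sum>c<Suc (Suc (n0 + 2)). alt_coeff (n0 + 2) a * alt_coeff (Suc (n0 + 2)) c * (?C i j a c * x N a c))"
        unfolding x_def by (intro sum.cong refl, subst corr_eq) (use ij in auto)
      moreover have "(\<Sum>r\<in>J. corr ?n i j (fst (?pr r)) (snd (?pr r)) * nu N ?n (ovl_prod N ?pr (J - {r})))
        = (\<Sum>r\<in>J. ?C i j (fst (?pr r)) (snd (?pr r)) * W N r)"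
        unfolding W_def by (intro sum.cong refl, subst corr_eq) (use ij prJ in \<open>auto intro: less_SucI simp: less_Suc_eq\<close>)
      ultimately show ?thesis unfolding \<epsilon>_def x_def by simp
    qed
  qed
  have cs: "cavity_system n0 (x N) (z N) (X N) (Y N) J ?pr" if N: "0 < N" for N
  proof
    have ovl_sym: "ovl N i j = ovl N j i" for i j
      by (intro ext) (simp add: ovl_def overlap_def centre_def mult.commute eq_commute)
    show "x N i j = x N j i" for i j unfolding x_def by (simp only: ovl_sym[of i j])
    \<comment> \<open>Injections that fix the labels below \<open>n0\<close> leave the product alone
      and move only fresh labels; this is the exchangeability that the locale demands.\<close>
    have relabel: "nu N ?n (\<lambda>\<omega>. ovl N (\<pi> i) (\<pi> j) \<omega> * ovl_prod N ?pr J \<omega>) = nu N r (\<lambda>\<omega>. ovl N i j \<omega> * ovl_prod N ?pr J \<omega>)"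
      if ij: "i < r" "j < r" and r: "n0 \<le> r" and inj: "inj_on \<pi> {..<r}" and \<pi>: "\<And>a. a < r \<Longrightarrow> \<pi> a < ?n" and old: "\<And>a. a < n0 \<Longrightarrow> \<pi> a = a"
      for \<pi> i j r
    proof -
      let ?F = "\<lambda>\<omega>. ovl N i j \<omega> * ovl_prod N ?pr J \<omega>"
      have dep: "depends_below r ?F"
        by (intro depends_below_mult depends_below_ovl ij depends_below_ovl_prod replicas_below_mono[OF J r])
      have "centre (\<pi> i) (\<pi> j) = centre i j"
        using inj ij by (auto simp: centre_def inj_on_def)
      then have o: "ovl N i j (\<lambda>a. \<omega> (\<pi> a)) = ovl N (\<pi> i) (\<pi> j) \<omega>" for \<omega> by (simp add: ovl_def)
      have "ovl_prod N ?pr J (\<lambda>a. \<omega> (\<pi> a)) = ovl_prod N ?pr J \<omega>" for \<omega>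
        by (rule depends_belowD[OF depends_below_ovl_prod[OF J]]) (simp add: old)
      then show ?thesis using nu_relabel[OF N dep inj \<pi>] by (simp only: o)
    qed
    show "x N i f = z N i" if f: "i < n0" "n0 \<le> f" "f < n0 + 4" for i f
    proof -
      define \<pi> where "\<pi> a = (if a < n0 then a else f)" for a
      have "nu N ?n (\<lambda>\<omega>. ovl N (\<pi> i) (\<pi> n0) \<omega> * ovl_prod N ?pr J \<omega>) = z N i"
        unfolding z_def by (rule relabel) (use f in \<open>auto simp: inj_on_def \<pi>_def\<close>)
      then show ?thesis using f by (simp add: x_def \<pi>_def)
    qed
    show "x N f g = X N" if f: "n0 \<le> f" "f < n0 + 4" "n0 \<le> g" "g < n0 + 4" "f \<noteq> g" for f g
    proof -
      define \<pi> where "\<pi> a = (if a < n0 then a else if a = n0 then f else g)" for a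
      have "nu N ?n (\<lambda>\<omega>. ovl N (\<pi> n0) (\<pi> (n0 + 1)) \<omega> * ovl_prod N ?pr J \<omega>) = X N"
        unfolding X_def by (rule relabel) (use f in \<open>auto simp: inj_on_def \<pi>_def\<close>)
      then show ?thesis by (simp add: x_def \<pi>_def)
    qed
    show "x N f f = Y N" if f: "n0 \<le> f" "f < n0 + 4" for f
    proof -
      define \<pi> where "\<pi> a = (if a < n0 then a else f)" for a
      have "nu N ?n (\<lambda>\<omega>. ovl N (\<pi> n0) (\<pi> n0) \<omega> * ovl_prod N ?pr J \<omega>) = Y N"
        unfolding Y_def by (rule relabel) (use f in \<open>auto simp: inj_on_def \<pi>_def\<close>)
      then show ?thesis by (simp add: x_def \<pi>_def)
    qed
    show "finite J" unfolding J_def by simp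
    show "fst (?pr j) < n0 \<and> snd (?pr j) < n0" if "j \<in> J" for j by (rule prJ[OF that])
  qed
  \<comment> \<open>The locale works at one fixed \<open>N\<close>; its quantities are restated as
    sequences in \<open>N\<close> so that error estimates apply to them.\<close>
  define O2 where "O2 N = (\<Sum>i<n0. (\<Sum>j<n0. x N i j - z N i - z N j + X N) - (x N i i - 2 * z N i + X N))" for N
  define \<tau> where "\<tau> N = (\<Sum>i<n0. z N i - X N)" for N
  define \<sigma> where "\<sigma> N = (\<Sum>i<n0. x N i i - Y N)" for N
  define WT where "WT N = (\<Sum>j\<in>J. of_bool (fst (?pr j) \<noteq> snd (?pr j)) * W N j)" for N
  define WS where "WS N = (\<Sum>j\<in>J. of_bool (fst (?pr j) = snd (?pr j)) * W N j)" for N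
  note sys_defs = cavity_system.\<epsilon>_def cavity_system.dsum_def cavity_system.Q_def cavity_system.O2_def cavity_system.O1_def
    cavity_system.\<tau>_def cavity_system.t_def cavity_system.\<sigma>_def cavity_system.s_def cavity_system.WT_def cavity_system.WS_def
  have r1: "vanishing (\<lambda>N. \<kappa>M3 * O2 N - 2 * (\<kappa>F - \<kappa>G) * WT N)"
  proof (rule vanishing_cong)
    show "vanishing (\<lambda>N. \<Sum>i<n0. \<Sum>j\<in>{..<n0} - {i}. \<epsilon> N i j - \<epsilon> N i (Suc n0) - \<epsilon> N n0 j + \<epsilon> N n0 (Suc n0))"
      by (intro vanishing_sum vanishing_add vanishing_diff eps) auto
    show "(\<Sum>i<n0. \<Sum>j\<in>{..<n0} - {i}. \<epsilon> N i j - \<epsilon> N i (Suc n0) - \<epsilon> N n0 j + \<epsilon> N n0 (Suc n0))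
      = \<kappa>M3 * O2 N - 2 * (\<kappa>F - \<kappa>G) * WT N" if "0 < N" for N
      using cavity_system.system_1[OF cs[OF that], of ?b \<kappa>F \<kappa>G \<kappa>E \<kappa>D \<kappa>I3 \<kappa>I5 \<kappa>K4 "W N", unfolded sys_defs[OF cs[OF that]]]
      unfolding \<epsilon>_def O2_def WT_def cM3_def .
  qed
  have r2: "vanishing (\<lambda>N. \<kappa>M1 * \<tau> N - ?b / 2 * \<kappa>E * \<sigma> N - ?b * \<kappa>G * O2 N - (2 * \<kappa>G * WT N + \<kappa>E * WS N))"
  proof (rule vanishing_cong)
    show "vanishing (\<lambda>N. \<Sum>i<n0. \<epsilon> N i (Suc n0) - \<epsilon> N n0 (Suc n0))"
      by (intro vanishing_sum vanishing_diff eps) auto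
    show "(\<Sum>i<n0. \<epsilon> N i (Suc n0) - \<epsilon> N n0 (Suc n0))
      = \<kappa>M1 * \<tau> N - ?b / 2 * \<kappa>E * \<sigma> N - ?b * \<kappa>G * O2 N - (2 * \<kappa>G * WT N + \<kappa>E * WS N)" if "0 < N" for N
      using cavity_system.system_2[OF cs[OF that], of ?b \<kappa>F \<kappa>G \<kappa>E \<kappa>D \<kappa>I3 \<kappa>I5 \<kappa>K4 "W N", unfolded sys_defs[OF cs[OF that]]]
      unfolding \<epsilon>_def O2_def \<tau>_def \<sigma>_def WT_def WS_def cM1_def .
  qed
  have r3: "vanishing (\<lambda>N. \<kappa>M2 * \<sigma> N + 2 * ?b * \<kappa>E * \<tau> N - ?b * \<kappa>E * O2 N - (2 * \<kappa>E * WT N + \<kappa>D * WS N))"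
  proof (rule vanishing_cong)
    show "vanishing (\<lambda>N. \<Sum>i<n0. \<epsilon> N i i - \<epsilon> N n0 n0)"
      by (intro vanishing_sum vanishing_diff eps) auto
    show "(\<Sum>i<n0. \<epsilon> N i i - \<epsilon> N n0 n0)
      = \<kappa>M2 * \<sigma> N + 2 * ?b * \<kappa>E * \<tau> N - ?b * \<kappa>E * O2 N - (2 * \<kappa>E * WT N + \<kappa>D * WS N)" if "0 < N" for N
      using cavity_system.system_3[OF cs[OF that], of ?b \<kappa>F \<kappa>G \<kappa>E \<kappa>D \<kappa>I3 \<kappa>I5 \<kappa>K4 "W N", unfolded sys_defs[OF cs[OF that]]]
      unfolding \<epsilon>_def O2_def \<tau>_def \<sigma>_def WT_def WS_def cM2_def .
  qed
  have r4: "vanishing (\<lambda>N. \<kappa>M1 * X N - ?b * \<kappa>E * Y N - (\<kappa>I3 * WT N + \<kappa>I5 * WS N)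
      - ?b * ((2 * \<kappa>G - \<kappa>I3) * \<tau> N + \<kappa>I5 / 2 * \<sigma> N + \<kappa>I3 / 2 * O2 N))"
  proof (rule vanishing_cong)
    show "vanishing (\<lambda>N. \<epsilon> N n0 (Suc n0))" by (rule eps) auto
    show "\<epsilon> N n0 (Suc n0) = \<kappa>M1 * X N - ?b * \<kappa>E * Y N - (\<kappa>I3 * WT N + \<kappa>I5 * WS N)
      - ?b * ((2 * \<kappa>G - \<kappa>I3) * \<tau> N + \<kappa>I5 / 2 * \<sigma> N + \<kappa>I3 / 2 * O2 N)" if "0 < N" for N
      using cavity_system.system_4[OF cs[OF that], of ?b \<kappa>F \<kappa>G \<kappa>E \<kappa>D \<kappa>I3 \<kappa>I5 \<kappa>K4 "W N", unfolded sys_defs[OF cs[OF that]]]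
      unfolding \<epsilon>_def O2_def \<tau>_def \<sigma>_def WT_def WS_def cM1_def .
  qed
  have r5: "vanishing (\<lambda>N. \<kappa>M2 * Y N + ?b * \<kappa>E * X N - (\<kappa>I5 * WT N + \<kappa>K4 * WS N)
      - ?b * ((\<kappa>E - \<kappa>I5) * \<tau> N + \<kappa>K4 / 2 * \<sigma> N + \<kappa>I5 / 2 * O2 N))"
  proof (rule vanishing_cong)
    show "vanishing (\<lambda>N. \<epsilon> N n0 n0)" by (rule eps) auto
    show "\<epsilon> N n0 n0 = \<kappa>M2 * Y N + ?b * \<kappa>E * X N - (\<kappa>I5 * WT N + \<kappa>K4 * WS N)
      - ?b * ((\<kappa>E - \<kappa>I5) * \<tau> N + \<kappa>K4 / 2 * \<sigma> N + \<kappa>I5 / 2 * O2 N)" if "0 < N" for N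
      using cavity_system.system_5[OF cs[OF that], of ?b \<kappa>F \<kappa>G \<kappa>E \<kappa>D \<kappa>I3 \<kappa>I5 \<kappa>K4 "W N", unfolded sys_defs[OF cs[OF that]]]
      unfolding \<epsilon>_def O2_def \<tau>_def \<sigma>_def WT_def WS_def cM2_def .
  qed
  \<comment> \<open>This makes the denominator of \<open>A2sq\<close> agree with
    \<open>cM3\<close>.\<close>
  have A: "\<kappa>A = \<kappa>F - \<kappa>G" by (simp add: const_eqs)
  have M: "\<kappa>M = \<kappa>M1 * \<kappa>M2 + ?b\<^sup>2 * \<kappa>E\<^sup>2" by (simp add: cM_def flip: power_mult)
  have a2: "A2sq \<S> \<beta> D h p q 1 = (\<kappa>F - \<kappa>G) / \<kappa>M3" by (simp add: A2sq_def A cM3_def)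
  have a1: "A1sq \<S> \<beta> D h p q 1 = (\<kappa>G * \<kappa>M2 + ?b / 2 * \<kappa>E\<^sup>2) / (\<kappa>M * \<kappa>M3)" by (simp add: A1sq_def)
  have b1: "B1sq \<S> \<beta> D h p q 1 = (\<kappa>D * \<kappa>M1 - 2 * ?b * \<kappa>E\<^sup>2) / \<kappa>M" by (simp add: B1sq_def)
  have c1: "C1sq \<S> \<beta> D h p q 1 = \<kappa>E / \<kappa>M" by (simp add: C1sq_def)
  note solve = solve_cavity_system[OF cM1_def cM2_def cM3_def M denominators a2 a1 b1 c1 r1 r2 r3 r4 r5]
  have ins: "nu N r (\<lambda>\<omega>. ovl N i j \<omega> * ovl_prod N ?pr J \<omega>)
      = smom N (k + of_bool (i \<noteq> j)) (m + of_bool (i = j))"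
    if N: "0 < N" and ij: "n0 \<le> i" "i < r" "n0 \<le> j" "j < r" for N r i j
  proof -
    \<comment> \<open>The additional overlap gets the index \<open>k + m\<close>, the first one
      outside \<open>J\<close>; its replicas are fresh, so the blocks stay disjoint.\<close>
    let ?pr' = "?pr(k + m := (i, j))"
    have notin: "k + m \<notin> J" by (simp add: J_def)
    have e: "(\<lambda>\<omega>. ovl N i j \<omega> * ovl_prod N ?pr J \<omega>) = ovl_prod N ?pr' (insert (k + m) J)"
    proof
      fix \<omega>
      have "(\<Prod>l\<in>J. ovl N (fst (?pr' l)) (snd (?pr' l)) \<omega>) = ovl_prod N ?pr J \<omega>"
        unfolding ovl_prod_def using notin by (intro prod.cong) auto
      then show "ovl N i j \<omega> * ovl_prod N ?pr J \<omega> = ovl_prod N ?pr' (insert (k + m) J) \<omega>"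
        unfolding ovl_prod_def[of N ?pr'] using notin by (simp add: J_def)
    qed
    have "nu N r (ovl_prod N ?pr' (insert (k + m) J))
      = smom N (card {l \<in> insert (k + m) J. fst (?pr' l) \<noteq> snd (?pr' l)}) (card {l \<in> insert (k + m) J. fst (?pr' l) = snd (?pr' l)})"
    proof (rule nu_ovl_prod_blocks[OF N])
      show "replicas_below r ?pr' (insert (k + m) J)"
      proof -
        have "fst (?pr' l) < r \<and> snd (?pr' l) < r" if "l \<in> insert (k + m) J" for l
        proof (cases "l = k + m")
          case True then show ?thesis using ij by simp
        next
          case False then show ?thesis using prJ[of l] that ij by auto
        qed
        then show ?thesis unfolding replicas_below_def J_def by blast
      qed
      show "{fst (?pr' a), snd (?pr' a)} \<inter> {fst (?pr' c), snd (?pr' c)} = {}"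
        if "a \<in> insert (k + m) J" "c \<in> insert (k + m) J" "a \<noteq> c" for a c
      proof -
        have new: "{fst (?pr a), snd (?pr a)} \<inter> {i, j} = {}" if "a \<in> J" for a
          using prJ[OF that] ij by auto
        show ?thesis using that new[of a] new[of c] block_disjoint[of a c k] notin by auto
      qed
    qed
    also have "{l \<in> insert (k + m) J. fst (?pr' l) \<noteq> snd (?pr' l)} = {..<k} \<union> (if i \<noteq> j then {k + m} else {})"
      by (auto simp: J_def fst_block_eq_snd split: if_splits)
    also have "{l \<in> insert (k + m) J. fst (?pr' l) = snd (?pr' l)} = {k..<k + m} \<union> (if i = j then {k + m} else {})"
      by (auto simp: J_def fst_block_eq_snd split: if_splits)
    also have "card ({..<k} \<union> (if i \<noteq> j then {k + m} else {})) = k + of_bool (i \<noteq> j)" by simp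
    also have "card ({k..<k + m} \<union> (if i = j then {k + m} else {})) = m + of_bool (i = j)" by simp
    finally show ?thesis unfolding e .
  qed
  have XT: "X N = smom N (Suc k) m" "Y N = smom N k (Suc m)" if "0 < N" for N
    unfolding X_def Y_def using ins[OF that, of n0 "n0 + 2" "n0 + 1"] ins[OF that, of n0 "n0 + 1" n0] by simp_all
  have Wj: "W N j = (if j < k then smom N (k - 1) m else smom N k (m - 1))" if N: "0 < N" and j: "j \<in> J" for N j
  proof -
    have "W N j = smom N (card {l \<in> J - {j}. fst (?pr l) \<noteq> snd (?pr l)}) (card {l \<in> J - {j}. fst (?pr l) = snd (?pr l)})"
      unfolding W_def
    proof (rule nu_ovl_prod_blocks[OF N])
      show "replicas_below ?n ?pr (J - {j})"
        using replicas_below_mono[OF J, of ?n] by (auto simp: replicas_below_def)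
    qed (rule block_disjoint)
    also have "{l \<in> J - {j}. fst (?pr l) \<noteq> snd (?pr l)} = {..<k} - {j}"
      by (auto simp: J_def fst_block_eq_snd split: if_splits)
    also have "{l \<in> J - {j}. fst (?pr l) = snd (?pr l)} = {k..<k + m} - {j}"
      by (auto simp: J_def fst_block_eq_snd split: if_splits)
    finally show ?thesis using j by (auto simp: J_def card_Diff_singleton_if)
  qed
  have WTs: "WT N = real k * smom N (k - 1) m" and WSs: "WS N = real m * smom N k (m - 1)" if N: "0 < N" for N
  proof -
    have "WT N = (\<Sum>j\<in>J. if j < k then smom N (k - 1) m else 0)"
      unfolding WT_def by (intro sum.cong) (auto simp: Wj[OF N] fst_block_eq_snd)
    also have "\<dots> = real (card (J \<inter> {j. j < k})) * smom N (k - 1) m"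
      by (simp add: sum.If_cases J_def)
    also have "J \<inter> {j. j < k} = {..<k}" by (auto simp: J_def)
    finally show "WT N = real k * smom N (k - 1) m" by simp
    have "WS N = (\<Sum>j\<in>J. if j < k then 0 else smom N k (m - 1))"
      unfolding WS_def by (intro sum.cong) (auto simp: Wj[OF N] fst_block_eq_snd)
    also have "\<dots> = real (card (J \<inter> - {j. j < k})) * smom N k (m - 1)"
      by (simp add: sum.If_cases J_def)
    also have "J \<inter> - {j. j < k} = {k..<k + m}" by (auto simp: J_def)
    finally show "WS N = real m * smom N k (m - 1)" by simp
  qed
  have "vanishing (\<lambda>N. X N - A0sq \<S> \<beta> D h p q 1 * WT N - C0sq \<S> \<beta> D h p q 1 * WS N)"
    using solve(1) by (simp add: A0sq_def C0sq_def)
  then show ?T by (rule vanishing_cong) (simp add: XT WTs WSs)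
  have "\<exists>\<kappa>. vanishing (\<lambda>N. Y N - \<kappa> * WT N - B0sq \<S> \<beta> D h p q 1 * WS N)"
    using solve(2) by (simp add: B0sq_def)
  then obtain \<kappa> where "vanishing (\<lambda>N. Y N - \<kappa> * WT N - B0sq \<S> \<beta> D h p q 1 * WS N)" by blast
  then have "vanishing (\<lambda>N. smom N k (Suc m) - \<kappa> * (real k * smom N (k - 1) m)
    - B0sq \<S> \<beta> D h p q 1 * (real m * smom N k (m - 1)))"
    by (rule vanishing_cong) (simp add: XT WTs WSs)
  then show ?S by blast
qed

lemma prob_space_disorder: "prob_space (disorder N)"
  unfolding disorder_def by (rule gprod.prob_space_axioms)

text \<open>Induction along Stein's recursion. Once no factor T is left the equation for S is used,
  and its unspecified coefficient is then multiplied by 0.\<close>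

theorem smom_wick:
  "vanishing (\<lambda>N. smom N k m - wick (A0sq \<S> \<beta> D h p q 1) (C0sq \<S> \<beta> D h p q 1) (B0sq \<S> \<beta> D h p q 1) k m)"
proof (induction "A0sq \<S> \<beta> D h p q 1" "C0sq \<S> \<beta> D h p q 1" "B0sq \<S> \<beta> D h p q 1" k m rule: wick.induct)
  case 1
  have "smom N 0 0 = 1" for N using prob_space.prob_space[OF prob_space_disorder] by (simp add: smom_def)
  then show ?case by (simp add: vanishing_zero)
next
  case (2 m)
  let ?b = "B0sq \<S> \<beta> D h p q 1" and ?w = "wick (A0sq \<S> \<beta> D h p q 1) (C0sq \<S> \<beta> D h p q 1) (B0sq \<S> \<beta> D h p q 1)"
  have "vanishing (\<lambda>N. smom N 0 (Suc m) - ?b * (real m * smom N 0 (m - 1)))"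
    using smom_recursion(2)[of 0 m] by simp
  from vanishing_add[OF this vanishing_cmult[OF 2, of "?b * real m"]]
  show ?case by (rule vanishing_cong) (simp add: algebra_simps)
next
  case (3 k m)
  let ?a = "A0sq \<S> \<beta> D h p q 1" and ?c = "C0sq \<S> \<beta> D h p q 1"
  have "vanishing (\<lambda>N. smom N (Suc k) m - ?a * (real k * smom N (k - 1) m) - ?c * (real m * smom N k (m - 1)))"
    using smom_recursion(1)[of k m] by simp
  from vanishing_add[OF vanishing_add[OF this vanishing_cmult[OF 3(1), of "?a * real k"]] vanishing_cmult[OF 3(2), of "?c * real m"]]
  show ?case by (rule vanishing_cong) (simp add: algebra_simps)
qed

lemma covariance_scale:
  "A0sq \<S> \<beta> D h p q N = (1 / sqrt (real N))\<^sup>2 * A0sq \<S> \<beta> D h p q 1"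
  "B0sq \<S> \<beta> D h p q N = (1 / sqrt (real N))\<^sup>2 * B0sq \<S> \<beta> D h p q 1"
  "C0sq \<S> \<beta> D h p q N = (1 / sqrt (real N))\<^sup>2 * C0sq \<S> \<beta> D h p q 1"
proof -
  define t where "t = 1 / real N"
  have t: "(1 / sqrt (real N))\<^sup>2 = t" by (simp add: power_divide t_def)
  have pieces: "A1sq \<S> \<beta> D h p q N = t * A1sq \<S> \<beta> D h p q 1" "A2sq \<S> \<beta> D h p q N = t * A2sq \<S> \<beta> D h p q 1"
    "B1sq \<S> \<beta> D h p q N = t * B1sq \<S> \<beta> D h p q 1" "C1sq \<S> \<beta> D h p q N = t * C1sq \<S> \<beta> D h p q 1"
    "1 / (\<kappa>M * real N) = t * (1 / (\<kappa>M * real 1))"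
    by (simp_all add: A1sq_def A2sq_def B1sq_def C1sq_def t_def)
  show "A0sq \<S> \<beta> D h p q N = (1 / sqrt (real N))\<^sup>2 * A0sq \<S> \<beta> D h p q 1"
    unfolding t A0sq_def pieces by (simp only: distrib_left mult_ac)
  show "B0sq \<S> \<beta> D h p q N = (1 / sqrt (real N))\<^sup>2 * B0sq \<S> \<beta> D h p q 1"
    unfolding t B0sq_def pieces by (simp only: distrib_left mult_ac)
  show "C0sq \<S> \<beta> D h p q N = (1 / sqrt (real N))\<^sup>2 * C0sq \<S> \<beta> D h p q 1"
    unfolding t C0sq_def pieces by (simp only: distrib_left mult_ac)
qed

text \<open>With r = 1 / sqrt N both moments are r^(k + k') times their scaled versions, and the
  scaled error supplies one more factor r.\<close>

theorem overlap_moment_expansion: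
  "\<exists>C. \<forall>N::nat. N \<ge> 2 \<longrightarrow> (\<forall>(M :: 'a measure) X Y.
     centered_gaussian_pair M X Y (A0sq \<S> \<beta> D h p q N) (C0sq \<S> \<beta> D h p q N) (B0sq \<S> \<beta> D h p q N) \<longrightarrow>
     \<bar>(\<integral>g. (overlapT \<S> N \<beta> D h q g) ^ k * (overlapS \<S> N \<beta> D h p g) ^ k' \<partial>disorder N)
        - (\<integral>x. (X x) ^ k * (Y x) ^ k' \<partial>M)\<bar>
     \<le> C * real N powr (- (real (k + k') + 1) / 2))"
proof -
  let ?w = "wick (A0sq \<S> \<beta> D h p q 1) (C0sq \<S> \<beta> D h p q 1) (B0sq \<S> \<beta> D h p q 1) k k'"
  obtain C where C: "\<forall>N>0. \<bar>smom N k k' - ?w\<bar> \<le> C / sqrt (real N)"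
    using smom_wick[of k k'] unfolding vanishing_def by blast
  have "\<bar>(\<integral>g. (overlapT \<S> N \<beta> D h q g) ^ k * (overlapS \<S> N \<beta> D h p g) ^ k' \<partial>disorder N)
        - (\<integral>x. (X x) ^ k * (Y x) ^ k' \<partial>M)\<bar> \<le> C * real N powr (- (real (k + k') + 1) / 2)"
    if N: "N \<ge> 2" and pair: "centered_gaussian_pair M X Y (A0sq \<S> \<beta> D h p q N) (C0sq \<S> \<beta> D h p q N) (B0sq \<S> \<beta> D h p q N)"
    for N :: nat and M :: "'a measure" and X Y
  proof -
    define r where "r = 1 / sqrt (real N)"
    have r: "0 < r" "r * sqrt (real N) = 1" using N by (auto simp: r_def)
    have "(\<integral>x. (X x) ^ k * (Y x) ^ k' \<partial>M) = r ^ (k + k') * ?w"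
      unfolding gaussian_pair_moment[OF pair] covariance_scale[of N] r_def[symmetric] by (rule wick_scale)
    moreover have "(\<integral>g. (overlapT \<S> N \<beta> D h q g) ^ k * (overlapS \<S> N \<beta> D h p g) ^ k' \<partial>disorder N) = r ^ (k + k') * smom N k k'"
    proof -
      have "smom N k k' = sqrt (real N) ^ (k + k') * (\<integral>g. (overlapT \<S> N \<beta> D h q g) ^ k * (overlapS \<S> N \<beta> D h p g) ^ k' \<partial>disorder N)"
      proof -
        have "(sqrt (real N) * overlapT \<S> N \<beta> D h q g) ^ k * (sqrt (real N) * overlapS \<S> N \<beta> D h p g) ^ k'
          = sqrt (real N) ^ (k + k') * ((overlapT \<S> N \<beta> D h q g) ^ k * (overlapS \<S> N \<beta> D h p g) ^ k')" for g
          by (simp only: power_mult_distrib power_add mult_ac)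
        then show ?thesis unfolding smom_def by simp
      qed
      then have "r ^ (k + k') * smom N k k' = (r * sqrt (real N)) ^ (k + k') *
        (\<integral>g. (overlapT \<S> N \<beta> D h q g) ^ k * (overlapS \<S> N \<beta> D h p g) ^ k' \<partial>disorder N)"
        by (simp only: power_mult_distrib mult.assoc)
      then show ?thesis unfolding r(2) by simp
    qed
    ultimately have "\<bar>(\<integral>g. (overlapT \<S> N \<beta> D h q g) ^ k * (overlapS \<S> N \<beta> D h p g) ^ k' \<partial>disorder N)
        - (\<integral>x. (X x) ^ k * (Y x) ^ k' \<partial>M)\<bar> = r ^ (k + k') * \<bar>smom N k k' - ?w\<bar>"
      using r(1) by (simp add: abs_mult flip: right_diff_distrib)
    also have "\<dots> \<le> r ^ (k + k') * (C * r)"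
      using C N r(1) by (intro mult_left_mono) (auto simp: r_def)
    also have "\<dots> = C * r ^ (k + k' + 1)" by simp
    also have "r ^ (k + k' + 1) = real N powr (- (real (k + k') + 1) / 2)"
    proof -
      have re: "r = real N powr (- 1 / 2)"
        using N by (simp add: r_def powr_half_sqrt[symmetric] powr_minus_divide)
      have "r ^ (k + k' + 1) = r powr real (k + k' + 1)" by (rule powr_realpow[OF r(1), symmetric])
      also have "\<dots> = real N powr (- 1 / 2 * real (k + k' + 1))" unfolding re by (rule powr_powr)
      also have "- 1 / 2 * real (k + k' + 1) = - (real (k + k') + 1) / 2" by (simp add: field_simps)
      finally show ?thesis .
    qed
    finally show ?thesis .
  qed
  then show ?thesis by blast
qed

end

theorem theorem4p11:
  fixes \<S> :: nat and h D :: real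
  assumes "\<S> \<ge> 1" and "h \<ge> 0"
  shows "\<exists>\<beta>'>0. \<forall>\<beta>. 0 < \<beta> \<and> \<beta> < \<beta>' \<longrightarrow>
     (\<forall>p q. fixed_point \<S> \<beta> D h p q \<longrightarrow>
       (\<forall>k k' :: nat. \<exists>C. \<forall>N::nat. N \<ge> 2 \<longrightarrow>
          (\<forall>(M :: 'a measure) X Y.
             centered_gaussian_pair M X Y
               (A0sq \<S> \<beta> D h p q N) (C0sq \<S> \<beta> D h p q N) (B0sq \<S> \<beta> D h p q N) \<longrightarrow>
             \<bar>(\<integral>g. (overlapT \<S> N \<beta> D h q g) ^ k * (overlapS \<S> N \<beta> D h p g) ^ k' \<partial>disorder N)
              - (\<integral>x. (X x) ^ k * (Y x) ^ k' \<partial>M)\<bar>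
             \<le> C * real N powr (- (real (k + k') + 1) / 2))))"
proof (rule exI[of _ "1 / (50 * (real \<S>)\<^sup>2)"], intro conjI allI impI)
  let ?B = "1 / (50 * (real \<S>)\<^sup>2)"
  have s: "0 < (real \<S>)\<^sup>2" using assms(1) by simp
  then show "0 < ?B" by simp
  fix \<beta> p q k k'
  assume \<beta>: "0 < \<beta> \<and> \<beta> < ?B" and fp: "fixed_point \<S> \<beta> D h p q"
  \<comment> \<open>Squaring \<beta> < 1 / (50 S^2) gives 2500 \<beta>^2 S^4 \<le> 1, slightly more
    than \<open>high_temperature\<close> asks for.\<close>
  have "\<beta> * (50 * (real \<S>)\<^sup>2) \<le> 1" using \<beta> s by (simp add: field_simps)
  then have "(\<beta> * (50 * (real \<S>)\<^sup>2))\<^sup>2 \<le> 1" using \<beta> s by (intro power_le_one) auto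
  then have "2500 * (\<beta>\<^sup>2 * real \<S> ^ 4) \<le> 1" by (simp add: power_mult_distrib flip: power_mult)
  moreover have "0 \<le> \<beta>\<^sup>2 * real \<S> ^ 4" by simp
  ultimately have small: "2000 * \<beta>\<^sup>2 * real \<S> ^ 4 \<le> 1" by linarith
  interpret high_temperature \<S> \<beta> D h p q by unfold_locales (use assms(1) fp small in auto)
  show "\<exists>C. \<forall>N::nat. N \<ge> 2 \<longrightarrow> (\<forall>(M :: 'a measure) X Y.
     centered_gaussian_pair M X Y (A0sq \<S> \<beta> D h p q N) (C0sq \<S> \<beta> D h p q N) (B0sq \<S> \<beta> D h p q N) \<longrightarrow>
     \<bar>(\<integral>g. (overlapT \<S> N \<beta> D h q g) ^ k * (overlapS \<S> N \<beta> D h p g) ^ k' \<partial>disorder N)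
        - (\<integral>x. (X x) ^ k * (Y x) ^ k' \<partial>M)\<bar>
     \<le> C * real N powr (- (real (k + k') + 1) / 2))"
    by (rule overlap_moment_expansion)
qed

end
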